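(* Let $P=d^*$ be the divergence operator acting on one-forms, on a smooth Riemannian manifold $(M,g)$. (a) Let $\Omega\subset M$ be a relatively compact open set with smooth boundary, and let $f\in C^\infty(M)$ be a function with compact support in $\Omega$ such that $\int_\Omega f v\,d\mu_g=0$ for every smooth function $v$ on $\Omega$ with $dv=0$. Then there exists a smooth one-form $U$ on $M$ with compact support in $\overline\Omega$ such that $d^*U=f$. (b) Let $\Omega_1,\Omega_2\subset M$ be open sets with $\Omega:=\Omega_1\cap\Omega_2\ne\emptyset$, $\overline\Omega$ compact, and $\partial\Omega$ a smooth submanifold which is the union of two disjoint smooth submanifolds $\partial\Omega=\partial_1\Omega\cup\partial_2\Omega$ with $\partial_i\Omega\subset\Omega_i$. Let $V$ be a smooth one-form on $\Omega_1$ with $d^*V=0$ and $W$ a smooth one-form on $\Omega_2$ with $d^*W=0$. Let $\chi$ be a smooth cutoff function equal to $1$ near $\overline{\Omega_1\setminus\Omega}$ and equal to $0$ near $\overline{\Omega_2\setminus\Omega}$. If $$\int_{\partial_2\Omega}W(\nu)\,v=\int_{\partial_1\Omega}V(\nu)\,v\qquad\text{for every smooth }v\text{ on }\Omega\text{ with }dv=0,$$ then there exists a smooth one-form $U$ on $\Omega_1\cup\Omega_2$, supported in $\overline\Omega$, such that $d^*(\chi V+(1-\chi)W+U)=0$ on $\Omega_1\cup\Omega_2$.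
   Context: $(M,g)$ is not assumed connected, complete or compact. $d^*\omega=-\nabla^i\omega_i$; its formal $L^2$ adjoint is $d$ acting on functions, whose kernel on $\Omega$ consists of the locally constant functions (extended continuously to $\overline\Omega$ in the boundary integrals). In (b), $\nu$ is the unit normal to $\partial\Omega$ which points out of $\Omega$ on $\partial_2\Omega$ and into $\Omega$ on $\partial_1\Omega$, and the boundary integrals use the induced measure. The forms $\chi V$ and $(1-\chi)W$ are extended by zero to $\Omega_1\cup\Omega_2$. *)

theory Defs
  imports "HOL-Analysis.Analysis"
begin

section \<open>Smooth functions on open subsets of Euclidean space\<close>

text \<open>For open \<open>S\<close>, being \<open>C\<^sup>k\<^sup>+\<^sup>1\<close> means being differentiable with all directional
  derivatives of class \<open>C\<^sup>k\<close>.\<close>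

fun Ck_on :: "nat \<Rightarrow> 'b::real_normed_vector set \<Rightarrow> ('b \<Rightarrow> 'c::real_normed_vector) \<Rightarrow> bool" where
  "Ck_on 0 S f \<longleftrightarrow> continuous_on S f"
| "Ck_on (Suc k) S f \<longleftrightarrow>
     (\<forall>x\<in>S. f differentiable (at x)) \<and> (\<forall>v. Ck_on k S (\<lambda>x. frechet_derivative f (at x) v))"

definition smooth_on :: "'b::real_normed_vector set \<Rightarrow> ('b \<Rightarrow> 'c::real_normed_vector) \<Rightarrow> bool" where
  "smooth_on S f \<longleftrightarrow> (\<forall>k. Ck_on k S f)"


section \<open>Smooth manifolds\<close>

text \<open>A chart is a pair of an open domain and a coordinate map; the values of the coordinate map
  outside the domain are irrelevant.  The points of the manifold are all the elements of the
  Hausdorff second countable type \<open>'a\<close>; the dimension is \<open>CARD('n)\<close>.\<close>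

type_synonym ('a, 'n) chart = "'a set \<times> ('a \<Rightarrow> real ^ 'n)"

abbreviation chart_dom :: "('a, 'n::finite) chart \<Rightarrow> 'a set" where
  "chart_dom \<equiv> fst"

abbreviation coords :: "('a, 'n::finite) chart \<Rightarrow> 'a \<Rightarrow> real ^ 'n" where
  "coords \<equiv> snd"

definition coords_inv :: "('a, 'n::finite) chart \<Rightarrow> real ^ 'n \<Rightarrow> 'a" where
  "coords_inv c = inv_into (chart_dom c) (coords c)"

definition is_chart :: "('a::topological_space, 'n::finite) chart \<Rightarrow> bool" where
  "is_chart c \<longleftrightarrow> open (chart_dom c) \<and> open (coords c ` chart_dom c) \<and>
     homeomorphism (chart_dom c) (coords c ` chart_dom c) (coords c) (coords_inv c)"

definition smoothly_compatible ::
    "('a, 'n::finite) chart \<Rightarrow> ('a, 'n) chart \<Rightarrow> bool" where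
  "smoothly_compatible c d \<longleftrightarrow>
     smooth_on (coords c ` (chart_dom c \<inter> chart_dom d)) (coords d \<circ> coords_inv c) \<and>
     smooth_on (coords d ` (chart_dom c \<inter> chart_dom d)) (coords c \<circ> coords_inv d)"

text \<open>\<open>A\<close> is a maximal smooth atlas, i.e. it contains every chart of the smooth structure.\<close>

locale smooth_manifold =
  fixes A :: "('a::{t2_space, second_countable_topology}, 'n::finite) chart set"
  assumes charts: "c \<in> A \<Longrightarrow> is_chart c"
    and covering: "(\<Union>c\<in>A. chart_dom c) = UNIV"
    and compatible: "c \<in> A \<Longrightarrow> d \<in> A \<Longrightarrow> smoothly_compatible c d"
    and maximal: "is_chart c \<Longrightarrow> (\<And>d. d \<in> A \<Longrightarrow> smoothly_compatible c d) \<Longrightarrow> c \<in> A"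

definition chart_at :: "('a, 'n::finite) chart set \<Rightarrow> 'a \<Rightarrow> ('a, 'n) chart" where
  "chart_at A p = (SOME c. c \<in> A \<and> p \<in> chart_dom c)"

definition smooth_function_on ::
    "('a, 'n::finite) chart set \<Rightarrow> 'a set \<Rightarrow> ('a \<Rightarrow> real) \<Rightarrow> bool" where
  "smooth_function_on A S f \<longleftrightarrow>
     (\<forall>c\<in>A. smooth_on (coords c ` (S \<inter> chart_dom c)) (f \<circ> coords_inv c))"


section \<open>Tensor fields\<close>

text \<open>Tensor fields are given by their components in every chart, subject to the usual
  transformation law under a change of coordinates.  Only the components of \<open>T c p\<close> with
  \<open>p\<close> in the domain of \<open>c\<close> are meaningful.\<close>

definition transition_deriv ::
    "('a, 'n::finite) chart \<Rightarrow> ('a, 'n) chart \<Rightarrow> 'a \<Rightarrow> real ^ 'n \<Rightarrow> real ^ 'n" where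
  "transition_deriv c d p = frechet_derivative (coords d \<circ> coords_inv c) (at (coords c p))"

definition vector_field_on ::
    "('a, 'n::finite) chart set \<Rightarrow> 'a set \<Rightarrow> (('a, 'n) chart \<Rightarrow> 'a \<Rightarrow> real ^ 'n) \<Rightarrow> bool" where
  "vector_field_on A S X \<longleftrightarrow>
     (\<forall>c\<in>A. \<forall>d\<in>A. \<forall>p\<in>S \<inter> chart_dom c \<inter> chart_dom d. X d p = transition_deriv c d p (X c p))"

definition one_form_on ::
    "('a, 'n::finite) chart set \<Rightarrow> 'a set \<Rightarrow> (('a, 'n) chart \<Rightarrow> 'a \<Rightarrow> real ^ 'n) \<Rightarrow> bool" where
  "one_form_on A S \<omega> \<longleftrightarrow>
     (\<forall>c\<in>A. \<forall>d\<in>A. \<forall>p\<in>S \<inter> chart_dom c \<inter> chart_dom d. \<forall>x.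
        \<omega> c p \<bullet> x = \<omega> d p \<bullet> transition_deriv c d p x)"

definition smooth_components_on ::
    "('a, 'n::finite) chart set \<Rightarrow> 'a set \<Rightarrow> (('a, 'n) chart \<Rightarrow> 'a \<Rightarrow> 'b::real_normed_vector) \<Rightarrow> bool"
  where
  "smooth_components_on A S T \<longleftrightarrow>
     (\<forall>c\<in>A. smooth_on (coords c ` (S \<inter> chart_dom c)) (T c \<circ> coords_inv c))"

definition smooth_one_form_on ::
    "('a, 'n::finite) chart set \<Rightarrow> 'a set \<Rightarrow> (('a, 'n) chart \<Rightarrow> 'a \<Rightarrow> real ^ 'n) \<Rightarrow> bool" where
  "smooth_one_form_on A S \<omega> \<longleftrightarrow> one_form_on A S \<omega> \<and> smooth_components_on A S \<omega>"

definition form_support ::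
    "('a::topological_space, 'n::finite) chart set \<Rightarrow> 'a set \<Rightarrow> (('a, 'n) chart \<Rightarrow> 'a \<Rightarrow> real ^ 'n)
      \<Rightarrow> 'a set" where
  "form_support A S \<omega> = closure {p \<in> S. \<exists>c\<in>A. p \<in> chart_dom c \<and> \<omega> c p \<noteq> 0}"

definition apply_form ::
    "('a, 'n::finite) chart set \<Rightarrow> (('a, 'n) chart \<Rightarrow> 'a \<Rightarrow> real ^ 'n)
      \<Rightarrow> (('a, 'n) chart \<Rightarrow> 'a \<Rightarrow> real ^ 'n) \<Rightarrow> 'a \<Rightarrow> real" where
  "apply_form A \<omega> X p = (let c = chart_at A p in \<omega> c p \<bullet> X c p)"

definition partial_deriv :: "('a, 'n::finite) chart \<Rightarrow> 'n \<Rightarrow> ('a \<Rightarrow> real) \<Rightarrow> 'a \<Rightarrow> real" where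
  "partial_deriv c i f p = frechet_derivative (f \<circ> coords_inv c) (at (coords c p)) (axis i 1)"

definition differential :: "('a \<Rightarrow> real) \<Rightarrow> ('a, 'n::finite) chart \<Rightarrow> 'a \<Rightarrow> real ^ 'n" where
  "differential f c p = (\<chi> i. partial_deriv c i f p)"

definition zero_differential_on ::
    "('a, 'n::finite) chart set \<Rightarrow> 'a set \<Rightarrow> ('a \<Rightarrow> real) \<Rightarrow> bool" where
  "zero_differential_on A S v \<longleftrightarrow> (\<forall>c\<in>A. \<forall>p\<in>S \<inter> chart_dom c. differential v c p = 0)"


section \<open>Riemannian metrics and the divergence operator\<close>

locale riemannian_manifold = smooth_manifold A
  for A :: "('a::{t2_space, second_countable_topology}, 'n::finite) chart set" +
  fixes g :: "('a, 'n) chart \<Rightarrow> 'a \<Rightarrow> real ^ 'n ^ 'n"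
  assumes metric_transform:
      "c \<in> A \<Longrightarrow> d \<in> A \<Longrightarrow> p \<in> chart_dom c \<inter> chart_dom d \<Longrightarrow>
        x \<bullet> (g c p *v y) = transition_deriv c d p x \<bullet> (g d p *v transition_deriv c d p y)"
    and metric_smooth: "smooth_components_on A UNIV g"
    and metric_symmetric: "c \<in> A \<Longrightarrow> p \<in> chart_dom c \<Longrightarrow> transpose (g c p) = g c p"
    and metric_positive: "c \<in> A \<Longrightarrow> p \<in> chart_dom c \<Longrightarrow> x \<noteq> 0 \<Longrightarrow> x \<bullet> (g c p *v x) > 0"

text \<open>\<open>christoffel g c p k i j\<close> is the symbol with upper index \<open>k\<close> and lower indices \<open>i\<close>, \<open>j\<close> of the
  Levi-Civita connection.\<close>

definition christoffel ::
    "(('a, 'n::finite) chart \<Rightarrow> 'a \<Rightarrow> real ^ 'n ^ 'n) \<Rightarrow> ('a, 'n) chart \<Rightarrow> 'a \<Rightarrow> 'n \<Rightarrow> 'n \<Rightarrow> 'n \<Rightarrow> real"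
  where
  "christoffel g c p k i j =
     (\<Sum>l\<in>UNIV. matrix_inv (g c p) $ k $ l *
        (partial_deriv c i (\<lambda>q. g c q $ j $ l) p
         + partial_deriv c j (\<lambda>q. g c q $ i $ l) p
         - partial_deriv c l (\<lambda>q. g c q $ i $ j) p)) / 2"

text \<open>The component \<open>\<nabla>\<^sub>j \<omega>\<^sub>i\<close> in the chart \<open>c\<close>.\<close>

definition covariant_deriv ::
    "(('a, 'n::finite) chart \<Rightarrow> 'a \<Rightarrow> real ^ 'n ^ 'n) \<Rightarrow> (('a, 'n) chart \<Rightarrow> 'a \<Rightarrow> real ^ 'n)
      \<Rightarrow> ('a, 'n) chart \<Rightarrow> 'a \<Rightarrow> 'n \<Rightarrow> 'n \<Rightarrow> real" where
  "covariant_deriv g \<omega> c p j i =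
     partial_deriv c j (\<lambda>q. \<omega> c q $ i) p - (\<Sum>k\<in>UNIV. christoffel g c p k j i * \<omega> c p $ k)"

text \<open>\<open>d\<^sup>*\<omega> = - g\<^sup>i\<^sup>j \<nabla>\<^sub>j \<omega>\<^sub>i\<close>; the value does not depend on the chart in which it is computed.\<close>

definition codifferential ::
    "('a, 'n::finite) chart set \<Rightarrow> (('a, 'n) chart \<Rightarrow> 'a \<Rightarrow> real ^ 'n ^ 'n)
      \<Rightarrow> (('a, 'n) chart \<Rightarrow> 'a \<Rightarrow> real ^ 'n) \<Rightarrow> 'a \<Rightarrow> real" where
  "codifferential A g \<omega> p =
     (let c = chart_at A p in
        - (\<Sum>i\<in>UNIV. \<Sum>j\<in>UNIV. matrix_inv (g c p) $ i $ j * covariant_deriv g \<omega> c p j i))"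


section \<open>Hypersurfaces, boundaries and unit normals\<close>

definition slice_charts ::
    "('a, 'n::finite) chart set \<Rightarrow> 'a set \<Rightarrow> (('a, 'n) chart \<times> 'n) set" where
  "slice_charts A S = {(c, k). c \<in> A \<and> S \<inter> chart_dom c = {p \<in> chart_dom c. coords c p $ k = 0}}"

text \<open>Embedded submanifolds of codimension one, not necessarily closed, possibly empty.\<close>

definition smooth_hypersurface :: "('a, 'n::finite) chart set \<Rightarrow> 'a set \<Rightarrow> bool" where
  "smooth_hypersurface A S \<longleftrightarrow> (\<forall>p\<in>S. \<exists>(c, k)\<in>slice_charts A S. p \<in> chart_dom c)"

definition smooth_boundary ::
    "('a::topological_space, 'n::finite) chart set \<Rightarrow> 'a set \<Rightarrow> bool" where
  "smooth_boundary A \<Omega> \<longleftrightarrow>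
     (\<forall>p\<in>frontier \<Omega>. \<exists>c\<in>A. \<exists>k. p \<in> chart_dom c \<and>
        \<Omega> \<inter> chart_dom c = {q \<in> chart_dom c. coords c q $ k < 0})"

text \<open>In a slice chart for \<open>S\<close>, the tangent space of \<open>S\<close> consists of the vectors whose \<open>k\<close>-th
  component vanishes.\<close>

definition unit_normal_on ::
    "('a, 'n::finite) chart set \<Rightarrow> (('a, 'n) chart \<Rightarrow> 'a \<Rightarrow> real ^ 'n ^ 'n) \<Rightarrow> 'a set
      \<Rightarrow> (('a, 'n) chart \<Rightarrow> 'a \<Rightarrow> real ^ 'n) \<Rightarrow> bool" where
  "unit_normal_on A g S \<nu> \<longleftrightarrow>
     vector_field_on A S \<nu> \<and>
     (\<forall>c\<in>A. \<forall>p\<in>S \<inter> chart_dom c. \<nu> c p \<bullet> (g c p *v \<nu> c p) = 1) \<and>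
     (\<forall>(c, k)\<in>slice_charts A S. \<forall>p\<in>S \<inter> chart_dom c. \<forall>x. x $ k = 0 \<longrightarrow> x \<bullet> (g c p *v \<nu> c p) = 0)"

text \<open>Moving from the boundary point \<open>p\<close> in the direction \<open>X\<close> one gets out of the closure of \<open>\<Omega>\<close>,
  and moving in the direction \<open>-X\<close> one gets into \<open>\<Omega>\<close>.  In particular \<open>\<Omega>\<close> lies on one side of its
  boundary only.\<close>

definition points_out_of ::
    "('a::topological_space, 'n::finite) chart set \<Rightarrow> 'a set \<Rightarrow> (('a, 'n) chart \<Rightarrow> 'a \<Rightarrow> real ^ 'n)
      \<Rightarrow> 'a \<Rightarrow> bool" where
  "points_out_of A \<Omega> X p \<longleftrightarrow>
     (\<forall>c\<in>A. p \<in> chart_dom c \<longrightarrow>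
        (\<forall>\<^sub>F t in at_right 0. coords c p + t *\<^sub>R X c p \<in> coords c ` (chart_dom c - closure \<Omega>)) \<and>
        (\<forall>\<^sub>F t in at_right 0. coords c p - t *\<^sub>R X c p \<in> coords c ` (chart_dom c \<inter> \<Omega>)))"

definition points_into ::
    "('a::topological_space, 'n::finite) chart set \<Rightarrow> 'a set \<Rightarrow> (('a, 'n) chart \<Rightarrow> 'a \<Rightarrow> real ^ 'n)
      \<Rightarrow> 'a \<Rightarrow> bool" where
  "points_into A \<Omega> X p \<longleftrightarrow> points_out_of A \<Omega> (\<lambda>c q. - X c q) p"


section \<open>Riemannian measures\<close>

text \<open>The Riemannian measure \<open>sqrt (det g) dx\<close> of the domain of one chart, as a Borel measure on
  the manifold which vanishes outside that domain.  These measures agree on overlaps of chart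
  domains, so their supremum in the lattice of measures is the measure obtained by gluing them.\<close>

definition chart_volume ::
    "(('a::topological_space, 'n::finite) chart \<Rightarrow> 'a \<Rightarrow> real ^ 'n ^ 'n) \<Rightarrow> ('a, 'n) chart
      \<Rightarrow> 'a measure" where
  "chart_volume g c =
     distr (density (restrict_space lborel (coords c ` chart_dom c))
              (\<lambda>x. ennreal (sqrt (det (g c (coords_inv c x))))))
       borel (coords_inv c)"

definition riemannian_measure ::
    "('a::topological_space, 'n::finite) chart set \<Rightarrow> (('a, 'n) chart \<Rightarrow> 'a \<Rightarrow> real ^ 'n ^ 'n)
      \<Rightarrow> 'a measure" where
  "riemannian_measure A g = (SUP c\<in>A. chart_volume g c)"

text \<open>The \<open>(n-1)\<close>-dimensional Lebesgue measure of the hyperplane \<open>x\<^sub>k = 0\<close>, as a measure on the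
  whole space (for \<open>n = 1\<close>, the unit point mass at the origin).\<close>

definition hyperplane_measure :: "'n::finite \<Rightarrow> (real ^ 'n) measure" where
  "hyperplane_measure k =
     distr (PiM (UNIV - {k}) (\<lambda>_. lborel)) borel (\<lambda>y. \<chi> i. if i = k then 0 else y i)"

text \<open>The determinant of the matrix \<open>G\<close> with its \<open>k\<close>-th row and column deleted; for the components
  of \<open>g\<close> in a slice chart this is the determinant of the induced metric.\<close>

definition principal_minor :: "'n::finite \<Rightarrow> real ^ 'n ^ 'n \<Rightarrow> real" where
  "principal_minor k G =
     det (\<chi> i j. if i = k \<or> j = k then (if i = j then 1 else 0) else G $ i $ j)"

definition slice_volume ::
    "(('a::topological_space, 'n::finite) chart \<Rightarrow> 'a \<Rightarrow> real ^ 'n ^ 'n) \<Rightarrow> ('a, 'n) chart \<Rightarrow> 'n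
      \<Rightarrow> 'a measure" where
  "slice_volume g c k =
     distr (density (restrict_space (hyperplane_measure k) (coords c ` chart_dom c))
              (\<lambda>x. ennreal (sqrt (principal_minor k (g c (coords_inv c x))))))
       borel (coords_inv c)"

text \<open>The measure induced by \<open>g\<close> on the hypersurface \<open>S\<close>, as a measure on the manifold
  concentrated on \<open>S\<close>.\<close>

definition hypersurface_measure ::
    "('a::topological_space, 'n::finite) chart set \<Rightarrow> (('a, 'n) chart \<Rightarrow> 'a \<Rightarrow> real ^ 'n ^ 'n) \<Rightarrow> 'a set
      \<Rightarrow> 'a measure" where
  "hypersurface_measure A g S = (SUP (c, k)\<in>slice_charts A S. slice_volume g c k)"

end

theory Submission
  imports Defs "HOL-Library.Function_Algebras"
begin

text \<open>
  In a chart, \<open>d\<^sup>*\<omega>\<close> is minus the Euclidean divergence of the flux density \<open>sqrt (det g) \<omega>\<^sup>#\<close>,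
  divided by \<open>sqrt (det g)\<close>.  Every compactly supported system of \<open>n\<close> functions is the flux
  density of a one-form, so in a chart the equation \<open>d\<^sup>*U = f\<close> asks for a compactly supported
  vector field with prescribed divergence.  In a box this can be solved up to a multiple of one
  fixed bump: integrate the coordinates one after the other, and leave the mean value over each
  line on the bump (\<open>box_poincare\<close>, \<open>local_coexactness\<close>).

  The passage from local to global is by duality.  Let \<open>E\<close> be the space of all \<open>d\<^sup>*U\<close> with \<open>U\<close>
  smooth and compactly supported in \<open>\<Omega>\<close>.  If \<open>f\<close> is not in \<open>E\<close>, there is a linear functional
  \<open>L\<close> on all functions with \<open>L = 0\<close> on \<open>E\<close> and \<open>L f = 1\<close> (\<open>separating_functional\<close>).  By the
  local solution, \<open>L\<close> is a multiple \<open>v p\<close> of the integral on the functions supported near \<open>p\<close>.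
  Comparing two such multiples on a bump supported in both neighbourhoods shows that \<open>v\<close> is locally
  constant, and cutting \<open>f\<close> into finitely many pieces with small supports gives
  \<open>1 = L f = \<integral> f v\<close>.  Hence \<open>f\<close> is in \<open>E\<close> as soon as it is orthogonal to the locally constant
  functions (\<open>coexact_if_orthogonal_to_locally_constant\<close>), which is (a).

  For (b), put \<open>\<omega> = \<chi> V + (1 - \<chi>) W\<close>.  It is \<open>V\<close> near \<open>\<partial>\<^sub>1\<Omega>\<close> and \<open>W\<close> near \<open>\<partial>\<^sub>2\<Omega>\<close>, so \<open>d\<^sup>*\<omega>\<close> has
  compact support in \<open>\<Omega>\<close>, and by the above it suffices that \<open>\<integral> v d\<^sup>*\<omega> = 0\<close> for every locally
  constant \<open>v\<close>.  Near a boundary point \<open>\<Omega>\<close> is a half ball in a suitable chart, hence connected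
  there, so \<open>v\<close> extends to the closure of \<open>\<Omega>\<close> as a locally constant function, and the divergence
  theorem turns \<open>\<integral> v d\<^sup>*\<omega>\<close> into the difference of the boundary integrals of \<open>V(\<nu>) v\<close> and
  \<open>W(\<nu>) v\<close>, which vanishes by hypothesis (\<open>divergence_theorem\<close>, \<open>divergence_free_gluing\<close>).

  Two foundations of this argument are less obvious.  The measures are defined as suprema of
  chart measures, and they restrict to the measure of each chart because the chart measures agree
  on overlaps: this is the change of variables formula, applied for the hypersurface measure to a
  transition map that is thickened from the hyperplane to a slab.  And \<open>d\<^sup>*\<omega>\<close> is defined through
  Christoffel symbols in one chart at each point; that its value is the same in every chart
  (\<open>codifferential_chart\<close>) is derived from integrals instead of the transformation law of these
  symbols: in any chart the expression for \<open>d\<^sup>*(b \<omega>)\<close> integrates to zero for every bump \<open>b\<close>.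
\<close>

section \<open>Calculus of smooth functions\<close>

named_theorems smooth_intros

lemma frechet_derivative_cong_open:
  assumes "open S" "x \<in> S" "\<And>y. y \<in> S \<Longrightarrow> f y = g y"
  shows "frechet_derivative f (at x) = frechet_derivative g (at x)"
proof -
  have "(f has_derivative D) (at x) \<longleftrightarrow> (g has_derivative D) (at x)" for D
    using has_derivative_transform_within_open[OF _ assms(1,2), of f D UNIV g]
      has_derivative_transform_within_open[OF _ assms(1,2), of g D UNIV f] assms(3) by auto
  then show ?thesis by (simp add: frechet_derivative_def)
qed

lemma differentiable_cong_open:
  assumes "open S" "x \<in> S" "\<And>y. y \<in> S \<Longrightarrow> f y = g y" "f differentiable (at x)"
  shows "g differentiable (at x)"
  using assms(4) has_derivative_transform_within_open[OF _ assms(1,2), of f _ UNIV g] assms(3)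
  unfolding differentiable_def by blast

text \<open>The derivatives in \<open>Ck_on\<close> are taken in the whole space, so only on open sets are
  they determined by the values on the set.\<close>

lemma Ck_on_cong:
  assumes "open S" "\<And>x. x \<in> S \<Longrightarrow> f x = g x" "Ck_on k S f"
  shows "Ck_on k S g"
  using assms(2,3)
proof (induction k arbitrary: f g)
  case 0
  then show ?case by (auto cong: continuous_on_cong)
next
  case (Suc k)
  have "\<forall>x\<in>S. g differentiable (at x)"
    using Suc.prems(2) differentiable_cong_open[OF assms(1) _ Suc.prems(1)] by auto
  moreover have "Ck_on k S (\<lambda>x. frechet_derivative g (at x) v)" for v
  proof (rule Suc.IH)
    show "Ck_on k S (\<lambda>x. frechet_derivative f (at x) v)" using Suc.prems(2) by auto
    show "frechet_derivative f (at x) v = frechet_derivative g (at x) v" if "x \<in> S" for x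
      using frechet_derivative_cong_open[OF assms(1) that Suc.prems(1)] by simp
  qed
  ultimately show ?case by simp
qed

text \<open>Replaces the Hilbert choice hidden in \<open>frechet_derivative\<close> by an explicit derivative,
  so that the closure properties follow by induction from the usual differentiation rules.\<close>

lemma Ck_on_SucI:
  assumes "open S" "\<And>x. x \<in> S \<Longrightarrow> (f has_derivative f' x) (at x)"
    and "\<And>v. Ck_on k S (\<lambda>x. f' x v)"
  shows "Ck_on (Suc k) S f"
proof -
  have "f' x = frechet_derivative f (at x)" if "x \<in> S" for x
    using frechet_derivative_at[OF assms(2)[OF that]] .
  then have "Ck_on k S (\<lambda>x. frechet_derivative f (at x) v)" for v
    using Ck_on_cong[OF assms(1) _ assms(3)[of v]] by simp
  then show ?thesis using assms(2) by (auto simp: differentiable_def)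
qed

lemma Ck_on_Suc_derivative:
  "Ck_on (Suc k) S f \<Longrightarrow> x \<in> S \<Longrightarrow> (f has_derivative frechet_derivative f (at x)) (at x)"
  by (auto simp: frechet_derivative_works)

lemma Ck_on_subset: "Ck_on k S f \<Longrightarrow> T \<subseteq> S \<Longrightarrow> Ck_on k T f"
  by (induction k arbitrary: f) (auto intro: continuous_on_subset)

lemma Ck_on_SucD: "Ck_on (Suc k) S f \<Longrightarrow> Ck_on k S f"
proof (induction k arbitrary: f)
  case 0
  then show ?case
    by (auto intro!: continuous_at_imp_continuous_on differentiable_imp_continuous_within)
next
  case (Suc k)
  have d: "\<forall>x\<in>S. f differentiable (at x)" and "Ck_on (Suc k) S (\<lambda>x. frechet_derivative f (at x) v)" for v
    using Suc.prems Ck_on.simps(2)[of "Suc k" S f] by blast+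
  then have "Ck_on k S (\<lambda>x. frechet_derivative f (at x) v)" for v
    using Suc.IH by blast
  with d show ?case using Ck_on.simps(2)[of k S f] by blast
qed

lemma Ck_on_locally:
  assumes "\<And>x. x \<in> S \<Longrightarrow> \<exists>T. open T \<and> x \<in> T \<and> Ck_on k T f"
  shows "Ck_on k S f"
  using assms
proof (induction k arbitrary: f)
  case 0
  have "isCont f x" if x: "x \<in> S" for x
  proof -
    obtain T where "open T" "x \<in> T" "continuous_on T f" using 0[OF x] by auto
    then show ?thesis by (simp add: continuous_on_eq_continuous_at)
  qed
  then show ?case by (simp add: continuous_at_imp_continuous_on)
next
  case (Suc k)
  have "f differentiable (at x)" if "x \<in> S" for x
    using Suc.prems[OF that] by auto
  moreover have "Ck_on k S (\<lambda>x. frechet_derivative f (at x) v)" for v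
    by (rule Suc.IH) (use Suc.prems in fastforce)
  ultimately show ?case using Ck_on.simps(2)[of k S f] by blast
qed

lemma Ck_on_const: "Ck_on k S (\<lambda>x. c)"
  by (induction k arbitrary: c) (auto simp: frechet_derivative_const)

lemma Ck_on_bounded_linear:
  assumes "bounded_linear L"
  shows "Ck_on k S L"
proof (cases k)
  case 0
  then show ?thesis using assms by (auto intro!: linear_continuous_on)
next
  case (Suc m)
  have "(L has_derivative L) (at x)" for x using assms by (rule bounded_linear_imp_has_derivative)
  then have "Ck_on (Suc m) UNIV L" by (intro Ck_on_SucI) (auto intro: Ck_on_const)
  then show ?thesis using Suc Ck_on_subset by blast
qed

lemma Ck_on_compose_linear:
  assumes "bounded_linear L" "open S" "Ck_on k S f"
  shows "Ck_on k S (\<lambda>x. L (f x))"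
  using assms(3)
proof (induction k arbitrary: f)
  case 0
  then show ?case using bounded_linear.continuous_on[OF assms(1)] by auto
next
  case (Suc k)
  show ?case
  proof (rule Ck_on_SucI[OF assms(2)])
    show "((\<lambda>x. L (f x)) has_derivative (\<lambda>v. L (frechet_derivative f (at x) v))) (at x)" if "x \<in> S" for x
      using bounded_linear.has_derivative[OF assms(1) Ck_on_Suc_derivative[OF Suc.prems that]] .
  qed (use Suc in auto)
qed

lemma Ck_on_add:
  assumes "open S" "Ck_on k S f" "Ck_on k S g"
  shows "Ck_on k S (\<lambda>x. f x + g x)"
  using assms(2,3)
proof (induction k arbitrary: f g)
  case 0
  then show ?case by (auto intro: continuous_on_add)
next
  case (Suc k)
  show ?case
  proof (rule Ck_on_SucI[OF assms(1)])
    show "((\<lambda>x. f x + g x) has_derivative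
       (\<lambda>v. frechet_derivative f (at x) v + frechet_derivative g (at x) v)) (at x)" if "x \<in> S" for x
      by (intro has_derivative_add Ck_on_Suc_derivative[OF Suc.prems(1) that] Ck_on_Suc_derivative[OF Suc.prems(2) that])
  qed (use Suc in auto)
qed

lemma Ck_on_sum:
  assumes "open S" "\<And>i. i \<in> I \<Longrightarrow> Ck_on k S (f i)"
  shows "Ck_on k S (\<lambda>x. \<Sum>i\<in>I. f i x)"
  using assms(2) by (induction I rule: infinite_finite_induct) (auto intro: Ck_on_const Ck_on_add[OF assms(1)])

lemma Ck_on_bilinear:
  assumes "bounded_bilinear B" "open S" "Ck_on k S f" "Ck_on k S g"
  shows "Ck_on k S (\<lambda>x. B (f x) (g x))"
  using assms(3,4)
proof (induction k arbitrary: f g)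
  case 0
  then show ?case using bounded_bilinear.continuous_on[OF assms(1)] by auto
next
  case (Suc k)
  show ?case
  proof (rule Ck_on_SucI[OF assms(2)])
    show "((\<lambda>x. B (f x) (g x)) has_derivative
       (\<lambda>v. B (f x) (frechet_derivative g (at x) v) + B (frechet_derivative f (at x) v) (g x))) (at x)"
      if "x \<in> S" for x
      by (intro bounded_bilinear.FDERIV[OF assms(1)] Ck_on_Suc_derivative[OF Suc.prems(1) that] Ck_on_Suc_derivative[OF Suc.prems(2) that])
    show "Ck_on k S (\<lambda>x. B (f x) (frechet_derivative g (at x) v) + B (frechet_derivative f (at x) v) (g x))" for v
      using Suc.prems Ck_on_SucD[OF Suc.prems(1)] Ck_on_SucD[OF Suc.prems(2)]
      by (intro Ck_on_add[OF assms(2)] Suc.IH) auto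
  qed
qed

lemma Ck_on_compose:
  fixes f :: "'a::real_normed_vector \<Rightarrow> 'b::euclidean_space" and g :: "'b \<Rightarrow> 'c::real_normed_vector"
  assumes "open S" "f ` S \<subseteq> T" "Ck_on k S f" "Ck_on k T g"
  shows "Ck_on k S (\<lambda>x. g (f x))"
  using assms(3,4)
proof (induction k arbitrary: g)
  case 0
  then show ?case using continuous_on_compose2[of T g S f] assms(2) by auto
next
  case (Suc k)
  let ?f' = "\<lambda>x. frechet_derivative f (at x)" and ?g' = "\<lambda>x. frechet_derivative g (at x)"
  show ?case
  proof (rule Ck_on_SucI[OF assms(1)])
    fix x assume x: "x \<in> S"
    have g: "(g has_derivative ?g' (f x)) (at (f x))"
      using Ck_on_Suc_derivative[OF Suc.prems(2)] x assms(2) by blast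
    have "((\<lambda>x. g (f x)) has_derivative (\<lambda>v. ?g' (f x) (?f' x v))) (at x)"
      using has_derivative_compose[OF Ck_on_Suc_derivative[OF Suc.prems(1) x] g] by (simp add: o_def)
    \<comment> \<open>In a basis the chain rule is a finite sum of products, whose factors are covered by the
      induction hypothesis.\<close>
    moreover have "?g' (f x) (?f' x v) = (\<Sum>b\<in>Basis. (?f' x v \<bullet> b) *\<^sub>R ?g' (f x) b)" for v
    proof -
      have lin: "linear (?g' (f x))" using g by (rule has_derivative_linear)
      have "?g' (f x) (?f' x v) = ?g' (f x) (\<Sum>b\<in>Basis. (?f' x v \<bullet> b) *\<^sub>R b)"
        by (simp add: euclidean_representation)
      also have "\<dots> = (\<Sum>b\<in>Basis. (?f' x v \<bullet> b) *\<^sub>R ?g' (f x) b)"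
        by (simp add: linear_sum[OF lin] linear_scale[OF lin])
      finally show ?thesis .
    qed
    ultimately show "((\<lambda>x. g (f x)) has_derivative
        (\<lambda>v. \<Sum>b\<in>Basis. (?f' x v \<bullet> b) *\<^sub>R ?g' (f x) b)) (at x)" by simp
  next
    fix v
    have "Ck_on k S (\<lambda>x. ?g' (f x) b)" for b
      using Suc.IH[of "\<lambda>y. ?g' y b"] Ck_on_SucD[OF Suc.prems(1)] Suc.prems(2) by simp
    then show "Ck_on k S (\<lambda>x. \<Sum>b\<in>Basis. (?f' x v \<bullet> b) *\<^sub>R ?g' (f x) b)"
      using Suc.prems(1)
      by (intro Ck_on_sum assms(1) Ck_on_bilinear[OF bounded_bilinear_scaleR]
          Ck_on_compose_linear[OF bounded_linear_inner_left]) auto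
  qed
qed

lemma smooth_on_cong: "open S \<Longrightarrow> (\<And>x. x \<in> S \<Longrightarrow> f x = g x) \<Longrightarrow> smooth_on S f \<Longrightarrow> smooth_on S g"
  unfolding smooth_on_def using Ck_on_cong by blast

lemma smooth_on_subset: "smooth_on S f \<Longrightarrow> T \<subseteq> S \<Longrightarrow> smooth_on T f"
  unfolding smooth_on_def using Ck_on_subset by blast

lemma smooth_on_locally:
  assumes "\<And>x. x \<in> S \<Longrightarrow> \<exists>T. open T \<and> x \<in> T \<and> smooth_on T f"
  shows "smooth_on S f"
  unfolding smooth_on_def
proof
  fix k show "Ck_on k S f"
    using assms by (intro Ck_on_locally) (metis smooth_on_def)
qed

lemma smooth_on_imp_continuous_on: "smooth_on S f \<Longrightarrow> continuous_on S f"
  unfolding smooth_on_def using Ck_on.simps(1) by blast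

lemma smooth_on_imp_derivative:
  "smooth_on S f \<Longrightarrow> x \<in> S \<Longrightarrow> (f has_derivative frechet_derivative f (at x)) (at x)"
  unfolding smooth_on_def using Ck_on_Suc_derivative by blast

lemma smooth_on_imp_differentiable: "smooth_on S f \<Longrightarrow> x \<in> S \<Longrightarrow> f differentiable (at x)"
  using smooth_on_imp_derivative by (auto simp: differentiable_def)

lemma smooth_on_derivative [smooth_intros]:
  "smooth_on S f \<Longrightarrow> smooth_on S (\<lambda>x. frechet_derivative f (at x) v)"
  unfolding smooth_on_def using Ck_on.simps(2) by blast

lemma smooth_on_const [smooth_intros]: "smooth_on S (\<lambda>x. c)"
  by (simp add: smooth_on_def Ck_on_const)

lemma smooth_on_bounded_linear: "bounded_linear L \<Longrightarrow> smooth_on S L"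
  by (simp add: smooth_on_def Ck_on_bounded_linear)

lemma smooth_on_ident [smooth_intros]: "smooth_on S (\<lambda>x. x)"
  by (rule smooth_on_bounded_linear) (rule bounded_linear_ident)

lemma smooth_on_compose_linear:
  "bounded_linear L \<Longrightarrow> open S \<Longrightarrow> smooth_on S f \<Longrightarrow> smooth_on S (\<lambda>x. L (f x))"
  by (simp add: smooth_on_def Ck_on_compose_linear)

lemma smooth_on_bilinear:
  "bounded_bilinear B \<Longrightarrow> open S \<Longrightarrow> smooth_on S f \<Longrightarrow> smooth_on S g \<Longrightarrow> smooth_on S (\<lambda>x. B (f x) (g x))"
  by (simp add: smooth_on_def Ck_on_bilinear)

lemma smooth_on_compose:
  fixes f :: "'a::real_normed_vector \<Rightarrow> 'b::euclidean_space" and g :: "'b \<Rightarrow> 'c::real_normed_vector"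
  shows "open S \<Longrightarrow> f ` S \<subseteq> T \<Longrightarrow> smooth_on S f \<Longrightarrow> smooth_on T g \<Longrightarrow> smooth_on S (\<lambda>x. g (f x))"
  unfolding smooth_on_def using Ck_on_compose by blast

lemma smooth_on_add [smooth_intros]:
  "open S \<Longrightarrow> smooth_on S f \<Longrightarrow> smooth_on S g \<Longrightarrow> smooth_on S (\<lambda>x. f x + g x)"
  by (simp add: smooth_on_def Ck_on_add)

lemma smooth_on_uminus [smooth_intros]:
  "open S \<Longrightarrow> smooth_on S f \<Longrightarrow> smooth_on S (\<lambda>x. - f x)"
  by (rule smooth_on_compose_linear[OF bounded_linear_minus[OF bounded_linear_ident]])

lemma smooth_on_diff [smooth_intros]:
  "open S \<Longrightarrow> smooth_on S f \<Longrightarrow> smooth_on S g \<Longrightarrow> smooth_on S (\<lambda>x. f x - g x)"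
  using smooth_on_add[of S f "\<lambda>x. - g x"] smooth_on_uminus[of S g] by simp

lemma smooth_on_sum [smooth_intros]:
  "open S \<Longrightarrow> (\<And>i. i \<in> I \<Longrightarrow> smooth_on S (f i)) \<Longrightarrow> smooth_on S (\<lambda>x. \<Sum>i\<in>I. f i x)"
  by (simp add: smooth_on_def Ck_on_sum)

lemma smooth_on_scaleR [smooth_intros]:
  "open S \<Longrightarrow> smooth_on S f \<Longrightarrow> smooth_on S g \<Longrightarrow> smooth_on S (\<lambda>x. f x *\<^sub>R g x)"
  by (rule smooth_on_bilinear[OF bounded_bilinear_scaleR])

lemma smooth_on_inner [smooth_intros]:
  "open S \<Longrightarrow> smooth_on S f \<Longrightarrow> smooth_on S g \<Longrightarrow> smooth_on S (\<lambda>x. f x \<bullet> g x)"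
  by (rule smooth_on_bilinear[OF bounded_bilinear_inner])

lemma smooth_on_mult [smooth_intros]:
  fixes f g :: "'a::real_normed_vector \<Rightarrow> real"
  shows "open S \<Longrightarrow> smooth_on S f \<Longrightarrow> smooth_on S g \<Longrightarrow> smooth_on S (\<lambda>x. f x * g x)"
  by (rule smooth_on_bilinear[OF bounded_bilinear_mult])

lemma smooth_on_prod [smooth_intros]:
  fixes f :: "'i \<Rightarrow> 'a::real_normed_vector \<Rightarrow> real"
  shows "open S \<Longrightarrow> (\<And>i. i \<in> I \<Longrightarrow> smooth_on S (f i)) \<Longrightarrow> smooth_on S (\<lambda>x. \<Prod>i\<in>I. f i x)"
  by (induction I rule: infinite_finite_induct) (auto intro: smooth_intros)

lemma smooth_on_nth [smooth_intros]:
  "open S \<Longrightarrow> smooth_on S f \<Longrightarrow> smooth_on S (\<lambda>x. f x $ i)"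
  by (rule smooth_on_compose_linear[OF bounded_linear_vec_nth])

lemma vec_lambda_axis_sum: "(\<chi> i. f i) = (\<Sum>i\<in>UNIV. (f i :: real) *\<^sub>R axis i 1)"
  by (simp add: vec_eq_iff axis_def if_distrib cong: if_cong)

lemma smooth_on_vec_lambda [smooth_intros]:
  fixes f :: "'n::finite \<Rightarrow> 'a::real_normed_vector \<Rightarrow> real"
  assumes "open S" "\<And>i. smooth_on S (f i)"
  shows "smooth_on S (\<lambda>x. \<chi> i. f i x)"
  unfolding vec_lambda_axis_sum using assms by (intro smooth_intros)

lemma Ck_on_inverse: "Ck_on k {x::real. x \<noteq> 0} inverse"
proof (induction k)
  case 0
  then show ?case by (auto intro!: continuous_intros)
next
  case (Suc k)
  have op: "open {x::real. x \<noteq> 0}" by (simp add: open_Collect_neq continuous_on_const continuous_on_id)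
  show ?case
  proof (rule Ck_on_SucI[OF op])
    show "(inverse has_derivative (\<lambda>v. - (inverse x * v * inverse x))) (at x)" if "x \<in> {x::real. x \<noteq> 0}" for x
      using has_derivative_inverse'[of x UNIV] that by simp
    show "Ck_on k {x::real. x \<noteq> 0} (\<lambda>x. - (inverse x * v * inverse x))" for v
      by (intro Ck_on_compose_linear[OF bounded_linear_minus[OF bounded_linear_ident]] op
        Ck_on_bilinear[OF bounded_bilinear_mult] Suc Ck_on_const)
  qed
qed

lemma smooth_on_inverse [smooth_intros]:
  fixes f :: "'a::real_normed_vector \<Rightarrow> real"
  assumes "open S" "smooth_on S f" "\<And>x. x \<in> S \<Longrightarrow> f x \<noteq> 0"
  shows "smooth_on S (\<lambda>x. inverse (f x))"
  by (rule smooth_on_compose[where T = "{x. x \<noteq> 0}", OF assms(1) _ assms(2)]) (use assms in \<open>auto simp: smooth_on_def Ck_on_inverse\<close>)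

lemma smooth_on_divide [smooth_intros]:
  fixes f g :: "'a::real_normed_vector \<Rightarrow> real"
  assumes "open S" "smooth_on S f" "smooth_on S g" "\<And>x. x \<in> S \<Longrightarrow> g x \<noteq> 0"
  shows "smooth_on S (\<lambda>x. f x / g x)"
  unfolding divide_inverse using assms by (intro smooth_intros)

lemma Ck_on_sqrt: "Ck_on k {0<..} sqrt"
proof (induction k)
  case 0
  then show ?case by (auto intro!: continuous_intros)
next
  case (Suc k)
  show ?case
  proof (rule Ck_on_SucI)
    show "(sqrt has_derivative (\<lambda>v. inverse (sqrt x) * (v / 2))) (at x)" if "x \<in> {0<..}" for x
    proof -
      have "(*) (inverse (sqrt x) / 2) = (\<lambda>v. inverse (sqrt x) * (v / 2))" by auto
      then show ?thesis using DERIV_real_sqrt[of x] that by (simp add: has_field_derivative_def)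
    qed
    have "Ck_on k {0<..} (\<lambda>x. inverse (sqrt x))"
      by (rule Ck_on_compose[OF _ _ Suc Ck_on_inverse]) auto
    then show "Ck_on k {0<..} (\<lambda>x. inverse (sqrt x) * (v / 2))" for v
      by (intro Ck_on_bilinear[OF bounded_bilinear_mult] Ck_on_const) auto
  qed auto
qed

lemma smooth_on_sqrt [smooth_intros]:
  fixes f :: "'a::real_normed_vector \<Rightarrow> real"
  assumes "open S" "smooth_on S f" "\<And>x. x \<in> S \<Longrightarrow> f x > 0"
  shows "smooth_on S (\<lambda>x. sqrt (f x))"
  by (rule smooth_on_compose[where T = "{0<..}", OF assms(1) _ assms(2)]) (use assms in \<open>auto simp: smooth_on_def Ck_on_sqrt\<close>)

lemma smooth_on_det [smooth_intros]:
  fixes f :: "'a::real_normed_vector \<Rightarrow> real ^ 'n ^ 'n"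
  assumes "open S" "smooth_on S f"
  shows "smooth_on S (\<lambda>x. det (f x))"
  unfolding det_def using assms by (intro smooth_intros)

lemma smooth_on_extend_zero:
  fixes f :: "'a::real_normed_vector \<Rightarrow> 'b::real_normed_vector"
  assumes "open S" "smooth_on S f" "closed K" "\<And>x. x \<notin> K \<Longrightarrow> f x = 0" "K \<subseteq> S"
  shows "smooth_on UNIV f"
proof (rule smooth_on_locally)
  fix x :: 'a
  show "\<exists>T. open T \<and> x \<in> T \<and> smooth_on T f"
  proof (cases "x \<in> K")
    case False
    have "smooth_on (- K) f"
      by (rule smooth_on_cong[OF _ _ smooth_on_const[of _ 0]]) (use assms in auto)
    then show ?thesis using False assms by blast
  qed (use assms in blast)
qed

section \<open>Smooth bump functions\<close>

text \<open>The family is closed under differentiation up to linear combinations, which makes smoothness of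
  \<open>flat 0\<close> at the origin an induction over all \<open>m\<close> at once.\<close>

definition flat :: "nat \<Rightarrow> real \<Rightarrow> real" where
  "flat m t = (if t > 0 then exp (- inverse t) * inverse t ^ m else 0)"

lemma tendsto_flat: "((flat m) \<longlongrightarrow> 0) (at 0)"
proof -
  have "((\<lambda>t. (inverse t)^m / exp (inverse t)) \<longlongrightarrow> (0::real)) (at_right 0)"
    by (rule filterlim_compose[OF tendsto_power_div_exp_0 filterlim_inverse_at_top_right])
  then have "(flat m \<longlongrightarrow> 0) (at_right 0)"
    by (rule Lim_transform_eventually)
      (auto simp: flat_def eventually_at_right_less exp_minus field_simps intro!: eventually_at_rightI[of 0 1])
  moreover have "(flat m \<longlongrightarrow> 0) (at_left 0)"
    by (rule Lim_transform_eventually[OF tendsto_const])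
      (auto simp: flat_def intro!: eventually_at_leftI[of "-1" 0])
  ultimately show ?thesis by (simp add: filterlim_at_split)
qed

text \<open>At the origin the difference quotient of \<open>flat m\<close> is \<open>flat (Suc m)\<close>,
  which tends to zero.\<close>

lemma has_real_derivative_flat:
  "(flat m has_real_derivative flat (m + 2) t - real m * flat (m + 1) t) (at t)"
proof -
  consider "t > 0" | "t < 0" | "t = 0" by linarith
  then show ?thesis
  proof cases
    case 1
    have "((\<lambda>t. exp (- inverse t) * inverse t ^ m) has_real_derivative
        exp (- inverse t) * inverse t ^ 2 * inverse t ^ m
        - exp (- inverse t) * (real m * inverse t ^ (m - Suc 0) * inverse t ^ 2)) (at t)"
      using 1 by (auto intro!: derivative_eq_intros simp: power2_eq_square)
    also have "exp (- inverse t) * inverse t ^ 2 * inverse t ^ m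
        - exp (- inverse t) * (real m * inverse t ^ (m - Suc 0) * inverse t ^ 2)
        = flat (m + 2) t - real m * flat (m + 1) t"
      using 1 by (cases m) (simp_all add: flat_def algebra_simps power2_eq_square)
    finally have "((\<lambda>t. exp (- inverse t) * inverse t ^ m) has_real_derivative
        flat (m + 2) t - real m * flat (m + 1) t) (at t)" .
    then show ?thesis
      by (rule has_field_derivative_transform_within_open[where S = "{0<..}"]) (use 1 in \<open>auto simp: flat_def\<close>)
  next
    case 2
    have "((\<lambda>t. 0) has_real_derivative flat (m + 2) t - real m * flat (m + 1) t) (at t)"
      using 2 by (auto simp: flat_def)
    then show ?thesis
      by (rule has_field_derivative_transform_within_open[where S = "{..<0}"]) (use 2 in \<open>auto simp: flat_def\<close>)
  next
    case 3
    have "flat (Suc m) = (\<lambda>h. (flat m (0 + h) - flat m 0) / h)"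
      by (auto simp: flat_def divide_inverse)
    then have "(flat m has_real_derivative 0) (at 0)"
      using tendsto_flat[of "Suc m"] unfolding DERIV_def by simp
    then show ?thesis using 3 by (simp add: flat_def[of _ 0])
  qed
qed

lemma Ck_on_flat: "Ck_on k UNIV (flat m)"
proof (induction k arbitrary: m)
  case 0
  have "isCont (flat m) t" for t by (rule DERIV_isCont[OF has_real_derivative_flat])
  then show ?case by (simp add: continuous_at_imp_continuous_on)
next
  case (Suc k)
  show ?case
  proof (rule Ck_on_SucI)
    show "(flat m has_derivative (\<lambda>v. (flat (m + 2) t + (- real m) * flat (m + 1) t) * v)) (at t)" for t
      using has_real_derivative_flat[of m t] by (simp add: has_field_derivative_def)
    show "Ck_on k UNIV (\<lambda>t. (flat (m + 2) t + (- real m) * flat (m + 1) t) * v)" for v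
      by (intro Ck_on_bilinear[OF bounded_bilinear_mult] Ck_on_add Suc Ck_on_const) auto
  qed auto
qed

lemma smooth_on_flat [smooth_intros]:
  fixes f :: "'a::real_normed_vector \<Rightarrow> real"
  assumes "open S" "smooth_on S f"
  shows "smooth_on S (\<lambda>x. flat m (f x))"
  by (rule smooth_on_compose[where T = UNIV, OF assms(1) _ assms(2)]) (auto simp: smooth_on_def Ck_on_flat)

lemma flat_pos_iff: "flat 0 t > 0 \<longleftrightarrow> t > 0" and flat_nonneg: "flat 0 t \<ge> 0"
  and flat_eq_0: "t \<le> 0 \<Longrightarrow> flat m t = 0"
  by (auto simp: flat_def)

definition bump :: "'a::real_inner \<Rightarrow> real \<Rightarrow> 'a \<Rightarrow> real" where
  "bump p r x = flat 0 (r\<^sup>2 - (x - p) \<bullet> (x - p))"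

lemma smooth_on_bump: "open S \<Longrightarrow> smooth_on S (bump p r)"
  unfolding bump_def by (intro smooth_intros)

lemma bump_nonneg: "bump p r x \<ge> 0"
  by (simp add: bump_def flat_nonneg)

lemma bump_pos_iff:
  assumes "r > 0" shows "bump p r x > 0 \<longleftrightarrow> x \<in> ball p r"
proof -
  have "(norm (x - p))\<^sup>2 < r\<^sup>2 \<longleftrightarrow> norm (x - p) < r"
    using assms by (metis norm_ge_zero less_imp_le power_less_imp_less_base power_strict_mono zero_less_numeral)
  then show ?thesis
    by (simp add: bump_def flat_pos_iff dist_norm norm_minus_commute[of p] power2_norm_eq_inner)
qed

lemma bump_eq_0: "r > 0 \<Longrightarrow> x \<notin> ball p r \<Longrightarrow> bump p r x = 0"
  using bump_nonneg[of p r x] bump_pos_iff[of r p x] by linarith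

section \<open>Coordinate lines\<close>

definition set_coord :: "'n::finite \<Rightarrow> real ^ 'n \<Rightarrow> real \<Rightarrow> real ^ 'n" where
  "set_coord i x s = x + (s - x $ i) *\<^sub>R axis i 1"

lemma set_coord_nth [simp]: "set_coord i x s $ j = (if j = i then s else x $ j)"
  by (simp add: set_coord_def axis_def)

lemma set_coord_set_coord [simp]: "set_coord i (set_coord i x s) t = set_coord i x t"
  by (simp add: vec_eq_iff)

lemma set_coord_commute: "i \<noteq> j \<Longrightarrow> set_coord i (set_coord j x s) t = set_coord j (set_coord i x t) s"
  by (simp add: vec_eq_iff)

lemma set_coord_self [simp]: "set_coord i x (x $ i) = x"
  by (simp add: vec_eq_iff)

abbreviation partial :: "'n::finite \<Rightarrow> (real ^ 'n \<Rightarrow> real) \<Rightarrow> real ^ 'n \<Rightarrow> real" where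
  "partial i f x \<equiv> frechet_derivative f (at x) (axis i 1)"

lemma has_derivative_along_coordinate_line:
  assumes "f differentiable (at (set_coord i x s))"
  shows "((\<lambda>s. f (set_coord i x s)) has_real_derivative partial i f (set_coord i x s)) (at s)"
proof -
  let ?f' = "frechet_derivative f (at (set_coord i x s))"
  have f: "(f has_derivative ?f') (at (set_coord i x s))"
    using assms by (simp add: frechet_derivative_works)
  have u: "(set_coord i x has_derivative (\<lambda>t. t *\<^sub>R axis i 1)) (at s)"
    unfolding set_coord_def by (auto intro!: derivative_eq_intros)
  have "((\<lambda>s. f (set_coord i x s)) has_derivative (\<lambda>t. ?f' (t *\<^sub>R axis i 1))) (at s)"
    using has_derivative_compose[OF u f] by simp
  moreover have "?f' (t *\<^sub>R axis i 1) = partial i f (set_coord i x s) * t" for t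
    using linear_scale[OF has_derivative_linear[OF f]] by simp
  ultimately show ?thesis by (simp add: has_field_derivative_def)
qed

lemma smooth_on_set_coord [smooth_intros]:
  fixes f :: "'a::real_normed_vector \<Rightarrow> real ^ 'n"
  assumes "open S" "smooth_on S f" "smooth_on S g"
  shows "smooth_on S (\<lambda>x. set_coord i (f x) (g x))"
  unfolding set_coord_def using assms by (intro smooth_intros)

lemma frechet_derivative_eq_0_outside:
  assumes "closed K" "\<And>x. x \<notin> K \<Longrightarrow> f x = 0" "x \<notin> K"
  shows "frechet_derivative f (at x) v = 0"
proof -
  have "frechet_derivative f (at x) = frechet_derivative (\<lambda>_. 0) (at x)"
    by (rule frechet_derivative_cong_open[of "- K"]) (use assms in auto)
  then show ?thesis by (simp add: frechet_derivative_const)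
qed

section \<open>Slicing Lebesgue measure by coordinate hyperplanes\<close>

lemma borel_measurable_vec_lambda:
  fixes f :: "'a \<Rightarrow> 'n::finite \<Rightarrow> real"
  assumes "\<And>i. (\<lambda>x. f x i) \<in> borel_measurable M"
  shows "(\<lambda>x. \<chi> i. f x i) \<in> borel_measurable M"
  by (subst borel_measurable_euclidean_space) (use assms in \<open>auto simp: Basis_vec_def inner_axis\<close>)

text \<open>Both measures give a box the product of its side lengths.  This is the bridge to Fubini's theorem
  for product measures.\<close>

lemma lborel_vec_eq_PiM:
  "(lborel :: (real ^ 'n::finite) measure) = distr (PiM UNIV (\<lambda>_. lborel)) borel (\<lambda>y. \<chi> i. y i)"
proof (rule lborel_eqI)
  interpret product_sigma_finite "\<lambda>_::'n. lborel :: real measure" ..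
  have m: "(\<lambda>y. \<chi> i. y i) \<in> borel_measurable (PiM UNIV (\<lambda>_::'n. lborel :: real measure))"
    by (rule borel_measurable_vec_lambda) auto
  fix l u :: "real ^ 'n"
  assume le: "\<And>b. b \<in> Basis \<Longrightarrow> l \<bullet> b \<le> u \<bullet> b"
  have le': "l $ i \<le> u $ i" for i
    using le[of "axis i 1"] by (auto simp: inner_axis)
  have "(\<lambda>y. \<chi> i. y i) -` box l u \<inter> space (PiM UNIV (\<lambda>_::'n. lborel :: real measure))
      = (PiE UNIV (\<lambda>i. {l $ i <..< u $ i}))"
    by (auto simp: box_def space_PiM Basis_vec_def inner_axis)
  then have "emeasure (distr (PiM UNIV (\<lambda>_. lborel)) borel (\<lambda>y. \<chi> i. y i)) (box l u)
      = emeasure (PiM UNIV (\<lambda>_. lborel)) (PiE UNIV (\<lambda>i. {l $ i <..< u $ i}))"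
    using m by (subst emeasure_distr) auto
  also have "\<dots> = (\<Prod>i\<in>UNIV. ennreal (u $ i - l $ i))"
    using le' by (subst emeasure_PiM) auto
  also have "\<dots> = ennreal (\<Prod>i\<in>UNIV. u $ i - l $ i)"
    using le' by (intro prod_ennreal) auto
  also have "(\<Prod>i\<in>UNIV. u $ i - l $ i) = (\<Prod>b\<in>Basis. (u - l) \<bullet> b)"
  proof -
    have B: "Basis = (\<lambda>i. axis i 1 :: real ^ 'n) ` UNIV" by (auto simp: Basis_vec_def)
    show ?thesis unfolding B
      by (subst prod.reindex) (auto simp: inj_on_def axis_eq_axis inner_axis)
  qed
  finally show "emeasure (distr (PiM UNIV (\<lambda>_. lborel)) borel (\<lambda>y. \<chi> i. y i)) (box l u)
      = ennreal (\<Prod>b\<in>Basis. (u - l) \<bullet> b)" .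
qed simp

lemma measurable_hyperplane_embedding:
  "(\<lambda>y. \<chi> i. if i = k then 0 else y i) \<in> borel_measurable (PiM (UNIV - {k}) (\<lambda>_::'n::finite. lborel :: real measure))"
proof (rule borel_measurable_vec_lambda)
  fix i
  show "(\<lambda>y. if i = k then 0 else y i) \<in> borel_measurable (PiM (UNIV - {k}) (\<lambda>_::'n. lborel :: real measure))"
    by (cases "i = k") auto
qed

lemma sets_hyperplane_measure [measurable_cong, simp]: "sets (hyperplane_measure k) = sets borel"
  and space_hyperplane_measure [simp]: "space (hyperplane_measure k) = UNIV"
  by (auto simp: hyperplane_measure_def)

lemma set_coord_measurable [measurable]:
  "(\<lambda>p. set_coord k (fst p) (snd p)) \<in> borel_measurable (borel \<Otimes>\<^sub>M borel)"
  unfolding set_coord_def borel_prod by (intro borel_measurable_continuous_onI continuous_intros)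

lemma set_coord_hyperplane_embedding: "set_coord k (\<chi> i. if i = k then 0 else y i) s = (\<chi> i. (y(k := s)) i)"
  by (simp add: vec_eq_iff)

lemma nn_integral_lborel_hyperplane:
  fixes h :: "real ^ 'n::finite \<Rightarrow> ennreal"
  assumes [measurable]: "h \<in> borel_measurable borel"
  shows "(\<integral>\<^sup>+x. h x \<partial>lborel) = (\<integral>\<^sup>+z. (\<integral>\<^sup>+s. h (set_coord k z s) \<partial>lborel) \<partial>hyperplane_measure k)"
proof -
  interpret product_sigma_finite "\<lambda>_::'n. lborel :: real measure" ..
  note measurable_hyperplane_embedding[of k, measurable]
  have m[measurable]: "(\<lambda>y. \<chi> i. y i) \<in> borel_measurable (PiM UNIV (\<lambda>_::'n. lborel :: real measure))"
    by (rule borel_measurable_vec_lambda) auto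
  have U: "UNIV = insert k (UNIV - {k})" by auto
  have "(\<integral>\<^sup>+x. h x \<partial>lborel) = (\<integral>\<^sup>+y. h (\<chi> i. y i) \<partial>PiM UNIV (\<lambda>_. lborel))"
    by (subst lborel_vec_eq_PiM, subst nn_integral_distr) auto
  also have "\<dots> = (\<integral>\<^sup>+y. (\<integral>\<^sup>+s. h (\<chi> i. (y(k := s)) i) \<partial>lborel) \<partial>PiM (UNIV - {k}) (\<lambda>_. lborel))"
    using product_nn_integral_insert[of "UNIV - {k}" k "\<lambda>y. h (\<chi> i. y i)"] measurable_compose[OF m assms]
    by (simp add: insert_Diff_single insert_absorb)
  also have "\<dots> = (\<integral>\<^sup>+y. (\<integral>\<^sup>+s. h (set_coord k (\<chi> i. if i = k then 0 else y i) s) \<partial>lborel) \<partial>PiM (UNIV - {k}) (\<lambda>_. lborel))"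
    by (simp only: set_coord_hyperplane_embedding)
  also have "\<dots> = (\<integral>\<^sup>+z. (\<integral>\<^sup>+s. h (set_coord k z s) \<partial>lborel) \<partial>hyperplane_measure k)"
    unfolding hyperplane_measure_def by (subst nn_integral_distr) auto
  finally show ?thesis .
qed

lemma integral_lborel_hyperplane:
  fixes h :: "real ^ 'n::finite \<Rightarrow> real"
  assumes h: "integrable lborel h"
  shows "(\<integral>x. h x \<partial>lborel) = (\<integral>z. (\<integral>s. h (set_coord k z s) \<partial>lborel) \<partial>hyperplane_measure k)"
proof -
  interpret product_sigma_finite "\<lambda>_::'n. lborel :: real measure" ..
  have [measurable]: "h \<in> borel_measurable borel" using h by auto
  note measurable_hyperplane_embedding[of k, measurable]
  have m[measurable]: "(\<lambda>y. \<chi> i. y i) \<in> borel_measurable (PiM UNIV (\<lambda>_::'n. lborel :: real measure))"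
    by (rule borel_measurable_vec_lambda) auto
  have "integrable (PiM UNIV (\<lambda>_::'n. lborel :: real measure)) (\<lambda>y. h (\<chi> i. y i))"
    using h by (subst (asm) lborel_vec_eq_PiM, subst (asm) integrable_distr_eq) auto
  then have i: "integrable (PiM (insert k (UNIV - {k})) (\<lambda>_::'n. lborel :: real measure)) (\<lambda>y. h (\<chi> i. y i))"
    by (simp add: insert_Diff_single insert_absorb)
  have "(\<integral>x. h x \<partial>lborel) = (\<integral>y. h (\<chi> i. y i) \<partial>PiM UNIV (\<lambda>_. lborel))"
    by (subst lborel_vec_eq_PiM, subst integral_distr) auto
  also have "\<dots> = (\<integral>y. (\<integral>s. h (\<chi> i. (y(k := s)) i) \<partial>lborel) \<partial>PiM (UNIV - {k}) (\<lambda>_. lborel))"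
    using product_integral_insert[OF _ _ i] by (simp add: insert_Diff_single insert_absorb)
  also have "\<dots> = (\<integral>y. (\<integral>s. h (set_coord k (\<chi> i. if i = k then 0 else y i) s) \<partial>lborel) \<partial>PiM (UNIV - {k}) (\<lambda>_. lborel))"
    by (simp only: set_coord_hyperplane_embedding)
  also have "\<dots> = (\<integral>z. (\<integral>s. h (set_coord k z s) \<partial>lborel) \<partial>hyperplane_measure k)"
    unfolding hyperplane_measure_def
  proof (subst integral_distr)
    show "(\<lambda>z. LINT s|lborel. h (set_coord k z s)) \<in> borel_measurable borel"
      by (rule lborel.borel_measurable_lebesgue_integral) measurable
  qed auto
  finally show ?thesis .
qed

lemma AE_hyperplane_measure: "AE z in hyperplane_measure k. z $ k = 0"
  unfolding hyperplane_measure_def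
  by (subst AE_distr_iff) (auto simp: measurable_hyperplane_embedding)

section \<open>Integration by parts in half spaces\<close>

lemma integrable_continuous_support_cbox:
  fixes f :: "'a::euclidean_space \<Rightarrow> real"
  assumes "continuous_on UNIV f" "\<And>x. x \<notin> cbox a b \<Longrightarrow> f x = 0"
  shows "integrable lborel f"
proof -
  have "integrable lborel (\<lambda>x. indicator (cbox a b) x *\<^sub>R f x)"
    using assms(1) by (intro borel_integrable_compact) (auto intro: continuous_on_subset)
  moreover have "(\<lambda>x. indicator (cbox a b) x *\<^sub>R f x) = f"
    using assms(2) by (intro ext) (auto simp: indicator_def)
  ultimately show ?thesis by simp
qed

text \<open>The fundamental theorem of calculus for a compactly supported function on the line, the two half
  lines included: these are the one-dimensional cases of the divergence theorem without and with
  boundary.\<close>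

lemma integral_derivative_half_lines:
  fixes f f' :: "real \<Rightarrow> real"
  assumes d: "\<And>s. (f has_real_derivative f' s) (at s)" and c: "continuous_on UNIV f'"
    and z: "\<And>s. s \<notin> {a..b} \<Longrightarrow> f s = 0"
  shows "(\<integral>s. f' s \<partial>lborel) = 0"
    "(\<integral>s. indicator {..<0} s * f' s \<partial>lborel) = f 0"
    "(\<integral>s. indicator {0<..} s * f' s \<partial>lborel) = - f 0"
proof -
  \<comment> \<open>A symmetric interval with \<open>0\<close> in its interior contains the support, whatever
    the position of \<open>a\<close> and \<open>b\<close> is.\<close>
  define R where "R = max \<bar>a\<bar> \<bar>b\<bar> + 1"
  have R: "f s = 0" if "\<bar>s\<bar> \<ge> R" for s
  proof (rule z)
    show "s \<notin> {a..b}" using that by (auto simp: R_def max_def abs_if split: if_splits)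
  qed
  have fR: "f R = 0" "f (- R) = 0" "R > 0" using R[of R] R[of "-R"] by (auto simp: R_def)
  have out: "f' s = 0" if "s \<notin> {- R..R}" for s
  proof -
    have "(f has_real_derivative 0) (at s)"
    proof (rule has_field_derivative_transform_within_open[where f = "\<lambda>_. 0" and S = "- {- R..R}"])
      show "0 = f t" if "t \<in> - {- R..R}" for t using R[of t] that by auto
    qed (use that in auto)
    then show ?thesis using d DERIV_unique by blast
  qed
  have F: "(\<integral>s. indicator {u..v} s *\<^sub>R f' s \<partial>lborel) = f v - f u" if "u \<le> v" for u v
    using that d c by (intro integral_FTC_atLeastAtMost)
      (auto simp: has_real_derivative_iff_has_vector_derivative intro: continuous_on_subset has_vector_derivative_at_within)
  have "f' s = indicator {- R..R} s *\<^sub>R f' s" for s using out[of s] by (auto simp: indicator_def)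
  then have "(\<integral>s. f' s \<partial>lborel) = (\<integral>s. indicator {- R..R} s *\<^sub>R f' s \<partial>lborel)" by presburger
  then show "(\<integral>s. f' s \<partial>lborel) = 0" using F[of "- R" R] fR by simp
  have m: "f' \<in> borel_measurable borel" using c by (rule borel_measurable_continuous_onI)
  have ne: "AE s in lborel. s \<noteq> (0::real)" by (rule AE_lborel_singleton)
  have "AE s in lborel. indicator {..<0} s * f' s = indicator {- R..0} s *\<^sub>R f' s"
    using ne
  proof eventually_elim
    case (elim s)
    then show ?case using out[of s] fR(3) by (auto simp: indicator_def)
  qed
  then have "(\<integral>s. indicator {..<0} s * f' s \<partial>lborel) = (\<integral>s. indicator {- R..0} s *\<^sub>R f' s \<partial>lborel)"
    by (intro integral_cong_AE) (use m in measurable)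
  then show "(\<integral>s. indicator {..<0} s * f' s \<partial>lborel) = f 0" using F[of "- R" 0] fR by simp
  have "AE s in lborel. indicator {0<..} s * f' s = indicator {0..R} s *\<^sub>R f' s"
    using ne
  proof eventually_elim
    case (elim s)
    then show ?case using out[of s] fR(3) by (auto simp: indicator_def)
  qed
  then have "(\<integral>s. indicator {0<..} s * f' s \<partial>lborel) = (\<integral>s. indicator {0..R} s *\<^sub>R f' s \<partial>lborel)"
    by (intro integral_cong_AE) (use m in measurable)
  then show "(\<integral>s. indicator {0<..} s * f' s \<partial>lborel) = - f 0" using F[of 0 R] fR by simp
qed

context
  fixes X :: "real ^ 'n::finite \<Rightarrow> real" and a b :: "real ^ 'n"
  assumes X: "smooth_on UNIV X" and X0: "\<And>x. x \<notin> cbox a b \<Longrightarrow> X x = 0"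
begin

lemma continuous_partial: "continuous_on UNIV (partial i X)"
  using smooth_on_derivative[OF X] by (rule smooth_on_imp_continuous_on)

lemma integrable_partial: "integrable lborel (partial i X)"
proof (rule integrable_continuous_support_cbox[OF continuous_partial])
  show "partial i X x = 0" if "x \<notin> cbox a b" for x
    by (rule frechet_derivative_eq_0_outside[OF closed_cbox[of a b]]) (use X0 that in auto)
qed

lemma integral_partial_line:
  shows "(\<integral>s. partial i X (set_coord i z s) \<partial>lborel) = 0"
    "(\<integral>s. indicator {..<0} s * partial i X (set_coord i z s) \<partial>lborel) = X (set_coord i z 0)"
    "(\<integral>s. indicator {0<..} s * partial i X (set_coord i z s) \<partial>lborel) = - X (set_coord i z 0)"
proof -
  have d: "((\<lambda>s. X (set_coord i z s)) has_real_derivative partial i X (set_coord i z s)) (at s)" for s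
    using smooth_on_imp_differentiable[OF X] by (intro has_derivative_along_coordinate_line) auto
  have c: "continuous_on UNIV (\<lambda>s. partial i X (set_coord i z s))"
    by (rule continuous_on_compose2[OF continuous_partial]) (auto simp: set_coord_def intro!: continuous_intros)
  have o: "X (set_coord i z s) = 0" if "s \<notin> {a $ i..b $ i}" for s
  proof (rule X0)
    show "set_coord i z s \<notin> cbox a b"
      using that by (auto simp: mem_box_cart dest!: spec[of _ i])
  qed
  show "(\<integral>s. partial i X (set_coord i z s) \<partial>lborel) = 0"
    "(\<integral>s. indicator {..<0} s * partial i X (set_coord i z s) \<partial>lborel) = X (set_coord i z 0)"
    "(\<integral>s. indicator {0<..} s * partial i X (set_coord i z s) \<partial>lborel) = - X (set_coord i z 0)"
    by (rule integral_derivative_half_lines[where f = "\<lambda>s. X (set_coord i z s)", OF d c o]; simp)+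
qed

lemma integral_partial: "(\<integral>x. partial i X x \<partial>lborel) = 0"
  by (subst integral_lborel_hyperplane[OF integrable_partial, where k = i]) (simp add: integral_partial_line)

lemma integral_hyperplane_set_coord: "(\<integral>z. X (set_coord k z 0) \<partial>hyperplane_measure k) = (\<integral>z. X z \<partial>hyperplane_measure k)"
proof (rule integral_cong_AE)
  have mX[measurable]: "X \<in> borel_measurable borel"
    using smooth_on_imp_continuous_on[OF X] by (rule borel_measurable_continuous_onI)
  show "X \<in> borel_measurable (hyperplane_measure k)" by measurable
  have "(\<lambda>z. set_coord k z 0) \<in> borel_measurable borel"
    unfolding set_coord_def by measurable
  from measurable_compose[OF this mX]
  show "(\<lambda>z. X (set_coord k z 0)) \<in> borel_measurable (hyperplane_measure k)" by simp
  show "AE z in hyperplane_measure k. X (set_coord k z 0) = X z"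
    using AE_hyperplane_measure[of k]
  proof eventually_elim
    case (elim z)
    then show ?case using set_coord_self[of k z] by simp
  qed
qed

text \<open>Integrate first along the direction of differentiation: a line parallel to the boundary
  contributes nothing, a line across the boundary contributes the boundary value.\<close>

lemma integral_partial_half_space:
  shows "(\<integral>x. indicator {x. x $ k < 0} x * partial i X x \<partial>lborel)
      = (if i = k then (\<integral>z. X z \<partial>hyperplane_measure k) else 0)"
    "(\<integral>x. indicator {x. x $ k > 0} x * partial i X x \<partial>lborel)
      = (if i = k then - (\<integral>z. X z \<partial>hyperplane_measure k) else 0)"
proof -
  have int: "integrable lborel (\<lambda>x. indicator {x. x $ k < 0} x * partial i X x)"
    "integrable lborel (\<lambda>x. indicator {x. x $ k > 0} x * partial i X x)"
    using integrable_mult_indicator[OF _ integrable_partial[of i], of "{x. x $ k < 0}"]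
      integrable_mult_indicator[OF _ integrable_partial[of i], of "{x. x $ k > 0}"] by auto
  have i1: "(\<integral>s. indicator {x. x $ k < 0} (set_coord i z s) * partial i X (set_coord i z s) \<partial>lborel)
      = (if i = k then X (set_coord k z 0) else 0)" for z
    using integral_partial_line(2)[of i z] integral_partial_line(1)[of i z]
    by (auto simp: indicator_def if_distrib cong: if_cong)
  have i2: "(\<integral>s. indicator {x. x $ k > 0} (set_coord i z s) * partial i X (set_coord i z s) \<partial>lborel)
      = (if i = k then - X (set_coord k z 0) else 0)" for z
    using integral_partial_line(3)[of i z] integral_partial_line(1)[of i z]
    by (auto simp: indicator_def if_distrib cong: if_cong)
  show "(\<integral>x. indicator {x. x $ k < 0} x * partial i X x \<partial>lborel)
      = (if i = k then (\<integral>z. X z \<partial>hyperplane_measure k) else 0)"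
    by (subst integral_lborel_hyperplane[OF int(1), where k = i]) (simp add: i1 integral_hyperplane_set_coord)
  show "(\<integral>x. indicator {x. x $ k > 0} x * partial i X x \<partial>lborel)
      = (if i = k then - (\<integral>z. X z \<partial>hyperplane_measure k) else 0)"
    by (subst integral_lborel_hyperplane[OF int(2), where k = i]) (simp add: i2 integral_hyperplane_set_coord)
qed

end

section \<open>Compactly supported vector fields with prescribed divergence\<close>

lemma smooth_on_fst [smooth_intros]: "open S \<Longrightarrow> smooth_on S f \<Longrightarrow> smooth_on S (\<lambda>x. fst (f x))"
  by (rule smooth_on_compose_linear[OF bounded_linear_fst])

lemma smooth_on_snd [smooth_intros]: "open S \<Longrightarrow> smooth_on S f \<Longrightarrow> smooth_on S (\<lambda>x. snd (f x))"
  by (rule smooth_on_compose_linear[OF bounded_linear_snd])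

text \<open>The derivative of the integral is the integral of the derivative, which is again of the same form,
  so the induction on the order of differentiability closes.\<close>

lemma smooth_on_parametric_integral:
  fixes H :: "'b::euclidean_space \<times> real \<Rightarrow> real"
  assumes "smooth_on UNIV H"
  shows "smooth_on UNIV (\<lambda>x. integral {0..1} (\<lambda>t. H (x, t)))"
proof -
  have "Ck_on k UNIV (\<lambda>x. integral {0..1} (\<lambda>t. H (x, t)))" for k
    using assms
  proof (induction k arbitrary: H)
    case 0
    have "continuous_on (UNIV \<times> cbox 0 1) (\<lambda>(x, t). H (x, t))"
      using smooth_on_imp_continuous_on[OF 0] by (auto intro: continuous_on_subset)
    from integral_continuous_on_param[OF this] show ?case by simp
  next
    case (Suc k)
    let ?H' = "\<lambda>p. frechet_derivative H (at p)"
    define D where "D x t = Blinfun (\<lambda>v. ?H' (x, t) (v, 0))" for x t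
    have HD: "(H has_derivative ?H' p) (at p)" for p
      using smooth_on_imp_derivative[OF Suc.prems] by simp
    have D: "blinfun_apply (D x t) = (\<lambda>v. ?H' (x, t) (v, 0))" for x t
    proof -
      have "bounded_linear (\<lambda>v. ?H' (x, t) (v, 0))"
        using has_derivative_bounded_linear[OF HD]
        by (rule bounded_linear_compose) (auto intro!: bounded_linear_Pair bounded_linear_ident bounded_linear_zero)
      then show ?thesis unfolding D_def by (rule bounded_linear_Blinfun_apply)
    qed
    have c: "continuous_on UNIV (\<lambda>p. ?H' p v)" for v
      using smooth_on_derivative[OF Suc.prems] by (rule smooth_on_imp_continuous_on)
    have cD: "continuous_on (UNIV \<times> cbox 0 1) (\<lambda>(x, t). D x t)"
    proof (rule continuous_on_blinfun_componentwise)
      fix i :: 'b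
      have "continuous_on (UNIV \<times> cbox 0 1) (\<lambda>p. ?H' p (i, 0))"
        using continuous_on_subset[OF c] by blast
      then show "continuous_on (UNIV \<times> cbox 0 1) (\<lambda>p. (case p of (x, t) \<Rightarrow> D x t) i)"
        by (simp add: D case_prod_beta)
    qed
    have Dx: "((\<lambda>x. integral (cbox 0 1) (\<lambda>t. H (x, t))) has_derivative integral (cbox 0 1) (D x)) (at x)" for x
    proof (rule leibniz_rule[where U = UNIV and f = "\<lambda>x t. H (x, t)" and fx = D])
      show "((\<lambda>x. H (x, t)) has_derivative blinfun_apply (D x t)) (at x within UNIV)" for x t
      proof -
        have "((\<lambda>x. (x, t)) has_derivative (\<lambda>v. (v, 0))) (at x)"
          by (auto intro!: derivative_eq_intros)
        from has_derivative_compose[OF this HD] show ?thesis by (simp add: D)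
      qed
      have "continuous_on UNIV H" using Suc.prems by (rule smooth_on_imp_continuous_on)
      then have "continuous_on (cbox 0 1) (\<lambda>t. H (x, t))" for x
        by (rule continuous_on_compose2) (auto intro!: continuous_on_Pair continuous_on_const continuous_on_id)
      then show "(\<lambda>t. H (x, t)) integrable_on cbox 0 1" for x
        by (rule integrable_continuous)
    qed (use cD in auto)
    have "D x integrable_on cbox 0 1" for x
    proof (rule integrable_continuous)
      show "continuous_on (cbox 0 1) (D x)"
      proof -
        have "continuous_on (cbox 0 1) (\<lambda>t::real. (x, t))"
          by (intro continuous_on_Pair continuous_on_const continuous_on_id)
        from continuous_on_compose2[OF cD this] show ?thesis by auto
      qed
    qed
    then have eq: "integral (cbox 0 1) (D x) v = integral {0..1} (\<lambda>t. ?H' (x, t) (v, 0))" for x v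
      by (subst blinfun_apply_integral) (auto simp: D)
    show ?case
    proof (rule Ck_on_SucI)
      show "((\<lambda>x. integral {0..1} (\<lambda>t. H (x, t))) has_derivative
          (\<lambda>v. integral {0..1} (\<lambda>t. ?H' (x, t) (v, 0)))) (at x)" for x
        using Dx[of x] unfolding eq[symmetric] by simp
      show "Ck_on k UNIV (\<lambda>x. integral {0..1} (\<lambda>t. ?H' (x, t) (v, 0)))" for v
        by (rule Suc.IH[OF smooth_on_derivative[OF Suc.prems]])
    qed simp
  qed
  then show ?thesis by (simp add: smooth_on_def)
qed

text \<open>The oriented integral of \<open>f\<close> from \<open>\<alpha>\<close> to \<open>\<beta>\<close>,
  pulled back to the fixed interval \<open>{0..1}\<close>.  In this form smooth dependence on the end point is
  a special case of smooth dependence on parameters.\<close>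

definition segment_integral :: "real \<Rightarrow> real \<Rightarrow> (real \<Rightarrow> real) \<Rightarrow> real" where
  "segment_integral \<alpha> \<beta> f = (\<beta> - \<alpha>) * integral {0..1} (\<lambda>t. f (\<alpha> + t * (\<beta> - \<alpha>)))"

lemma segment_integral_FTC:
  assumes "\<And>s. (F has_real_derivative f s) (at s)"
  shows "segment_integral \<alpha> \<beta> f = F \<beta> - F \<alpha>"
proof -
  have "((\<lambda>t. (\<beta> - \<alpha>) * f (\<alpha> + t * (\<beta> - \<alpha>))) has_integral
      F (\<alpha> + 1 * (\<beta> - \<alpha>)) - F (\<alpha> + 0 * (\<beta> - \<alpha>))) {0..1}"
  proof (rule fundamental_theorem_of_calculus)
    fix t :: real
    have "((\<lambda>t. F (\<alpha> + t * (\<beta> - \<alpha>))) has_real_derivative f (\<alpha> + t * (\<beta> - \<alpha>)) * (\<beta> - \<alpha>)) (at t)"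
      by (rule DERIV_chain'[OF _ assms]) (auto intro!: derivative_eq_intros)
    then show "((\<lambda>t. F (\<alpha> + t * (\<beta> - \<alpha>))) has_vector_derivative (\<beta> - \<alpha>) * f (\<alpha> + t * (\<beta> - \<alpha>)))
        (at t within {0..1})"
      by (simp add: has_real_derivative_iff_has_vector_derivative mult.commute has_vector_derivative_at_within)
  qed simp
  from integral_unique[OF this] show ?thesis by (simp add: segment_integral_def)
qed

lemma antiderivative_on_line:
  fixes f :: "real \<Rightarrow> real"
  assumes "continuous_on UNIV f"
  obtains F where "\<And>s. (F has_real_derivative f s) (at s)"
proof -
  have "isCont f x" for x using assms by (simp add: continuous_on_eq_continuous_at)
  then obtain F where "\<And>s. - \<infinity> < ereal s \<Longrightarrow> ereal s < \<infinity> \<Longrightarrow> (F has_vector_derivative f s) (at s)"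
    using einterval_antiderivative[of "- \<infinity>" "\<infinity>" f] by auto
  then show ?thesis
    by (intro that[of F]) (simp add: has_real_derivative_iff_has_vector_derivative)
qed

lemma segment_integral_has_derivative:
  assumes "continuous_on UNIV f"
  shows "((\<lambda>s. segment_integral \<alpha> s f) has_real_derivative f s) (at s)"
proof -
  obtain F where F: "\<And>s. (F has_real_derivative f s) (at s)"
    using antiderivative_on_line[OF assms] by blast
  have "((\<lambda>s. F s - F \<alpha>) has_real_derivative f s) (at s)"
    using F by (auto intro!: derivative_eq_intros)
  then show ?thesis using segment_integral_FTC[OF F] by simp
qed

text \<open>The antiderivative of a function with vanishing mean is constant on either side of the support,
  with the same constant.\<close>

lemma segment_integral_eq_0_outside:
  assumes "continuous_on UNIV f" "\<And>s. s \<notin> {\<alpha>..\<beta>} \<Longrightarrow> f s = 0" "segment_integral \<alpha> \<beta> f = 0" "s \<notin> {\<alpha>..\<beta>}" "\<alpha> \<le> \<beta>"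
  shows "segment_integral \<alpha> s f = 0"
proof -
  obtain F where F: "\<And>s. (F has_real_derivative f s) (at s)"
    using antiderivative_on_line[OF assms(1)] by blast
  have c: "continuous_on S F" for S
    using F DERIV_isCont by (blast intro: continuous_at_imp_continuous_on)
  have const: "F v = F u" if "u < v" "\<And>s. u < s \<Longrightarrow> s < v \<Longrightarrow> f s = 0" for u v
  proof (rule DERIV_isconst_end[OF that(1) c])
    show "(F has_real_derivative 0) (at s)" if "u < s" "s < v" for s
      using F[of s] \<open>\<And>s. u < s \<Longrightarrow> s < v \<Longrightarrow> f s = 0\<close>[OF that] by simp
  qed
  have 0: "F \<beta> = F \<alpha>" using assms(3) segment_integral_FTC[OF F] by simp
  have "F s = F \<alpha>"
  proof (cases "s < \<alpha>")
    case True
    then show ?thesis using const[of s \<alpha>] assms(2) by auto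
  next
    case False
    then show ?thesis using const[of \<beta> s] assms(2,4) 0 by auto
  qed
  then show ?thesis using segment_integral_FTC[OF F] by simp
qed

lemma segment_integral_zero [simp]: "segment_integral \<alpha> \<beta> (\<lambda>s. 0) = 0"
  by (simp add: segment_integral_def)

lemma segment_integral_cmult: "segment_integral \<alpha> \<beta> (\<lambda>s. c * f s) = c * segment_integral \<alpha> \<beta> f"
  by (simp add: segment_integral_def)

lemma segment_integral_diff:
  assumes "continuous_on UNIV f" "continuous_on UNIV g"
  shows "segment_integral \<alpha> \<beta> (\<lambda>s. f s - g s) = segment_integral \<alpha> \<beta> f - segment_integral \<alpha> \<beta> g"
proof -
  have "(\<lambda>t. h (\<alpha> + t * (\<beta> - \<alpha>))) integrable_on {0..1}" if "continuous_on UNIV h" for h :: "real \<Rightarrow> real"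
    by (intro integrable_continuous_interval continuous_on_compose2[OF that]) (auto intro!: continuous_intros)
  then show ?thesis using assms by (simp add: segment_integral_def integral_diff right_diff_distrib)
qed

lemma smooth_on_segment_integral:
  fixes h :: "real ^ 'n::finite \<Rightarrow> real"
  assumes h: "smooth_on UNIV h" and b: "smooth_on UNIV b"
  shows "smooth_on UNIV (\<lambda>x. segment_integral \<alpha> (b x) (\<lambda>s. h (set_coord i x s)))"
proof -
  have b2: "smooth_on UNIV (\<lambda>p. b (fst p))"
    by (rule smooth_on_compose[where T = UNIV]) (auto intro: smooth_intros b)
  have "smooth_on UNIV (\<lambda>p. h (set_coord i (fst p) (\<alpha> + snd p * (b (fst p) - \<alpha>))))"
    by (rule smooth_on_compose[where T = UNIV, OF _ _ _ h]) (auto intro!: smooth_intros b2)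
  from smooth_on_parametric_integral[OF this] show ?thesis
    unfolding segment_integral_def by (intro smooth_intros b) auto
qed

lemma normalized_bump_on_interval:
  fixes \<alpha> \<beta> :: real
  assumes "\<alpha> < \<beta>"
  obtains r where "smooth_on UNIV r" "\<And>s. s \<notin> {\<alpha>..\<beta>} \<Longrightarrow> r s = 0" "segment_integral \<alpha> \<beta> r = 1"
    "\<And>s. r s \<ge> 0" "r ((\<alpha> + \<beta>) / 2) > 0"
proof -
  define f where "f s = flat 0 ((s - \<alpha>) * (\<beta> - s))" for s
  have f: "smooth_on UNIV f" unfolding f_def by (intro smooth_intros) auto
  obtain F where F: "\<And>s. (F has_real_derivative f s) (at s)"
    using antiderivative_on_line[OF smooth_on_imp_continuous_on[OF f]] by blast
  have "F \<alpha> < F \<beta>"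
  proof (rule DERIV_pos_imp_increasing_open[OF assms])
    show "\<exists>y. (F has_real_derivative y) (at s) \<and> 0 < y" if "\<alpha> < s" "s < \<beta>" for s
      using F[of s] that by (auto simp: f_def flat_pos_iff intro!: exI[of _ "f s"])
    show "continuous_on {\<alpha>..\<beta>} F"
      using F DERIV_isCont by (blast intro: continuous_at_imp_continuous_on)
  qed
  then have c: "segment_integral \<alpha> \<beta> f > 0" using segment_integral_FTC[OF F] by simp
  show ?thesis
  proof
    show "smooth_on UNIV (\<lambda>s. inverse (segment_integral \<alpha> \<beta> f) * f s)" by (intro smooth_intros f) auto
    show "inverse (segment_integral \<alpha> \<beta> f) * f s = 0" if "s \<notin> {\<alpha>..\<beta>}" for s
    proof -
      have "(s - \<alpha>) * (\<beta> - s) \<le> 0"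
        using that assms by (cases "s < \<alpha>") (auto intro: mult_nonpos_nonneg mult_nonneg_nonpos)
      then show ?thesis by (simp add: f_def flat_eq_0)
    qed
    show "segment_integral \<alpha> \<beta> (\<lambda>s. inverse (segment_integral \<alpha> \<beta> f) * f s) = 1" using c by (simp add: segment_integral_cmult)
    show "inverse (segment_integral \<alpha> \<beta> f) * f s \<ge> 0" for s using c by (simp add: f_def flat_nonneg)
    have "((\<alpha> + \<beta>) / 2 - \<alpha>) * (\<beta> - (\<alpha> + \<beta>) / 2) > 0" using assms by (intro mult_pos_pos) auto
    then show "inverse (segment_integral \<alpha> \<beta> f) * f ((\<alpha> + \<beta>) / 2) > 0"
      using c unfolding f_def by (simp add: flat_pos_iff)
  qed
qed

text \<open>Change the coordinates of \<open>x\<close> into those of \<open>y\<close> one at a time.\<close>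

lemma coordinate_independent_imp_constant:
  fixes m :: "real ^ 'n::finite \<Rightarrow> 'b"
  assumes "\<And>x i s. m (set_coord i x s) = m x"
  shows "m x = m y"
proof -
  have "m (\<chi> i. if i \<in> J then y $ i else x $ i) = m x" if "finite J" for J
    using that
  proof induction
    case (insert j J)
    have "(\<chi> i. if i \<in> insert j J then y $ i else x $ i) = set_coord j (\<chi> i. if i \<in> J then y $ i else x $ i) (y $ j)"
      by (simp add: vec_eq_iff)
    then show ?case using insert.IH assms by simp
  qed simp
  from this[of UNIV] show ?thesis by simp
qed

text \<open>Let \<open>r\<^sub>i\<close> be a bump of integral \<open>1\<close> on the \<open>i\<close>-th
  side of the box.  By induction on a set \<open>J\<close> of coordinates, \<open>h\<close> is a divergence
  plus \<open>m\<close> times the product of the \<open>r\<^sub>i\<close>, \<open>i \<in> J\<close>, where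
  \<open>m\<close> does not depend on the coordinates in \<open>J\<close>.  For a new coordinate
  \<open>j\<close>, replace \<open>m\<close> by its integral \<open>M\<close> over the \<open>j\<close>-lines
  times \<open>r\<^sub>j\<close>: the error has mean zero on each \<open>j\<close>-line, hence a
  \<open>j\<close>-antiderivative with support in the box.  When all coordinates are treated, \<open>m\<close>
  is a constant.  No integral over the box occurs; the constant is later identified by integrating the
  decomposition.\<close>

lemma box_poincare:
  fixes \<alpha> \<beta> :: "real ^ 'n::finite"
  assumes le: "\<And>i. \<alpha> $ i < \<beta> $ i"
  obtains \<rho> where "smooth_on UNIV \<rho>" "\<And>x. x \<notin> cbox \<alpha> \<beta> \<Longrightarrow> \<rho> x = 0" "\<And>x. \<rho> x \<ge> 0" "\<exists>x. \<rho> x > 0"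
    and "\<And>h. smooth_on UNIV h \<Longrightarrow> (\<And>x. x \<notin> cbox \<alpha> \<beta> \<Longrightarrow> h x = 0) \<Longrightarrow>
      \<exists>X \<kappa>. (\<forall>i. smooth_on UNIV (X i) \<and> (\<forall>x. x \<notin> cbox \<alpha> \<beta> \<longrightarrow> X i x = 0)) \<and>
        (\<forall>x. h x = (\<Sum>i\<in>UNIV. partial i (X i) x) + \<kappa> * \<rho> x)"
proof -
  have "\<forall>i. \<exists>r. smooth_on UNIV r \<and> (\<forall>s. s \<notin> {\<alpha> $ i..\<beta> $ i} \<longrightarrow> r s = 0) \<and> segment_integral (\<alpha> $ i) (\<beta> $ i) r = 1 \<and>
    (\<forall>s. r s \<ge> 0) \<and> r ((\<alpha> $ i + \<beta> $ i) / 2) > 0"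
    using normalized_bump_on_interval[OF le] by metis
  then obtain r where r: "\<And>i. smooth_on UNIV (r i)" "\<And>i s. s \<notin> {\<alpha> $ i..\<beta> $ i} \<Longrightarrow> r i s = 0"
    "\<And>i. segment_integral (\<alpha> $ i) (\<beta> $ i) (r i) = 1" "\<And>i s. r i s \<ge> 0" "\<And>i. r i ((\<alpha> $ i + \<beta> $ i) / 2) > 0"
    by metis
  define R where "R J x = (\<Prod>i\<in>J. r i (x $ i))" for J and x :: "real ^ 'n"
  have rx: "smooth_on UNIV (\<lambda>x::real^'n. r i (x $ i))" for i
    by (rule smooth_on_compose[where T = UNIV, OF _ _ _ r(1)]) (auto intro!: smooth_intros)
  have R: "smooth_on UNIV (R J)" for J
    unfolding R_def by (intro smooth_intros rx) auto
  have R_0: "R J x = 0" if "i \<in> J" "x $ i \<notin> {\<alpha> $ i..\<beta> $ i}" for i J x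
    using r(2)[OF that(2)] that(1) by (auto simp: R_def)
  have outD: "\<exists>i. x $ i \<notin> {\<alpha> $ i..\<beta> $ i}" if "x \<notin> cbox \<alpha> \<beta>" for x
    using that by (auto simp: mem_box_cart)
  have outI: "x \<notin> cbox \<alpha> \<beta>" if "x $ i \<notin> {\<alpha> $ i..\<beta> $ i}" for x i
    using that by (auto simp: mem_box_cart)
  show ?thesis
  proof
    show "smooth_on UNIV (R UNIV)" by (rule R)
    show "R UNIV x = 0" if "x \<notin> cbox \<alpha> \<beta>" for x using outD[OF that] R_0 by blast
    show "R UNIV x \<ge> 0" for x unfolding R_def by (intro prod_nonneg) (simp add: r)
    have "R UNIV (\<chi> i. (\<alpha> $ i + \<beta> $ i) / 2) > 0" unfolding R_def by (intro prod_pos) (simp add: r)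
    then show "\<exists>x. R UNIV x > 0" by blast
    fix h :: "real ^ 'n \<Rightarrow> real"
    assume h: "smooth_on UNIV h" and h0: "\<And>x. x \<notin> cbox \<alpha> \<beta> \<Longrightarrow> h x = 0"
    have "\<exists>X m. (\<forall>i. smooth_on UNIV (X i) \<and> (\<forall>x. x \<notin> cbox \<alpha> \<beta> \<longrightarrow> X i x = 0)) \<and>
      smooth_on UNIV m \<and> (\<forall>i\<in>J. \<forall>x s. m (set_coord i x s) = m x) \<and>
      (\<forall>x. \<forall>j. j \<notin> J \<longrightarrow> x $ j \<notin> {\<alpha> $ j..\<beta> $ j} \<longrightarrow> m x = 0) \<and>
      (\<forall>x. h x = (\<Sum>i\<in>J. partial i (X i) x) + R J x * m x)" if "finite J" for J
      using that
    proof induction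
      case empty
      have "smooth_on UNIV (\<lambda>x::real^'n. 0::real)" by (rule smooth_on_const)
      then show ?case
        by (intro exI[of _ "\<lambda>_ _. 0"] exI[of _ h]) (use h h0 outI in \<open>auto simp: R_def\<close>)
    next
      case (insert j J)
      then obtain X m where X: "\<And>i. smooth_on UNIV (X i)" "\<And>i x. x \<notin> cbox \<alpha> \<beta> \<Longrightarrow> X i x = 0"
        and m: "smooth_on UNIV m" "\<And>i x s. i \<in> J \<Longrightarrow> m (set_coord i x s) = m x"
          "\<And>x j. j \<notin> J \<Longrightarrow> x $ j \<notin> {\<alpha> $ j..\<beta> $ j} \<Longrightarrow> m x = 0"
        and dec: "\<And>x. h x = (\<Sum>i\<in>J. partial i (X i) x) + R J x * m x" by blast
      define M where "M x = segment_integral (\<alpha> $ j) (\<beta> $ j) (\<lambda>s. m (set_coord j x s))" for x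
      define k where "k x = R J x * m x - R (insert j J) x * M x" for x
      define Y where "Y x = segment_integral (\<alpha> $ j) (x $ j) (\<lambda>s. k (set_coord j x s))" for x
      have M: "smooth_on UNIV M" unfolding M_def by (intro smooth_on_segment_integral m smooth_intros)
      have k: "smooth_on UNIV k" unfolding k_def by (intro smooth_intros R m M) auto
      have Y: "smooth_on UNIV Y" unfolding Y_def by (intro smooth_on_segment_integral k smooth_intros) auto
      have line: "continuous_on UNIV (\<lambda>s. f (set_coord j x s))" if "smooth_on UNIV f" for f :: "real ^ 'n \<Rightarrow> real" and x
        using smooth_on_imp_continuous_on[OF that]
        by (rule continuous_on_compose2) (auto simp: set_coord_def intro!: continuous_intros)
      have RJ: "R J (set_coord j x s) = R J x" for x s
        unfolding R_def using insert.hyps by (intro prod.cong) auto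
      have RjJ: "R (insert j J) x = r j (x $ j) * R J x" for x
        unfolding R_def using insert.hyps by simp
      have M_set_coord: "M (set_coord i x s) = M x" if "i \<in> insert j J" for i x s
      proof (cases "i = j")
        case False
        then have "m (set_coord j (set_coord i x s) t) = m (set_coord j x t)" for t
          using m(2)[of i] that by (subst set_coord_commute) auto
        then show ?thesis by (simp add: M_def)
      qed (simp add: M_def)
      have M0: "M x = 0" if "i \<notin> insert j J" "x $ i \<notin> {\<alpha> $ i..\<beta> $ i}" for i x
      proof -
        have "m (set_coord j x s) = 0" for s using m(3)[of i "set_coord j x s"] that by auto
        then show ?thesis by (simp add: M_def)
      qed
      have k0: "k x = 0" if "x $ i \<notin> {\<alpha> $ i..\<beta> $ i}" for x i
        using that R_0[of i J x] R_0[of i "insert j J" x] m(3)[of i x] M0[of i x]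
        by (cases "i \<in> J"; cases "i = j") (auto simp: k_def)
      have "(\<lambda>s. k (set_coord j x s)) = (\<lambda>s. R J x * m (set_coord j x s) - (R J x * M x) * r j s)" for x
        by (simp add: k_def RJ RjJ M_set_coord fun_eq_iff)
      then have segment_k: "segment_integral (\<alpha> $ j) (\<beta> $ j) (\<lambda>s. k (set_coord j x s)) = 0" for x
        using line[OF m(1), of x] smooth_on_imp_continuous_on[OF r(1)[of j]]
        by (simp add: segment_integral_diff segment_integral_cmult r(3) M_def[symmetric] continuous_on_mult_left)
      have Y0: "Y x = 0" if out: "x \<notin> cbox \<alpha> \<beta>" for x
      proof -
        obtain i where i: "x $ i \<notin> {\<alpha> $ i..\<beta> $ i}" using outD[OF out] by blast
        show ?thesis
        proof (cases "i = j")
          case True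
          show ?thesis unfolding Y_def
            by (rule segment_integral_eq_0_outside[OF line[OF k] _ segment_k]) (use True i le[of j] k0[of _ j] in \<open>auto intro: less_imp_le\<close>)
        next
          case False
          then have "k (set_coord j x s) = 0" for s using k0[of "set_coord j x s" i] i by auto
          then show ?thesis by (simp add: Y_def)
        qed
      qed
      have pdY: "partial j Y x = k x" for x
      proof -
        have "((\<lambda>s. Y (set_coord j x s)) has_real_derivative partial j Y (set_coord j x (x $ j))) (at (x $ j))"
          using smooth_on_imp_differentiable[OF Y] by (intro has_derivative_along_coordinate_line) auto
        moreover have "((\<lambda>s. Y (set_coord j x s)) has_real_derivative k (set_coord j x (x $ j))) (at (x $ j))"
          using segment_integral_has_derivative[OF line[OF k, of x], of "\<alpha> $ j" "x $ j"] by (simp add: Y_def)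
        ultimately show ?thesis by (auto dest: DERIV_unique)
      qed
      have "h x = (\<Sum>i\<in>insert j J. partial i ((X(j := Y)) i) x) + R (insert j J) x * M x" for x
      proof -
        have "(\<Sum>i\<in>J. partial i ((X(j := Y)) i) x) = (\<Sum>i\<in>J. partial i (X i) x)"
          using insert.hyps by (intro sum.cong) auto
        then show ?thesis using insert.hyps dec[of x] by (simp add: pdY k_def)
      qed
      then show ?case
        by (intro exI[of _ "X(j := Y)"] exI[of _ M]) (use X Y Y0 M M_set_coord M0 in auto)
    qed
    from this[of UNIV] obtain X m where X: "\<forall>i. smooth_on UNIV (X i) \<and> (\<forall>x. x \<notin> cbox \<alpha> \<beta> \<longrightarrow> X i x = 0)"
      and m: "\<forall>i x s. m (set_coord i x s) = m x" and dec: "\<forall>x. h x = (\<Sum>i\<in>UNIV. partial i (X i) x) + R UNIV x * m x"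
      by auto
    have "m x = m 0" for x using coordinate_independent_imp_constant m by metis
    then show "\<exists>X \<kappa>. (\<forall>i. smooth_on UNIV (X i) \<and> (\<forall>x. x \<notin> cbox \<alpha> \<beta> \<longrightarrow> X i x = 0)) \<and>
        (\<forall>x. h x = (\<Sum>i\<in>UNIV. partial i (X i) x) + \<kappa> * R UNIV x)"
      using X dec by (intro exI[of _ X] exI[of _ "m 0"]) (metis mult.commute)
  qed
qed

section \<open>Change of variables for an arbitrary index type\<close>

text \<open>The formula \<open>has_measure_differentiable_image\<close> is about vectors with a well-ordered index type.  It is
  transported along a bijection between a finite type and a well-ordered copy of it; relabelling the
  coordinates changes neither Lebesgue measure nor determinants.\<close>

typedef ('n::finite) ordered_copy = "UNIV :: 'n set"
  morphisms of_copy to_copy by simp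

instantiation ordered_copy :: (finite) wellorder
begin

definition "x \<le> y \<longleftrightarrow> to_nat (of_copy x) \<le> to_nat (of_copy y)"
definition "x < y \<longleftrightarrow> to_nat (of_copy x) < to_nat (of_copy y)"

instance
proof
  fix x y z :: "'a ordered_copy"
  show "x < y \<longleftrightarrow> x \<le> y \<and> \<not> y \<le> x" "x \<le> x" "x \<le> y \<or> y \<le> x"
    by (auto simp: less_eq_ordered_copy_def less_ordered_copy_def)
  show "x \<le> y \<Longrightarrow> y \<le> z \<Longrightarrow> x \<le> z" by (auto simp: less_eq_ordered_copy_def)
  show "x \<le> y \<Longrightarrow> y \<le> x \<Longrightarrow> x = y" by (auto simp: less_eq_ordered_copy_def of_copy_inject)
next
  fix P :: "'a ordered_copy \<Rightarrow> bool" and a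
  assume P: "\<And>x. (\<And>y. y < x \<Longrightarrow> P y) \<Longrightarrow> P x"
  show "P a"
    by (induction a rule: measure_induct_rule[of "\<lambda>x. to_nat (of_copy x)"])
      (rule P, simp add: less_ordered_copy_def)
qed

end

instance ordered_copy :: (finite) finite
proof
  have "(UNIV :: 'a ordered_copy set) = to_copy ` UNIV"
    by (metis of_copy_inverse surjI)
  then show "finite (UNIV :: 'a ordered_copy set)" by (metis finite finite_imageI)
qed

definition vec_to_copy :: "real ^ 'n::finite \<Rightarrow> real ^ 'n ordered_copy" where
  "vec_to_copy x = (\<chi> i. x $ of_copy i)"

definition vec_of_copy :: "real ^ 'n::finite ordered_copy \<Rightarrow> real ^ 'n" where
  "vec_of_copy x = (\<chi> i. x $ to_copy i)"

lemma vec_copy_inverse [simp]: "vec_of_copy (vec_to_copy x) = x" "vec_to_copy (vec_of_copy y) = y"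
  by (simp_all add: vec_to_copy_def vec_of_copy_def vec_eq_iff to_copy_inverse of_copy_inverse)

lemma bounded_linear_vec_copy: "bounded_linear vec_to_copy" "bounded_linear vec_of_copy"
  by (auto intro!: linear_conv_bounded_linear[THEN iffD1] linearI simp: vec_to_copy_def vec_of_copy_def vec_eq_iff)

lemma bij_to_copy: "bij to_copy"
  by (metis bijI' of_copy_inverse to_copy_inverse UNIV_I)

lemma bij_of_copy: "bij of_copy"
  by (metis bijI' of_copy_inverse to_copy_inverse UNIV_I)

lemma det_reindex:
  fixes M :: "real ^ 'n::finite ^ 'n"
  shows "det (\<chi> i j. M $ of_copy i $ of_copy j) = det M"
proof -
  let ?f = "to_copy :: 'n \<Rightarrow> 'n ordered_copy"
  have inj: "inj ?f" and surj: "range ?f = UNIV" using bij_to_copy by (auto simp: bij_def)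
  have mp: "map_permutation UNIV ?f p i = ?f (p (of_copy i))" for p i
  proof -
    have "inv_into UNIV ?f i = of_copy i"
      by (metis inv_f_f inj of_copy_inverse)
    then show ?thesis by (simp add: map_permutation_def surj restrict_id_def)
  qed
  have bij: "bij_betw (map_permutation UNIV ?f) {p. p permutes (UNIV::'n set)} {p. p permutes (UNIV::'n ordered_copy set)}"
  proof (rule bij_betwI')
    fix p q :: "'n \<Rightarrow> 'n"
    show "map_permutation UNIV ?f p = map_permutation UNIV ?f q \<longleftrightarrow> p = q"
      unfolding fun_eq_iff mp by (metis to_copy_inverse UNIV_I)
  next
    fix p :: "'n \<Rightarrow> 'n" assume "p \<in> {p. p permutes UNIV}"
    then have "map_permutation UNIV ?f p permutes UNIV"
      by (intro map_permutation_permutes) (auto simp: bij_to_copy)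
    then show "map_permutation UNIV ?f p \<in> {p. p permutes UNIV}" by simp
  next
    fix q :: "'n ordered_copy \<Rightarrow> 'n ordered_copy" assume "q \<in> {p. p permutes UNIV}"
    then have "bij q" by (simp add: permutes_bij)
    let ?p = "\<lambda>i. of_copy (q (to_copy i))"
    have "bij (of_copy \<circ> q \<circ> to_copy)"
      using \<open>bij q\<close> bij_to_copy bij_of_copy by (intro bij_comp)
    then have "bij ?p" by (simp add: o_def)
    then have "?p permutes UNIV" by (auto simp: permutes_def bij_def inj_def surj_def) metis+
    moreover have "q = map_permutation UNIV ?f ?p"
      by (simp add: fun_eq_iff mp of_copy_inverse)
    ultimately show "\<exists>p\<in>{p. p permutes UNIV}. q = map_permutation UNIV ?f p" by blast
  qed
  have "det (\<chi> i j. M $ of_copy i $ of_copy j)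
      = (\<Sum>p | p permutes UNIV. of_int (sign p) * (\<Prod>i\<in>UNIV. M $ of_copy i $ of_copy (p i)))"
    by (simp add: det_def)
  also have "\<dots> = (\<Sum>p | p permutes (UNIV :: 'n set). of_int (sign (map_permutation UNIV ?f p))
      * (\<Prod>i\<in>UNIV. M $ of_copy i $ of_copy (map_permutation UNIV ?f p i)))"
    by (rule sum.reindex_bij_betw[OF bij, symmetric])
  also have "\<dots> = (\<Sum>p | p permutes (UNIV :: 'n set). of_int (sign p) * (\<Prod>i\<in>UNIV. M $ i $ p i))"
  proof (rule sum.cong[OF refl])
    fix p assume "p \<in> {p. p permutes (UNIV :: 'n set)}"
    then have "sign (map_permutation UNIV ?f p) = sign p"
      by (intro sign_map_permutation) (auto simp: inj)
    moreover have "(\<Prod>i\<in>UNIV. M $ of_copy i $ of_copy (map_permutation UNIV ?f p i)) = (\<Prod>i\<in>UNIV. M $ i $ p i)"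
      by (rule prod.reindex_bij_betw[OF bij_of_copy, of "\<lambda>i. M $ i $ p i", simplified mp[symmetric] to_copy_inverse[OF UNIV_I, symmetric], symmetric, simplified]
          | simp add: mp to_copy_inverse prod.reindex_bij_betw[OF bij_of_copy, of "\<lambda>i. M $ i $ p i"])+
    ultimately show "of_int (sign (map_permutation UNIV ?f p))
      * (\<Prod>i\<in>UNIV. M $ of_copy i $ of_copy (map_permutation UNIV ?f p i)) = of_int (sign p) * (\<Prod>i\<in>UNIV. M $ i $ p i)"
      by simp
  qed
  finally show ?thesis by (simp add: det_def)
qed

lemma distr_vec_to_copy: "distr lborel borel vec_to_copy = (lborel :: (real ^ 'n::finite ordered_copy) measure)"
proof (rule lborel_eqI[symmetric])
  have m: "vec_to_copy \<in> borel_measurable (borel :: (real ^ 'n) measure)"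
    by (intro borel_measurable_continuous_onI linear_continuous_on bounded_linear_vec_copy)
  fix l u :: "real ^ 'n ordered_copy"
  assume le: "\<And>b. b \<in> Basis \<Longrightarrow> l \<bullet> b \<le> u \<bullet> b"
  have le': "l $ i \<le> u $ i" for i using le[of "axis i 1"] by (auto simp: inner_axis)
  have P: "(\<Prod>b\<in>Basis. (y - x) \<bullet> b) = (\<Prod>i\<in>UNIV. y $ i - x $ i)" for x y :: "real ^ 'm::finite"
  proof -
    have B: "Basis = (\<lambda>i. axis i 1 :: real ^ 'm) ` UNIV" by (auto simp: Basis_vec_def)
    show ?thesis unfolding B
      by (subst prod.reindex) (auto simp: inj_on_def axis_eq_axis inner_axis)
  qed
  have "vec_to_copy -` box l u = box (vec_of_copy l) (vec_of_copy u)"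
    unfolding set_eq_iff vimage_eq mem_box_cart
    by (simp add: vec_to_copy_def vec_of_copy_def) (metis of_copy_inverse to_copy_inverse UNIV_I)
  then have "emeasure (distr lborel borel vec_to_copy) (box l u) = emeasure lborel (box (vec_of_copy l) (vec_of_copy u))"
    using m by (subst emeasure_distr) auto
  also have "\<dots> = (\<Prod>b\<in>Basis. (vec_of_copy u - vec_of_copy l) \<bullet> b)"
    using le' by (intro emeasure_lborel_box) (auto simp: Basis_vec_def inner_axis vec_of_copy_def)
  also have "(\<Prod>b\<in>Basis. (vec_of_copy u - vec_of_copy l) \<bullet> b) = (\<Prod>b\<in>Basis. (u - l) \<bullet> b)"
    unfolding P by (simp add: vec_of_copy_def prod.reindex_bij_betw[OF bij_to_copy, of "\<lambda>i. u $ i - l $ i"])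
  finally show "emeasure (distr lborel borel vec_to_copy) (box l u) = (\<Prod>b\<in>Basis. (u - l) \<bullet> b)" .
qed simp

text \<open>The formula \<open>has_measure_differentiable_image\<close> characterises measurability of the
  image together with its measure by integrability of the Jacobian; here both are infinite at the same
  time.\<close>

lemma emeasure_differentiable_image_ordered:
  fixes \<Phi> :: "real ^ 'n::{finite,wellorder} \<Rightarrow> real ^ 'n::_"
  assumes E: "E \<in> sets borel" and d: "\<And>x. x \<in> E \<Longrightarrow> (\<Phi> has_derivative \<Phi>' x) (at x)"
    and inj: "inj_on \<Phi> E" and im: "\<Phi> ` E \<in> sets borel"
    and m: "(\<lambda>x. indicator E x * \<bar>det (matrix (\<Phi>' x))\<bar>) \<in> borel_measurable borel"
  shows "emeasure lborel (\<Phi> ` E) = (\<integral>\<^sup>+x. ennreal (indicator E x * \<bar>det (matrix (\<Phi>' x))\<bar>) \<partial>lborel)"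
proof -
  have "E \<in> sets lebesgue" using E by auto
  note iff = has_measure_differentiable_image[OF this has_derivative_at_withinI[OF d] inj]
  let ?D = "\<lambda>x. indicator E x * \<bar>det (matrix (\<Phi>' x))\<bar>"
  have restrict: "(?D has_integral r) UNIV \<longleftrightarrow> ((\<lambda>x. \<bar>det (matrix (\<Phi>' x))\<bar>) has_integral r) E" for r
  proof -
    have "?D = (\<lambda>x. if x \<in> E then \<bar>det (matrix (\<Phi>' x))\<bar> else 0)" by (auto simp: indicator_def)
    then show ?thesis by (simp only: has_integral_restrict_UNIV)
  qed
  have em: "emeasure lborel (\<Phi> ` E) = emeasure lebesgue (\<Phi> ` E)"
    using im by (simp add: emeasure_completion)
  show ?thesis
  proof (cases "(\<integral>\<^sup>+x. ennreal (?D x) \<partial>lborel) < \<infinity>")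
    case True
    then obtain r where r: "(\<integral>\<^sup>+x. ennreal (?D x) \<partial>lborel) = ennreal r" "r \<ge> 0"
      by (cases "\<integral>\<^sup>+x. ennreal (?D x) \<partial>lborel" rule: ennreal_cases) auto
    have "(?D has_integral r) UNIV"
      by (rule nn_integral_has_integral[OF m _ r]) simp
    then have "\<Phi> ` E \<in> lmeasurable" "measure lebesgue (\<Phi> ` E) = r" using iff restrict by auto
    then show ?thesis using em r by (metis emeasure_eq_measure2 fmeasurableD2 emeasure_eq_ennreal_measure)
  next
    case False
    have "emeasure lebesgue (\<Phi> ` E) = \<infinity>"
    proof (rule ccontr)
      assume "emeasure lebesgue (\<Phi> ` E) \<noteq> \<infinity>"
      then have "\<Phi> ` E \<in> lmeasurable" using im by (intro fmeasurableI) (auto simp: top.not_eq_extremum)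
      then have "(?D has_integral measure lebesgue (\<Phi> ` E)) UNIV" using iff restrict by auto
      then have "(\<integral>\<^sup>+x. ennreal (?D x) \<partial>lborel) = ennreal (measure lebesgue (\<Phi> ` E))"
        by (intro nn_integral_has_integral_lborel m) auto
      then show False using False by simp
    qed
    moreover have "(\<integral>\<^sup>+x. ennreal (?D x) \<partial>lborel) = \<infinity>"
      using False by (metis infinity_ennreal_def top.not_eq_extremum)
    ultimately show ?thesis using em by simp
  qed
qed

lemma matrix_vec_copy:
  fixes f :: "real ^ 'n::finite \<Rightarrow> real ^ 'n"
  assumes "linear f"
  shows "matrix (\<lambda>y. vec_to_copy (f (vec_of_copy y))) = (\<chi> i j. matrix f $ of_copy i $ of_copy j)"
proof -
  have "vec_of_copy (axis j 1) = axis (of_copy j) 1" for j :: "'n ordered_copy"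
    by (auto simp: vec_of_copy_def axis_def vec_eq_iff to_copy_inverse of_copy_inverse dest: arg_cong[of _ _ to_copy])
  then show ?thesis by (simp add: matrix_def vec_to_copy_def)
qed

text \<open>Conjugate \<open>\<Phi>\<close> with the relabelling of the coordinates.\<close>

lemma emeasure_differentiable_image:
  fixes \<Phi> :: "real ^ 'n::finite \<Rightarrow> real ^ 'n"
  assumes E: "E \<in> sets borel" and d: "\<And>x. x \<in> E \<Longrightarrow> (\<Phi> has_derivative \<Phi>' x) (at x)"
    and inj: "inj_on \<Phi> E" and im: "\<Phi> ` E \<in> sets borel"
    and m: "(\<lambda>x. indicator E x * \<bar>det (matrix (\<Phi>' x))\<bar>) \<in> borel_measurable borel"
  shows "emeasure lborel (\<Phi> ` E) = (\<integral>\<^sup>+x. ennreal (indicator E x * \<bar>det (matrix (\<Phi>' x))\<bar>) \<partial>lborel)"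
proof -
  let ?T = "vec_to_copy :: real ^ 'n \<Rightarrow> _" and ?F = "vec_of_copy :: _ \<Rightarrow> real ^ 'n"
  define \<Psi> where "\<Psi> y = ?T (\<Phi> (?F y))" for y
  define \<Psi>' where "\<Psi>' y = (\<lambda>v. ?T (\<Phi>' (?F y) (?F v)))" for y
  have mT: "?T \<in> borel_measurable borel" and mF: "?F \<in> borel_measurable borel"
    by (intro borel_measurable_continuous_onI linear_continuous_on bounded_linear_vec_copy)+
  have TE: "?T ` A = ?F -` A" for A
    by (auto simp: image_iff) (metis vec_copy_inverse(2))
  have bor: "?T ` A \<in> sets borel" if "A \<in> sets borel" for A
    using measurable_sets[OF mF that] by (simp add: TE)
  have vT: "?T -` (?T ` A) = A" for A by (auto dest: arg_cong[of _ _ ?F])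
  have emT: "emeasure lborel (?T ` A) = emeasure lborel A" if "A \<in> sets borel" for A
    by (subst distr_vec_to_copy[symmetric], subst emeasure_distr) (use mT bor[OF that] vT in auto)
  have det: "det (matrix (\<Psi>' y)) = det (matrix (\<Phi>' (?F y)))" if "y \<in> ?T ` E" for y
  proof -
    have "linear (\<Phi>' (?F y))" using d[of "?F y"] that by (auto intro: has_derivative_linear)
    then show ?thesis unfolding \<Psi>'_def by (simp add: matrix_vec_copy det_reindex)
  qed
  have ind: "indicator (?T ` E) y * \<bar>det (matrix (\<Psi>' y))\<bar> = indicator E (?F y) * \<bar>det (matrix (\<Phi>' (?F y)))\<bar>" for y
    using det[of y] by (auto simp: indicator_def TE)
  have "\<Psi> ` ?T ` E = ?T ` \<Phi> ` E" by (simp add: \<Psi>_def image_image)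
  then have "emeasure lborel (\<Phi> ` E) = emeasure lborel (\<Psi> ` ?T ` E)" using emT[OF im] by simp
  also have "\<dots> = (\<integral>\<^sup>+y. ennreal (indicator (?T ` E) y * \<bar>det (matrix (\<Psi>' y))\<bar>) \<partial>lborel)"
  proof (rule emeasure_differentiable_image_ordered)
    show "?T ` E \<in> sets borel" by (rule bor[OF E])
    show "(\<Psi> has_derivative \<Psi>' y) (at y)" if "y \<in> ?T ` E" for y
    proof -
      have "(?F has_derivative ?F) (at y)" by (rule bounded_linear_imp_has_derivative[OF bounded_linear_vec_copy(2)])
      moreover have "(\<Phi> has_derivative \<Phi>' (?F y)) (at (?F y))" using that by (intro d) auto
      ultimately have "((\<lambda>y. \<Phi> (?F y)) has_derivative (\<lambda>v. \<Phi>' (?F y) (?F v))) (at y)"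
        by (rule has_derivative_compose)
      from bounded_linear.has_derivative[OF bounded_linear_vec_copy(1) this]
      show ?thesis by (simp add: \<Psi>_def[abs_def] \<Psi>'_def)
    qed
    show "inj_on \<Psi> (?T ` E)"
      using inj by (auto simp: inj_on_def \<Psi>_def dest!: arg_cong[of _ _ ?F])
    show "\<Psi> ` ?T ` E \<in> sets borel" using bor[OF im] \<open>\<Psi> ` ?T ` E = ?T ` \<Phi> ` E\<close> by simp
    show "(\<lambda>y. indicator (?T ` E) y * \<bar>det (matrix (\<Psi>' y))\<bar>) \<in> borel_measurable borel"
      unfolding ind by (rule measurable_compose[OF mF m])
  qed
  also have "\<dots> = (\<integral>\<^sup>+y. ennreal (indicator E (?F y) * \<bar>det (matrix (\<Phi>' (?F y)))\<bar>) \<partial>lborel)"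
    by (simp only: ind)
  also have "\<dots> = (\<integral>\<^sup>+x. ennreal (indicator E x * \<bar>det (matrix (\<Phi>' x))\<bar>) \<partial>lborel)"
    using measurable_compose[OF mF m]
    by (subst distr_vec_to_copy[symmetric], subst nn_integral_distr) (use mT in auto)
  finally show ?thesis .
qed

text \<open>Both sides are integrals of \<open>F\<close>: with respect to Lebesgue measure on the image, and
  with respect to the image under \<open>\<Phi>\<close> of the Jacobian times Lebesgue measure.  These
  measures agree on Borel sets by the formula for the measure of an image.\<close>

theorem nn_integral_change_of_variables:
  fixes \<Phi> :: "real ^ 'n::finite \<Rightarrow> real ^ 'n" and F :: "real ^ 'n \<Rightarrow> ennreal"
  assumes S: "open S" and im: "open (\<Phi> ` S)" and d: "\<And>x. x \<in> S \<Longrightarrow> (\<Phi> has_derivative \<Phi>' x) (at x)"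
    and inj: "inj_on \<Phi> S" and c: "continuous_on S (\<lambda>x. det (matrix (\<Phi>' x)))"
    and F: "F \<in> borel_measurable borel"
  shows "(\<integral>\<^sup>+y. F y * indicator (\<Phi> ` S) y \<partial>lborel)
    = (\<integral>\<^sup>+x. ennreal \<bar>det (matrix (\<Phi>' x))\<bar> * F (\<Phi> x) * indicator S x \<partial>lborel)"
proof -
  have Sm: "S \<in> sets borel" "\<Phi> ` S \<in> sets borel" using S im by auto
  have cont: "continuous_on S \<Phi>"
    using d by (auto intro!: continuous_at_imp_continuous_on has_derivative_continuous)
  have m\<Phi>: "\<Phi> \<in> measurable (restrict_space lborel S) borel"
    using borel_measurable_continuous_on_restrict[OF cont] by (simp add: measurable_cong_sets[OF sets_restrict_space_cong[OF sets_lborel] refl])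
  have mD: "(\<lambda>x. indicator A x * \<bar>det (matrix (\<Phi>' x))\<bar>) \<in> borel_measurable borel" if "A \<subseteq> S" "A \<in> sets borel" for A
  proof -
    have "(\<lambda>x. indicator S x *\<^sub>R \<bar>det (matrix (\<Phi>' x))\<bar>) \<in> borel_measurable borel"
      by (rule borel_measurable_continuous_on_indicator[OF Sm(1)]) (intro continuous_intros c)
    then have "(\<lambda>x. indicator A x * (indicator S x *\<^sub>R \<bar>det (matrix (\<Phi>' x))\<bar>)) \<in> borel_measurable borel"
      using that(2) by measurable
    also have "(\<lambda>x. indicator A x * (indicator S x *\<^sub>R \<bar>det (matrix (\<Phi>' x))\<bar>)) = (\<lambda>x. indicator A x * \<bar>det (matrix (\<Phi>' x))\<bar>)"
      using that(1) by (auto simp: indicator_def fun_eq_iff)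
    finally show ?thesis .
  qed
  have mdet: "(\<lambda>x. ennreal \<bar>det (matrix (\<Phi>' x))\<bar>) \<in> borel_measurable (restrict_space lborel S)"
    using borel_measurable_continuous_on_restrict[OF c]
    by (simp add: measurable_cong_sets[OF sets_restrict_space_cong[OF sets_lborel] refl])
  let ?\<mu> = "distr (density (restrict_space lborel S) (\<lambda>x. ennreal \<bar>det (matrix (\<Phi>' x))\<bar>)) borel \<Phi>"
  have eq: "?\<mu> = density lborel (indicator (\<Phi> ` S))"
  proof (rule measure_eqI)
    fix A assume "A \<in> sets ?\<mu>"
    then have A: "A \<in> sets borel" by simp
    define E where "E = \<Phi> -` A \<inter> S"
    have "E \<in> sets (restrict_space borel S)"
      using measurable_sets[OF borel_measurable_continuous_on_restrict[OF cont] A] by (simp add: E_def space_restrict_space)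
    then have E: "E \<in> sets borel" "E \<subseteq> S"
      using Sm by (auto simp: sets_restrict_space E_def)
    have img: "\<Phi> ` E = A \<inter> \<Phi> ` S" by (auto simp: E_def)
    have "emeasure ?\<mu> A = emeasure (density (restrict_space lborel S) (\<lambda>x. ennreal \<bar>det (matrix (\<Phi>' x))\<bar>)) E"
      using m\<Phi> A by (subst emeasure_distr) (auto simp: E_def space_restrict_space)
    also have "\<dots> = (\<integral>\<^sup>+x. ennreal \<bar>det (matrix (\<Phi>' x))\<bar> * indicator E x \<partial>restrict_space lborel S)"
      using mdet E Sm by (subst emeasure_density) (auto simp: sets_restrict_space_iff)
    also have "\<dots> = (\<integral>\<^sup>+x. ennreal (indicator E x * \<bar>det (matrix (\<Phi>' x))\<bar>) \<partial>lborel)"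
      using Sm E by (subst nn_integral_restrict_space) (auto intro!: nn_integral_cong simp: indicator_def)
    also have "\<dots> = emeasure lborel (\<Phi> ` E)"
      using E d inj Sm A img
      by (intro emeasure_differentiable_image[symmetric] mD) (auto intro: inj_on_subset)
    also have "\<dots> = emeasure (density lborel (indicator (\<Phi> ` S))) A"
      using A Sm img by (subst emeasure_density) (auto simp flip: indicator_inter_arith simp: Int_commute)
    finally show "emeasure ?\<mu> A = emeasure (density lborel (indicator (\<Phi> ` S))) A" .
  qed simp
  have "(\<integral>\<^sup>+y. F y * indicator (\<Phi> ` S) y \<partial>lborel) = (\<integral>\<^sup>+y. F y \<partial>density lborel (indicator (\<Phi> ` S)))"
    using F Sm by (subst nn_integral_density) (auto simp: mult.commute)
  also have "\<dots> = (\<integral>\<^sup>+y. F y \<partial>?\<mu>)" by (simp only: eq)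
  also have "\<dots> = (\<integral>\<^sup>+x. F (\<Phi> x) \<partial>density (restrict_space lborel S) (\<lambda>x. ennreal \<bar>det (matrix (\<Phi>' x))\<bar>))"
    using F m\<Phi> by (subst nn_integral_distr) auto
  also have "\<dots> = (\<integral>\<^sup>+x. ennreal \<bar>det (matrix (\<Phi>' x))\<bar> * F (\<Phi> x) \<partial>restrict_space lborel S)"
    using mdet measurable_compose[OF m\<Phi> F] by (subst nn_integral_density) auto
  also have "\<dots> = (\<integral>\<^sup>+x. ennreal \<bar>det (matrix (\<Phi>' x))\<bar> * F (\<Phi> x) * indicator S x \<partial>lborel)"
    using Sm by (subst nn_integral_restrict_space) auto
  finally show ?thesis .
qed

section \<open>Charts and smooth functions on a manifold\<close>

context smooth_manifold
begin

lemma open_chart_dom: "c \<in> A \<Longrightarrow> open (chart_dom c)"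
  and open_chart_range: "c \<in> A \<Longrightarrow> open (coords c ` chart_dom c)"
  and chart_homeomorphism:
    "c \<in> A \<Longrightarrow> homeomorphism (chart_dom c) (coords c ` chart_dom c) (coords c) (coords_inv c)"
  using charts by (auto simp: is_chart_def)

lemma continuous_on_coords: "c \<in> A \<Longrightarrow> continuous_on (chart_dom c) (coords c)"
  and continuous_on_coords_inv: "c \<in> A \<Longrightarrow> continuous_on (coords c ` chart_dom c) (coords_inv c)"
  using chart_homeomorphism by (auto simp: homeomorphism_def)

lemma coords_inv_coords [simp]: "c \<in> A \<Longrightarrow> p \<in> chart_dom c \<Longrightarrow> coords_inv c (coords c p) = p"
  using chart_homeomorphism by (auto simp: homeomorphism_def)

lemma coords_coords_inv [simp]:
  "c \<in> A \<Longrightarrow> x \<in> coords c ` chart_dom c \<Longrightarrow> coords c (coords_inv c x) = x"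
  by auto

lemma inj_on_coords: "c \<in> A \<Longrightarrow> inj_on (coords c) (chart_dom c)"
  by (metis coords_inv_coords inj_onI)

lemma coords_image_eq:
  "c \<in> A \<Longrightarrow> coords c ` (S \<inter> chart_dom c) = coords c ` chart_dom c \<inter> coords_inv c -` S"
  by auto

lemma open_coords_image: "c \<in> A \<Longrightarrow> open S \<Longrightarrow> open (coords c ` (S \<inter> chart_dom c))"
  unfolding coords_image_eq
  by (intro continuous_open_preimage continuous_on_coords_inv open_chart_range)

lemma open_coords_preimage: "c \<in> A \<Longrightarrow> open W \<Longrightarrow> open (chart_dom c \<inter> coords c -` W)"
  by (intro continuous_open_preimage continuous_on_coords open_chart_dom)

lemma coords_mem_image_iff:
  "c \<in> A \<Longrightarrow> p \<in> chart_dom c \<Longrightarrow> coords c p \<in> coords c ` (S \<inter> chart_dom c) \<longleftrightarrow> p \<in> S"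
  by (auto simp: coords_image_eq)

lemma chart_at: "chart_at A p \<in> A" "p \<in> chart_dom (chart_at A p)"
proof -
  have "\<exists>c. c \<in> A \<and> p \<in> chart_dom c" using covering by blast
  then have "chart_at A p \<in> A \<and> p \<in> chart_dom (chart_at A p)" unfolding chart_at_def by (rule someI_ex)
  then show "chart_at A p \<in> A" "p \<in> chart_dom (chart_at A p)" by auto
qed

lemma smooth_on_transition:
  "c \<in> A \<Longrightarrow> d \<in> A \<Longrightarrow> smooth_on (coords c ` (chart_dom c \<inter> chart_dom d)) (coords d \<circ> coords_inv c)"
  using compatible by (auto simp: smoothly_compatible_def)

lemma open_overlap: "c \<in> A \<Longrightarrow> d \<in> A \<Longrightarrow> open (coords c ` (chart_dom c \<inter> chart_dom d))"
  using open_coords_image[of c "chart_dom d"] open_chart_dom[of d] by (simp add: Int_commute)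

lemma transition_has_derivative:
  assumes "c \<in> A" "d \<in> A" "p \<in> chart_dom c" "p \<in> chart_dom d"
  shows "((coords d \<circ> coords_inv c) has_derivative transition_deriv c d p) (at (coords c p))"
  unfolding transition_deriv_def
  using smooth_on_imp_derivative[OF smooth_on_transition[OF assms(1,2)]] assms(3,4) by blast

lemma linear_transition_deriv:
  "c \<in> A \<Longrightarrow> d \<in> A \<Longrightarrow> p \<in> chart_dom c \<Longrightarrow> p \<in> chart_dom d \<Longrightarrow> linear (transition_deriv c d p)"
  using transition_has_derivative has_derivative_linear by blast

lemma transition_deriv_self:
  assumes "c \<in> A" "p \<in> chart_dom c"
  shows "transition_deriv c c p x = x"
proof -
  have "((\<lambda>x. x) has_derivative (\<lambda>x. x)) (at (coords c p))" by (rule has_derivative_ident)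
  then have "((coords c \<circ> coords_inv c) has_derivative (\<lambda>x. x)) (at (coords c p))"
    by (rule has_derivative_transform_within_open[OF _ open_chart_range[OF assms(1)]]) (use assms in auto)
  from has_derivative_unique[OF this transition_has_derivative[OF assms(1,1,2,2)]] show ?thesis by metis
qed

lemma transition_deriv_compose:
  assumes "c \<in> A" "d \<in> A" "e \<in> A" "p \<in> chart_dom c" "p \<in> chart_dom d" "p \<in> chart_dom e"
  shows "transition_deriv d e p (transition_deriv c d p x) = transition_deriv c e p x"
proof -
  have dp: "(coords d \<circ> coords_inv c) (coords c p) = coords d p" using assms by simp
  have "((\<lambda>x. (coords e \<circ> coords_inv d) ((coords d \<circ> coords_inv c) x)) has_derivative
      (\<lambda>x. transition_deriv d e p (transition_deriv c d p x))) (at (coords c p))"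
    using has_derivative_compose[OF transition_has_derivative[OF assms(1,2,4,5)]]
      transition_has_derivative[OF assms(2,3,5,6)] dp by metis
  then have "((coords e \<circ> coords_inv c) has_derivative
      (\<lambda>x. transition_deriv d e p (transition_deriv c d p x))) (at (coords c p))"
    by (rule has_derivative_transform_within_open[OF _ open_overlap[OF assms(1,2)]]) (use assms in auto)
  from has_derivative_unique[OF this transition_has_derivative[OF assms(1,3,4,6)]] show ?thesis by metis
qed

text \<open>Smoothness on a set inside one chart passes to every other chart by composition with the
  transition map.\<close>

lemma smooth_chart_change:
  fixes f :: "'a \<Rightarrow> 'b::real_normed_vector"
  assumes "c \<in> A" "d \<in> A" "open S" "S \<subseteq> chart_dom c"
    and "smooth_on (coords c ` S) (f \<circ> coords_inv c)"
  shows "smooth_on (coords d ` (S \<inter> chart_dom d)) (f \<circ> coords_inv d)"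
proof (rule smooth_on_cong)
  show op: "open (coords d ` (S \<inter> chart_dom d))" using assms by (intro open_coords_image)
  show "smooth_on (coords d ` (S \<inter> chart_dom d)) (\<lambda>y. (f \<circ> coords_inv c) ((coords c \<circ> coords_inv d) y))"
  proof (rule smooth_on_compose[OF op])
    show "(coords c \<circ> coords_inv d) ` coords d ` (S \<inter> chart_dom d) \<subseteq> coords c ` S"
      using assms by auto
    show "smooth_on (coords d ` (S \<inter> chart_dom d)) (coords c \<circ> coords_inv d)"
      using smooth_on_transition[OF assms(2,1)] by (rule smooth_on_subset) (use assms in auto)
  qed fact
  show "(f \<circ> coords_inv c) ((coords c \<circ> coords_inv d) y) = (f \<circ> coords_inv d) y"
    if "y \<in> coords d ` (S \<inter> chart_dom d)" for y
    using that assms by auto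
qed

lemma smooth_chart_locally:
  assumes "c \<in> A" "\<And>p. p \<in> S \<inter> chart_dom c \<Longrightarrow> \<exists>T. open T \<and> p \<in> T \<and> smooth_on (coords c ` (T \<inter> chart_dom c)) F"
  shows "smooth_on (coords c ` (S \<inter> chart_dom c)) F"
proof (rule smooth_on_locally)
  fix x assume "x \<in> coords c ` (S \<inter> chart_dom c)"
  then obtain p where p: "p \<in> S \<inter> chart_dom c" "x = coords c p" by auto
  obtain T where "open T" "p \<in> T" "smooth_on (coords c ` (T \<inter> chart_dom c)) F"
    using assms(2)[OF p(1)] by blast
  then show "\<exists>T. open T \<and> x \<in> T \<and> smooth_on T F"
    using open_coords_image[OF assms(1)] p by blast
qed

lemma smooth_chart_cong:
  assumes "c \<in> A" "open S" "\<And>p. p \<in> S \<inter> chart_dom c \<Longrightarrow> f p = g p"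
    "smooth_on (coords c ` (S \<inter> chart_dom c)) (f \<circ> coords_inv c)"
  shows "smooth_on (coords c ` (S \<inter> chart_dom c)) (g \<circ> coords_inv c)"
  by (rule smooth_on_cong[OF open_coords_image[OF assms(1,2)] _ assms(4)]) (use assms(1,3) in auto)

lemma smooth_function_onI_chart:
  assumes "c \<in> A" "open S" "S \<subseteq> chart_dom c" "smooth_on (coords c ` S) (f \<circ> coords_inv c)"
  shows "smooth_function_on A S f"
  unfolding smooth_function_on_def using smooth_chart_change[OF assms(1) _ assms(2-4)] by blast

lemma smooth_function_on_locally:
  assumes "\<And>p. p \<in> S \<Longrightarrow> \<exists>T. open T \<and> p \<in> T \<and> smooth_function_on A T f"
  shows "smooth_function_on A S f"
  unfolding smooth_function_on_def
proof
  fix c assume c: "c \<in> A"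
  show "smooth_on (coords c ` (S \<inter> chart_dom c)) (f \<circ> coords_inv c)"
  proof (rule smooth_chart_locally[OF c])
    fix p assume "p \<in> S \<inter> chart_dom c"
    then obtain T where "open T" "p \<in> T" "smooth_function_on A T f" using assms by blast
    then show "\<exists>T. open T \<and> p \<in> T \<and> smooth_on (coords c ` (T \<inter> chart_dom c)) (f \<circ> coords_inv c)"
      using c by (auto simp: smooth_function_on_def)
  qed
qed

lemma smooth_function_on_subset: "smooth_function_on A S f \<Longrightarrow> T \<subseteq> S \<Longrightarrow> smooth_function_on A T f"
  unfolding smooth_function_on_def by (blast intro: smooth_on_subset)

lemma smooth_function_on_cong:
  "open S \<Longrightarrow> (\<And>p. p \<in> S \<Longrightarrow> f p = g p) \<Longrightarrow> smooth_function_on A S f \<Longrightarrow> smooth_function_on A S g"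
  unfolding smooth_function_on_def by (blast intro: smooth_chart_cong)

lemma smooth_function_on_const: "smooth_function_on A S (\<lambda>p. a)"
  by (simp add: smooth_function_on_def o_def smooth_on_const)

lemma smooth_function_on_mult:
  "open S \<Longrightarrow> smooth_function_on A S f \<Longrightarrow> smooth_function_on A S h \<Longrightarrow> smooth_function_on A S (\<lambda>p. f p * h p)"
  unfolding smooth_function_on_def o_def using open_coords_image by (auto intro!: smooth_intros)

lemma smooth_function_on_diff:
  "open S \<Longrightarrow> smooth_function_on A S f \<Longrightarrow> smooth_function_on A S h \<Longrightarrow> smooth_function_on A S (\<lambda>p. f p - h p)"
  unfolding smooth_function_on_def o_def using open_coords_image by (auto intro!: smooth_intros)

lemma smooth_function_on_sum:
  "open S \<Longrightarrow> (\<And>i. i \<in> I \<Longrightarrow> smooth_function_on A S (f i)) \<Longrightarrow> smooth_function_on A S (\<lambda>p. \<Sum>i\<in>I. f i p)"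
  unfolding smooth_function_on_def o_def using open_coords_image by (auto intro!: smooth_on_sum)

lemma smooth_function_on_divide:
  assumes "open S" "smooth_function_on A S f" "smooth_function_on A S h" "\<And>p. p \<in> S \<Longrightarrow> h p \<noteq> 0"
  shows "smooth_function_on A S (\<lambda>p. f p / h p)"
  unfolding smooth_function_on_def o_def
proof
  fix c assume c: "c \<in> A"
  then have "h (coords_inv c x) \<noteq> 0" if "x \<in> coords c ` (S \<inter> chart_dom c)" for x using that assms(4) by auto
  with c show "smooth_on (coords c ` (S \<inter> chart_dom c)) (\<lambda>x. f (coords_inv c x) / h (coords_inv c x))"
    using assms by (intro smooth_on_divide open_coords_image) (auto simp: smooth_function_on_def o_def)
qed

lemma smooth_function_imp_continuous:
  assumes "open S" "smooth_function_on A S f"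
  shows "continuous_on S f"
proof (intro continuous_at_imp_continuous_on ballI)
  fix p assume p: "p \<in> S"
  obtain c where c: "c \<in> A" "p \<in> chart_dom c" using chart_at by blast
  have "continuous_on (coords c ` (S \<inter> chart_dom c)) (f \<circ> coords_inv c)"
    using assms(2) c(1) by (intro smooth_on_imp_continuous_on) (auto simp: smooth_function_on_def)
  then have "continuous_on (S \<inter> chart_dom c) (\<lambda>q. (f \<circ> coords_inv c) (coords c q))"
    by (rule continuous_on_compose2) (auto intro: continuous_on_subset[OF continuous_on_coords[OF c(1)]])
  then have "continuous_on (S \<inter> chart_dom c) f"
    by (rule continuous_on_cong[THEN iffD1, OF refl, rotated]) (use c in auto)
  then show "isCont f p"
    using p c assms(1) open_chart_dom[OF c(1)] by (simp add: continuous_on_eq_continuous_at open_Int)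
qed

section \<open>One-forms\<close>

lemma smooth_one_form_onD:
  "smooth_one_form_on A S \<omega> \<Longrightarrow> c \<in> A \<Longrightarrow> smooth_on (coords c ` (S \<inter> chart_dom c)) (\<omega> c \<circ> coords_inv c)"
  by (auto simp: smooth_one_form_on_def smooth_components_on_def)

lemma one_form_eq:
  "smooth_one_form_on A S \<omega> \<Longrightarrow> c \<in> A \<Longrightarrow> d \<in> A \<Longrightarrow> p \<in> S \<Longrightarrow> p \<in> chart_dom c \<Longrightarrow> p \<in> chart_dom d \<Longrightarrow>
    \<omega> c p \<bullet> x = \<omega> d p \<bullet> transition_deriv c d p x"
  unfolding smooth_one_form_on_def one_form_on_def by blast

lemma smooth_one_form_on_subset:
  assumes \<omega>: "smooth_one_form_on A S \<omega>" and "T \<subseteq> S"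
  shows "smooth_one_form_on A T \<omega>"
  unfolding smooth_one_form_on_def one_form_on_def smooth_components_on_def
proof (intro conjI ballI allI)
  fix c d p x assume "c \<in> A" "d \<in> A" "p \<in> T \<inter> chart_dom c \<inter> chart_dom d"
  then show "\<omega> c p \<bullet> x = \<omega> d p \<bullet> transition_deriv c d p x"
    using assms(2) by (intro one_form_eq[OF \<omega>]) auto
next
  fix c assume "c \<in> A"
  then show "smooth_on (coords c ` (T \<inter> chart_dom c)) (\<omega> c \<circ> coords_inv c)"
    by (rule smooth_on_subset[OF smooth_one_form_onD[OF \<omega>]]) (use assms(2) in auto)
qed

lemma smooth_one_form_on_locally:
  assumes "\<And>p. p \<in> S \<Longrightarrow> \<exists>T. open T \<and> p \<in> T \<and> smooth_one_form_on A T \<omega>"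
  shows "smooth_one_form_on A S \<omega>"
  unfolding smooth_one_form_on_def
proof
  show "one_form_on A S \<omega>"
    unfolding one_form_on_def
  proof (intro ballI allI)
    fix c d p x assume *: "c \<in> A" "d \<in> A" "p \<in> S \<inter> chart_dom c \<inter> chart_dom d"
    then obtain T where "open T" "p \<in> T" "smooth_one_form_on A T \<omega>" using assms by blast
    then show "\<omega> c p \<bullet> x = \<omega> d p \<bullet> transition_deriv c d p x"
      using one_form_eq * by blast
  qed
  show "smooth_components_on A S \<omega>"
    unfolding smooth_components_on_def
  proof
    fix c assume c: "c \<in> A"
    show "smooth_on (coords c ` (S \<inter> chart_dom c)) (\<omega> c \<circ> coords_inv c)"
    proof (rule smooth_chart_locally[OF c])
      fix p assume "p \<in> S \<inter> chart_dom c"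
      then obtain T where "open T" "p \<in> T" "smooth_one_form_on A T \<omega>" using assms by blast
      then show "\<exists>T. open T \<and> p \<in> T \<and> smooth_on (coords c ` (T \<inter> chart_dom c)) (\<omega> c \<circ> coords_inv c)"
        using smooth_one_form_onD[OF _ c] by blast
    qed
  qed
qed

lemma smooth_one_form_on_cong:
  assumes "open S" "\<And>c p. c \<in> A \<Longrightarrow> p \<in> S \<Longrightarrow> \<omega> c p = \<theta> c p" "smooth_one_form_on A S \<omega>"
  shows "smooth_one_form_on A S \<theta>"
  unfolding smooth_one_form_on_def smooth_components_on_def
proof
  show "one_form_on A S \<theta>"
    unfolding one_form_on_def
  proof (intro ballI allI)
    fix c d p x assume "c \<in> A" "d \<in> A" "p \<in> S \<inter> chart_dom c \<inter> chart_dom d"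
    then show "\<theta> c p \<bullet> x = \<theta> d p \<bullet> transition_deriv c d p x"
      using one_form_eq[OF assms(3), of c d p x] assms(2)[of c p] assms(2)[of d p] by simp
  qed
  show "\<forall>c\<in>A. smooth_on (coords c ` (S \<inter> chart_dom c)) (\<theta> c \<circ> coords_inv c)"
  proof
    fix c assume c: "c \<in> A"
    show "smooth_on (coords c ` (S \<inter> chart_dom c)) (\<theta> c \<circ> coords_inv c)"
      by (rule smooth_chart_cong[OF c assms(1) _ smooth_one_form_onD[OF assms(3) c]]) (use assms(2) c in auto)
  qed
qed

lemma smooth_one_form_on_add:
  assumes S: "open S" and \<omega>: "smooth_one_form_on A S \<omega>" and \<theta>: "smooth_one_form_on A S \<theta>"
  shows "smooth_one_form_on A S (\<lambda>c p. \<omega> c p + \<theta> c p)"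
  unfolding smooth_one_form_on_def one_form_on_def smooth_components_on_def o_def
proof (intro conjI ballI allI)
  fix c d p x assume "c \<in> A" "d \<in> A" "p \<in> S \<inter> chart_dom c \<inter> chart_dom d"
  then show "(\<omega> c p + \<theta> c p) \<bullet> x = (\<omega> d p + \<theta> d p) \<bullet> transition_deriv c d p x"
    using one_form_eq[OF \<omega>, of c d p x] one_form_eq[OF \<theta>, of c d p x] by (simp add: inner_add_left)
next
  fix c assume c: "c \<in> A"
  show "smooth_on (coords c ` (S \<inter> chart_dom c)) (\<lambda>x. \<omega> c (coords_inv c x) + \<theta> c (coords_inv c x))"
    using smooth_one_form_onD[OF \<omega> c] smooth_one_form_onD[OF \<theta> c] open_coords_image[OF c S]
    by (intro smooth_on_add) (simp_all add: o_def)
qed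

lemma smooth_one_form_on_scale:
  assumes S: "open S" and f: "smooth_function_on A S f" and \<omega>: "smooth_one_form_on A S \<omega>"
  shows "smooth_one_form_on A S (\<lambda>c p. f p *\<^sub>R \<omega> c p)"
  unfolding smooth_one_form_on_def one_form_on_def smooth_components_on_def o_def
proof (intro conjI ballI allI)
  fix c d p x assume "c \<in> A" "d \<in> A" "p \<in> S \<inter> chart_dom c \<inter> chart_dom d"
  then show "(f p *\<^sub>R \<omega> c p) \<bullet> x = (f p *\<^sub>R \<omega> d p) \<bullet> transition_deriv c d p x"
    using one_form_eq[OF \<omega>, of c d p x] by simp
next
  fix c assume c: "c \<in> A"
  show "smooth_on (coords c ` (S \<inter> chart_dom c)) (\<lambda>x. f (coords_inv c x) *\<^sub>R \<omega> c (coords_inv c x))"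
    using smooth_one_form_onD[OF \<omega> c] f c open_coords_image[OF c S]
    by (intro smooth_on_scaleR) (simp_all add: smooth_function_on_def o_def)
qed

lemma smooth_one_form_on_zero: "smooth_one_form_on A S (\<lambda>c p. 0)"
  by (auto simp: smooth_one_form_on_def one_form_on_def smooth_components_on_def o_def smooth_on_const)

lemma smooth_one_form_on_sum:
  assumes "open S" "finite I" "\<And>i. i \<in> I \<Longrightarrow> smooth_one_form_on A S (\<omega> i)"
  shows "smooth_one_form_on A S (\<lambda>c p. \<Sum>i\<in>I. \<omega> i c p)"
  using assms(2,3)
  by (induction I) (auto intro: smooth_one_form_on_zero smooth_one_form_on_add[OF assms(1)])

text \<open>The one-form with components \<open>w\<close> in the chart \<open>c\<close>, extended by zero: in
  a chart \<open>d\<close> its components are the pullback of \<open>w\<close> by the derivative of the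
  transition from \<open>d\<close> to \<open>c\<close>.\<close>

definition chart_form :: "('a, 'n) chart \<Rightarrow> ('a \<Rightarrow> real ^ 'n) \<Rightarrow> ('a, 'n) chart \<Rightarrow> 'a \<Rightarrow> real ^ 'n" where
  "chart_form c w d p = (if p \<in> chart_dom c then (\<chi> j. w p \<bullet> transition_deriv d c p (axis j 1)) else 0)"

lemma chart_form_inner:
  assumes "c \<in> A" "d \<in> A" "p \<in> chart_dom c" "p \<in> chart_dom d"
  shows "chart_form c w d p \<bullet> x = w p \<bullet> transition_deriv d c p x"
proof -
  have lin: "linear (transition_deriv d c p)" using assms by (intro linear_transition_deriv)
  have "transition_deriv d c p x = transition_deriv d c p (\<Sum>j\<in>UNIV. x $ j *\<^sub>R axis j 1)"
    by (simp add: vec_lambda_axis_sum[symmetric])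
  also have "\<dots> = (\<Sum>j\<in>UNIV. x $ j *\<^sub>R transition_deriv d c p (axis j 1))"
    by (simp add: linear_sum[OF lin] linear_scale[OF lin])
  finally show ?thesis
    using assms(3) by (simp add: chart_form_def inner_vec_def[of "vec_lambda _"] inner_sum_right mult.commute)
qed

lemma chart_form_self: "c \<in> A \<Longrightarrow> p \<in> chart_dom c \<Longrightarrow> chart_form c w c p = w p"
  by (rule vector_eq_rdot[THEN iffD1]) (simp add: chart_form_inner transition_deriv_self)

lemma chart_form_eq_0: "w p = 0 \<Longrightarrow> chart_form c w d p = 0"
  by (subst vec_eq_iff) (simp add: chart_form_def)

lemma smooth_chart_form:
  assumes c: "c \<in> A" and w: "smooth_on (coords c ` chart_dom c) (w \<circ> coords_inv c)"
    and K: "compact K" "K \<subseteq> chart_dom c" "\<And>p. p \<notin> K \<Longrightarrow> w p = 0"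
  shows "smooth_one_form_on A UNIV (chart_form c w)"
proof (rule smooth_one_form_on_locally)
  fix p
  have loc: "smooth_one_form_on A (chart_dom c) (chart_form c w)"
    unfolding smooth_one_form_on_def
  proof
    show "one_form_on A (chart_dom c) (chart_form c w)"
      unfolding one_form_on_def
    proof (intro ballI allI)
      fix d e p x assume *: "d \<in> A" "e \<in> A" "p \<in> chart_dom c \<inter> chart_dom d \<inter> chart_dom e"
      then show "chart_form c w d p \<bullet> x = chart_form c w e p \<bullet> transition_deriv d e p x"
        using c by (simp add: chart_form_inner transition_deriv_compose)
    qed
    show "smooth_components_on A (chart_dom c) (chart_form c w)"
      unfolding smooth_components_on_def
    proof
      fix d assume d: "d \<in> A"
      let ?S = "coords d ` (chart_dom c \<inter> chart_dom d)"
      have op: "open ?S" using open_coords_image[OF d open_chart_dom[OF c]] .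
      have "smooth_on ?S (\<lambda>y. \<chi> j. (w \<circ> coords_inv d) y \<bullet> frechet_derivative (coords c \<circ> coords_inv d) (at y) (axis j 1))"
      proof (intro smooth_intros op)
        show "smooth_on ?S (w \<circ> coords_inv d)"
          by (rule smooth_chart_change[OF c d open_chart_dom[OF c] order_refl w])
        show "smooth_on ?S (coords c \<circ> coords_inv d)"
          using smooth_on_transition[OF d c] by (simp add: Int_commute)
      qed
      then show "smooth_on ?S (chart_form c w d \<circ> coords_inv d)"
        by (rule smooth_on_cong[OF op, rotated]) (use d in \<open>auto simp: chart_form_def transition_deriv_def\<close>)
    qed
  qed
  show "\<exists>T. open T \<and> p \<in> T \<and> smooth_one_form_on A T (chart_form c w)"
  proof (cases "p \<in> K")
    case True
    then show ?thesis using loc K(2) open_chart_dom[OF c] by blast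
  next
    case False
    have "open (- K)" using compact_imp_closed[OF K(1)] by auto
    moreover from this have "smooth_one_form_on A (- K) (chart_form c w)"
      by (rule smooth_one_form_on_cong[OF _ _ smooth_one_form_on_zero]) (use K(3) in \<open>auto simp: chart_form_eq_0\<close>)
    ultimately show ?thesis using False by blast
  qed
qed

section \<open>Transport between a chart and the manifold, and bumps\<close>

definition in_chart :: "('a, 'n) chart \<Rightarrow> ('a \<Rightarrow> 'b::zero) \<Rightarrow> real ^ 'n \<Rightarrow> 'b" where
  "in_chart c f x = (if x \<in> coords c ` chart_dom c then f (coords_inv c x) else 0)"

definition from_chart :: "('a, 'n) chart \<Rightarrow> (real ^ 'n \<Rightarrow> 'b::zero) \<Rightarrow> 'a \<Rightarrow> 'b" where
  "from_chart c h p = (if p \<in> chart_dom c then h (coords c p) else 0)"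

lemma compact_coords_image: "c \<in> A \<Longrightarrow> compact K \<Longrightarrow> K \<subseteq> chart_dom c \<Longrightarrow> compact (coords c ` K)"
  by (rule compact_continuous_image[OF continuous_on_subset[OF continuous_on_coords]])

lemma compact_coords_inv_image:
  "c \<in> A \<Longrightarrow> compact K \<Longrightarrow> K \<subseteq> coords c ` chart_dom c \<Longrightarrow> compact (coords_inv c ` K)"
  by (rule compact_continuous_image[OF continuous_on_subset[OF continuous_on_coords_inv]])

lemma in_chart_eq_0:
  assumes "c \<in> A" "\<And>p. p \<notin> K \<Longrightarrow> f p = 0" "x \<notin> coords c ` K"
  shows "in_chart c f x = 0"
  using assms by (auto simp: in_chart_def image_iff)

lemma smooth_in_chart:
  fixes f :: "'a \<Rightarrow> 'b::real_normed_vector"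
  assumes c: "c \<in> A" and S: "open S" and K: "compact K" "K \<subseteq> S \<inter> chart_dom c" "\<And>p. p \<notin> K \<Longrightarrow> f p = 0"
    and f: "smooth_on (coords c ` (S \<inter> chart_dom c)) (f \<circ> coords_inv c)"
  shows "smooth_on UNIV (in_chart c f)"
proof (rule smooth_on_extend_zero)
  show op: "open (coords c ` (S \<inter> chart_dom c))" by (rule open_coords_image[OF c S])
  show "smooth_on (coords c ` (S \<inter> chart_dom c)) (in_chart c f)"
    by (rule smooth_on_cong[OF op _ f]) (auto simp: in_chart_def)
  show "closed (coords c ` K)" using compact_coords_image[OF c K(1)] K(2) by (intro compact_imp_closed) auto
  show "coords c ` K \<subseteq> coords c ` (S \<inter> chart_dom c)" using K(2) by auto
qed (rule in_chart_eq_0[OF c K(3)])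

lemma from_chart_eq_0:
  assumes "c \<in> A" "\<And>x. x \<notin> K \<Longrightarrow> h x = 0" "p \<notin> coords_inv c ` K"
  shows "from_chart c h p = 0"
  using assms by (auto simp: from_chart_def image_iff) (metis coords_inv_coords)

lemma smooth_from_chart_dom:
  assumes c: "c \<in> A" and h: "smooth_on (coords c ` chart_dom c) h"
  shows "smooth_on (coords c ` chart_dom c) (from_chart c h \<circ> coords_inv c)"
  by (rule smooth_on_cong[OF open_chart_range[OF c] _ h]) (use c in \<open>auto simp: from_chart_def\<close>)

lemma smooth_from_chart:
  assumes c: "c \<in> A" and h: "smooth_on (coords c ` chart_dom c) h"
    and K: "compact K" "K \<subseteq> coords c ` chart_dom c" "\<And>x. x \<notin> K \<Longrightarrow> h x = 0"
  shows "smooth_function_on A UNIV (from_chart c h)"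
proof (rule smooth_function_on_locally)
  fix p
  show "\<exists>T. open T \<and> p \<in> T \<and> smooth_function_on A T (from_chart c h)"
  proof (cases "p \<in> coords_inv c ` K")
    case True
    then have "p \<in> chart_dom c" using c K(2) by auto
    then show ?thesis
      using smooth_function_onI_chart[OF c open_chart_dom[OF c] order_refl smooth_from_chart_dom[OF c h]]
        open_chart_dom[OF c] by blast
  next
    case False
    have "open (- coords_inv c ` K)"
      using compact_imp_closed[OF compact_coords_inv_image[OF c K(1,2)]] by auto
    moreover from this have "smooth_function_on A (- coords_inv c ` K) (from_chart c h)"
      by (rule smooth_function_on_cong[OF _ _ smooth_function_on_const[of _ 0]])
        (use from_chart_eq_0[OF c K(3)] in auto)
    ultimately show ?thesis using False by blast
  qed
qed

lemma manifold_bump: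
  assumes "open S" "p \<in> S"
  obtains b K where "smooth_function_on A UNIV b" "\<And>q. b q \<ge> 0" "b p > 0"
    "compact K" "K \<subseteq> S" "\<And>q. q \<notin> K \<Longrightarrow> b q = 0"
proof -
  obtain c where c: "c \<in> A" "p \<in> chart_dom c" using chart_at by blast
  have "open (coords c ` (S \<inter> chart_dom c))" by (rule open_coords_image[OF c(1) assms(1)])
  moreover have "coords c p \<in> coords c ` (S \<inter> chart_dom c)" using assms c by auto
  ultimately obtain r where r: "r > 0" "cball (coords c p) r \<subseteq> coords c ` (S \<inter> chart_dom c)"
    by (meson open_contains_cball)
  let ?K = "cball (coords c p) r"
  show ?thesis
  proof
    show "smooth_function_on A UNIV (from_chart c (bump (coords c p) r))"
    proof (rule smooth_from_chart[OF c(1), where K = ?K])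
      show "smooth_on (coords c ` chart_dom c) (bump (coords c p) r)"
        by (rule smooth_on_bump[OF open_chart_range[OF c(1)]])
    qed (use r in \<open>auto simp: bump_eq_0\<close>)
    show "from_chart c (bump (coords c p) r) q \<ge> 0" for q by (simp add: from_chart_def bump_nonneg)
    show "from_chart c (bump (coords c p) r) p > 0" using c r by (simp add: from_chart_def bump_pos_iff)
    show "compact (coords_inv c ` ?K)" using r(2) by (intro compact_coords_inv_image c) auto
    show "coords_inv c ` ?K \<subseteq> S" using r(2) c(1) by (auto simp: coords_image_eq)
    show "from_chart c (bump (coords c p) r) q = 0" if "q \<notin> coords_inv c ` ?K" for q
      by (rule from_chart_eq_0[OF c(1) _ that]) (use r in \<open>auto simp: bump_eq_0\<close>)
  qed
qed

text \<open>An unnormalised partition of unity: to write a function supported in \<open>K\<close> as a sum of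
  functions with small supports it suffices to divide by the sum of these bumps, which is positive on
  \<open>K\<close>.\<close>

lemma bump_cover:
  assumes K: "compact K" and N: "\<And>p. p \<in> K \<Longrightarrow> open (N p) \<and> p \<in> N p"
  obtains P b L where "finite P" "P \<subseteq> K" "\<And>p. p \<in> P \<Longrightarrow> smooth_function_on A UNIV (b p)"
    "\<And>p q. p \<in> P \<Longrightarrow> b p q \<ge> 0" "\<And>p. p \<in> P \<Longrightarrow> compact (L p)" "\<And>p. p \<in> P \<Longrightarrow> L p \<subseteq> N p"
    "\<And>p q. p \<in> P \<Longrightarrow> q \<notin> L p \<Longrightarrow> b p q = 0" "\<And>q. q \<in> K \<Longrightarrow> (\<Sum>p\<in>P. b p q) > (0::real)"
proof -
  have "\<forall>p\<in>K. \<exists>b L. smooth_function_on A UNIV b \<and> (\<forall>q. b q \<ge> 0) \<and> b p > 0 \<and>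
    compact L \<and> L \<subseteq> N p \<and> (\<forall>q. q \<notin> L \<longrightarrow> b q = 0)"
  proof
    fix p assume "p \<in> K"
    with N have "open (N p)" "p \<in> N p" by auto
    then obtain b L where "smooth_function_on A UNIV b" "\<And>q. b q \<ge> 0" "b p > 0"
      "compact L" "L \<subseteq> N p" "\<And>q. q \<notin> L \<Longrightarrow> b q = 0"
      by (rule manifold_bump) blast
    then show "\<exists>b L. smooth_function_on A UNIV b \<and> (\<forall>q. b q \<ge> 0) \<and> b p > 0 \<and>
      compact L \<and> L \<subseteq> N p \<and> (\<forall>q. q \<notin> L \<longrightarrow> b q = 0)" by blast
  qed
  from bchoice[OF this] obtain b where "\<forall>p\<in>K. \<exists>L. smooth_function_on A UNIV (b p) \<and> (\<forall>q. b p q \<ge> 0) \<and>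
    b p p > 0 \<and> compact L \<and> L \<subseteq> N p \<and> (\<forall>q. q \<notin> L \<longrightarrow> b p q = 0)" by blast
  from bchoice[OF this] obtain L where "\<forall>p\<in>K. smooth_function_on A UNIV (b p) \<and> (\<forall>q. b p q \<ge> 0) \<and>
    b p p > 0 \<and> compact (L p) \<and> L p \<subseteq> N p \<and> (\<forall>q. q \<notin> L p \<longrightarrow> b p q = 0)" by blast
  then have b: "\<And>p. p \<in> K \<Longrightarrow> smooth_function_on A UNIV (b p)"
    "\<And>p q. p \<in> K \<Longrightarrow> b p q \<ge> 0" "\<And>p. p \<in> K \<Longrightarrow> b p p > 0"
    "\<And>p. p \<in> K \<Longrightarrow> compact (L p)" "\<And>p. p \<in> K \<Longrightarrow> L p \<subseteq> N p" "\<And>p q. p \<in> K \<Longrightarrow> q \<notin> L p \<Longrightarrow> b p q = 0"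
    by blast+
  have "open {q. b p q > 0}" if "p \<in> K" for p
    using smooth_function_imp_continuous[OF open_UNIV b(1)[OF that]]
    by (intro open_Collect_less continuous_on_const)
  then obtain P where P: "P \<subseteq> K" "finite P" "K \<subseteq> (\<Union>p\<in>P. {q. b p q > 0})"
    using compactE_image[OF K, of K "\<lambda>p. {q. b p q > 0}"] b(3) by blast
  show ?thesis
  proof (rule that[of P b L])
    show "(\<Sum>p\<in>P. b p q) > 0" if q: "q \<in> K" for q
    proof -
      obtain p where "p \<in> P" "b p q > 0" using P(3) q by blast
      then show ?thesis using P b(2) by (intro sum_pos2) auto
    qed
  qed (use P b in blast)+
qed

end

section \<open>Positive definite matrices\<close>

definition posdef :: "real ^ 'n ^ 'n \<Rightarrow> bool" where
  "posdef G \<longleftrightarrow> transpose G = G \<and> (\<forall>x. x \<noteq> 0 \<longrightarrow> x \<bullet> (G *v x) > 0)"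

lemma matrix_inv_mult:
  fixes M :: "real ^ 'n ^ 'n"
  assumes "det M \<noteq> 0"
  shows "M ** matrix_inv M = mat 1" "matrix_inv M ** M = mat 1"
proof -
  have "\<exists>B. M ** B = mat 1 \<and> B ** M = mat 1"
    using assms by (simp add: invertible_det_nz[symmetric] invertible_def)
  then have "M ** matrix_inv M = mat 1 \<and> matrix_inv M ** M = mat 1"
    unfolding matrix_inv_def by (rule someI_ex)
  then show "M ** matrix_inv M = mat 1" "matrix_inv M ** M = mat 1" by auto
qed

lemma posdef_det_nz:
  assumes "posdef (G :: real ^ 'n ^ 'n)"
  shows "det G \<noteq> 0"
proof -
  have "x = 0" if "G *v x = 0" for x
  proof (rule ccontr)
    assume "x \<noteq> 0"
    then have "x \<bullet> (G *v x) > 0" using assms by (simp add: posdef_def)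
    then show False using that by simp
  qed
  then have "\<exists>B. B ** G = mat 1" using matrix_left_invertible_ker[of G] by blast
  then show ?thesis by (metis invertible_left_inverse invertible_det_nz)
qed

text \<open>On the segment from the identity to \<open>G\<close> all matrices are positive definite, so the
  determinant does not vanish and keeps the sign it has at the identity.\<close>

lemma posdef_det_pos:
  assumes "posdef (G :: real ^ 'n ^ 'n)"
  shows "det G > 0"
proof (rule ccontr)
  assume "\<not> det G > 0"
  define H where "H t = t *\<^sub>R G + (1 - t) *\<^sub>R mat 1" for t :: real
  have H: "posdef (H t)" if "0 \<le> t" "t \<le> 1" for t
    unfolding posdef_def
  proof (intro conjI allI impI)
    show "transpose (H t) = H t"
      using assms by (simp add: H_def posdef_def vec_eq_iff transpose_def mat_def)
    fix x :: "real ^ 'n" assume x: "x \<noteq> 0"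
    have "x \<bullet> (H t *v x) = t * (x \<bullet> (G *v x)) + (1 - t) * (x \<bullet> x)"
      by (simp add: H_def matrix_vector_mult_add_rdistrib scaleR_matrix_vector_assoc[symmetric] inner_add_right)
    moreover have "x \<bullet> (G *v x) > 0" "x \<bullet> x > 0" using assms x by (auto simp: posdef_def)
    ultimately show "x \<bullet> (H t *v x) > 0"
      using that by (cases "t = 0") (auto intro!: add_pos_nonneg)
  qed
  have "continuous_on {0..1} (\<lambda>t. det (H t))"
    unfolding det_def H_def by (intro continuous_intros) 
  moreover have "H 1 = G" "H 0 = mat 1" by (auto simp: H_def)
  ultimately obtain t where "0 \<le> t" "t \<le> 1" "det (H t) = 0"
    using IVT2'[of "\<lambda>t. det (H t)" 1 0 0] \<open>\<not> det G > 0\<close> by auto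
  then show False using H posdef_det_nz by blast
qed

lemma posdef_inv_symmetric:
  assumes "posdef (G :: real ^ 'n ^ 'n)"
  shows "matrix_inv G $ i $ j = matrix_inv G $ j $ i"
proof -
  let ?J = "matrix_inv G"
  note J = matrix_inv_mult[OF posdef_det_nz[OF assms]]
  have "transpose ?J ** G = mat 1"
    using arg_cong[OF J(1), of transpose] assms by (simp add: posdef_def matrix_transpose_mul transpose_mat)
  then have "transpose ?J ** (G ** ?J) = ?J" by (simp add: matrix_mul_assoc)
  then have "transpose ?J = ?J" using J(1) by simp
  then have "transpose ?J $ j $ i = ?J $ j $ i" by simp
  then show ?thesis by (simp add: transpose_def)
qed

text \<open>Cramer's rule.  It makes smoothness of the inverse a matter of determinants.\<close>

lemma matrix_inv_entry:
  fixes M :: "real ^ 'n ^ 'n"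
  assumes "det M \<noteq> 0"
  shows "matrix_inv M $ a $ k = det (\<chi> i j. if j = a then axis k 1 $ i else M $ i $ j) / det M"
proof -
  have "M *v (matrix_inv M *v axis k 1) = axis k 1"
    using matrix_inv_mult[OF assms] by (simp add: matrix_vector_mul_assoc)
  then have "matrix_inv M *v axis k 1 = (\<chi> a. det (\<chi> i j. if j = a then axis k 1 $ i else M $ i $ j) / det M)"
    using cramer[OF assms] by blast
  then show ?thesis by (simp add: matrix_vector_mult_basis column_def vec_eq_iff)
qed

lemma smooth_on_matrix_inv_entry [smooth_intros]:
  fixes G :: "'a::real_normed_vector \<Rightarrow> real ^ 'n ^ 'n"
  assumes S: "open S" and G: "smooth_on S G" and nz: "\<And>x. x \<in> S \<Longrightarrow> det (G x) \<noteq> 0"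
  shows "smooth_on S (\<lambda>x. matrix_inv (G x) $ a $ k)"
proof (rule smooth_on_cong[OF S])
  have *: "smooth_on S (\<lambda>x. if j = a then axis k 1 $ i else G x $ i $ j)" for i j
    by (cases "j = a") (use S G in \<open>auto intro: smooth_intros\<close>)
  show "smooth_on S (\<lambda>x. det (\<chi> i j. if j = a then axis k 1 $ i else G x $ i $ j) / det (G x))"
    unfolding det_def[of "\<chi> i j. _ i j"] vec_lambda_beta
    by (intro smooth_intros S G nz *)
qed (simp add: matrix_inv_entry nz)

section \<open>The divergence formula in coordinates\<close>

lemma frechet_derivative_mult_real:
  fixes f h :: "'a::real_normed_vector \<Rightarrow> real"
  assumes "f differentiable (at x)" "h differentiable (at x)"
  shows "frechet_derivative (\<lambda>x. f x * h x) (at x) v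
    = f x * frechet_derivative h (at x) v + frechet_derivative f (at x) v * h x"
  by (subst frechet_derivative_at[symmetric, OF has_derivative_mult])
    (use assms in \<open>auto simp: frechet_derivative_works[symmetric]\<close>)

lemma frechet_derivative_sum_fun:
  assumes "\<And>i. i \<in> I \<Longrightarrow> f i differentiable (at x)"
  shows "frechet_derivative (\<lambda>x. \<Sum>i\<in>I. f i x) (at x) v = (\<Sum>i\<in>I. frechet_derivative (f i) (at x) v)"
  by (subst frechet_derivative_at[symmetric, OF has_derivative_sum])
    (use assms in \<open>auto simp: frechet_derivative_works[symmetric]\<close>)

lemma frechet_derivative_cmult_real:
  fixes f :: "'a::real_normed_vector \<Rightarrow> real"
  assumes "f differentiable (at x)"
  shows "frechet_derivative (\<lambda>x. c * f x) (at x) v = c * frechet_derivative f (at x) v"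
  using frechet_derivative_mult_real[of "\<lambda>_. c" x f v] assms by (simp add: frechet_derivative_const)

lemma permutation_moves_other:
  assumes "p permutes UNIV" "p \<noteq> id"
  shows "\<exists>j. j \<noteq> i \<and> p j \<noteq> j"
proof (rule ccontr)
  assume "\<not> ?thesis"
  then have other: "p j = j" if "j \<noteq> i" for j using that by blast
  have "p i = i"
  proof (rule ccontr)
    assume "p i \<noteq> i"
    then have "p (p i) = p i" by (rule other)
    then show False using \<open>p i \<noteq> i\<close> permutes_inj[OF assms(1)] by (auto dest: injD)
  qed
  then have "p = id" using other by (metis eq_id_iff)
  then show False using assms(2) by simp
qed

text \<open>A permutation other than the identity moves at least two indices, so its term contains two
  off-diagonal factors and its derivative at the identity vanishes.\<close>

lemma has_derivative_det_at_identity: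
  fixes M :: "'a::real_normed_vector \<Rightarrow> real ^ 'n ^ 'n"
  assumes M: "\<And>i j. ((\<lambda>x. M x $ i $ j) has_derivative M' i j) (at x)" and x: "M x = mat 1"
  shows "((\<lambda>x. det (M x)) has_derivative (\<lambda>v. \<Sum>i\<in>UNIV. M' i i v)) (at x)"
proof -
  let ?P = "{p. p permutes (UNIV :: 'n set)}"
  have "((\<lambda>x. det (M x)) has_derivative
      (\<lambda>v. \<Sum>p\<in>?P. of_int (sign p) * (\<Sum>i\<in>UNIV. M' i (p i) v * (\<Prod>j\<in>UNIV - {i}. M x $ j $ p j)))) (at x)"
    unfolding det_def by (intro has_derivative_sum has_derivative_mult_right has_derivative_prod M)
  also have "(\<lambda>v. \<Sum>p\<in>?P. of_int (sign p) * (\<Sum>i\<in>UNIV. M' i (p i) v * (\<Prod>j\<in>UNIV - {i}. M x $ j $ p j)))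
      = (\<lambda>v. \<Sum>i\<in>UNIV. M' i i v)"
  proof
    fix v
    have "(\<Prod>j\<in>UNIV - {i}. M x $ j $ p j) = 0" if p: "p permutes UNIV" "p \<noteq> id" for p i
    proof -
      obtain j where "j \<noteq> i" "p j \<noteq> j" using permutation_moves_other[OF p] by blast
      then show ?thesis using x by (intro prod_zero) (auto simp: mat_def intro!: bexI[of _ j])
    qed
    then have "of_int (sign p) * (\<Sum>i\<in>UNIV. M' i (p i) v * (\<Prod>j\<in>UNIV - {i}. M x $ j $ p j)) = 0"
      if "p \<in> ?P - {id}" for p using that by (simp del: prod_zero_iff)
    then have "(\<Sum>p\<in>?P. of_int (sign p) * (\<Sum>i\<in>UNIV. M' i (p i) v * (\<Prod>j\<in>UNIV - {i}. M x $ j $ p j)))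
      = (\<Sum>p\<in>{id}. of_int (sign p) * (\<Sum>i\<in>UNIV. M' i (p i) v * (\<Prod>j\<in>UNIV - {i}. M x $ j $ p j)))"
      by (intro sum.mono_neutral_right ballI) (auto simp: permutes_id finite_permutations simp del: prod_zero_iff)
    also have "\<dots> = (\<Sum>i\<in>UNIV. M' i i v)" using x by (simp add: mat_def sign_id)
    finally show "(\<Sum>p\<in>?P. of_int (sign p) * (\<Sum>i\<in>UNIV. M' i (p i) v * (\<Prod>j\<in>UNIV - {i}. M x $ j $ p j)))
      = (\<Sum>i\<in>UNIV. M' i i v)" .
  qed
  finally show ?thesis .
qed

text \<open>Jacobi's formula, reduced to the identity matrix by multiplying with the constant matrix
  \<open>matrix_inv (G x)\<close>.\<close>

lemma has_derivative_det:
  fixes G :: "'a::real_normed_vector \<Rightarrow> real ^ 'n ^ 'n"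
  assumes G: "\<And>i j. (\<lambda>x. G x $ i $ j) differentiable (at x)" and nz: "det (G x) \<noteq> 0"
  shows "((\<lambda>x. det (G x)) has_derivative (\<lambda>v. det (G x) *
      (\<Sum>i\<in>UNIV. \<Sum>k\<in>UNIV. matrix_inv (G x) $ i $ k * frechet_derivative (\<lambda>x. G x $ k $ i) (at x) v))) (at x)"
proof -
  let ?J = "matrix_inv (G x)"
  have "((\<lambda>y. det (?J ** G y)) has_derivative
      (\<lambda>v. \<Sum>i\<in>UNIV. \<Sum>k\<in>UNIV. ?J $ i $ k * frechet_derivative (\<lambda>x. G x $ k $ i) (at x) v)) (at x)"
  proof (rule has_derivative_det_at_identity[where
        M' = "\<lambda>i j v. \<Sum>k\<in>UNIV. ?J $ i $ k * frechet_derivative (\<lambda>x. G x $ k $ j) (at x) v"])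
    show "((\<lambda>y. (?J ** G y) $ i $ j) has_derivative
      (\<lambda>v. \<Sum>k\<in>UNIV. ?J $ i $ k * frechet_derivative (\<lambda>x. G x $ k $ j) (at x) v)) (at x)" for i j
      unfolding matrix_matrix_mult_def vec_lambda_beta
      by (intro has_derivative_sum has_derivative_mult_right) (simp add: frechet_derivative_works[symmetric] G)
  qed (rule matrix_inv_mult[OF nz])
  then have "((\<lambda>y. det (G x) * det (?J ** G y)) has_derivative (\<lambda>v. det (G x) *
      (\<Sum>i\<in>UNIV. \<Sum>k\<in>UNIV. ?J $ i $ k * frechet_derivative (\<lambda>x. G x $ k $ i) (at x) v))) (at x)"
    by (rule has_derivative_mult_right)
  moreover have "det (G x) * det (?J ** G y) = det (G y)" for y
    using arg_cong[OF matrix_inv_mult(1)[OF nz], of det] by (simp add: det_mul)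
  ultimately show ?thesis by simp
qed

text \<open>Differentiate \<open>G G\<^sup>-\<^sup>1 = 1\<close> and multiply by
  \<open>G\<^sup>-\<^sup>1\<close> from the left.\<close>

lemma frechet_derivative_matrix_inv_entry:
  fixes G :: "'a::real_normed_vector \<Rightarrow> real ^ 'n ^ 'n"
  assumes S: "open S" "x \<in> S" and G: "smooth_on S G" and nz: "\<And>x. x \<in> S \<Longrightarrow> det (G x) \<noteq> 0"
  shows "frechet_derivative (\<lambda>x. matrix_inv (G x) $ k $ l) (at x) v
    = - (\<Sum>a\<in>UNIV. \<Sum>b\<in>UNIV. matrix_inv (G x) $ k $ a * frechet_derivative (\<lambda>x. G x $ a $ b) (at x) v
        * matrix_inv (G x) $ b $ l)"
proof -
  let ?J = "\<lambda>x. matrix_inv (G x)"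
  let ?dJ = "\<lambda>k l. frechet_derivative (\<lambda>x. ?J x $ k $ l) (at x) v"
  let ?dG = "\<lambda>a b. frechet_derivative (\<lambda>x. G x $ a $ b) (at x) v"
  have dG: "(\<lambda>x. G x $ a $ b) differentiable (at x)" for a b
    using smooth_on_imp_differentiable[OF _ S(2)] by (metis S(1) G smooth_on_nth)
  have dJ: "(\<lambda>x. ?J x $ a $ b) differentiable (at x)" for a b
    using smooth_on_imp_differentiable[OF smooth_on_matrix_inv_entry[OF S(1) G nz] S(2)] .
  have 0: "(\<Sum>b\<in>UNIV. G x $ a $ b * ?dJ b l + ?dG a b * ?J x $ b $ l) = 0" for a
  proof -
    have "(\<Sum>b\<in>UNIV. G y $ a $ b * ?J y $ b $ l) = mat 1 $ a $ l" if "y \<in> S" for y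
      using matrix_inv_mult(1)[OF nz[OF that]] by (simp add: matrix_matrix_mult_def vec_eq_iff)
    then have "frechet_derivative (\<lambda>y. \<Sum>b\<in>UNIV. G y $ a $ b * ?J y $ b $ l) (at x)
      = frechet_derivative (\<lambda>y. mat 1 $ a $ l :: real) (at x)"
      by (intro frechet_derivative_cong_open[OF S]) auto
    then have "frechet_derivative (\<lambda>y. \<Sum>b\<in>UNIV. G y $ a $ b * ?J y $ b $ l) (at x) v = 0"
      by (simp add: frechet_derivative_const)
    then show ?thesis by (simp add: frechet_derivative_sum_fun frechet_derivative_mult_real dG dJ differentiable_mult)
  qed
  have "0 = (\<Sum>a\<in>UNIV. ?J x $ k $ a * (\<Sum>b\<in>UNIV. G x $ a $ b * ?dJ b l + ?dG a b * ?J x $ b $ l))"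
    using 0 by simp
  also have "\<dots> = (\<Sum>a\<in>UNIV. \<Sum>b\<in>UNIV. ?J x $ k $ a * G x $ a $ b * ?dJ b l)
      + (\<Sum>a\<in>UNIV. \<Sum>b\<in>UNIV. ?J x $ k $ a * ?dG a b * ?J x $ b $ l)"
    by (simp add: sum_distrib_left sum.distrib distrib_left mult.assoc)
  also have "(\<Sum>a\<in>UNIV. \<Sum>b\<in>UNIV. ?J x $ k $ a * G x $ a $ b * ?dJ b l)
      = (\<Sum>b\<in>UNIV. (\<Sum>a\<in>UNIV. ?J x $ k $ a * G x $ a $ b) * ?dJ b l)"
    by (subst sum.swap) (simp add: sum_distrib_right)
  also have "\<dots> = (\<Sum>b\<in>UNIV. mat 1 $ k $ b * ?dJ b l)"
    using matrix_inv_mult(2)[OF nz[OF S(2)]] by (simp add: matrix_matrix_mult_def vec_eq_iff)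
  also have "\<dots> = ?dJ k l" by (simp add: mat_def if_distrib[of "\<lambda>z. z * _"] cong: if_cong)
  finally show ?thesis by simp
qed

text \<open>The contraction \<open>g\<^sup>i\<^sup>j \<Gamma>\<^sup>m\<^sub>i\<^sub>j\<close> with
  \<open>J\<close> for the inverse metric and \<open>D i j l\<close> for \<open>\<partial>\<^sub>i
  g\<^sub>j\<^sub>l\<close>: symmetry of \<open>J\<close> merges the first two of the three terms.\<close>

lemma christoffel_contraction:
  fixes J :: "'n::finite \<Rightarrow> 'n \<Rightarrow> real" and D :: "'n \<Rightarrow> 'n \<Rightarrow> 'n \<Rightarrow> real"
  assumes sym: "\<And>i j. J i j = J j i"
  shows "(\<Sum>i\<in>UNIV. \<Sum>j\<in>UNIV. J i j * ((\<Sum>l\<in>UNIV. J m l * (D j i l + D i j l - D l j i)) / 2))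
    = (\<Sum>i\<in>UNIV. \<Sum>a\<in>UNIV. \<Sum>b\<in>UNIV. J i a * D i a b * J b m)
      - (\<Sum>i\<in>UNIV. (\<Sum>a\<in>UNIV. \<Sum>b\<in>UNIV. J a b * D i b a) * J i m) / 2"
proof -
  define T where "T E = (\<Sum>i\<in>UNIV. \<Sum>j\<in>UNIV. \<Sum>l\<in>UNIV. J i j * J m l * E i j l)" for E :: "'n \<Rightarrow> 'n \<Rightarrow> 'n \<Rightarrow> real"
  have "(\<Sum>i\<in>UNIV. \<Sum>j\<in>UNIV. J i j * ((\<Sum>l\<in>UNIV. J m l * (D j i l + D i j l - D l j i)) / 2))
    = (T (\<lambda>i j l. D j i l) + T (\<lambda>i j l. D i j l) - T (\<lambda>i j l. D l j i)) / 2"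
    unfolding T_def
    by (simp add: sum_distrib_left sum.distrib sum_subtractf sum_divide_distrib add_divide_distrib
        diff_divide_distrib algebra_simps)
  moreover have "T (\<lambda>i j l. D j i l) = T (\<lambda>i j l. D i j l)"
    unfolding T_def by (subst sum.swap) (simp add: sym)
  moreover have "T (\<lambda>i j l. D i j l) = (\<Sum>i\<in>UNIV. \<Sum>a\<in>UNIV. \<Sum>b\<in>UNIV. J i a * D i a b * J b m)"
    unfolding T_def by (simp add: sym[of m] mult.assoc mult.commute[of "D _ _ _"])
  moreover have "T (\<lambda>i j l. D l j i) = (\<Sum>i\<in>UNIV. (\<Sum>a\<in>UNIV. \<Sum>b\<in>UNIV. J a b * D i b a) * J i m)"
  proof -
    have "T (\<lambda>i j l. D l j i) = (\<Sum>i\<in>UNIV. \<Sum>l\<in>UNIV. \<Sum>j\<in>UNIV. J i j * J m l * D l j i)"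
      unfolding T_def by (intro sum.cong refl sum.swap)
    also have "\<dots> = (\<Sum>l\<in>UNIV. \<Sum>i\<in>UNIV. \<Sum>j\<in>UNIV. J i j * J m l * D l j i)" by (rule sum.swap)
    also have "\<dots> = (\<Sum>i\<in>UNIV. (\<Sum>a\<in>UNIV. \<Sum>b\<in>UNIV. J a b * D i b a) * J i m)"
      by (simp add: sum_distrib_left sym[of m] mult_ac)
    finally show ?thesis .
  qed
  ultimately show ?thesis by simp
qed

text \<open>The product rule produces the derivative of \<open>w\<close>, that of the inverse metric, and that
  of \<open>sqrt (det G)\<close>, the last two given by \<open>frechet_derivative_matrix_inv_entry\<close> and
  Jacobi's formula.  Their sum is the contracted Christoffel symbol.\<close>

lemma divergence_formula:
  fixes G :: "real ^ 'n \<Rightarrow> real ^ 'n::finite ^ 'n" and w :: "real ^ 'n \<Rightarrow> real ^ 'n"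
  assumes S: "open S" "x \<in> S" and G: "smooth_on S G" and pos: "\<And>x. x \<in> S \<Longrightarrow> posdef (G x)"
    and w: "smooth_on S w"
  defines "J k l \<equiv> matrix_inv (G x) $ k $ l" and "D i j l \<equiv> partial i (\<lambda>x. G x $ j $ l) x"
  shows "(\<Sum>i\<in>UNIV. partial i (\<lambda>x. sqrt (det (G x)) * (\<Sum>j\<in>UNIV. matrix_inv (G x) $ i $ j * w x $ j)) x)
    = sqrt (det (G x)) * (\<Sum>i\<in>UNIV. \<Sum>j\<in>UNIV. J i j * (partial j (\<lambda>x. w x $ i) x
        - (\<Sum>k\<in>UNIV. (\<Sum>l\<in>UNIV. J k l * (D j i l + D i j l - D l j i)) / 2 * w x $ k)))"
proof -
  note nz = posdef_det_nz[OF pos] and dp = posdef_det_pos[OF pos]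
  define s where "s = sqrt (det (G x))"
  have s: "s > 0" "s * s = det (G x)" using dp[OF S(2)] by (auto simp: s_def)
  have sym: "J k l = J l k" for k l unfolding J_def by (rule posdef_inv_symmetric[OF pos[OF S(2)]])
  have dG: "(\<lambda>x. G x $ a $ b) differentiable (at x)" for a b
    using smooth_on_imp_differentiable[OF _ S(2)] by (metis S(1) G smooth_on_nth)
  have dJ: "(\<lambda>x. matrix_inv (G x) $ a $ b) differentiable (at x)" for a b
    using smooth_on_imp_differentiable[OF smooth_on_matrix_inv_entry[OF S(1) G nz] S(2)] .
  have dw: "(\<lambda>x. w x $ a) differentiable (at x)" for a
    using smooth_on_imp_differentiable[OF smooth_on_nth[OF S(1) w] S(2)] .
  have sq: "((\<lambda>x. sqrt (det (G x))) has_derivative (\<lambda>v. s / 2 *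
      (\<Sum>a\<in>UNIV. \<Sum>b\<in>UNIV. J a b * frechet_derivative (\<lambda>x. G x $ b $ a) (at x) v))) (at x)"
  proof -
    have "(sqrt has_derivative (\<lambda>v. inverse s / 2 * v)) (at (det (G x)))"
      using DERIV_real_sqrt[OF dp[OF S(2)]] unfolding has_field_derivative_def s_def .
    from has_derivative_compose[OF has_derivative_det[OF dG nz[OF S(2)]] this]
    have "((\<lambda>x. sqrt (det (G x))) has_derivative (\<lambda>v. inverse s / 2 * (s * s *
      (\<Sum>a\<in>UNIV. \<Sum>b\<in>UNIV. J a b * frechet_derivative (\<lambda>x. G x $ b $ a) (at x) v)))) (at x)"
      by (simp add: J_def s(2))
    moreover have "inverse s / 2 * (s * s * z) = s / 2 * z" for z using s(1) by (simp add: field_simps)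
    ultimately show ?thesis by (simp only:)
  qed
  have ds: "(\<lambda>x. sqrt (det (G x))) differentiable (at x)" using sq by (auto simp: differentiable_def)
  have pds: "partial i (\<lambda>x. sqrt (det (G x))) x = s / 2 * (\<Sum>a\<in>UNIV. \<Sum>b\<in>UNIV. J a b * D i b a)" for i
    by (subst frechet_derivative_at[OF sq, symmetric]) (simp add: D_def)
  have pdJ: "partial i (\<lambda>x. matrix_inv (G x) $ k $ l) x = - (\<Sum>a\<in>UNIV. \<Sum>b\<in>UNIV. J k a * D i a b * J b l)" for i k l
    using frechet_derivative_matrix_inv_entry[OF S G nz] by (simp add: J_def D_def)
  define B where "B i m = (\<Sum>a\<in>UNIV. \<Sum>b\<in>UNIV. J i a * D i a b * J b m)" for i m
  define C where "C i = (\<Sum>a\<in>UNIV. \<Sum>b\<in>UNIV. J a b * D i b a)" for i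
  have "partial i (\<lambda>x. sqrt (det (G x)) * (\<Sum>j\<in>UNIV. matrix_inv (G x) $ i $ j * w x $ j)) x
    = s * ((\<Sum>j\<in>UNIV. J i j * partial i (\<lambda>x. w x $ j) x)
      - (\<Sum>m\<in>UNIV. (B i m - C i * J i m / 2) * w x $ m))" for i
    using ds dJ dw
    by (simp add: frechet_derivative_mult_real frechet_derivative_sum_fun differentiable_mult differentiable_sum pds pdJ B_def[symmetric] C_def[symmetric])
       (simp add: J_def[symmetric] s_def[symmetric] sum.distrib sum_subtractf sum_distrib_left sum_distrib_right algebra_simps)
  then have "(\<Sum>i\<in>UNIV. partial i (\<lambda>x. sqrt (det (G x)) * (\<Sum>j\<in>UNIV. matrix_inv (G x) $ i $ j * w x $ j)) x)
    = s * ((\<Sum>i\<in>UNIV. \<Sum>j\<in>UNIV. J i j * partial i (\<lambda>x. w x $ j) x)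
      - (\<Sum>i\<in>UNIV. \<Sum>m\<in>UNIV. (B i m - C i * J i m / 2) * w x $ m))"
    by (simp add: sum_subtractf sum_distrib_left right_diff_distrib)
  also have "(\<Sum>i\<in>UNIV. \<Sum>m\<in>UNIV. (B i m - C i * J i m / 2) * w x $ m)
    = (\<Sum>m\<in>UNIV. ((\<Sum>i\<in>UNIV. B i m) - (\<Sum>i\<in>UNIV. C i * J i m) / 2) * w x $ m)"
    by (subst sum.swap) (simp add: sum_distrib_right[symmetric] sum_subtractf sum_divide_distrib)
  also have "\<dots> = (\<Sum>m\<in>UNIV. (\<Sum>i\<in>UNIV. \<Sum>j\<in>UNIV. J i j * ((\<Sum>l\<in>UNIV. J m l * (D j i l + D i j l - D l j i)) / 2)) * w x $ m)"
    unfolding B_def C_def using christoffel_contraction[of J, OF sym, where D = D] by simp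
  also have "\<dots> = (\<Sum>i\<in>UNIV. \<Sum>j\<in>UNIV. \<Sum>m\<in>UNIV. J i j * ((\<Sum>l\<in>UNIV. J m l * (D j i l + D i j l - D l j i)) / 2 * w x $ m))"
  proof -
    have "(\<Sum>m\<in>UNIV. (\<Sum>i\<in>UNIV. \<Sum>j\<in>UNIV. J i j * E m i j) * W m) = (\<Sum>i\<in>UNIV. \<Sum>j\<in>UNIV. \<Sum>m\<in>UNIV. J i j * (E m i j * W m))"
      for E :: "'n \<Rightarrow> 'n \<Rightarrow> 'n \<Rightarrow> real" and W
    proof -
      have "(\<Sum>m\<in>UNIV. (\<Sum>i\<in>UNIV. \<Sum>j\<in>UNIV. J i j * E m i j) * W m) = (\<Sum>m\<in>UNIV. \<Sum>i\<in>UNIV. \<Sum>j\<in>UNIV. J i j * (E m i j * W m))"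
        by (simp add: sum_distrib_right mult.assoc)
      also have "\<dots> = (\<Sum>i\<in>UNIV. \<Sum>m\<in>UNIV. \<Sum>j\<in>UNIV. J i j * (E m i j * W m))" by (rule sum.swap)
      also have "\<dots> = (\<Sum>i\<in>UNIV. \<Sum>j\<in>UNIV. \<Sum>m\<in>UNIV. J i j * (E m i j * W m))"
        by (intro sum.cong refl sum.swap)
      finally show ?thesis .
    qed
    then show ?thesis .
  qed
  also have "(\<Sum>i\<in>UNIV. \<Sum>j\<in>UNIV. J i j * partial i (\<lambda>x. w x $ j) x) = (\<Sum>i\<in>UNIV. \<Sum>j\<in>UNIV. J i j * partial j (\<lambda>x. w x $ i) x)"
    by (subst sum.swap) (simp add: sym)
  finally show ?thesis
    by (simp add: s_def[symmetric] sum_subtractf sum_distrib_left right_diff_distrib)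
qed

section \<open>Gluing measures\<close>

text \<open>The largest measure that agrees with \<open>M\<close> inside \<open>D\<close>: an upper bound for
  every measure that does not exceed \<open>M\<close> on the subsets of \<open>D\<close>.\<close>

lemma infinite_outside_measure:
  assumes s: "sets M = sets borel" and D: "D \<in> sets borel"
  obtains N where "sets N = sets borel" "\<And>B. B \<in> sets borel \<Longrightarrow> emeasure N B = (if B \<subseteq> D then emeasure M B else \<infinity>)"
proof -
  define \<mu> where "\<mu> B = (if B \<subseteq> D then emeasure M B else \<infinity>)" for B
  define N where "N = measure_of UNIV (sets borel) \<mu>"
  have sN: "sets N = sets borel" unfolding N_def by (metis sets.sigma_sets_eq sets_measure_of space_borel subset_UNIV Pow_UNIV)
  have "emeasure N B = \<mu> B" if "B \<in> sets borel" for B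
  proof (rule emeasure_measure_of[OF N_def])
    show "positive (sets N) \<mu>" by (simp add: positive_def \<mu>_def)
    show "countably_additive (sets N) \<mu>"
    proof (rule countably_additiveI)
      fix E :: "nat \<Rightarrow> _" assume E: "range E \<subseteq> sets N" "disjoint_family E" "(\<Union>i. E i) \<in> sets N"
      show "(\<Sum>i. \<mu> (E i)) = \<mu> (\<Union>i. E i)"
      proof (cases "\<forall>i. E i \<subseteq> D")
        case True
        then have "(\<Union>i. E i) \<subseteq> D" by blast
        moreover have "(\<Sum>i. emeasure M (E i)) = emeasure M (\<Union>i. E i)"
          using E s sN by (intro suminf_emeasure) auto
        ultimately show ?thesis using True by (simp add: \<mu>_def)
      next
        case False
        then obtain n where n: "\<not> E n \<subseteq> D" by blast
        have "\<mu> (E n) \<le> (\<Sum>i. \<mu> (E i))" using sum_le_suminf[of "\<lambda>i. \<mu> (E i)" "{n}"] by auto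
        then have "(\<Sum>i. \<mu> (E i)) = \<infinity>" using n by (simp add: \<mu>_def top_unique)
        moreover have "\<not> (\<Union>i. E i) \<subseteq> D" using n by blast
        ultimately show ?thesis by (simp add: \<mu>_def)
      qed
    qed
  qed (use that sN in auto)
  then show ?thesis using that[OF sN] by (simp add: \<mu>_def)
qed

text \<open>An upper bound for the supremum is the measure that equals \<open>M i\<close> inside \<open>D
  i\<close> and is infinite elsewhere.  It dominates the whole family: inside \<open>D i\<close> each \<open>M
  j\<close> is concentrated on \<open>D j\<close>, where it agrees with \<open>M i\<close>.\<close>

lemma emeasure_SUP_glued:
  fixes M :: "'i \<Rightarrow> 'a::topological_space measure"
  assumes s: "\<And>i. i \<in> I \<Longrightarrow> sets (M i) = sets borel"
    and D: "\<And>i. i \<in> I \<Longrightarrow> D i \<in> sets borel"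
    and conc: "\<And>i B. i \<in> I \<Longrightarrow> B \<in> sets borel \<Longrightarrow> emeasure (M i) B = emeasure (M i) (B \<inter> D i)"
    and agree: "\<And>i j B. i \<in> I \<Longrightarrow> j \<in> I \<Longrightarrow> B \<in> sets borel \<Longrightarrow> B \<subseteq> D i \<Longrightarrow> B \<subseteq> D j \<Longrightarrow>
      emeasure (M i) B = emeasure (M j) B"
    and i: "i \<in> I" and B: "B \<in> sets borel" "B \<subseteq> D i"
  shows "emeasure (SUP i\<in>I. M i) B = emeasure (M i) B"
proof (rule antisym)
  have sS: "sets (SUP i\<in>I. M i) = sets borel" using s i by (intro sets_SUP) auto
  have "M i \<le> (SUP i\<in>I. M i)" using i by (rule SUP_upper)
  then show "emeasure (M i) B \<le> emeasure (SUP i\<in>I. M i) B"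
    by (rule le_measureD3) (use s[OF i] sS B in auto)
  obtain N where N: "sets N = sets borel"
    "\<And>B. B \<in> sets borel \<Longrightarrow> emeasure N B = (if B \<subseteq> D i then emeasure (M i) B else \<infinity>)"
    using infinite_outside_measure[OF s[OF i] D[OF i]] by blast
  have "(SUP i\<in>I. M i) \<le> N"
  proof (rule SUP_least)
    fix j assume j: "j \<in> I"
    show "M j \<le> N"
      unfolding le_measure[OF trans[OF s[OF j] N(1)[symmetric]]]
    proof
      fix B assume "B \<in> sets (M j)"
      then have B: "B \<in> sets borel" using s[OF j] by simp
      show "emeasure (M j) B \<le> emeasure N B"
      proof (cases "B \<subseteq> D i")
        case True
        have "emeasure (M j) B = emeasure (M j) (B \<inter> D j)" by (rule conc[OF j B])
        also have "\<dots> = emeasure (M i) (B \<inter> D j)"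
          using B D[OF j] True by (intro agree j i) auto
        also have "\<dots> \<le> emeasure (M i) B" using B s[OF i] by (intro emeasure_mono) auto
        finally show ?thesis using N(2)[OF B] True by simp
      qed (use N(2)[OF B] in simp)
    qed
  qed
  then have "emeasure (SUP i\<in>I. M i) B \<le> emeasure N B"
    by (rule le_measureD3) (use sS N B in auto)
  then show "emeasure (SUP i\<in>I. M i) B \<le> emeasure (M i) B" using N(2)[OF B(1)] B(2) by simp
qed

lemma integral_eq_if_measures_agree:
  fixes f :: "'a::topological_space \<Rightarrow> real"
  assumes s: "sets M = sets borel" "sets N = sets borel" and D: "D \<in> sets borel"
    and agree: "\<And>B. B \<in> sets borel \<Longrightarrow> B \<subseteq> D \<Longrightarrow> emeasure M B = emeasure N B"
    and f: "\<And>p. p \<notin> D \<Longrightarrow> f p = 0"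
  shows "integral\<^sup>L M f = integral\<^sup>L N f" "integrable M f \<longleftrightarrow> integrable N f"
proof -
  have sp: "space M = UNIV" "space N = UNIV" using s[THEN sets_eq_imp_space_eq] by auto
  have eq: "restrict_space M D = restrict_space N D"
  proof (rule measure_eqI)
    show "sets (restrict_space M D) = sets (restrict_space N D)"
      using s by (intro sets_restrict_space_cong) simp
    fix B assume "B \<in> sets (restrict_space M D)"
    then have "B \<in> sets borel" "B \<subseteq> D" using s D by (auto simp: sets_restrict_space)
    then show "emeasure (restrict_space M D) B = emeasure (restrict_space N D) B"
      using s D sp agree by (subst (1 2) emeasure_restrict_space) auto
  qed
  have f': "f = (\<lambda>p. indicator D p *\<^sub>R f p)" using f by (auto simp: indicator_def fun_eq_iff)
  have DM: "D \<inter> space M \<in> sets M" "D \<inter> space N \<in> sets N" using D s sp by auto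
  show "integral\<^sup>L M f = integral\<^sup>L N f"
    by (subst (1 2) f') (use integral_restrict_space[OF DM(1), of f] integral_restrict_space[OF DM(2), of f] eq in simp)
  show "integrable M f \<longleftrightarrow> integrable N f"
    by (subst (1 2) f') (use integrable_restrict_space[OF DM(1), of f] integrable_restrict_space[OF DM(2), of f] eq
      in \<open>simp add: set_integrable_def\<close>)
qed

lemma borel_measurable_density_indicator:
  fixes \<rho> :: "'a::topological_space \<Rightarrow> real"
  assumes "open D" "continuous_on D \<rho>" "E \<in> sets borel" "E \<subseteq> D"
  shows "(\<lambda>x. ennreal (\<rho> x) * indicator E x) \<in> borel_measurable borel"
proof -
  have "(\<lambda>x. indicator D x *\<^sub>R \<rho> x) \<in> borel_measurable borel"
    using assms by (intro borel_measurable_continuous_on_indicator) auto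
  then have "(\<lambda>x. ennreal (indicator D x *\<^sub>R \<rho> x) * indicator E x) \<in> borel_measurable borel"
    using assms(3) by measurable
  also have "(\<lambda>x. ennreal (indicator D x *\<^sub>R \<rho> x) * indicator E x) = (\<lambda>x. ennreal (\<rho> x) * indicator E x)"
    using assms(4) by (auto simp: indicator_def fun_eq_iff)
  finally show ?thesis .
qed

text \<open>Integrals over the hyperplane are integrals over the slab of height \<open>1\<close> of functions
  that are constant across it.  So statements about Lebesgue measure apply to the hyperplane measure.\<close>

lemma nn_integral_hyperplane_thicken:
  fixes h :: "real ^ 'n::finite \<Rightarrow> ennreal"
  assumes [measurable]: "h \<in> borel_measurable borel"
  shows "(\<integral>\<^sup>+z. h z \<partial>hyperplane_measure k)
    = (\<integral>\<^sup>+x. h (set_coord k x 0) * indicator {x. 0 < x $ k \<and> x $ k < 1} x \<partial>lborel)"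
proof -
  have [measurable]: "(\<lambda>x. set_coord k x 0) \<in> borel_measurable borel" unfolding set_coord_def by measurable
  have "{x :: real ^ 'n. 0 < x $ k \<and> x $ k < 1} \<in> sets borel" by measurable
  then have "(\<integral>\<^sup>+x. h (set_coord k x 0) * indicator {x. 0 < x $ k \<and> x $ k < 1} x \<partial>lborel)
    = (\<integral>\<^sup>+z. (\<integral>\<^sup>+s. h (set_coord k z 0) * indicator {0<..<1::real} s \<partial>lborel) \<partial>hyperplane_measure k)"
    by (subst nn_integral_lborel_hyperplane[of _ k])
      (auto intro!: nn_integral_cong simp: indicator_def)
  also have "\<dots> = (\<integral>\<^sup>+z. h (set_coord k z 0) \<partial>hyperplane_measure k)"
    by (simp add: nn_integral_cmult)
  also have "\<dots> = (\<integral>\<^sup>+z. h z \<partial>hyperplane_measure k)"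
  proof (rule nn_integral_cong_AE)
    show "AE z in hyperplane_measure k. h (set_coord k z 0) = h z"
      using AE_hyperplane_measure[of k]
    proof eventually_elim
      case (elim z)
      then show ?case using set_coord_self[of k z] by simp
    qed
  qed
  finally show ?thesis by simp
qed

text \<open>A matrix that represents the pullback of the bilinear form \<open>Q\<close> by \<open>f\<close> is
  \<open>F\<^sup>T Q F\<close>.\<close>

lemma det_congruence:
  fixes P Q :: "real ^ 'n ^ 'n"
  assumes f: "linear f" and eq: "\<And>x y. x \<bullet> (P *v y) = f x \<bullet> (Q *v f y)"
  shows "det P = (det (matrix f))\<^sup>2 * det Q"
proof -
  let ?F = "matrix f"
  have "P *v y = (transpose ?F ** Q ** ?F) *v y" for y
  proof (rule vector_eq_ldot[THEN iffD1], rule allI)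
    fix x
    have "x \<bullet> ((transpose ?F ** Q ** ?F) *v y) = x \<bullet> (transpose ?F *v (Q *v (?F *v y)))"
      by (simp add: matrix_vector_mul_assoc matrix_mul_assoc)
    also have "\<dots> = (?F *v x) \<bullet> (Q *v (?F *v y))"
      by (metis dot_lmul_matrix inner_commute vector_transpose_matrix)
    also have "\<dots> = x \<bullet> (P *v y)" using eq by (simp add: fun_cong[OF matrix_vector_mul(2)[OF f]])
    finally show "x \<bullet> (P *v y) = x \<bullet> ((transpose ?F ** Q ** ?F) *v y)" by simp
  qed
  then have "P = transpose ?F ** Q ** ?F" by (simp add: matrix_eq)
  then show ?thesis by (simp add: det_mul power2_eq_square)
qed

section \<open>The Riemannian measure in a chart\<close>

context smooth_manifold
begin

lemma coords_inv_measurable: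
  assumes "c \<in> A" "sets \<L> = sets borel"
  shows "coords_inv c \<in> measurable (restrict_space \<L> (coords c ` chart_dom c)) borel"
  using borel_measurable_continuous_on_restrict[OF continuous_on_coords_inv[OF assms(1)]]
  by (simp add: measurable_cong_sets[OF sets_restrict_space_cong[OF assms(2)] refl])

lemma borel_coords_image:
  assumes "c \<in> A" "B \<in> sets borel"
  shows "coords c ` (B \<inter> chart_dom c) \<in> sets borel"
proof -
  have "coords_inv c -` B \<inter> coords c ` chart_dom c \<in> sets (restrict_space borel (coords c ` chart_dom c))"
    using measurable_sets[OF coords_inv_measurable[OF assms(1) refl] assms(2)] by (simp add: space_restrict_space)
  then show ?thesis
    using open_chart_range[OF assms(1)] by (auto simp: coords_image_eq[OF assms(1)] sets_restrict_space Int_commute)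
qed

definition chart_measure :: "(real ^ 'n) measure \<Rightarrow> ('a, 'n) chart \<Rightarrow> (real ^ 'n \<Rightarrow> real) \<Rightarrow> 'a measure" where
  "chart_measure \<L> c \<rho> = distr (density (restrict_space \<L> (coords c ` chart_dom c)) (\<lambda>x. ennreal (\<rho> x))) borel (coords_inv c)"

lemma sets_chart_measure [simp]: "sets (chart_measure \<L> c \<rho>) = sets borel"
  by (simp add: chart_measure_def)

lemma density_measurable:
  assumes "c \<in> A" "sets \<L> = sets borel" "continuous_on (coords c ` chart_dom c) \<rho>"
  shows "\<rho> \<in> borel_measurable (restrict_space \<L> (coords c ` chart_dom c))"
  using borel_measurable_continuous_on_restrict[OF assms(3)]
  by (simp add: measurable_cong_sets[OF sets_restrict_space_cong[OF assms(2)] refl])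

lemma emeasure_chart_measure:
  assumes c: "c \<in> A" and s: "sets \<L> = sets borel" and \<rho>: "continuous_on (coords c ` chart_dom c) \<rho>"
    and B: "B \<in> sets borel"
  shows "emeasure (chart_measure \<L> c \<rho>) B = (\<integral>\<^sup>+x. ennreal (\<rho> x) * indicator (coords c ` (B \<inter> chart_dom c)) x \<partial>\<L>)"
proof -
  let ?D = "coords c ` chart_dom c" and ?E = "coords c ` (B \<inter> chart_dom c)"
  have sp: "space \<L> = UNIV" using sets_eq_imp_space_eq[OF s] by simp
  have D: "?D \<inter> space \<L> \<in> sets \<L>" using open_chart_range[OF c] s sp by auto
  have E: "?E \<in> sets borel" by (rule borel_coords_image[OF c B])
  have "emeasure (chart_measure \<L> c \<rho>) B = emeasure (density (restrict_space \<L> ?D) (\<lambda>x. ennreal (\<rho> x))) ?E"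
    unfolding chart_measure_def using coords_inv_measurable[OF c s] B
    by (subst emeasure_distr) (auto simp: coords_image_eq[OF c] space_restrict_space sp Int_commute)
  also have "\<dots> = (\<integral>\<^sup>+x. ennreal (\<rho> x) * indicator ?E x \<partial>restrict_space \<L> ?D)"
    using density_measurable[OF c s \<rho>] E D s by (subst emeasure_density) (auto simp: sets_restrict_space_iff)
  also have "\<dots> = (\<integral>\<^sup>+x. ennreal (\<rho> x) * indicator ?E x \<partial>\<L>)"
    using D by (subst nn_integral_restrict_space) (auto intro!: nn_integral_cong simp: indicator_def)
  finally show ?thesis .
qed

lemma integral_chart_measure:
  fixes f :: "'a \<Rightarrow> real"
  assumes c: "c \<in> A" and s: "sets \<L> = sets borel" and \<rho>: "continuous_on (coords c ` chart_dom c) \<rho>"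
    and pos: "\<And>x. x \<in> coords c ` chart_dom c \<Longrightarrow> \<rho> x \<ge> 0"
    and f: "f \<in> borel_measurable borel"
  shows "integral\<^sup>L (chart_measure \<L> c \<rho>) f
      = (\<integral>x. indicator (coords c ` chart_dom c) x * (\<rho> x * f (coords_inv c x)) \<partial>\<L>)"
    "integrable (chart_measure \<L> c \<rho>) f
      \<longleftrightarrow> integrable \<L> (\<lambda>x. indicator (coords c ` chart_dom c) x * (\<rho> x * f (coords_inv c x)))"
proof -
  let ?D = "coords c ` chart_dom c"
  have sp: "space \<L> = UNIV" using sets_eq_imp_space_eq[OF s] by simp
  have D: "?D \<inter> space \<L> \<in> sets \<L>" using open_chart_range[OF c] s sp by auto
  note m = coords_inv_measurable[OF c s] density_measurable[OF c s \<rho>]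
  have fm: "(\<lambda>x. f (coords_inv c x)) \<in> borel_measurable (restrict_space \<L> ?D)"
    by (rule measurable_compose[OF m(1) f])
  have ae: "AE x in restrict_space \<L> ?D. 0 \<le> \<rho> x"
    using pos by (intro AE_I2) (auto simp: space_restrict_space)
  show "integral\<^sup>L (chart_measure \<L> c \<rho>) f = (\<integral>x. indicator ?D x * (\<rho> x * f (coords_inv c x)) \<partial>\<L>)"
    unfolding chart_measure_def using m f fm ae
    by (simp add: integral_distr integral_density integral_restrict_space[OF D])
  show "integrable (chart_measure \<L> c \<rho>) f \<longleftrightarrow> integrable \<L> (\<lambda>x. indicator ?D x * (\<rho> x * f (coords_inv c x)))"
    unfolding chart_measure_def using m f fm ae
    by (simp add: integrable_distr_eq integrable_density integrable_restrict_space[OF D] set_integrable_def)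
qed

lemma chart_measure_concentrated:
  assumes "c \<in> A" "sets \<L> = sets borel" "continuous_on (coords c ` chart_dom c) \<rho>" "B \<in> sets borel"
  shows "emeasure (chart_measure \<L> c \<rho>) B = emeasure (chart_measure \<L> c \<rho>) (B \<inter> chart_dom c)"
  using assms open_chart_dom[OF assms(1)] by (subst (1 2) emeasure_chart_measure) (auto simp: Int_assoc)

end

context riemannian_manifold
begin

lemma posdef_metric: "c \<in> A \<Longrightarrow> p \<in> chart_dom c \<Longrightarrow> posdef (g c p)"
  using metric_symmetric metric_positive by (simp add: posdef_def)

lemma smooth_metric: "c \<in> A \<Longrightarrow> smooth_on (coords c ` chart_dom c) (\<lambda>x. g c (coords_inv c x))"
  using metric_smooth by (auto simp: smooth_components_on_def o_def)

definition vol :: "('a, 'n) chart \<Rightarrow> 'a \<Rightarrow> real" where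
  "vol c p = sqrt (det (g c p))"

lemma vol_pos: "c \<in> A \<Longrightarrow> p \<in> chart_dom c \<Longrightarrow> vol c p > 0"
  unfolding vol_def using posdef_det_pos[OF posdef_metric] by simp

lemma smooth_vol: "c \<in> A \<Longrightarrow> smooth_on (coords c ` chart_dom c) (\<lambda>x. vol c (coords_inv c x))"
  unfolding vol_def
  by (intro smooth_intros smooth_metric open_chart_range) (auto intro: posdef_det_pos[OF posdef_metric])

lemma vol_transform:
  assumes "c \<in> A" "d \<in> A" "p \<in> chart_dom c" "p \<in> chart_dom d"
  shows "vol c p = \<bar>det (matrix (transition_deriv c d p))\<bar> * vol d p"
proof -
  have "det (g c p) = (det (matrix (transition_deriv c d p)))\<^sup>2 * det (g d p)"
  proof (rule det_congruence[OF linear_transition_deriv[OF assms]])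
    show "x \<bullet> (g c p *v y) = transition_deriv c d p x \<bullet> (g d p *v transition_deriv c d p y)" for x y
      using assms by (intro metric_transform) auto
  qed
  then show ?thesis by (simp add: vol_def real_sqrt_mult)
qed

lemma chart_volume_eq: "chart_volume g c = chart_measure lborel c (\<lambda>x. vol c (coords_inv c x))"
  by (simp add: chart_volume_def chart_measure_def vol_def)

lemma continuous_on_vol: "c \<in> A \<Longrightarrow> continuous_on (coords c ` chart_dom c) (\<lambda>x. vol c (coords_inv c x))"
  by (rule smooth_on_imp_continuous_on[OF smooth_vol])

lemma det_transition_continuous:
  assumes "c \<in> A" "d \<in> A"
  shows "continuous_on (coords c ` (chart_dom c \<inter> chart_dom d))
    (\<lambda>x. det (matrix (transition_deriv c d (coords_inv c x))))"
proof -
  let ?S = "coords c ` (chart_dom c \<inter> chart_dom d)"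
  have "smooth_on ?S (\<lambda>x. det (\<chi> i j. frechet_derivative (coords d \<circ> coords_inv c) (at x) (axis j 1) $ i))"
    unfolding det_def vec_lambda_beta
    by (intro smooth_intros open_overlap assms smooth_on_transition)
  then have "continuous_on ?S (\<lambda>x. det (\<chi> i j. frechet_derivative (coords d \<circ> coords_inv c) (at x) (axis j 1) $ i))"
    by (rule smooth_on_imp_continuous_on)
  then show ?thesis
    by (rule continuous_on_cong[THEN iffD1, OF refl, rotated]) (use assms in \<open>auto simp: matrix_def transition_deriv_def\<close>)
qed

text \<open>The Jacobian in the change of variables formula is the factor by which the densities \<open>sqrt
  (det g)\<close> of the two charts differ.\<close>

lemma chart_volume_agree:
  assumes c: "c \<in> A" and d: "d \<in> A" and B: "B \<in> sets borel" "B \<subseteq> chart_dom c" "B \<subseteq> chart_dom d"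
  shows "emeasure (chart_volume g c) B = emeasure (chart_volume g d) B"
proof -
  let ?S = "coords c ` (chart_dom c \<inter> chart_dom d)" and ?\<phi> = "coords d \<circ> coords_inv c"
  let ?F = "\<lambda>y. ennreal (vol d (coords_inv d y)) * indicator (coords d ` (B \<inter> chart_dom d)) y"
  have img: "?\<phi> ` ?S = coords d ` (chart_dom c \<inter> chart_dom d)" using c by (force simp: image_iff)
  have opd: "open (coords d ` (chart_dom c \<inter> chart_dom d))"
    using open_overlap[OF d c] by (simp add: Int_commute)
  have inj: "inj_on ?\<phi> ?S"
    by (rule inj_onI) (use c d inj_on_coords[OF d] in \<open>auto dest: inj_onD\<close>)
  have "emeasure (chart_volume g d) B = (\<integral>\<^sup>+y. ?F y \<partial>lborel)"
    unfolding chart_volume_eq using d B(1) by (simp add: emeasure_chart_measure continuous_on_vol)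
  also have "\<dots> = (\<integral>\<^sup>+y. ?F y * indicator (?\<phi> ` ?S) y \<partial>lborel)"
    unfolding img using B by (intro nn_integral_cong) (auto simp: indicator_def)
  also have "\<dots> = (\<integral>\<^sup>+x. ennreal \<bar>det (matrix (transition_deriv c d (coords_inv c x)))\<bar> * ?F (?\<phi> x) * indicator ?S x \<partial>lborel)"
  proof (rule nn_integral_change_of_variables)
    show "(?\<phi> has_derivative transition_deriv c d (coords_inv c x)) (at x)" if "x \<in> ?S" for x
      using that transition_has_derivative[OF c d, of "coords_inv c x"] c by auto
    show "?F \<in> borel_measurable borel"
      by (rule borel_measurable_density_indicator[OF open_chart_range[OF d] continuous_on_vol[OF d] borel_coords_image[OF d B(1)]]) auto
  qed (use c d img opd inj open_overlap det_transition_continuous in auto)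
  also have "\<dots> = (\<integral>\<^sup>+x. ennreal (vol c (coords_inv c x)) * indicator (coords c ` (B \<inter> chart_dom c)) x \<partial>lborel)"
  proof (rule nn_integral_cong)
    fix x
    show "ennreal \<bar>det (matrix (transition_deriv c d (coords_inv c x)))\<bar> * ?F (?\<phi> x) * indicator ?S x
      = ennreal (vol c (coords_inv c x)) * indicator (coords c ` (B \<inter> chart_dom c)) x"
    proof (cases "x \<in> ?S")
      case True
      then obtain p where p: "x = coords c p" "p \<in> chart_dom c" "p \<in> chart_dom d" by auto
      have "coords d p \<in> coords d ` (B \<inter> chart_dom d) \<longleftrightarrow> x \<in> coords c ` (B \<inter> chart_dom c)"
        using p c d by (simp add: coords_mem_image_iff)
      then show ?thesis
        using p c d vol_transform[OF c d p(2,3)] vol_pos[OF d p(3)]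
        by (simp add: indicator_def ennreal_mult[symmetric])
    next
      case False
      then have "x \<notin> coords c ` (B \<inter> chart_dom c)" using B by auto
      then show ?thesis using False by simp
    qed
  qed
  also have "\<dots> = emeasure (chart_volume g c) B"
    unfolding chart_volume_eq using c B(1) by (simp add: emeasure_chart_measure continuous_on_vol)
  finally show ?thesis by simp
qed

lemma sets_riemannian_measure [simp]: "sets (riemannian_measure A g) = sets borel"
  unfolding riemannian_measure_def
  by (rule sets_SUP) (use chart_at(1) in \<open>auto simp: chart_volume_eq\<close>)

lemma riemannian_measure_chart:
  assumes "c \<in> A" "B \<in> sets borel" "B \<subseteq> chart_dom c"
  shows "emeasure (riemannian_measure A g) B = emeasure (chart_volume g c) B"
  unfolding riemannian_measure_def
proof (rule emeasure_SUP_glued[where D = chart_dom and i = c])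
  show "emeasure (chart_volume g d) B = emeasure (chart_volume g d) (B \<inter> chart_dom d)"
    if "d \<in> A" "B \<in> sets borel" for d B
    unfolding chart_volume_eq using that continuous_on_vol by (intro chart_measure_concentrated) auto
  show "emeasure (chart_volume g d) B = emeasure (chart_volume g e) B"
    if "d \<in> A" "e \<in> A" "B \<in> sets borel" "B \<subseteq> chart_dom d" "B \<subseteq> chart_dom e" for d e B
    using that by (rule chart_volume_agree)
qed (use assms open_chart_dom in \<open>auto simp: chart_volume_eq\<close>)

lemma integral_riemannian_chart:
  fixes f :: "'a \<Rightarrow> real"
  assumes c: "c \<in> A" and f: "f \<in> borel_measurable borel" "\<And>p. p \<notin> chart_dom c \<Longrightarrow> f p = 0"
  shows "integral\<^sup>L (riemannian_measure A g) f = (\<integral>x. in_chart c (\<lambda>p. vol c p * f p) x \<partial>lborel)"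
    "integrable (riemannian_measure A g) f \<longleftrightarrow> integrable lborel (in_chart c (\<lambda>p. vol c p * f p))"
proof -
  have *: "integral\<^sup>L (riemannian_measure A g) f = integral\<^sup>L (chart_volume g c) f"
    "integrable (riemannian_measure A g) f \<longleftrightarrow> integrable (chart_volume g c) f"
    by (rule integral_eq_if_measures_agree[where D = "chart_dom c"];
      use assms open_chart_dom riemannian_measure_chart in \<open>auto simp: chart_volume_eq\<close>)+
  have i: "in_chart c (\<lambda>p. vol c p * f p)
      = (\<lambda>x. indicator (coords c ` chart_dom c) x * (vol c (coords_inv c x) * f (coords_inv c x)))"
    by (auto simp: in_chart_def indicator_def)
  have pos: "vol c (coords_inv c x) \<ge> 0" if "x \<in> coords c ` chart_dom c" for x
    using that vol_pos[OF c] c by (auto intro: less_imp_le)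
  show "integral\<^sup>L (riemannian_measure A g) f = (\<integral>x. in_chart c (\<lambda>p. vol c p * f p) x \<partial>lborel)"
    unfolding * i chart_volume_eq by (rule integral_chart_measure(1)) (use c f continuous_on_vol pos in auto)
  show "integrable (riemannian_measure A g) f \<longleftrightarrow> integrable lborel (in_chart c (\<lambda>p. vol c p * f p))"
    unfolding * i chart_volume_eq by (rule integral_chart_measure(2)) (use c f continuous_on_vol pos in auto)
qed

end

section \<open>The hypersurface measure in a slice chart\<close>

lemma set_coord_has_derivative:
  assumes "(f has_derivative f') F" "(h has_derivative h') F"
  shows "((\<lambda>x. set_coord l (f x) (h x)) has_derivative (\<lambda>v. set_coord l (f' v) (h' v))) F"
  unfolding set_coord_def
  by (intro has_derivative_add has_derivative_scaleR_left has_derivative_diff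
      bounded_linear.has_derivative[OF bounded_linear_vec_nth] assms)

text \<open>The matrix in the definition of \<open>principal_minor\<close> is the orthogonal sum of the
  restriction of \<open>G\<close> to the hyperplane \<open>x\<^sub>k = 0\<close> and of the standard form on
  the \<open>k\<close>-th axis.\<close>

lemma inner_principal_minor_matrix:
  fixes G :: "real ^ 'n::finite ^ 'n"
  shows "x \<bullet> ((\<chi> i j. if i = k \<or> j = k then (if i = j then 1 else 0) else G $ i $ j) *v y)
    = set_coord k x 0 \<bullet> (G *v set_coord k y 0) + x $ k * y $ k"
proof -
  let ?P = "(\<chi> i j. if i = k \<or> j = k then (if i = j then 1 else 0) else G $ i $ j) :: real ^ 'n ^ 'n"
  have row: "x $ i * (?P *v y) $ i = set_coord k x 0 $ i * (G *v set_coord k y 0) $ i + (if i = k then x $ k * y $ k else 0)" for i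
  proof (cases "i = k")
    case True
    have "(?P *v y) $ k = y $ k"
      by (simp add: matrix_vector_mult_def if_distrib[of "\<lambda>z. z * _"] cong: if_cong)
    then show ?thesis using True by simp
  next
    case False
    have "(?P *v y) $ i = (G *v set_coord k y 0) $ i"
      unfolding matrix_vector_mult_def using False by (auto intro!: sum.cong)
    then show ?thesis using False by simp
  qed
  show ?thesis unfolding inner_vec_def by (simp add: row sum.distrib)
qed

lemma posdef_principal_minor:
  assumes "posdef (G :: real ^ 'n::finite ^ 'n)"
  shows "principal_minor k G > 0"
  unfolding principal_minor_def
proof (rule posdef_det_pos)
  show "posdef (\<chi> i j. if i = k \<or> j = k then (if i = j then 1 else 0) else G $ i $ j)"
    unfolding posdef_def inner_principal_minor_matrix
  proof (intro conjI allI impI)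
    have "transpose G $ i $ j = G $ i $ j" for i j
      using assms by (simp add: posdef_def)
    then have "G $ i $ j = G $ j $ i" for i j by (simp add: transpose_def)
    then show "transpose (\<chi> i j. if i = k \<or> j = k then (if i = j then 1 else 0) else G $ i $ j)
      = (\<chi> i j. if i = k \<or> j = k then (if i = j then 1 else 0) else G $ i $ j)"
      by (auto simp: transpose_def vec_eq_iff)
    fix x :: "real ^ 'n" assume x: "x \<noteq> 0"
    show "0 < set_coord k x 0 \<bullet> (G *v set_coord k x 0) + x $ k * x $ k"
    proof (cases "set_coord k x 0 = 0")
      case True
      then have "x $ k \<noteq> 0" using x set_coord_self[of k x] by metis
      then have "x $ k * x $ k > 0" by (metis not_square_less_zero mult_eq_0_iff linorder_neqE_linordered_idom)
      then show ?thesis using True by simp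
    next
      case False
      then have "set_coord k x 0 \<bullet> (G *v set_coord k x 0) > 0" using assms by (simp add: posdef_def)
      then show ?thesis by (simp add: add_pos_nonneg)
    qed
  qed
qed

context riemannian_manifold
begin

definition area :: "('a, 'n) chart \<Rightarrow> 'n \<Rightarrow> 'a \<Rightarrow> real" where
  "area c k p = sqrt (principal_minor k (g c p))"

lemma area_pos: "c \<in> A \<Longrightarrow> p \<in> chart_dom c \<Longrightarrow> area c k p > 0"
  unfolding area_def using posdef_principal_minor[OF posdef_metric] by simp

lemma smooth_area: assumes c: "c \<in> A" shows "smooth_on (coords c ` chart_dom c) (\<lambda>x. area c k (coords_inv c x))"
proof -
  note S = open_chart_range[OF c]
  have e: "smooth_on (coords c ` chart_dom c)
    (\<lambda>x. if i = k \<or> j = k then if i = j then 1 else 0 else g c (coords_inv c x) $ i $ j)" for i j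
    using smooth_metric[OF c] S by (cases "i = k \<or> j = k") (simp_all add: smooth_on_const smooth_on_nth)
  have "smooth_on (coords c ` chart_dom c) (\<lambda>x. principal_minor k (g c (coords_inv c x)))"
    unfolding principal_minor_def det_def vec_lambda_beta by (intro smooth_intros S e)
  then show ?thesis unfolding area_def
    by (intro smooth_on_sqrt S) (use posdef_principal_minor[OF posdef_metric[OF c]] c in auto)
qed

lemma continuous_on_area: "c \<in> A \<Longrightarrow> continuous_on (coords c ` chart_dom c) (\<lambda>x. area c k (coords_inv c x))"
  by (rule smooth_on_imp_continuous_on[OF smooth_area])

lemma slice_volume_eq: "slice_volume g c k = chart_measure (hyperplane_measure k) c (\<lambda>x. area c k (coords_inv c x))"
  by (simp add: slice_volume_def chart_measure_def area_def)

lemma emeasure_slice_volume: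
  "c \<in> A \<Longrightarrow> B \<in> sets borel \<Longrightarrow> emeasure (slice_volume g c k) B
    = (\<integral>\<^sup>+x. ennreal (area c k (coords_inv c x)) * indicator (coords c ` (B \<inter> chart_dom c)) x \<partial>hyperplane_measure k)"
  unfolding slice_volume_eq using continuous_on_area by (simp add: emeasure_chart_measure)

lemma slice_charts_iff:
  "(c, k) \<in> slice_charts A \<Sigma> \<longleftrightarrow> c \<in> A \<and> \<Sigma> \<inter> chart_dom c = {p \<in> chart_dom c. coords c p $ k = 0}"
  by (simp add: slice_charts_def)

text \<open>The transition map sends the segment in direction \<open>v\<close>, which lies in the
  hypersurface, to points whose \<open>l\<close>-th coordinate is zero.\<close>

lemma transition_deriv_tangent:
  assumes c: "(c, k) \<in> slice_charts A \<Sigma>" and d: "(d, l) \<in> slice_charts A \<Sigma>"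
    and p: "p \<in> chart_dom c" "p \<in> chart_dom d" "p \<in> \<Sigma>" and v: "v $ k = 0"
  shows "transition_deriv c d p v $ l = 0"
proof -
  have cA: "c \<in> A" "d \<in> A" using c d by (auto simp: slice_charts_iff)
  let ?x = "coords c p" and ?S = "coords c ` (chart_dom c \<inter> chart_dom d)"
  let ?\<phi> = "coords d \<circ> coords_inv c"
  have xk: "?x $ k = 0" using c p by (auto simp: slice_charts_iff)
  have line: "((\<lambda>t. ?x + t *\<^sub>R v) has_derivative (\<lambda>t. t *\<^sub>R v)) (at 0)"
    by (auto intro!: derivative_eq_intros)
  have "((\<lambda>t. ?\<phi> (?x + t *\<^sub>R v)) has_derivative (\<lambda>t. transition_deriv c d p (t *\<^sub>R v))) (at 0)"
    using has_derivative_compose[OF line, of ?\<phi>] transition_has_derivative[OF cA p(1,2)] by simp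
  then have 1: "((\<lambda>t. ?\<phi> (?x + t *\<^sub>R v) $ l) has_derivative (\<lambda>t. transition_deriv c d p (t *\<^sub>R v) $ l)) (at 0)"
    by (rule bounded_linear.has_derivative[OF bounded_linear_vec_nth])
  have op: "open ((\<lambda>t. ?x + t *\<^sub>R v) -` ?S)"
    by (intro open_vimage open_overlap cA continuous_intros)
  have "((\<lambda>t. 0) has_derivative (\<lambda>t. 0)) (at (0::real))" by simp
  then have 2: "((\<lambda>t. ?\<phi> (?x + t *\<^sub>R v) $ l) has_derivative (\<lambda>t. 0)) (at 0)"
  proof (rule has_derivative_transform_within_open[OF _ op])
    show "0 \<in> (\<lambda>t. ?x + t *\<^sub>R v) -` ?S" using p by simp
    fix t assume "t \<in> (\<lambda>t. ?x + t *\<^sub>R v) -` ?S"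
    then obtain q where q: "?x + t *\<^sub>R v = coords c q" "q \<in> chart_dom c" "q \<in> chart_dom d" by auto
    have "coords c q $ k = 0" unfolding q(1)[symmetric] using xk v by simp
    then have "q \<in> \<Sigma>" using c q by (auto simp: slice_charts_iff)
    then have "coords d q $ l = 0" using d q by (auto simp: slice_charts_iff)
    then show "0 = ?\<phi> (?x + t *\<^sub>R v) $ l" using q cA by simp
  qed
  have "(\<lambda>t. transition_deriv c d p (t *\<^sub>R v) $ l) = (\<lambda>t. 0)" by (rule has_derivative_unique[OF 1 2])
  from fun_cong[OF this, of 1] show ?thesis by simp
qed

lemma slice_volume_concentrated:
  assumes c: "(c, k) \<in> slice_charts A \<Sigma>" and \<Sigma>: "\<Sigma> \<in> sets borel" and B: "B \<in> sets borel"
  shows "emeasure (slice_volume g c k) B = emeasure (slice_volume g c k) (B \<inter> \<Sigma>)"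
proof -
  have cA: "c \<in> A" using c by (auto simp: slice_charts_iff)
  have "AE x in hyperplane_measure k. ennreal (area c k (coords_inv c x)) * indicator (coords c ` (B \<inter> chart_dom c)) x
    = ennreal (area c k (coords_inv c x)) * indicator (coords c ` (B \<inter> \<Sigma> \<inter> chart_dom c)) x"
    using AE_hyperplane_measure[of k]
  proof eventually_elim
    case (elim x)
    have "x \<in> coords c ` (B \<inter> chart_dom c) \<longleftrightarrow> x \<in> coords c ` (B \<inter> \<Sigma> \<inter> chart_dom c)"
      using elim c by (auto simp: slice_charts_iff)
    then show ?case by (simp add: indicator_def)
  qed
  then show ?thesis
    using cA B \<Sigma> by (simp add: emeasure_slice_volume nn_integral_cong_AE cong: nn_integral_cong_AE)
qed

text \<open>The transition between two slice charts maps the hyperplane \<open>x\<^sub>k = 0\<close> to the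
  hyperplane \<open>y\<^sub>l = 0\<close>.  Its product \<open>\<Phi>\<close> with the identity of the
  transverse coordinate is a diffeomorphism between open sets of the whole space, and maps the slab over one
  hyperplane to the slab over the other.  The derivative of \<open>\<Phi>\<close> is a congruence between the
  matrices whose determinants define the two principal minors, so the change of variables formula for
  \<open>\<Phi>\<close> on the slabs is the claim.\<close>

lemma slice_volume_agree:
  assumes c: "(c, k) \<in> slice_charts A \<Sigma>" and d: "(d, l) \<in> slice_charts A \<Sigma>" and \<Sigma>: "\<Sigma> \<in> sets borel"
    and B0: "B0 \<in> sets borel" "B0 \<subseteq> chart_dom c" "B0 \<subseteq> chart_dom d"
  shows "emeasure (slice_volume g c k) B0 = emeasure (slice_volume g d l) B0"
proof -
  define B where "B = B0 \<inter> \<Sigma>"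
  have B: "B \<in> sets borel" "B \<subseteq> chart_dom c" "B \<subseteq> chart_dom d" "B \<subseteq> \<Sigma>"
    using B0 \<Sigma> by (auto simp: B_def)
  have cA: "c \<in> A" and dA: "d \<in> A" using c d by (auto simp: slice_charts_iff)
  let ?U = "coords c ` (chart_dom c \<inter> chart_dom d)" and ?\<phi> = "coords d \<circ> coords_inv c"
  let ?V = "coords d ` (chart_dom c \<inter> chart_dom d)" and ?\<psi> = "coords c \<circ> coords_inv d"
  \<comment> \<open>The cylinders over the overlap of the two charts within the hyperplanes.\<close>
  define S where "S = {x. set_coord k x 0 \<in> ?U}"
  define T where "T = {y. set_coord l y 0 \<in> ?V}"
  define \<Phi> where "\<Phi> x = set_coord l (?\<phi> (set_coord k x 0)) (x $ k)" for x
  define \<Psi> where "\<Psi> y = set_coord k (?\<psi> (set_coord l y 0)) (y $ l)" for y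
  define \<Phi>' where "\<Phi>' x v = set_coord l (transition_deriv c d (coords_inv c (set_coord k x 0)) (set_coord k v 0)) (v $ k)" for x v
  have cont: "continuous_on UNIV (\<lambda>x :: real ^ 'n. set_coord i x 0)" for i
    unfolding set_coord_def by (intro continuous_intros)
  have opS: "open S" unfolding S_def
    using continuous_open_vimage[OF open_overlap[OF cA dA], of "\<lambda>x. set_coord k x 0"] cont[of k]
    by (simp add: vimage_def continuous_on_eq_continuous_at)
  have opT: "open T" unfolding T_def
    using continuous_open_vimage[OF open_overlap[OF dA cA], of "\<lambda>x. set_coord l x 0"] cont[of l]
    by (simp add: vimage_def continuous_on_eq_continuous_at Int_commute)
  have pt: "\<exists>p. p \<in> chart_dom c \<and> p \<in> chart_dom d \<and> p \<in> \<Sigma> \<and> set_coord k x 0 = coords c p \<and> coords d p $ l = 0 \<and>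
      ?\<phi> (set_coord k x 0) = coords d p" if xS: "x \<in> S" for x
  proof -
    obtain p where p: "set_coord k x 0 = coords c p" "p \<in> chart_dom c" "p \<in> chart_dom d"
      using xS by (auto simp: S_def)
    have "coords c p $ k = 0" unfolding p(1)[symmetric] by simp
    then have "p \<in> \<Sigma>" using c p by (auto simp: slice_charts_iff)
    then show ?thesis using p d cA by (auto simp: slice_charts_iff)
  qed
  have pt': "\<exists>p. p \<in> chart_dom c \<and> p \<in> chart_dom d \<and> coords c p $ k = 0 \<and> set_coord l y 0 = coords d p \<and>
      ?\<psi> (set_coord l y 0) = coords c p" if yT: "y \<in> T" for y
  proof -
    obtain p where p: "set_coord l y 0 = coords d p" "p \<in> chart_dom c" "p \<in> chart_dom d"
      using yT by (auto simp: T_def)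
    have "coords d p $ l = 0" unfolding p(1)[symmetric] by simp
    then have "p \<in> \<Sigma>" using d p by (auto simp: slice_charts_iff)
    then show ?thesis using p c dA by (auto simp: slice_charts_iff)
  qed
  have \<Phi>0: "set_coord l (\<Phi> x) 0 = ?\<phi> (set_coord k x 0)" if x: "x \<in> S" for x
  proof -
    obtain p where p: "coords d p $ l = 0" "?\<phi> (set_coord k x 0) = coords d p" using pt[OF x] by blast
    then show ?thesis unfolding \<Phi>_def using set_coord_self[of l "coords d p"] by simp
  qed
  have \<Psi>0: "set_coord k (\<Psi> y) 0 = ?\<psi> (set_coord l y 0)" if y: "y \<in> T" for y
  proof -
    obtain p where p: "coords c p $ k = 0" "?\<psi> (set_coord l y 0) = coords c p" using pt'[OF y] by blast
    then show ?thesis unfolding \<Psi>_def using set_coord_self[of k "coords c p"] by simp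
  qed
  have \<Phi>l: "\<Phi> x $ l = x $ k" for x by (simp add: \<Phi>_def)
  have \<Psi>\<Phi>: "\<Psi> (\<Phi> x) = x" if x: "x \<in> S" for x
  proof -
    obtain p where p: "p \<in> chart_dom d" "set_coord k x 0 = coords c p" "?\<phi> (set_coord k x 0) = coords d p" using pt[OF x] by blast
    have "?\<psi> (set_coord l (\<Phi> x) 0) = set_coord k x 0" unfolding \<Phi>0[OF x] p(3) using p dA by simp
    then show ?thesis unfolding \<Psi>_def by (simp add: \<Phi>l)
  qed
  have \<Phi>\<Psi>: "\<Phi> (\<Psi> y) = y" if y: "y \<in> T" for y
  proof -
    obtain p where p: "p \<in> chart_dom c" "set_coord l y 0 = coords d p" "?\<psi> (set_coord l y 0) = coords c p" using pt'[OF y] by blast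
    have "?\<phi> (set_coord k (\<Psi> y) 0) = set_coord l y 0" unfolding \<Psi>0[OF y] p(3) using p cA by simp
    then show ?thesis unfolding \<Phi>_def by (simp add: \<Psi>_def)
  qed
  have img: "\<Phi> ` S = T"
  proof
    show "\<Phi> ` S \<subseteq> T"
    proof
      fix y assume "y \<in> \<Phi> ` S"
      then obtain x where x: "x \<in> S" "y = \<Phi> x" by blast
      then show "y \<in> T" using pt[OF x(1)] \<Phi>0[OF x(1)] by (auto simp: T_def)
    qed
    show "T \<subseteq> \<Phi> ` S"
    proof
      fix y assume y: "y \<in> T"
      have "\<Psi> y \<in> S" using pt'[OF y] \<Psi>0[OF y] by (auto simp: S_def)
      then show "y \<in> \<Phi> ` S" using \<Phi>\<Psi>[OF y] by (metis imageI)
    qed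
  qed
  have inj: "inj_on \<Phi> S" using \<Psi>\<Phi> by (metis inj_onI)
  have der: "(\<Phi> has_derivative \<Phi>' x) (at x)" if x: "x \<in> S" for x
  proof -
    obtain p where p: "p \<in> chart_dom c" "p \<in> chart_dom d" "set_coord k x 0 = coords c p" using pt[OF x] by blast
    have "((\<lambda>x. set_coord k x 0) has_derivative (\<lambda>v. set_coord k v 0)) (at x)"
      by (rule set_coord_has_derivative) auto
    moreover have "(?\<phi> has_derivative transition_deriv c d (coords_inv c (set_coord k x 0))) (at (set_coord k x 0))"
      using transition_has_derivative[OF cA dA p(1,2)] p cA by simp
    ultimately have "((\<lambda>x. ?\<phi> (set_coord k x 0)) has_derivative (\<lambda>v. transition_deriv c d (coords_inv c (set_coord k x 0)) (set_coord k v 0))) (at x)"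
      by (rule has_derivative_compose)
    then show ?thesis unfolding \<Phi>_def[abs_def] \<Phi>'_def[abs_def]
      by (rule set_coord_has_derivative) (rule bounded_linear_imp_has_derivative[OF bounded_linear_vec_nth])
  qed
  \<comment> \<open>The thickened transition maps the restriction of the metric to the hyperplane, plus the
    square of the transverse coordinate, to the corresponding form in the other chart.\<close>
  have area: "area c k p = \<bar>det (matrix (\<Phi>' x))\<bar> * area d l p"
    if x: "x \<in> S" and p: "p \<in> chart_dom c" "p \<in> chart_dom d" "p \<in> \<Sigma>" "set_coord k x 0 = coords c p" for x p
  proof -
    have ip: "coords_inv c (set_coord k x 0) = p" using p cA by simp
    have lin: "linear (\<Phi>' x)" using der[OF x] by (rule has_derivative_linear)
    have tan: "transition_deriv c d p (set_coord k v 0) $ l = 0" for v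
      by (rule transition_deriv_tangent[OF c d p(1-3)]) simp
    have \<Phi>'0: "set_coord l (\<Phi>' x v) 0 = transition_deriv c d p (set_coord k v 0)" for v
      unfolding \<Phi>'_def ip using tan[of v] set_coord_self[of l "transition_deriv c d p (set_coord k v 0)"] by simp
    have \<Phi>'l: "\<Phi>' x v $ l = v $ k" for v by (simp add: \<Phi>'_def)
    have "principal_minor k (g c p) = (det (matrix (\<Phi>' x)))\<^sup>2 * principal_minor l (g d p)"
      unfolding principal_minor_def
    proof (rule det_congruence[OF lin])
      fix v w
      show "v \<bullet> ((\<chi> i j. if i = k \<or> j = k then (if i = j then 1 else 0) else g c p $ i $ j) *v w)
        = \<Phi>' x v \<bullet> ((\<chi> i j. if i = l \<or> j = l then (if i = j then 1 else 0) else g d p $ i $ j) *v \<Phi>' x w)"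
        unfolding inner_principal_minor_matrix \<Phi>'0 \<Phi>'l
        using metric_transform[OF cA dA, of p "set_coord k v 0" "set_coord k w 0"] p by simp
    qed
    then show ?thesis by (simp add: area_def real_sqrt_mult)
  qed
  have cdet: "continuous_on S (\<lambda>x. det (matrix (\<Phi>' x)))"
  proof -
    have u: "smooth_on S (\<lambda>x. set_coord k x 0)" by (intro smooth_intros opS)
    have e: "smooth_on S (\<lambda>x. frechet_derivative ?\<phi> (at (set_coord k x 0)) (set_coord k (axis j 1) 0) $ i)" for i j
      by (rule smooth_on_compose[OF opS _ u smooth_on_nth[OF open_overlap[OF cA dA] smooth_on_derivative[OF smooth_on_transition[OF cA dA]]]])
        (auto simp: S_def)
    have "smooth_on S (\<lambda>x. if i = l then axis j 1 $ k else
        frechet_derivative ?\<phi> (at (set_coord k x 0)) (set_coord k (axis j 1) 0) $ i)" for i j :: 'n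
      using e by (cases "i = l") (auto simp: smooth_on_const)
    then have "smooth_on S (\<lambda>x. det (\<chi> i j. if i = l then axis j 1 $ k else
        frechet_derivative ?\<phi> (at (set_coord k x 0)) (set_coord k (axis j 1) 0) $ i))"
      unfolding det_def vec_lambda_beta by (intro smooth_intros opS)
    then have "continuous_on S (\<lambda>x. det (\<chi> i j. if i = l then axis j 1 $ k else
        frechet_derivative ?\<phi> (at (set_coord k x 0)) (set_coord k (axis j 1) 0) $ i))"
      by (rule smooth_on_imp_continuous_on)
    moreover have "det (matrix (\<Phi>' x)) = det (\<chi> i j. if i = l then axis j 1 $ k else
        frechet_derivative ?\<phi> (at (set_coord k x 0)) (set_coord k (axis j 1) 0) $ i)" if x: "x \<in> S" for x
    proof -
      obtain p where p: "p \<in> chart_dom c" "set_coord k x 0 = coords c p" using pt[OF x] by blast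
      have "coords c (coords_inv c (set_coord k x 0)) = set_coord k x 0" using p cA by simp
      then show ?thesis by (simp add: matrix_def \<Phi>'_def transition_deriv_def)
    qed
    ultimately show ?thesis by (simp cong: continuous_on_cong)
  qed
  let ?h = "\<lambda>c k x. ennreal (area c k (coords_inv c x)) * indicator (coords c ` (B \<inter> chart_dom c)) x"
  have hm: "?h c k \<in> borel_measurable borel" if "c \<in> A" for c k
    by (rule borel_measurable_density_indicator[OF open_chart_range[OF that] continuous_on_area[OF that] borel_coords_image[OF that B(1)]]) auto
  have um: "(\<lambda>x :: real ^ 'n. set_coord i x 0) \<in> borel_measurable borel" for i
    by (rule borel_measurable_continuous_onI[OF cont])
  have slab: "{x :: real ^ 'n. 0 < x $ i \<and> x $ i < 1} \<in> sets borel" for i by measurable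
  let ?F = "\<lambda>y. ?h d l (set_coord l y 0) * indicator {y. 0 < y $ l \<and> y $ l < 1} y"
  have "emeasure (slice_volume g d l) B = (\<integral>\<^sup>+y. ?F y \<partial>lborel)"
    unfolding emeasure_slice_volume[OF dA B(1)] by (rule nn_integral_hyperplane_thicken[OF hm[OF dA]])
  also have "\<dots> = (\<integral>\<^sup>+y. ?F y * indicator (\<Phi> ` S) y \<partial>lborel)"
    unfolding img using B by (intro nn_integral_cong) (auto simp: indicator_def T_def)
  also have "\<dots> = (\<integral>\<^sup>+x. ennreal \<bar>det (matrix (\<Phi>' x))\<bar> * ?F (\<Phi> x) * indicator S x \<partial>lborel)"
  proof (rule nn_integral_change_of_variables[OF opS _ der inj cdet])
    show "open (\<Phi> ` S)" using opT img by simp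
    show "?F \<in> borel_measurable borel"
      using measurable_compose[OF um[of l] hm[OF dA]] slab[of l] by measurable
  qed
  also have "\<dots> = (\<integral>\<^sup>+x. ?h c k (set_coord k x 0) * indicator {x. 0 < x $ k \<and> x $ k < 1} x \<partial>lborel)"
  proof (rule nn_integral_cong)
    fix x
    show "ennreal \<bar>det (matrix (\<Phi>' x))\<bar> * ?F (\<Phi> x) * indicator S x
      = ?h c k (set_coord k x 0) * indicator {x. 0 < x $ k \<and> x $ k < 1} x"
    proof (cases "x \<in> S")
      case True
      obtain p where p: "p \<in> chart_dom c" "p \<in> chart_dom d" "p \<in> \<Sigma>" "set_coord k x 0 = coords c p"
        "?\<phi> (set_coord k x 0) = coords d p" using pt[OF True] by blast
      have "coords d p \<in> coords d ` (B \<inter> chart_dom d) \<longleftrightarrow> coords c p \<in> coords c ` (B \<inter> chart_dom c)"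
        using p cA dA by (simp add: coords_mem_image_iff)
      then show ?thesis
        using True p(1-4) cA dA area[OF True p(1-4)] area_pos[OF dA p(2), of l]
        unfolding \<Phi>0[OF True] p(5) by (simp add: \<Phi>l indicator_def ennreal_mult[symmetric])
    next
      case False
      then have "set_coord k x 0 \<notin> coords c ` (B \<inter> chart_dom c)" using B by (auto simp: S_def)
      then show ?thesis using False by simp
    qed
  qed
  also have "\<dots> = emeasure (slice_volume g c k) B"
    unfolding emeasure_slice_volume[OF cA B(1)] by (rule nn_integral_hyperplane_thicken[OF hm[OF cA], symmetric])
  finally have "emeasure (slice_volume g c k) B = emeasure (slice_volume g d l) B" by simp
  then show ?thesis
    using slice_volume_concentrated[OF c \<Sigma> B0(1)] slice_volume_concentrated[OF d \<Sigma> B0(1)] by (simp add: B_def)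
qed

lemma hypersurface_measure_chart:
  assumes c: "(c, k) \<in> slice_charts A \<Sigma>" and \<Sigma>: "\<Sigma> \<in> sets borel" and B: "B \<in> sets borel" "B \<subseteq> chart_dom c"
  shows "emeasure (hypersurface_measure A g \<Sigma>) B = emeasure (slice_volume g c k) B"
proof -
  have "emeasure (SUP i\<in>slice_charts A \<Sigma>. slice_volume g (fst i) (snd i)) B = emeasure (slice_volume g (fst (c, k)) (snd (c, k))) B"
  proof (rule emeasure_SUP_glued[where D = "\<lambda>i. chart_dom (fst i)"])
    show "emeasure (slice_volume g (fst i) (snd i)) B = emeasure (slice_volume g (fst i) (snd i)) (B \<inter> chart_dom (fst i))"
      if "i \<in> slice_charts A \<Sigma>" "B \<in> sets borel" for i B
      unfolding slice_volume_eq using that continuous_on_area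
      by (intro chart_measure_concentrated) (auto simp: slice_charts_def)
    show "emeasure (slice_volume g (fst i) (snd i)) B = emeasure (slice_volume g (fst j) (snd j)) B"
      if "i \<in> slice_charts A \<Sigma>" "j \<in> slice_charts A \<Sigma>" "B \<in> sets borel" "B \<subseteq> chart_dom (fst i)" "B \<subseteq> chart_dom (fst j)" for i j B
      using slice_volume_agree[of "fst i" "snd i" \<Sigma> "fst j" "snd j" B] that \<Sigma> by simp
    show "chart_dom (fst i) \<in> sets borel" if "i \<in> slice_charts A \<Sigma>" for i
      using that open_chart_dom[of "fst i"] by (auto simp: slice_charts_def)
  qed (use c B in \<open>auto simp: slice_volume_eq\<close>)
  then show ?thesis by (simp add: hypersurface_measure_def case_prod_beta)
qed

lemma integral_hypersurface_chart:
  fixes f :: "'a \<Rightarrow> real"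
  assumes c: "(c, k) \<in> slice_charts A \<Sigma>" and \<Sigma>: "\<Sigma> \<in> sets borel"
    and f: "f \<in> borel_measurable borel" "\<And>p. p \<notin> chart_dom c \<Longrightarrow> f p = 0"
  shows "integral\<^sup>L (hypersurface_measure A g \<Sigma>) f = (\<integral>x. in_chart c (\<lambda>p. area c k p * f p) x \<partial>hyperplane_measure k)"
    "integrable (hypersurface_measure A g \<Sigma>) f \<longleftrightarrow> integrable (hyperplane_measure k) (in_chart c (\<lambda>p. area c k p * f p))"
proof -
  have cA: "c \<in> A" using c by (auto simp: slice_charts_iff)
  have sH: "sets (hypersurface_measure A g \<Sigma>) = sets borel"
    unfolding hypersurface_measure_def by (rule sets_SUP) (use c in \<open>auto simp: slice_volume_eq\<close>)
  have dm: "chart_dom c \<in> sets borel" using open_chart_dom[OF cA] by auto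
  note ag = integral_eq_if_measures_agree[OF sH _ dm, of "slice_volume g c k" f]
  have *: "integral\<^sup>L (hypersurface_measure A g \<Sigma>) f = integral\<^sup>L (slice_volume g c k) f"
    "integrable (hypersurface_measure A g \<Sigma>) f \<longleftrightarrow> integrable (slice_volume g c k) f"
    using ag hypersurface_measure_chart[OF c \<Sigma>] f(2) by (auto simp: slice_volume_eq)
  have i: "in_chart c (\<lambda>p. area c k p * f p)
      = (\<lambda>x. indicator (coords c ` chart_dom c) x * (area c k (coords_inv c x) * f (coords_inv c x)))"
    by (auto simp: in_chart_def indicator_def)
  have pos: "area c k (coords_inv c x) \<ge> 0" if "x \<in> coords c ` chart_dom c" for x
    using that area_pos[OF cA] cA by (auto intro: less_imp_le)
  show "integral\<^sup>L (hypersurface_measure A g \<Sigma>) f = (\<integral>x. in_chart c (\<lambda>p. area c k p * f p) x \<partial>hyperplane_measure k)"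
    unfolding * i slice_volume_eq by (rule integral_chart_measure(1)) (use cA f continuous_on_area pos in auto)
  show "integrable (hypersurface_measure A g \<Sigma>) f \<longleftrightarrow> integrable (hyperplane_measure k) (in_chart c (\<lambda>p. area c k p * f p))"
    unfolding * i slice_volume_eq by (rule integral_chart_measure(2)) (use cA f continuous_on_area pos in auto)
qed

end

section \<open>The codifferential as the divergence of the flux density\<close>

lemma integral_lborel_pos:
  fixes F :: "'a::euclidean_space \<Rightarrow> real"
  assumes c: "continuous_on UNIV F" and i: "integrable lborel F" and nn: "\<And>x. F x \<ge> 0" and x: "F x > 0"
  shows "(\<integral>x. F x \<partial>lborel) > 0"
proof -
  have "(\<integral>x. F x \<partial>lborel) \<noteq> 0"
  proof
    assume "(\<integral>x. F x \<partial>lborel) = 0"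
    then have ae: "AE x in lborel. F x = 0"
      using integral_nonneg_eq_0_iff_AE[OF i] nn by auto
    have op: "open {x. F x > 0}" by (intro open_Collect_less continuous_on_const c)
    have "{x. F x > 0} \<in> null_sets lborel"
    proof (rule AE_iff_null_sets[THEN iffD2])
      show "{x. F x > 0} \<in> sets lborel" using op by simp
      show "AE x in lborel. x \<notin> {x. F x > 0}" using ae by eventually_elim simp
    qed
    then have "negligible {x. F x > 0}"
      unfolding negligible_iff_null_sets by (rule null_sets_completionI)
    then show False using open_not_negligible[OF op] x by blast
  qed
  moreover have "(\<integral>x. F x \<partial>lborel) \<ge> 0" using nn by (intro integral_nonneg_AE) auto
  ultimately show ?thesis by simp
qed

context smooth_manifold
begin

lemma partial_deriv_cong:
  assumes "c \<in> A" "open S" "p \<in> S" "p \<in> chart_dom c" "\<And>q. q \<in> S \<Longrightarrow> f q = h q"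
  shows "partial_deriv c i f p = partial_deriv c i h p"
  unfolding partial_deriv_def
  by (subst frechet_derivative_cong_open[OF open_coords_image[OF assms(1,2)], of _ _ "h \<circ> coords_inv c"])
    (use assms in auto)

lemma partial_deriv_add:
  assumes "c \<in> A" "p \<in> S" "p \<in> chart_dom c"
    and "smooth_on (coords c ` (S \<inter> chart_dom c)) (f \<circ> coords_inv c)"
    and "smooth_on (coords c ` (S \<inter> chart_dom c)) (h \<circ> coords_inv c)"
  shows "partial_deriv c i (\<lambda>q. f q + h q) p = partial_deriv c i f p + partial_deriv c i h p"
proof -
  have x: "coords c p \<in> coords c ` (S \<inter> chart_dom c)" using assms by auto
  show ?thesis unfolding partial_deriv_def
    using has_derivative_add[OF smooth_on_imp_derivative[OF assms(4) x] smooth_on_imp_derivative[OF assms(5) x]]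
    by (subst frechet_derivative_at[symmetric, where f = "(\<lambda>q. f q + h q) \<circ> coords_inv c"]) (auto simp: o_def)
qed

lemma partial_deriv_mult:
  assumes "c \<in> A" "p \<in> S" "p \<in> chart_dom c"
    and "smooth_on (coords c ` (S \<inter> chart_dom c)) (f \<circ> coords_inv c)"
    and "smooth_on (coords c ` (S \<inter> chart_dom c)) (h \<circ> coords_inv c)"
  shows "partial_deriv c i (\<lambda>q. f q * h q) p = f p * partial_deriv c i h p + partial_deriv c i f p * h p"
proof -
  have x: "coords c p \<in> coords c ` (S \<inter> chart_dom c)" using assms by auto
  show ?thesis unfolding partial_deriv_def
    using frechet_derivative_mult_real[OF smooth_on_imp_differentiable[OF assms(4) x] smooth_on_imp_differentiable[OF assms(5) x]] assms(1,3)
    by (simp add: o_def)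
qed

lemma smooth_partial_deriv:
  assumes "c \<in> A" "open S" "smooth_on (coords c ` (S \<inter> chart_dom c)) (f \<circ> coords_inv c)"
  shows "smooth_on (coords c ` (S \<inter> chart_dom c)) (partial_deriv c i f \<circ> coords_inv c)"
  by (rule smooth_on_cong[OF open_coords_image[OF assms(1,2)] _ smooth_on_derivative[OF assms(3)]])
    (use assms(1) in \<open>auto simp: partial_deriv_def\<close>)

lemma partial_in_chart:
  assumes c: "c \<in> A" and K: "compact K" "K \<subseteq> chart_dom c" "\<And>p. p \<notin> K \<Longrightarrow> f p = 0"
  shows "partial i (in_chart c f) x = in_chart c (partial_deriv c i f) x"
proof (cases "x \<in> coords c ` chart_dom c")
  case True
  have "frechet_derivative (in_chart c f) (at x) = frechet_derivative (f \<circ> coords_inv c) (at x)"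
    by (rule frechet_derivative_cong_open[OF open_chart_range[OF c] True]) (simp add: in_chart_def)
  then show ?thesis using True c by (auto simp: in_chart_def partial_deriv_def)
next
  case False
  have "partial i (in_chart c f) x = 0"
  proof (rule frechet_derivative_eq_0_outside)
    show "closed (coords c ` K)" by (intro compact_imp_closed compact_coords_image c K)
    show "in_chart c f y = 0" if "y \<notin> coords c ` K" for y by (rule in_chart_eq_0[OF c K(3) that])
    show "x \<notin> coords c ` K" using False K(2) by auto
  qed
  then show ?thesis using False by (simp add: in_chart_def)
qed

lemma differential_inner:
  assumes c: "c \<in> A" and p: "p \<in> chart_dom c" and f: "smooth_function_on A UNIV f"
  shows "differential f c p \<bullet> x = frechet_derivative (f \<circ> coords_inv c) (at (coords c p)) x"
proof -
  let ?f' = "frechet_derivative (f \<circ> coords_inv c) (at (coords c p))"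
  have "smooth_on (coords c ` (UNIV \<inter> chart_dom c)) (f \<circ> coords_inv c)"
    using f c unfolding smooth_function_on_def by blast
  then have lin: "linear ?f'"
    using p by (intro has_derivative_linear[OF smooth_on_imp_derivative]) auto
  have "?f' x = ?f' (\<Sum>j\<in>UNIV. x $ j *\<^sub>R axis j 1)" by (simp add: vec_lambda_axis_sum[symmetric])
  also have "\<dots> = differential f c p \<bullet> x"
    by (simp add: linear_sum[OF lin] linear_scale[OF lin] differential_def partial_deriv_def inner_vec_def mult.commute)
  finally show ?thesis by simp
qed

lemma differential_transform:
  assumes c: "c \<in> A" and d: "d \<in> A" and p: "p \<in> chart_dom c" "p \<in> chart_dom d" and f: "smooth_function_on A UNIV f"
  shows "differential f c p \<bullet> x = differential f d p \<bullet> transition_deriv c d p x"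
proof -
  let ?S = "coords c ` (chart_dom c \<inter> chart_dom d)"
  have "smooth_on (coords d ` (UNIV \<inter> chart_dom d)) (f \<circ> coords_inv d)"
    using f d unfolding smooth_function_on_def by blast
  then have 1: "((f \<circ> coords_inv d) has_derivative frechet_derivative (f \<circ> coords_inv d) (at (coords d p)))
      (at ((coords d \<circ> coords_inv c) (coords c p)))"
    using smooth_on_imp_derivative[of _ "f \<circ> coords_inv d" "coords d p"] p c by auto
  have "((\<lambda>x. (f \<circ> coords_inv d) ((coords d \<circ> coords_inv c) x)) has_derivative
      (\<lambda>x. frechet_derivative (f \<circ> coords_inv d) (at (coords d p)) (transition_deriv c d p x))) (at (coords c p))"
    by (rule has_derivative_compose[OF transition_has_derivative[OF c d p] 1])
  then have "((f \<circ> coords_inv c) has_derivative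
      (\<lambda>x. frechet_derivative (f \<circ> coords_inv d) (at (coords d p)) (transition_deriv c d p x))) (at (coords c p))"
    by (rule has_derivative_transform_within_open[OF _ open_overlap[OF c d]]) (use p c d in auto)
  from frechet_derivative_at[OF this] show ?thesis
    using differential_inner[OF c p(1) f] differential_inner[OF d p(2) f] by metis
qed

end

context riemannian_manifold
begin

definition sharp :: "('a, 'n) chart \<Rightarrow> (('a, 'n) chart \<Rightarrow> 'a \<Rightarrow> real ^ 'n) \<Rightarrow> 'a \<Rightarrow> real ^ 'n" where
  "sharp c \<omega> p = matrix_inv (g c p) *v \<omega> c p"

lemma metric_sharp: "c \<in> A \<Longrightarrow> p \<in> chart_dom c \<Longrightarrow> g c p *v sharp c \<omega> p = \<omega> c p"
  using matrix_inv_mult(1)[OF posdef_det_nz[OF posdef_metric]]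
  by (simp add: sharp_def matrix_vector_mul_assoc)

lemma sharp_unique:
  assumes "c \<in> A" "p \<in> chart_dom c" "\<And>x. x \<bullet> (g c p *v u) = \<omega> c p \<bullet> x"
  shows "u = sharp c \<omega> p"
proof -
  have "g c p *v u = \<omega> c p"
    using assms(3) by (intro vector_eq_ldot[THEN iffD1]) (simp add: inner_commute)
  then have "matrix_inv (g c p) *v (g c p *v u) = sharp c \<omega> p" by (simp add: sharp_def)
  then show ?thesis
    using matrix_inv_mult(2)[OF posdef_det_nz[OF posdef_metric[OF assms(1,2)]]]
    by (simp add: matrix_vector_mul_assoc)
qed

lemma sharp_transform:
  assumes c: "c \<in> A" and d: "d \<in> A" and p: "p \<in> chart_dom c" "p \<in> chart_dom d"
    and \<omega>: "\<And>x. \<omega> c p \<bullet> x = \<omega> d p \<bullet> transition_deriv c d p x"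
  shows "transition_deriv c d p (sharp c \<omega> p) = sharp d \<omega> p"
proof (rule sharp_unique[OF d p(2)])
  fix y
  let ?x = "transition_deriv d c p y"
  have y: "transition_deriv c d p ?x = y"
    using transition_deriv_compose[OF d c d p(2,1,2)] transition_deriv_self[OF d p(2)] by simp
  have "?x \<bullet> (g c p *v sharp c \<omega> p) = y \<bullet> (g d p *v transition_deriv c d p (sharp c \<omega> p))"
    using metric_transform[OF c d, of p ?x "sharp c \<omega> p"] p y by simp
  then show "y \<bullet> (g d p *v transition_deriv c d p (sharp c \<omega> p)) = \<omega> d p \<bullet> y"
    using metric_sharp[OF c p(1), of \<omega>] \<omega>[of ?x] y by (simp add: inner_commute)
qed

text \<open>The vector density \<open>sqrt (det g) \<omega>\<^sup>#\<close>.  Its divergence is the plain sum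
  of partial derivatives, to which integration by parts in the chart applies.\<close>

definition flux :: "('a, 'n) chart \<Rightarrow> (('a, 'n) chart \<Rightarrow> 'a \<Rightarrow> real ^ 'n) \<Rightarrow> 'n \<Rightarrow> 'a \<Rightarrow> real" where
  "flux c \<omega> i p = vol c p * sharp c \<omega> p $ i"

text \<open>The expression that defines \<open>codifferential\<close>, in a chart of one's choice.\<close>

definition codiff_in :: "('a, 'n) chart \<Rightarrow> (('a, 'n) chart \<Rightarrow> 'a \<Rightarrow> real ^ 'n) \<Rightarrow> 'a \<Rightarrow> real" where
  "codiff_in c \<omega> p = - (\<Sum>i\<in>UNIV. \<Sum>j\<in>UNIV. matrix_inv (g c p) $ i $ j * covariant_deriv g \<omega> c p j i)"

lemma codifferential_chart_at: "codifferential A g \<omega> p = codiff_in (chart_at A p) \<omega> p"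
  by (simp add: codifferential_def codiff_in_def Let_def)

lemma flux_eq: "flux c \<omega> i p = vol c p * (\<Sum>j\<in>UNIV. matrix_inv (g c p) $ i $ j * \<omega> c p $ j)"
  by (simp add: flux_def sharp_def matrix_vector_mult_def)

lemma smooth_flux:
  assumes c: "c \<in> A" and S: "open S" and \<omega>: "smooth_one_form_on A S \<omega>"
  shows "smooth_on (coords c ` (S \<inter> chart_dom c)) (flux c \<omega> i \<circ> coords_inv c)"
proof -
  let ?S = "coords c ` (S \<inter> chart_dom c)"
  note op = open_coords_image[OF c S]
  have sub: "?S \<subseteq> coords c ` chart_dom c" by auto
  have "smooth_on ?S (\<lambda>x. vol c (coords_inv c x) *
      (\<Sum>j\<in>UNIV. matrix_inv (g c (coords_inv c x)) $ i $ j * (\<omega> c \<circ> coords_inv c) x $ j))"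
    by (intro smooth_intros op smooth_on_subset[OF smooth_vol[OF c] sub] smooth_on_subset[OF smooth_metric[OF c] sub]
        smooth_one_form_onD[OF \<omega> c]) (use posdef_det_nz[OF posdef_metric[OF c]] c in auto)
  then show ?thesis by (simp add: o_def flux_eq)
qed

lemma codiff_in_flux:
  assumes c: "c \<in> A" and S: "open S" "p \<in> S" and p: "p \<in> chart_dom c" and \<omega>: "smooth_one_form_on A S \<omega>"
  shows "vol c p * codiff_in c \<omega> p = - (\<Sum>i\<in>UNIV. partial_deriv c i (flux c \<omega> i) p)"
proof -
  let ?S = "coords c ` (S \<inter> chart_dom c)" and ?x = "coords c p"
  have sub: "?S \<subseteq> coords c ` chart_dom c" by auto
  have x: "?x \<in> ?S" using S p by auto
  have "smooth_on ?S (\<lambda>x. g c (coords_inv c x))" by (rule smooth_on_subset[OF smooth_metric[OF c] sub])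
  moreover have "posdef (g c (coords_inv c x))" if "x \<in> ?S" for x using that c by (auto intro: posdef_metric)
  moreover have "smooth_on ?S (\<lambda>x. \<omega> c (coords_inv c x))" using smooth_one_form_onD[OF \<omega> c] by (simp add: o_def)
  ultimately show ?thesis
    using divergence_formula[OF open_coords_image[OF c S(1)] x, of "\<lambda>x. g c (coords_inv c x)" "\<lambda>x. \<omega> c (coords_inv c x)"] c p
    by (simp add: codiff_in_def covariant_deriv_def christoffel_def partial_deriv_def o_def flux_eq vol_def)
qed

lemma flux_add: "flux c (\<lambda>c p. \<omega> c p + \<theta> c p) i p = flux c \<omega> i p + flux c \<theta> i p"
  by (simp add: flux_eq sum.distrib algebra_simps)

lemma flux_scale: "flux c (\<lambda>c p. b p *\<^sub>R \<omega> c p) i p = b p * flux c \<omega> i p"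
  by (simp add: flux_eq sum_distrib_left algebra_simps)

lemma codiff_in_cong:
  assumes "c \<in> A" "open S" "p \<in> S" "p \<in> chart_dom c" "\<And>q. q \<in> S \<Longrightarrow> \<omega> c q = \<theta> c q"
  shows "codiff_in c \<omega> p = codiff_in c \<theta> p"
proof -
  have "partial_deriv c j (\<lambda>q. \<omega> c q $ i) p = partial_deriv c j (\<lambda>q. \<theta> c q $ i) p" for i j
    by (rule partial_deriv_cong[OF assms(1-4)]) (simp add: assms(5))
  then show ?thesis using assms(3,5) by (simp add: codiff_in_def covariant_deriv_def)
qed

lemma codifferential_cong:
  assumes "open S" "p \<in> S" "\<And>c q. c \<in> A \<Longrightarrow> q \<in> S \<Longrightarrow> \<omega> c q = \<theta> c q"
  shows "codifferential A g \<omega> p = codifferential A g \<theta> p"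
  unfolding codifferential_chart_at
  by (rule codiff_in_cong[OF _ assms(1,2)]) (use chart_at assms(3) in auto)

text \<open>The Leibniz rule.  The second term involves only tensors, so it takes the same value in all
  charts.\<close>

lemma codiff_in_scale:
  assumes c: "c \<in> A" and S: "open S" "p \<in> S" and p: "p \<in> chart_dom c" and \<omega>: "smooth_one_form_on A S \<omega>"
    and b: "smooth_function_on A S b"
  shows "vol c p * codiff_in c (\<lambda>c p. b p *\<^sub>R \<omega> c p) p
    = b p * (vol c p * codiff_in c \<omega> p) - vol c p * (differential b c p \<bullet> sharp c \<omega> p)"
proof -
  have sb: "smooth_on (coords c ` (S \<inter> chart_dom c)) (b \<circ> coords_inv c)"
    using b c unfolding smooth_function_on_def by blast
  have "vol c p * codiff_in c (\<lambda>c p. b p *\<^sub>R \<omega> c p) p = - (\<Sum>i\<in>UNIV. partial_deriv c i (\<lambda>p. b p * flux c \<omega> i p) p)"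
    using codiff_in_flux[OF c S p smooth_one_form_on_scale[OF S(1) b \<omega>]] by (simp add: flux_scale[abs_def])
  also have "\<dots> = - (\<Sum>i\<in>UNIV. b p * partial_deriv c i (flux c \<omega> i) p + partial_deriv c i b p * flux c \<omega> i p)"
    by (simp add: partial_deriv_mult[OF c S(2) p sb smooth_flux[OF c S(1) \<omega>]])
  also have "\<dots> = b p * (- (\<Sum>i\<in>UNIV. partial_deriv c i (flux c \<omega> i) p)) - (\<Sum>i\<in>UNIV. partial_deriv c i b p * flux c \<omega> i p)"
    by (simp add: sum.distrib sum_distrib_left)
  also have "(\<Sum>i\<in>UNIV. partial_deriv c i b p * flux c \<omega> i p) = vol c p * (differential b c p \<bullet> sharp c \<omega> p)"
    by (simp add: flux_def inner_vec_def differential_def sum_distrib_left algebra_simps)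
  finally show ?thesis by (simp only: codiff_in_flux[OF c S p \<omega>])
qed

lemma smooth_codiff_in:
  assumes c: "c \<in> A" and S: "open S" and \<omega>: "smooth_one_form_on A S \<omega>"
  shows "smooth_on (coords c ` (S \<inter> chart_dom c)) (codiff_in c \<omega> \<circ> coords_inv c)"
proof (rule smooth_on_cong)
  let ?S = "coords c ` (S \<inter> chart_dom c)"
  show op: "open ?S" by (rule open_coords_image[OF c S])
  have sub: "?S \<subseteq> coords c ` chart_dom c" by auto
  show "smooth_on ?S (\<lambda>x. - (\<Sum>i\<in>UNIV. (partial_deriv c i (flux c \<omega> i) \<circ> coords_inv c) x) / vol c (coords_inv c x))"
    by (intro smooth_intros op smooth_partial_deriv[OF c S] smooth_flux[OF c S \<omega>] smooth_on_subset[OF smooth_vol[OF c] sub])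
      (use vol_pos[OF c] c in force)
  fix x assume "x \<in> ?S"
  then obtain p where p: "p \<in> S" "p \<in> chart_dom c" "x = coords c p" by auto
  have "vol c p \<noteq> 0" using vol_pos[OF c p(2)] by simp
  then show "- (\<Sum>i\<in>UNIV. (partial_deriv c i (flux c \<omega> i) \<circ> coords_inv c) x) / vol c (coords_inv c x) = (codiff_in c \<omega> \<circ> coords_inv c) x"
    using codiff_in_flux[OF c S p(1,2) \<omega>] p(2,3) c by (simp add: field_simps)
qed

context
  fixes c S \<theta> K
  assumes c: "c \<in> A" and S: "open S" and \<theta>: "smooth_one_form_on A S \<theta>"
    and K: "compact K" "K \<subseteq> S \<inter> chart_dom c" "\<And>p. p \<notin> K \<Longrightarrow> \<theta> c p = 0"
begin

lemma flux_eq_0: "p \<notin> K \<Longrightarrow> flux c \<theta> i p = 0"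
  using K(3) by (simp add: flux_eq)

lemma smooth_in_chart_flux: "smooth_on UNIV (in_chart c (flux c \<theta> i))"
  by (rule smooth_in_chart[OF c S K(1,2) flux_eq_0 smooth_flux[OF c S \<theta>]])

lemma in_chart_flux_support: obtains a b where "\<And>i x. x \<notin> cbox a b \<Longrightarrow> in_chart c (flux c \<theta> i) x = 0"
proof -
  have "compact (coords c ` K)" using K by (intro compact_coords_image c) auto
  then obtain a b where ab: "coords c ` K \<subseteq> cbox a b" using compact_imp_bounded bounded_subset_cbox_symmetric by metis
  have "in_chart c (flux c \<theta> i) x = 0" if "x \<notin> cbox a b" for i x
    by (rule in_chart_eq_0[OF c flux_eq_0]) (use ab that in auto)
  then show ?thesis by (rule that)
qed

lemma codiff_in_eq_0: "p \<in> chart_dom c \<Longrightarrow> p \<notin> K \<Longrightarrow> codiff_in c \<theta> p = 0"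
proof -
  assume p: "p \<in> chart_dom c" "p \<notin> K"
  have "codiff_in c \<theta> p = codiff_in c (\<lambda>c p. 0) p"
    by (rule codiff_in_cong[OF c, of "- K"]) (use p K compact_imp_closed[OF K(1)] in auto)
  also have "\<dots> = 0"
    by (simp add: codiff_in_def covariant_deriv_def partial_deriv_def o_def frechet_derivative_const)
  finally show ?thesis .
qed

text \<open>With compact support in the chart, the density \<open>sqrt (det g) d\<^sup>*\<theta>\<close> is
  minus a sum of partial derivatives on the whole coordinate space, so integration by parts applies to
  it.\<close>

lemma in_chart_codiff:
  "in_chart c (\<lambda>p. vol c p * codiff_in c \<theta> p) x = - (\<Sum>i\<in>UNIV. partial i (in_chart c (flux c \<theta> i)) x)"
proof -
  have KD: "K \<subseteq> chart_dom c" using K by auto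
  have "partial i (in_chart c (flux c \<theta> i)) x = in_chart c (partial_deriv c i (flux c \<theta> i)) x" for i
    by (rule partial_in_chart[OF c K(1) KD flux_eq_0])
  moreover have "vol c p * codiff_in c \<theta> p = - (\<Sum>i\<in>UNIV. partial_deriv c i (flux c \<theta> i) p)" if p: "p \<in> chart_dom c" for p
  proof (cases "p \<in> S")
    case True
    show ?thesis by (rule codiff_in_flux[OF c S True p \<theta>])
  next
    case False
    then have pK: "p \<notin> K" using K by auto
    have "partial_deriv c i (flux c \<theta> i) p = 0" for i
    proof -
      have "partial_deriv c i (flux c \<theta> i) p = partial_deriv c i (\<lambda>_. 0) p"
        by (rule partial_deriv_cong[OF c, of "- K"]) (use p pK flux_eq_0 compact_imp_closed[OF K(1)] in auto)
      then show ?thesis by (simp add: partial_deriv_def o_def frechet_derivative_const)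
    qed
    then show ?thesis using codiff_in_eq_0[OF p pK] by simp
  qed
  ultimately show ?thesis using c by (auto simp: in_chart_def)
qed

lemma integral_in_chart_codiff: "(\<integral>x. in_chart c (\<lambda>p. vol c p * codiff_in c \<theta> p) x \<partial>lborel) = 0"
proof -
  obtain a b where ab: "\<And>i x. x \<notin> cbox a b \<Longrightarrow> in_chart c (flux c \<theta> i) x = 0"
    using in_chart_flux_support by blast
  show ?thesis unfolding in_chart_codiff
    by (simp add: Bochner_Integration.integral_sum integrable_partial[OF smooth_in_chart_flux ab] integral_partial[OF smooth_in_chart_flux ab])
qed

lemma integral_in_chart_codiff_half_space:
  shows "(\<integral>x. indicator {x. x $ k < 0} x * in_chart c (\<lambda>p. vol c p * codiff_in c \<theta> p) x \<partial>lborel)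
      = - (\<integral>x. in_chart c (flux c \<theta> k) x \<partial>hyperplane_measure k)"
    "(\<integral>x. indicator {x. x $ k > 0} x * in_chart c (\<lambda>p. vol c p * codiff_in c \<theta> p) x \<partial>lborel)
      = (\<integral>x. in_chart c (flux c \<theta> k) x \<partial>hyperplane_measure k)"
proof -
  obtain a b where ab: "\<And>i x. x \<notin> cbox a b \<Longrightarrow> in_chart c (flux c \<theta> i) x = 0"
    using in_chart_flux_support by blast
  have int: "integrable lborel (\<lambda>x. indicator {x. x $ k < 0} x * partial i (in_chart c (flux c \<theta> i)) x)"
    "integrable lborel (\<lambda>x. indicator {x. x $ k > 0} x * partial i (in_chart c (flux c \<theta> i)) x)" for i
    using integrable_mult_indicator[OF _ integrable_partial[OF smooth_in_chart_flux ab, where i = i], of "{x. x $ k < 0}"]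
      integrable_mult_indicator[OF _ integrable_partial[OF smooth_in_chart_flux ab, where i = i], of "{x. x $ k > 0}"] by auto
  show "(\<integral>x. indicator {x. x $ k < 0} x * in_chart c (\<lambda>p. vol c p * codiff_in c \<theta> p) x \<partial>lborel)
      = - (\<integral>x. in_chart c (flux c \<theta> k) x \<partial>hyperplane_measure k)"
  proof -
    have "(\<integral>x. indicator {x. x $ k < 0} x * in_chart c (\<lambda>p. vol c p * codiff_in c \<theta> p) x \<partial>lborel)
      = (\<integral>x. - (\<Sum>i\<in>UNIV. indicator {x. x $ k < 0} x * partial i (in_chart c (flux c \<theta> i)) x) \<partial>lborel)"
      unfolding in_chart_codiff by (simp only: mult_minus_right sum_distrib_left)
    also have "\<dots> = - (\<Sum>i\<in>UNIV. (\<integral>x. indicator {x. x $ k < 0} x * partial i (in_chart c (flux c \<theta> i)) x \<partial>lborel))"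
      by (subst Bochner_Integration.integral_minus, subst Bochner_Integration.integral_sum) (simp_all only: int)
    also have "\<dots> = - (\<Sum>i\<in>UNIV. if i = k then (\<integral>x. in_chart c (flux c \<theta> i) x \<partial>hyperplane_measure k) else 0)"
    proof -
      have "(\<integral>x. indicator {x. x $ k < 0} x * partial i (in_chart c (flux c \<theta> i)) x \<partial>lborel)
        = (if i = k then (\<integral>x. in_chart c (flux c \<theta> i) x \<partial>hyperplane_measure k) else 0)" for i
        by (rule integral_partial_half_space(1)[OF smooth_in_chart_flux ab])
      then show ?thesis by (simp only:)
    qed
    finally show ?thesis by simp
  qed
  show "(\<integral>x. indicator {x. x $ k > 0} x * in_chart c (\<lambda>p. vol c p * codiff_in c \<theta> p) x \<partial>lborel)
      = (\<integral>x. in_chart c (flux c \<theta> k) x \<partial>hyperplane_measure k)"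
  proof -
    have "(\<integral>x. indicator {x. x $ k > 0} x * in_chart c (\<lambda>p. vol c p * codiff_in c \<theta> p) x \<partial>lborel)
      = (\<integral>x. - (\<Sum>i\<in>UNIV. indicator {x. x $ k > 0} x * partial i (in_chart c (flux c \<theta> i)) x) \<partial>lborel)"
      unfolding in_chart_codiff by (simp only: mult_minus_right sum_distrib_left)
    also have "\<dots> = - (\<Sum>i\<in>UNIV. (\<integral>x. indicator {x. x $ k > 0} x * partial i (in_chart c (flux c \<theta> i)) x \<partial>lborel))"
      by (subst Bochner_Integration.integral_minus, subst Bochner_Integration.integral_sum) (simp_all only: int)
    also have "\<dots> = - (\<Sum>i\<in>UNIV. if i = k then - (\<integral>x. in_chart c (flux c \<theta> i) x \<partial>hyperplane_measure k) else 0)"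
    proof -
      have "(\<integral>x. indicator {x. x $ k > 0} x * partial i (in_chart c (flux c \<theta> i)) x \<partial>lborel)
        = (if i = k then - (\<integral>x. in_chart c (flux c \<theta> i) x \<partial>hyperplane_measure k) else 0)" for i
        by (rule integral_partial_half_space(2)[OF smooth_in_chart_flux ab])
      then show ?thesis by (simp only:)
    qed
    finally show ?thesis by simp
  qed
qed

end

end

section \<open>Chart independence of the codifferential\<close>

lemma smooth_on_matrix_vector_mult [smooth_intros]:
  fixes M :: "'a::real_normed_vector \<Rightarrow> real ^ 'n ^ 'm"
  assumes "open S" "smooth_on S M" "smooth_on S v"
  shows "smooth_on S (\<lambda>x. M x *v v x)"
  unfolding matrix_vector_mult_def using assms by (intro smooth_intros)

context smooth_manifold
begin

lemma smooth_function_extend_zero: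
  assumes "open S" "smooth_function_on A S f" "compact K" "K \<subseteq> S" "\<And>p. p \<notin> K \<Longrightarrow> f p = 0"
  shows "smooth_function_on A UNIV f"
proof (rule smooth_function_on_locally)
  fix p
  have "open (- K)" using compact_imp_closed[OF assms(3)] by auto
  moreover from this have "smooth_function_on A (- K) f"
    by (rule smooth_function_on_cong[OF _ _ smooth_function_on_const[of _ 0]]) (use assms in auto)
  ultimately show "\<exists>T. open T \<and> p \<in> T \<and> smooth_function_on A T f"
    using assms(1,2,4) by (cases "p \<in> K") blast+
qed

lemma smooth_function_measurable:
  "smooth_function_on A UNIV f \<Longrightarrow> f \<in> borel_measurable borel"
  by (intro borel_measurable_continuous_onI smooth_function_imp_continuous) auto

end

context riemannian_manifold
begin

lemma smooth_in_chart_vol: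
  assumes c: "c \<in> A" and f: "smooth_function_on A UNIV f" and K: "compact K" "K \<subseteq> chart_dom c" "\<And>p. p \<notin> K \<Longrightarrow> f p = 0"
  shows "smooth_on UNIV (in_chart c (\<lambda>p. vol c p * f p))"
proof (rule smooth_in_chart[OF c open_UNIV K(1)])
  have "smooth_on (coords c ` chart_dom c) (f \<circ> coords_inv c)"
    using f c by (auto simp: smooth_function_on_def)
  then have "smooth_on (coords c ` chart_dom c) (\<lambda>x. vol c (coords_inv c x) * (f \<circ> coords_inv c) x)"
    by (intro smooth_intros smooth_vol open_chart_range c)
  then show "smooth_on (coords c ` (UNIV \<inter> chart_dom c)) ((\<lambda>p. vol c p * f p) \<circ> coords_inv c)"
    by (simp add: o_def)
qed (use K in auto)

lemma integrable_riemannian: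
  assumes c: "c \<in> A" and f: "smooth_function_on A UNIV f" and K: "compact K" "K \<subseteq> chart_dom c" "\<And>p. p \<notin> K \<Longrightarrow> f p = 0"
  shows "integrable (riemannian_measure A g) f"
proof -
  have "compact (coords c ` K)" using K by (intro compact_coords_image c) auto
  then obtain a b where ab: "coords c ` K \<subseteq> cbox a b" using compact_imp_bounded bounded_subset_cbox_symmetric by metis
  have "integrable lborel (in_chart c (\<lambda>p. vol c p * f p))"
  proof (rule integrable_continuous_support_cbox)
    show "continuous_on UNIV (in_chart c (\<lambda>p. vol c p * f p))"
      by (rule smooth_on_imp_continuous_on[OF smooth_in_chart_vol[OF c f K]])
    show "in_chart c (\<lambda>p. vol c p * f p) x = 0" if "x \<notin> cbox a b" for x
      by (rule in_chart_eq_0[OF c, of K]) (use K ab that in auto)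
  qed
  then show ?thesis
    using integral_riemannian_chart(2)[OF c smooth_function_measurable[OF f]] K by blast
qed

lemma integral_riemannian_pos:
  assumes c: "c \<in> A" and f: "smooth_function_on A UNIV f" and K: "compact K" "K \<subseteq> chart_dom c" "\<And>p. p \<notin> K \<Longrightarrow> f p = 0"
    and nn: "\<And>p. f p \<ge> 0" and p: "f p > 0"
  shows "integral\<^sup>L (riemannian_measure A g) f > 0"
proof -
  have f0: "f p = 0" if "p \<notin> chart_dom c" for p using K that by blast
  note ic = integral_riemannian_chart[OF c smooth_function_measurable[OF f] f0]
  have pc: "p \<in> chart_dom c" using p f0 by force
  have "(\<integral>x. in_chart c (\<lambda>p. vol c p * f p) x \<partial>lborel) > 0"
  proof (rule integral_lborel_pos)
    show "continuous_on UNIV (in_chart c (\<lambda>p. vol c p * f p))"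
      by (rule smooth_on_imp_continuous_on[OF smooth_in_chart_vol[OF c f K]])
    show "integrable lborel (in_chart c (\<lambda>p. vol c p * f p))"
      using integrable_riemannian[OF c f K] ic(2) by simp
    show "in_chart c (\<lambda>p. vol c p * f p) x \<ge> 0" for x
      using nn vol_pos[OF c] c by (auto simp: in_chart_def intro!: mult_nonneg_nonneg[OF less_imp_le])
    show "in_chart c (\<lambda>p. vol c p * f p) (coords c p) > 0"
      using pc p vol_pos[OF c pc] c by (simp add: in_chart_def)
  qed
  then show ?thesis using ic(1) by simp
qed

lemma smooth_function_codiff_in:
  assumes c: "c \<in> A" and S: "open S" "S \<subseteq> chart_dom c" and \<omega>: "smooth_one_form_on A S \<omega>"
  shows "smooth_function_on A S (codiff_in c \<omega>)"
  using smooth_codiff_in[OF c S(1) \<omega>] S(2) by (intro smooth_function_onI_chart[OF c S]) (simp add: Int_absorb2)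

lemma integral_codiff_in:
  assumes c: "c \<in> A" and S: "open S" "S \<subseteq> chart_dom c" and \<theta>: "smooth_one_form_on A S \<theta>"
    and K: "compact K" "K \<subseteq> S" "\<And>p. p \<notin> K \<Longrightarrow> \<theta> c p = 0"
  defines "u \<equiv> \<lambda>p. if p \<in> S then codiff_in c \<theta> p else 0"
  shows "smooth_function_on A UNIV u" "\<And>p. p \<notin> K \<Longrightarrow> u p = 0"
    "integrable (riemannian_measure A g) u" "integral\<^sup>L (riemannian_measure A g) u = 0"
proof -
  have K': "K \<subseteq> S \<inter> chart_dom c" "K \<subseteq> chart_dom c" using K S by auto
  show u0: "\<And>p. p \<notin> K \<Longrightarrow> u p = 0"
    using codiff_in_eq_0[OF c S(1) \<theta> K(1) K'(1) K(3)] S(2) by (auto simp: u_def)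
  have "smooth_function_on A S u"
    by (rule smooth_function_on_cong[OF S(1) _ smooth_function_codiff_in[OF c S \<theta>]]) (simp add: u_def)
  then show u: "smooth_function_on A UNIV u"
    using K u0 by (intro smooth_function_extend_zero[OF S(1)]) auto
  show "integrable (riemannian_measure A g) u"
    by (rule integrable_riemannian[OF c u K(1) K'(2) u0])
  have "in_chart c (\<lambda>p. vol c p * u p) = in_chart c (\<lambda>p. vol c p * codiff_in c \<theta> p)"
  proof -
    have "u p = codiff_in c \<theta> p" if "p \<in> chart_dom c" for p
      using u0[of p] codiff_in_eq_0[OF c S(1) \<theta> K(1) K'(1) K(3) that] K(2) by (cases "p \<in> K") (auto simp: u_def)
    then show ?thesis using c by (auto simp: in_chart_def fun_eq_iff)
  qed
  moreover have "u p = 0" if "p \<notin> chart_dom c" for p using u0 that K' by blast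
  ultimately show "integral\<^sup>L (riemannian_measure A g) u = 0"
    using integral_riemannian_chart(1)[OF c smooth_function_measurable[OF u]]
      integral_in_chart_codiff[OF c S(1) \<theta> K(1) K'(1) K(3)] by simp
qed

text \<open>If the two expressions differed at \<open>p\<close>, multiply \<open>\<omega>\<close> by a bump
  \<open>b\<close> supported where the difference \<open>h\<close> is positive.  By the Leibniz rule the
  expressions for \<open>b \<omega>\<close> differ by \<open>b h\<close>, the other terms being tensorial;
  this has positive integral.  But each expression for \<open>b \<omega>\<close> is a divergence in its chart
  and integrates to zero.\<close>

lemma codiff_in_not_less:
  assumes c: "c \<in> A" and d: "d \<in> A" and S: "open S" "p \<in> S" and p: "p \<in> chart_dom c" "p \<in> chart_dom d"
    and \<omega>: "smooth_one_form_on A S \<omega>"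
  shows "\<not> codiff_in d \<omega> p < codiff_in c \<omega> p"
proof
  assume lt: "codiff_in d \<omega> p < codiff_in c \<omega> p"
  define R where "R = S \<inter> chart_dom c \<inter> chart_dom d"
  have R: "open R" "p \<in> R" "R \<subseteq> chart_dom c" "R \<subseteq> chart_dom d" "R \<subseteq> S"
    using S p open_chart_dom[OF c] open_chart_dom[OF d] by (auto simp: R_def)
  note \<omega>R = smooth_one_form_on_subset[OF \<omega> R(5)]
  define h where "h q = codiff_in c \<omega> q - codiff_in d \<omega> q" for q
  have h: "smooth_function_on A R h" unfolding h_def
    by (intro smooth_function_on_diff R smooth_function_codiff_in c d \<omega>R)
  have "open (R \<inter> h -` {0<..})"
    by (intro continuous_open_preimage smooth_function_imp_continuous R h) auto
  moreover have "p \<in> R \<inter> h -` {0<..}" using lt R by (simp add: h_def)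
  ultimately obtain b K where b: "smooth_function_on A UNIV b" "\<And>q. b q \<ge> 0" "b p > 0"
    and K: "compact K" "K \<subseteq> R \<inter> h -` {0<..}" "\<And>q. q \<notin> K \<Longrightarrow> b q = 0"
    by (rule manifold_bump) blast
  let ?\<theta> = "\<lambda>c q. b q *\<^sub>R \<omega> c q"
  have bR: "smooth_function_on A R b" using b(1) by (rule smooth_function_on_subset) simp
  have \<theta>: "smooth_one_form_on A R ?\<theta>" by (rule smooth_one_form_on_scale[OF R(1) bR \<omega>R])
  have KR: "K \<subseteq> R" using K by auto
  have \<theta>0: "\<And>q. q \<notin> K \<Longrightarrow> ?\<theta> e q = 0" for e by (simp add: K(3))
  define uc where "uc = (\<lambda>q. if q \<in> R then codiff_in c ?\<theta> q else 0)"
  define ud where "ud = (\<lambda>q. if q \<in> R then codiff_in d ?\<theta> q else 0)"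
  note uc = integral_codiff_in[OF c R(1,3) \<theta> K(1) KR \<theta>0, folded uc_def]
  note ud = integral_codiff_in[OF d R(1,4) \<theta> K(1) KR \<theta>0, folded ud_def]
  have scale: "codiff_in e ?\<theta> q = b q * codiff_in e \<omega> q - differential b e q \<bullet> sharp e \<omega> q"
    if "e \<in> A" "q \<in> R" "q \<in> chart_dom e" for e q
  proof -
    have "vol e q * codiff_in e ?\<theta> q = vol e q * (b q * codiff_in e \<omega> q - differential b e q \<bullet> sharp e \<omega> q)"
      unfolding codiff_in_scale[OF that(1) R(1) that(2,3) \<omega>R bR] by (simp add: algebra_simps)
    then show ?thesis using vol_pos[OF that(1,3)] by simp
  qed
  have eq: "uc q - ud q = b q * h q" if "q \<in> R" for q
  proof -
    have q: "q \<in> chart_dom c" "q \<in> chart_dom d" "q \<in> S" using that R by auto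
    have "transition_deriv c d q (sharp c \<omega> q) = sharp d \<omega> q"
      by (rule sharp_transform[OF c d q(1,2)]) (rule one_form_eq[OF \<omega> c d q(3,1,2)])
    then have "differential b c q \<bullet> sharp c \<omega> q = differential b d q \<bullet> sharp d \<omega> q"
      using differential_transform[OF c d q(1,2) b(1), of "sharp c \<omega> q"] by simp
    then show ?thesis using that scale[OF c that q(1)] scale[OF d that q(2)]
      by (simp add: uc_def ud_def h_def right_diff_distrib)
  qed
  let ?f = "\<lambda>q. uc q - ud q"
  have f: "smooth_function_on A UNIV ?f" by (intro smooth_function_on_diff uc ud) simp
  have f0: "?f q = 0" if "q \<notin> K" for q
    using uc(2)[OF _ that] ud(2)[OF _ that] by (simp add: uc_def ud_def)
  have "integral\<^sup>L (riemannian_measure A g) ?f > 0"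
  proof (rule integral_riemannian_pos[OF c f K(1) _ f0])
    show "K \<subseteq> chart_dom c" using KR R by auto
    show "?f q \<ge> 0" for q
    proof (cases "q \<in> K")
      case True
      then have "q \<in> R" "h q > 0" using K(2) by auto
      then show ?thesis unfolding eq[OF \<open>q \<in> R\<close>] using b(2)[of q] by simp
    next
      case False
      then show ?thesis using f0 by simp
    qed
    show "?f p > 0" using eq[OF R(2)] b(3) lt by (simp add: h_def)
  qed
  moreover have "integral\<^sup>L (riemannian_measure A g) ?f = 0" using uc(3,4) ud(3,4) by simp
  ultimately show False by simp
qed

theorem codifferential_chart:
  assumes "c \<in> A" "open S" "p \<in> S" "p \<in> chart_dom c" "smooth_one_form_on A S \<omega>"
  shows "codifferential A g \<omega> p = codiff_in c \<omega> p"
  unfolding codifferential_chart_at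
  using codiff_in_not_less[OF assms(1) chart_at(1) assms(2-4) chart_at(2) assms(5)]
    codiff_in_not_less[OF chart_at(1) assms(1) assms(2,3) chart_at(2) assms(4,5)]
  by (meson linorder_neqE_linordered_idom)

lemma smooth_codifferential:
  assumes S: "open S" and \<omega>: "smooth_one_form_on A S \<omega>"
  shows "smooth_function_on A S (codifferential A g \<omega>)"
proof (rule smooth_function_on_locally)
  fix p assume p: "p \<in> S"
  let ?c = "chart_at A p" and ?T = "S \<inter> chart_dom (chart_at A p)"
  have T: "open ?T" using S open_chart_dom[OF chart_at(1)] by auto
  have \<omega>T: "smooth_one_form_on A ?T \<omega>" by (rule smooth_one_form_on_subset[OF \<omega>]) auto
  have "smooth_function_on A ?T (codifferential A g \<omega>)"
    by (rule smooth_function_on_cong[OF T _ smooth_function_codiff_in[OF chart_at(1) T _ \<omega>T]])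
      (use codifferential_chart[OF chart_at(1) S _ _ \<omega>] in auto)
  then show "\<exists>T. open T \<and> p \<in> T \<and> smooth_function_on A T (codifferential A g \<omega>)"
    using T p chart_at(2) by blast
qed

lemma codifferential_zero: "codifferential A g (\<lambda>c p. 0) p = 0"
  by (simp add: codifferential_chart_at codiff_in_def covariant_deriv_def partial_deriv_def o_def frechet_derivative_const)

lemma codifferential_add:
  assumes S: "open S" "p \<in> S" and \<omega>: "smooth_one_form_on A S \<omega>" and \<theta>: "smooth_one_form_on A S \<theta>"
  shows "codifferential A g (\<lambda>c p. \<omega> c p + \<theta> c p) p = codifferential A g \<omega> p + codifferential A g \<theta> p"
proof -
  define c where "c = chart_at A p"
  have c: "c \<in> A" and p: "p \<in> chart_dom c" using chart_at by (auto simp: c_def)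
  have "vol c p * codiff_in c (\<lambda>c p. \<omega> c p + \<theta> c p) p = vol c p * (codiff_in c \<omega> p + codiff_in c \<theta> p)"
    using codiff_in_flux[OF c S p \<omega>] codiff_in_flux[OF c S p \<theta>]
      codiff_in_flux[OF c S p smooth_one_form_on_add[OF S(1) \<omega> \<theta>]]
    by (simp add: flux_add[abs_def] partial_deriv_add[OF c S(2) p smooth_flux[OF c S(1) \<omega>] smooth_flux[OF c S(1) \<theta>]]
        sum.distrib distrib_left)
  then show ?thesis using vol_pos[OF c p] by (simp add: codifferential_chart_at c_def[symmetric])
qed

lemma codifferential_scale:
  assumes S: "open S" "p \<in> S" and \<omega>: "smooth_one_form_on A S \<omega>"
  shows "codifferential A g (\<lambda>c p. a *\<^sub>R \<omega> c p) p = a * codifferential A g \<omega> p"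
proof -
  define c where "c = chart_at A p"
  have c: "c \<in> A" and p: "p \<in> chart_dom c" using chart_at by (auto simp: c_def)
  have "differential (\<lambda>_. a) c p = 0"
    by (simp add: differential_def partial_deriv_def o_def frechet_derivative_const vec_eq_iff)
  then show ?thesis
    using codiff_in_scale[OF c S p \<omega> smooth_function_on_const[of _ a]] vol_pos[OF c p]
    by (simp add: codifferential_chart_at c_def[symmetric])
qed

lemma codifferential_eq_0:
  assumes "closed K" "p \<notin> K" "\<And>c q. c \<in> A \<Longrightarrow> q \<notin> K \<Longrightarrow> \<omega> c q = 0"
  shows "codifferential A g \<omega> p = 0"
  using codifferential_cong[of "- K" p \<omega> "\<lambda>c p. 0"] assms codifferential_zero by auto

section \<open>Local solvability\<close>

text \<open>Transport of \<open>box_poincare\<close> by a chart: a vector field \<open>X\<close> with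
  divergence \<open>sqrt (det g) h - \<kappa> \<rho>\<close> is, up to sign, the flux density of the form
  \<open>g X / sqrt (det g)\<close>.  The function \<open>r\<close> is the fixed bump \<open>\<rho> / sqrt
  (det g)\<close>, and \<open>\<kappa>\<close> is determined by \<open>h\<close> because a codifferential of
  compact support has integral zero.\<close>

lemma local_coexactness:
  assumes S: "open S" "p \<in> S"
  obtains c N r where "c \<in> A" "N \<subseteq> chart_dom c" "open N" "p \<in> N" "N \<subseteq> S"
    "integral\<^sup>L (riemannian_measure A g) r \<noteq> 0"
    "\<And>h K. smooth_function_on A UNIV h \<Longrightarrow> compact K \<Longrightarrow> K \<subseteq> N \<Longrightarrow> (\<And>q. q \<notin> K \<Longrightarrow> h q = 0) \<Longrightarrow>
      \<exists>U L \<kappa>. smooth_one_form_on A UNIV U \<and> compact L \<and> L \<subseteq> S \<and> (\<forall>c\<in>A. \<forall>q. q \<notin> L \<longrightarrow> U c q = 0) \<and>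
        (\<forall>q. h q = codifferential A g U q + \<kappa> * r q) \<and>
        integral\<^sup>L (riemannian_measure A g) h = \<kappa> * integral\<^sup>L (riemannian_measure A g) r"
proof -
  define c where "c = chart_at A p"
  have c: "c \<in> A" and p: "p \<in> chart_dom c" using chart_at by (auto simp: c_def)
  let ?D = "coords c ` chart_dom c"
  have "open (coords c ` (S \<inter> chart_dom c))" "coords c p \<in> coords c ` (S \<inter> chart_dom c)"
    using open_coords_image[OF c S(1)] S p by auto
  then obtain \<alpha> \<beta> where box: "cbox \<alpha> \<beta> \<subseteq> coords c ` (S \<inter> chart_dom c)" "coords c p \<in> box \<alpha> \<beta>" 
    by (metis open_contains_cbox)
  have ab: "\<alpha> $ i < \<beta> $ i" for i using box(2) unfolding mem_box_cart by (meson less_trans)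
  obtain \<rho> where \<rho>: "smooth_on UNIV \<rho>" "\<And>x. x \<notin> cbox \<alpha> \<beta> \<Longrightarrow> \<rho> x = 0" "\<And>x. \<rho> x \<ge> 0" "\<exists>x. \<rho> x > 0"
    and dec: "\<And>h. smooth_on UNIV h \<Longrightarrow> (\<And>x. x \<notin> cbox \<alpha> \<beta> \<Longrightarrow> h x = 0) \<Longrightarrow>
      \<exists>X \<kappa>. (\<forall>i. smooth_on UNIV (X i) \<and> (\<forall>x. x \<notin> cbox \<alpha> \<beta> \<longrightarrow> X i x = 0)) \<and>
        (\<forall>x. h x = (\<Sum>i\<in>UNIV. partial i (X i) x) + \<kappa> * \<rho> x)"
    using box_poincare[of \<alpha> \<beta>, OF ab] by blast
  define K0 where "K0 = coords_inv c ` cbox \<alpha> \<beta>"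
  have boxD: "cbox \<alpha> \<beta> \<subseteq> ?D" using box by auto
  have K0: "compact K0" "K0 \<subseteq> S" "K0 \<subseteq> chart_dom c"
    using box(1) c compact_coords_inv_image[OF c compact_cbox boxD] by (auto simp: K0_def coords_image_eq)
  define N where "N = chart_dom c \<inter> coords c -` box \<alpha> \<beta>"
  have N: "open N" "p \<in> N" "N \<subseteq> K0"
  proof -
    show "open N" unfolding N_def by (intro open_coords_preimage c open_box)
    show "p \<in> N" using p box by (simp add: N_def)
    show "N \<subseteq> K0"
    proof
      fix q assume "q \<in> N"
      then have "coords c q \<in> cbox \<alpha> \<beta>" "q = coords_inv c (coords c q)"
        using box_subset_cbox[of \<alpha> \<beta>] c by (auto simp: N_def)
      then show "q \<in> K0" unfolding K0_def by blast
    qed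
  qed
  define r where "r = from_chart c (\<lambda>x. \<rho> x / vol c (coords_inv c x))"
  have r0: "\<And>q. q \<notin> K0 \<Longrightarrow> r q = 0"
    unfolding r_def K0_def by (rule from_chart_eq_0[OF c]) (use \<rho>(2) in auto)
  have r: "smooth_function_on A UNIV r" unfolding r_def
  proof (rule smooth_from_chart[OF c _ compact_cbox boxD])
    show "smooth_on ?D (\<lambda>x. \<rho> x / vol c (coords_inv c x))"
      by (intro smooth_intros open_chart_range c smooth_vol smooth_on_subset[OF \<rho>(1)]) (use vol_pos[OF c] c in force)+
  qed (use \<rho>(2) in auto)
  have rpos: "integral\<^sup>L (riemannian_measure A g) r > 0"
  proof -
    obtain x where x: "\<rho> x > 0" using \<rho>(4) by blast
    then have "x \<in> ?D" using \<rho>(2)[of x] boxD by force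
    then obtain q where q: "x = coords c q" "q \<in> chart_dom c" by auto
    show ?thesis
    proof (rule integral_riemannian_pos[OF c r K0(1,3) r0])
      show "r q \<ge> 0" for q using \<rho>(3) vol_pos[OF c] c
        by (auto simp: r_def from_chart_def intro!: divide_nonneg_pos)
      show "r q > 0" using q x vol_pos[OF c q(2)] c by (simp add: r_def from_chart_def)
    qed
  qed
  show ?thesis
  proof (rule that[OF c _ N(1,2)])
    show "N \<subseteq> chart_dom c" "N \<subseteq> S" using N K0 by auto
    show "integral\<^sup>L (riemannian_measure A g) r \<noteq> 0" using rpos by simp
    fix h K assume h: "smooth_function_on A UNIV h" and "compact K" "K \<subseteq> N" and "\<And>q. q \<notin> K \<Longrightarrow> h q = 0"
    then have h0: "\<And>q. q \<notin> K0 \<Longrightarrow> h q = 0" using N(3) by blast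
    have H0: "in_chart c (\<lambda>q. vol c q * h q) x = 0" if "x \<notin> cbox \<alpha> \<beta>" for x
    proof (rule in_chart_eq_0[OF c])
      show "vol c q * h q = 0" if "q \<notin> K0" for q using h0 that by simp
      have "coords c ` K0 = cbox \<alpha> \<beta>" using boxD c by (force simp: K0_def image_image)
      then show "x \<notin> coords c ` K0" using that by simp
    qed
    obtain X \<kappa> where X: "\<And>i. smooth_on UNIV (X i)" "\<And>i x. x \<notin> cbox \<alpha> \<beta> \<Longrightarrow> X i x = 0"
      and XH: "\<And>x. in_chart c (\<lambda>q. vol c q * h q) x = (\<Sum>i\<in>UNIV. partial i (X i) x) + \<kappa> * \<rho> x"
      using dec[OF smooth_in_chart_vol[OF c h K0(1,3) h0] H0] by blast
    define w where "w = from_chart c (\<lambda>x. (- inverse (vol c (coords_inv c x))) *\<^sub>R (g c (coords_inv c x) *v (\<chi> i. X i x)))"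
    have "smooth_on ?D (\<lambda>x. (- inverse (vol c (coords_inv c x))) *\<^sub>R (g c (coords_inv c x) *v (\<chi> i. X i x)))"
      by (intro smooth_intros open_chart_range c smooth_vol smooth_metric smooth_on_subset[OF X(1)])
        (use vol_pos[OF c] c in force)+
    from smooth_from_chart_dom[OF c this] have ws: "smooth_on ?D (w \<circ> coords_inv c)" by (simp add: w_def)
    have w0: "\<And>q. q \<notin> K0 \<Longrightarrow> w q = 0"
      unfolding w_def K0_def
    proof (rule from_chart_eq_0[OF c])
      fix x assume "x \<notin> cbox \<alpha> \<beta>"
      then have "(\<chi> i. X i x) = 0" by (simp add: X(2) vec_eq_iff)
      then show "(- inverse (vol c (coords_inv c x))) *\<^sub>R (g c (coords_inv c x) *v (\<chi> i. X i x)) = 0" by simp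
    qed
    define U where "U = chart_form c w"
    have U: "smooth_one_form_on A UNIV U" unfolding U_def by (rule smooth_chart_form[OF c ws K0(1,3) w0])
    have U0: "U d q = 0" if "q \<notin> K0" for d q unfolding U_def by (rule chart_form_eq_0) (rule w0[OF that])
    have flux: "flux c U i q = - X i (coords c q)" if q: "q \<in> chart_dom c" for i q
    proof -
      have "sharp c U q = (- inverse (vol c q)) *\<^sub>R (\<chi> i. X i (coords c q))"
        using matrix_inv_mult(2)[OF posdef_det_nz[OF posdef_metric[OF c q]]] q c
        by (simp add: sharp_def U_def chart_form_self w_def from_chart_def matrix_vector_mult_scaleR matrix_vector_mul_assoc
            del: scaleR_minus_left)
      then show ?thesis using vol_pos[OF c q] by (simp add: flux_def)
    qed
    have cod: "vol c q * codiff_in c U q = (\<Sum>i\<in>UNIV. partial i (X i) (coords c q))" if q: "q \<in> chart_dom c" for q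
    proof -
      have "partial_deriv c i (flux c U i) q = - partial i (X i) (coords c q)" for i
      proof -
        have "frechet_derivative (flux c U i \<circ> coords_inv c) (at (coords c q)) = frechet_derivative (\<lambda>x. (-1) * X i x) (at (coords c q))"
          by (rule frechet_derivative_cong_open[OF open_chart_range[OF c]]) (use q c flux in auto)
        then show ?thesis
          using frechet_derivative_cmult_real[OF smooth_on_imp_differentiable[OF X(1) UNIV_I], of "-1"] by (simp add: partial_deriv_def)
      qed
      then show ?thesis using codiff_in_flux[OF c open_UNIV UNIV_I q U] by (simp add: sum_negf)
    qed
    have hq: "h q = codifferential A g U q + \<kappa> * r q" for q
    proof (cases "q \<in> chart_dom c")
      case True
      have "vol c q * h q = vol c q * (codifferential A g U q + \<kappa> * r q)"
        using XH[of "coords c q"] cod[OF True] True c vol_pos[OF c True] codifferential_chart[OF c open_UNIV UNIV_I True U]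
        by (simp add: in_chart_def r_def from_chart_def distrib_left)
      then show ?thesis using vol_pos[OF c True] by simp
    next
      case False
      then have "q \<notin> K0" using K0 by auto
      then show ?thesis using h0 r0 codifferential_eq_0[OF compact_imp_closed[OF K0(1)] _ U0] by auto
    qed
    define u where "u = (\<lambda>p. if p \<in> chart_dom c then codiff_in c U p else 0)"
    note uI = integral_codiff_in[OF c open_chart_dom[OF c] order_refl smooth_one_form_on_subset[OF U subset_UNIV] K0(1,3) U0, folded u_def]
    have u: "codifferential A g U q = u q" for q
    proof (cases "q \<in> chart_dom c")
      case True
      then show ?thesis using codifferential_chart[OF c open_UNIV UNIV_I True U] by (simp add: u_def)
    next
      case False
      then have "q \<notin> K0" using K0 by auto
      then show ?thesis using codifferential_eq_0[OF compact_imp_closed[OF K0(1)] _ U0] False by (auto simp: u_def)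
    qed
    have "integral\<^sup>L (riemannian_measure A g) h = integral\<^sup>L (riemannian_measure A g) (\<lambda>q. u q + \<kappa> * r q)"
      using hq u by (metis (no_types, lifting) ext)
    also have "\<dots> = \<kappa> * integral\<^sup>L (riemannian_measure A g) r"
      using uI(3,4) integrable_riemannian[OF c r K0(1,3) r0] by simp
    finally have int: "integral\<^sup>L (riemannian_measure A g) h = \<kappa> * integral\<^sup>L (riemannian_measure A g) r" .
    show "\<exists>U L \<kappa>. smooth_one_form_on A UNIV U \<and> compact L \<and> L \<subseteq> S \<and> (\<forall>c\<in>A. \<forall>q. q \<notin> L \<longrightarrow> U c q = 0) \<and>
        (\<forall>q. h q = codifferential A g U q + \<kappa> * r q) \<and>
        integral\<^sup>L (riemannian_measure A g) h = \<kappa> * integral\<^sup>L (riemannian_measure A g) r"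
      using U U0 hq int K0 by (intro exI[of _ U] exI[of _ K0] exI[of _ \<kappa>]) auto
  qed
qed

end

section \<open>The range of the codifferential on compactly supported forms\<close>

text \<open>Extend a basis of \<open>E\<close> by \<open>f\<close> to a basis of the space of all
  functions.\<close>

lemma separating_functional:
  fixes E :: "('a \<Rightarrow> real) set" and f :: "'a \<Rightarrow> real"
  assumes zero: "(\<lambda>p. 0) \<in> E" and add: "\<And>u v. u \<in> E \<Longrightarrow> v \<in> E \<Longrightarrow> (\<lambda>p. u p + v p) \<in> E"
    and scale: "\<And>a u. u \<in> E \<Longrightarrow> (\<lambda>p. a * u p) \<in> E" and f: "f \<notin> E"
  obtains L :: "('a \<Rightarrow> real) \<Rightarrow> real" where "\<And>u v. L (\<lambda>p. u p + v p) = L u + L v"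
    "\<And>a u. L (\<lambda>p. a * u p) = a * L u" "\<And>u. u \<in> E \<Longrightarrow> L u = 0" "L f = 1"
proof -
  define sc where "sc a u = (\<lambda>p. a * u p)" for a :: real and u :: "'a \<Rightarrow> real"
  interpret V: vector_space sc
    by unfold_locales (auto simp: sc_def fun_eq_iff algebra_simps)
  interpret R: vector_space "(*) :: real \<Rightarrow> real \<Rightarrow> real"
    by unfold_locales (auto simp: algebra_simps)
  interpret VR: vector_space_pair sc "(*) :: real \<Rightarrow> real \<Rightarrow> real" ..
  have sub: "V.subspace E"
  proof (rule V.subspaceI)
    show "0 \<in> E" using zero by (simp add: zero_fun_def)
    show "x + y \<in> E" if "x \<in> E" "y \<in> E" for x y using add[OF that] by (simp add: plus_fun_def)
    show "sc a x \<in> E" if "x \<in> E" for a x using scale[OF that] by (simp add: sc_def)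
  qed
  obtain B where B: "B \<subseteq> E" "V.independent B" "E \<subseteq> V.span B"
    using V.maximal_independent_subset[of E] by blast
  have "V.span B = E" using B V.span_minimal[OF B(1) sub] by auto
  then have "V.independent (insert f B)" using B(2) f by (simp add: V.independent_insert)
  from VR.linear_independent_extend[OF this, of "\<lambda>x. if x = f then 1 else 0"]
  obtain L where L: "Vector_Spaces.linear sc (*) L" "\<And>x. x \<in> insert f B \<Longrightarrow> L x = (if x = f then 1 else 0)" by blast
  interpret L: Vector_Spaces.linear sc "(*) :: real \<Rightarrow> real \<Rightarrow> real" L by (rule L(1))
  show ?thesis
  proof
    show "L (\<lambda>p. u p + v p) = L u + L v" for u v using L.add[of u v] by (simp add: plus_fun_def)
    show "L (\<lambda>p. a * u p) = a * L u" for a u using L.scale[of a u] by (simp add: sc_def)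
    show "L f = 1" using L(2) by simp
    have "L x = 0" if "x \<in> B" for x using L(2)[of x] that B(1) f by auto
    then have "L u = 0" if "u \<in> V.span B" for u using VR.linear_eq_0_on_span[OF L(1) _ that] by blast
    then show "L u = 0" if "u \<in> E" for u using that B(3) by blast
  qed
qed

context smooth_manifold
begin

definition locally_constant_on :: "'a set \<Rightarrow> ('a \<Rightarrow> real) \<Rightarrow> bool" where
  "locally_constant_on S v \<longleftrightarrow> (\<forall>p\<in>S. \<exists>N a. open N \<and> p \<in> N \<and> (\<forall>q\<in>N. v q = a))"

lemma locally_constant_onE:
  assumes "locally_constant_on S v" "p \<in> S"
  obtains N a where "open N" "p \<in> N" "\<forall>q\<in>N. v q = a"
  using assms unfolding locally_constant_on_def by blast

lemma locally_constant_smooth: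
  assumes "locally_constant_on S v"
  shows "smooth_function_on A S v"
proof (rule smooth_function_on_locally)
  fix p assume "p \<in> S"
  with assms obtain N a where "open N" "p \<in> N" "\<forall>q\<in>N. v q = a"
    by (rule locally_constant_onE)
  moreover from this have "smooth_function_on A N v"
    using smooth_function_on_cong[OF _ _ smooth_function_on_const[of N a], of v] by simp
  ultimately show "\<exists>T. open T \<and> p \<in> T \<and> smooth_function_on A T v" by blast
qed

lemma locally_constant_zero_differential:
  assumes "locally_constant_on S v"
  shows "zero_differential_on A S v"
  unfolding zero_differential_on_def
proof (intro ballI)
  fix c p assume c: "c \<in> A" and p: "p \<in> S \<inter> chart_dom c"
  from p have "p \<in> S" by simp
  with assms obtain N a where N: "open N" "p \<in> N" "\<forall>q\<in>N. v q = a"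
    by (rule locally_constant_onE)
  have "partial_deriv c i v p = 0" for i
  proof -
    have "partial_deriv c i v p = partial_deriv c i (\<lambda>_. a) p"
      by (rule partial_deriv_cong[OF c N(1,2)]) (use p N(3) in auto)
    then show ?thesis by (simp add: partial_deriv_def o_def frechet_derivative_const)
  qed
  then show "differential v c p = 0" by (simp add: differential_def vec_eq_iff)
qed

end

context riemannian_manifold
begin

definition coexact_on :: "'a set \<Rightarrow> ('a \<Rightarrow> real) set" where
  "coexact_on S = {f. \<exists>U L. smooth_one_form_on A UNIV U \<and> compact L \<and> L \<subseteq> S \<and>
     (\<forall>c\<in>A. \<forall>q. q \<notin> L \<longrightarrow> U c q = 0) \<and> f = codifferential A g U}"

lemma coexact_on_zero: "(\<lambda>p. 0) \<in> coexact_on S"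
  unfolding coexact_on_def
  using smooth_one_form_on_zero codifferential_zero
  by (auto intro!: exI[of _ "\<lambda>c p. 0"] exI[of _ "{}"])

lemma coexact_on_add:
  assumes "u \<in> coexact_on S" "v \<in> coexact_on S"
  shows "(\<lambda>p. u p + v p) \<in> coexact_on S"
proof -
  obtain U K where U: "smooth_one_form_on A UNIV U" "compact K" "K \<subseteq> S" "\<And>c q. c \<in> A \<Longrightarrow> q \<notin> K \<Longrightarrow> U c q = 0"
    "u = codifferential A g U" using assms(1) by (auto simp: coexact_on_def)
  obtain V L where V: "smooth_one_form_on A UNIV V" "compact L" "L \<subseteq> S" "\<And>c q. c \<in> A \<Longrightarrow> q \<notin> L \<Longrightarrow> V c q = 0"
    "v = codifferential A g V" using assms(2) by (auto simp: coexact_on_def)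
  show ?thesis unfolding coexact_on_def mem_Collect_eq
    using U V smooth_one_form_on_add[OF open_UNIV U(1) V(1)] codifferential_add[OF open_UNIV UNIV_I U(1) V(1)]
    by (intro exI[of _ "\<lambda>c p. U c p + V c p"] exI[of _ "K \<union> L"]) auto
qed

lemma coexact_on_scale:
  assumes "u \<in> coexact_on S"
  shows "(\<lambda>p. a * u p) \<in> coexact_on S"
proof -
  obtain U K where U: "smooth_one_form_on A UNIV U" "compact K" "K \<subseteq> S" "\<And>c q. c \<in> A \<Longrightarrow> q \<notin> K \<Longrightarrow> U c q = 0"
    "u = codifferential A g U" using assms(1) by (auto simp: coexact_on_def)
  show ?thesis unfolding coexact_on_def mem_Collect_eq
    using U smooth_one_form_on_scale[OF open_UNIV smooth_function_on_const U(1), of a] codifferential_scale[OF open_UNIV UNIV_I U(1)]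
    by (intro exI[of _ "\<lambda>c p. a *\<^sub>R U c p"] exI[of _ K]) auto
qed

text \<open>Multiply \<open>f\<close> by the normalised bumps of a cover of its support.\<close>

lemma smooth_decomposition:
  assumes f: "smooth_function_on A UNIV f" and K: "compact K" "\<And>q. q \<notin> K \<Longrightarrow> f q = 0"
    and N: "\<And>p. p \<in> K \<Longrightarrow> open (N p) \<and> p \<in> N p"
  obtains P F L where "finite P" "P \<subseteq> K" "\<And>p. p \<in> P \<Longrightarrow> smooth_function_on A UNIV (F p)"
    "\<And>p. p \<in> P \<Longrightarrow> compact (L p)" "\<And>p. p \<in> P \<Longrightarrow> L p \<subseteq> N p" "\<And>p q. p \<in> P \<Longrightarrow> q \<notin> L p \<Longrightarrow> F p q = 0"
    "\<And>q. f q = (\<Sum>p\<in>P. F p q)"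
proof -
  obtain P b L where P: "finite P" "P \<subseteq> K" and b: "\<And>p. p \<in> P \<Longrightarrow> smooth_function_on A UNIV (b p)"
    "\<And>p q. p \<in> P \<Longrightarrow> b p q \<ge> 0" and L: "\<And>p. p \<in> P \<Longrightarrow> compact (L p)" "\<And>p. p \<in> P \<Longrightarrow> L p \<subseteq> N p"
    "\<And>p q. p \<in> P \<Longrightarrow> q \<notin> L p \<Longrightarrow> b p q = 0" and pos: "\<And>q. q \<in> K \<Longrightarrow> (\<Sum>p\<in>P. b p q) > (0::real)"
    using bump_cover[OF K(1) N] by blast
  define s where "s q = (\<Sum>p\<in>P. b p q)" for q
  have s: "smooth_function_on A UNIV s" unfolding s_def by (intro smooth_function_on_sum b) auto
  have os: "open {q. s q > 0}"
    by (intro open_Collect_less continuous_on_const smooth_function_imp_continuous s) auto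
  have fs: "smooth_function_on A UNIV (\<lambda>q. f q / s q)"
  proof (rule smooth_function_extend_zero[OF os _ K(1)])
    show "smooth_function_on A {q. s q > 0} (\<lambda>q. f q / s q)"
      by (rule smooth_function_on_divide[OF os])
        (auto intro: smooth_function_on_subset[OF f] smooth_function_on_subset[OF s])
  qed (use pos K(2) in \<open>auto simp: s_def\<close>)
  show ?thesis
  proof (rule that[OF P])
    show "smooth_function_on A UNIV (\<lambda>q. b p q * (f q / s q))" if "p \<in> P" for p
      by (intro smooth_function_on_mult b that fs) simp
    show "b p q * (f q / s q) = 0" if "p \<in> P" "q \<notin> L p" for p q using L(3)[OF that] by simp
    show "f q = (\<Sum>p\<in>P. b p q * (f q / s q))" for q
    proof (cases "q \<in> K")
      case True
      then have "s q \<noteq> 0" using pos by (force simp: s_def)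
      moreover have "(\<Sum>p\<in>P. b p q * (f q / s q)) = s q * (f q / s q)"
        unfolding s_def by (simp only: sum_distrib_right)
      ultimately show ?thesis by simp
    qed (simp add: K(2))
  qed (use L in auto)
qed

text \<open>A functional that separates \<open>f\<close> from the range is locally a multiple of the integral,
  and the local factors form a locally constant function \<open>v\<close>; so \<open>L f = \<integral> f v =
  0\<close>, which contradicts \<open>L f = 1\<close>.\<close>

theorem coexact_if_orthogonal_to_locally_constant:
  assumes S: "open S" and f: "smooth_function_on A UNIV f" and K: "compact K" "K \<subseteq> S" "\<And>q. q \<notin> K \<Longrightarrow> f q = 0"
    and orth: "\<And>v. locally_constant_on S v \<Longrightarrow> integral\<^sup>L (riemannian_measure A g) (\<lambda>p. f p * v p) = 0"
  shows "f \<in> coexact_on S"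
proof (rule ccontr)
  assume "f \<notin> coexact_on S"
  then obtain L :: "('a \<Rightarrow> real) \<Rightarrow> real" where L: "\<And>u v. L (\<lambda>p. u p + v p) = L u + L v"
    "\<And>a u. L (\<lambda>p. a * u p) = a * L u" "\<And>u. u \<in> coexact_on S \<Longrightarrow> L u = 0" "L f = 1"
    using separating_functional[OF coexact_on_zero coexact_on_add coexact_on_scale] by blast
  let ?I = "integral\<^sup>L (riemannian_measure A g)"
  \<comment> \<open>\<open>L\<close> is \<open>a\<close> times the integral on the functions with compact
    support in \<open>N\<close>.\<close>
  define Q where "Q p a N \<longleftrightarrow> open N \<and> p \<in> N \<and> N \<subseteq> S \<and> (\<exists>c\<in>A. N \<subseteq> chart_dom c) \<and>
    (\<forall>h K. smooth_function_on A UNIV h \<and> compact K \<and> K \<subseteq> N \<and> (\<forall>q. q \<notin> K \<longrightarrow> h q = 0) \<longrightarrow> L h = a * ?I h)" for p a N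
  have "\<forall>p\<in>S. \<exists>a N. Q p a N"
  proof
    fix p assume p: "p \<in> S"
    show "\<exists>a N. Q p a N"
    proof (rule local_coexactness[OF S p])
    fix c N r assume c: "c \<in> A" "N \<subseteq> chart_dom c" "open N" "p \<in> N" "N \<subseteq> S" and r: "?I r \<noteq> 0"
      and ex: "\<And>h K. smooth_function_on A UNIV h \<Longrightarrow> compact K \<Longrightarrow> K \<subseteq> N \<Longrightarrow> (\<And>q. q \<notin> K \<Longrightarrow> h q = 0) \<Longrightarrow>
      \<exists>U L \<kappa>. smooth_one_form_on A UNIV U \<and> compact L \<and> L \<subseteq> S \<and> (\<forall>c\<in>A. \<forall>q. q \<notin> L \<longrightarrow> U c q = 0) \<and>
        (\<forall>q. h q = codifferential A g U q + \<kappa> * r q) \<and> ?I h = \<kappa> * ?I r"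
    have "L h = (L r / ?I r) * ?I h"
      if h: "smooth_function_on A UNIV h" "compact K" "K \<subseteq> N" "\<And>q. q \<notin> K \<Longrightarrow> h q = 0" for h K
    proof -
      obtain U M \<kappa> where U: "smooth_one_form_on A UNIV U" "compact M" "M \<subseteq> S" "\<forall>c\<in>A. \<forall>q. q \<notin> M \<longrightarrow> U c q = 0"
        and hq: "\<And>q. h q = codifferential A g U q + \<kappa> * r q" and I: "?I h = \<kappa> * ?I r"
        using ex[OF h] by blast
      have "codifferential A g U \<in> coexact_on S" using U by (auto simp: coexact_on_def)
      then have "L (codifferential A g U) = 0" by (rule L(3))
      moreover have "h = (\<lambda>q. codifferential A g U q + \<kappa> * r q)" using hq by blast
      ultimately have "L h = \<kappa> * L r" using L(1,2) by simp
      then show ?thesis using I r by simp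
    qed
    then have "Q p (L r / ?I r) N" unfolding Q_def using c by blast
    then show "\<exists>a N. Q p a N" by blast
    qed
  qed
  from bchoice[OF this] obtain v where "\<forall>p\<in>S. \<exists>N. Q p (v p) N" by blast
  from bchoice[OF this] obtain N where N: "\<And>p. p \<in> S \<Longrightarrow> Q p (v p) (N p)" by blast
  have NQ: "open (N p)" "p \<in> N p" "N p \<subseteq> S" "\<exists>c\<in>A. N p \<subseteq> chart_dom c"
    "\<And>h K. smooth_function_on A UNIV h \<Longrightarrow> compact K \<Longrightarrow> K \<subseteq> N p \<Longrightarrow> (\<And>q. q \<notin> K \<Longrightarrow> h q = 0) \<Longrightarrow> L h = v p * ?I h"
    if "p \<in> S" for p
    using N[OF that] unfolding Q_def by blast+
  \<comment> \<open>Both factors can be read off from a bump supported in both neighbourhoods, whose integral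
    is positive.\<close>
  have const: "v q = v p" if p: "p \<in> S" and q: "q \<in> N p" for p q
  proof -
    have qS: "q \<in> S" using NQ(3)[OF p] q by auto
    obtain c where c: "c \<in> A" "N p \<subseteq> chart_dom c" using NQ(4)[OF p] by blast
    have "open (N p \<inter> N q)" "q \<in> N p \<inter> N q" using NQ(1)[OF p] NQ(1,2)[OF qS] q by auto
    then obtain b M where b: "smooth_function_on A UNIV b" "\<And>q. b q \<ge> 0" "b q > 0"
      and M: "compact M" "M \<subseteq> N p \<inter> N q" "\<And>q. q \<notin> M \<Longrightarrow> b q = 0" by (rule manifold_bump) blast
    have "?I b > 0"
      by (rule integral_riemannian_pos[OF c(1) b(1) M(1) _ M(3) b(2,3)]) (use M(2) c(2) in auto)
    moreover have "v p * ?I b = v q * ?I b"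
      using NQ(5)[OF p b(1) M(1) _ M(3)] NQ(5)[OF qS b(1) M(1) _ M(3)] M(2) by auto
    ultimately show ?thesis by simp
  qed
  have lc: "locally_constant_on S v"
    unfolding locally_constant_on_def using NQ(1,2) const by blast
  have NK: "open (N p) \<and> p \<in> N p" if "p \<in> K" for p using NQ(1,2) K(2) that by blast
  obtain P F C where P: "finite P" "P \<subseteq> K" and F: "\<And>p. p \<in> P \<Longrightarrow> smooth_function_on A UNIV (F p)"
    and C: "\<And>p. p \<in> P \<Longrightarrow> compact (C p)" "\<And>p. p \<in> P \<Longrightarrow> C p \<subseteq> N p" "\<And>p q. p \<in> P \<Longrightarrow> q \<notin> C p \<Longrightarrow> F p q = 0"
    and fF: "\<And>q. f q = (\<Sum>p\<in>P. F p q)"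
    using smooth_decomposition[OF f K(1,3) NK] by metis
  have PS: "p \<in> S" if "p \<in> P" for p using P K that by auto
  have Lsum: "L (\<lambda>q. \<Sum>p\<in>P'. F p q) = (\<Sum>p\<in>P'. L (F p))" if "finite P'" for P'
    using that
  proof induction
    case empty
    show ?case using L(3)[OF coexact_on_zero] by simp
  next
    case (insert p P')
    then show ?case using L(1)[of "F p" "\<lambda>q. \<Sum>p\<in>P'. F p q"] by simp
  qed
  have Fv: "(\<lambda>q. F p q * v q) = (\<lambda>q. v p * F p q)" if "p \<in> P" for p
  proof
    fix q show "F p q * v q = v p * F p q"
      using C(3)[OF that, of q] const[OF PS[OF that], of q] C(2)[OF that] by (cases "q \<in> C p") auto
  qed
  have int: "integrable (riemannian_measure A g) (F p)" if p: "p \<in> P" for p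
  proof -
    obtain c where c: "c \<in> A" "N p \<subseteq> chart_dom c" using NQ(4)[OF PS[OF p]] by blast
    show ?thesis by (rule integrable_riemannian[OF c(1) F[OF p] C(1)[OF p] _ C(3)[OF p]]) (use c C(2)[OF p] in auto)
  qed
  have "f = (\<lambda>q. \<Sum>p\<in>P. F p q)" by (rule ext) (rule fF)
  then have "1 = L (\<lambda>q. \<Sum>p\<in>P. F p q)" using L(4) by simp
  also have "\<dots> = (\<Sum>p\<in>P. L (F p))" by (rule Lsum[OF P(1)])
  also have "\<dots> = (\<Sum>p\<in>P. ?I (\<lambda>q. F p q * v q))"
  proof (rule sum.cong[OF refl])
    fix p assume p: "p \<in> P"
    show "L (F p) = ?I (\<lambda>q. F p q * v q)"
      unfolding Fv[OF p] using NQ(5)[OF PS[OF p] F[OF p] C(1,2)[OF p] C(3)[OF p]] by simp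
  qed
  also have "\<dots> = ?I (\<lambda>q. \<Sum>p\<in>P. F p q * v q)"
    by (rule Bochner_Integration.integral_sum[symmetric]) (use Fv int in simp)
  also have "\<dots> = ?I (\<lambda>q. f q * v q)" by (simp add: fF sum_distrib_right)
  also have "\<dots> = 0" by (rule orth[OF lc])
  finally show False by simp
qed

lemma form_support_subset:
  assumes "compact K" "\<And>c q. c \<in> A \<Longrightarrow> q \<notin> K \<Longrightarrow> U c q = 0"
  shows "form_support A S U \<subseteq> K"
  unfolding form_support_def by (rule closure_minimal) (use assms compact_imp_closed in auto)

theorem codifferential_solvable:
  fixes \<Omega> :: "'a set"
  assumes \<Omega>: "open \<Omega>" and f: "smooth_function_on A UNIV f"
    and K: "compact (closure {p. f p \<noteq> 0})" "closure {p. f p \<noteq> 0} \<subseteq> \<Omega>"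
    and orth: "\<And>v. smooth_function_on A \<Omega> v \<Longrightarrow> zero_differential_on A \<Omega> v \<Longrightarrow>
      (LINT p:\<Omega>|riemannian_measure A g. f p * v p) = 0"
  obtains U where "smooth_one_form_on A UNIV U" "compact (form_support A UNIV U)"
    "form_support A UNIV U \<subseteq> \<Omega>" "\<And>p. codifferential A g U p = f p"
proof -
  let ?K = "closure {p. f p \<noteq> 0}"
  have f0: "f q = 0" if "q \<notin> ?K" for q using that closure_subset[of "{p. f p \<noteq> 0}"] by blast
  have "f \<in> coexact_on \<Omega>"
  proof (rule coexact_if_orthogonal_to_locally_constant[OF \<Omega> f K f0])
    fix v assume v: "locally_constant_on \<Omega> v"
    have "(LINT p:\<Omega>|riemannian_measure A g. f p * v p) = integral\<^sup>L (riemannian_measure A g) (\<lambda>p. f p * v p)"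
      unfolding set_lebesgue_integral_def
    proof (rule Bochner_Integration.integral_cong[OF refl])
      fix p
      show "indicator \<Omega> p *\<^sub>R (f p * v p) = f p * v p"
        using f0[of p] K(2) by (cases "p \<in> \<Omega>") auto
    qed
    then show "integral\<^sup>L (riemannian_measure A g) (\<lambda>p. f p * v p) = 0"
      using orth[OF locally_constant_smooth[OF v] locally_constant_zero_differential[OF v]] by simp
  qed
  then obtain U L where U: "smooth_one_form_on A UNIV U" "compact L" "L \<subseteq> \<Omega>"
    "\<And>c q. c \<in> A \<Longrightarrow> q \<notin> L \<Longrightarrow> U c q = 0" "f = codifferential A g U" by (auto simp: coexact_on_def)
  have sub: "form_support A UNIV U \<subseteq> L" by (rule form_support_subset[OF U(2,4)])
  have "compact (form_support A UNIV U)"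
    using compact_Int_closed[OF U(2), of "form_support A UNIV U"] sub
    by (simp add: form_support_def Int_absorb1)
  then show ?thesis using that U sub by blast
qed

end

section \<open>Cutoff functions and domains near a smooth boundary point\<close>

text \<open>On the slab over the hyperplane the function is bounded and vanishes outside a bounded
  box.\<close>

lemma integrable_hyperplane_measure:
  fixes X :: "real ^ 'n::finite \<Rightarrow> real"
  assumes c: "continuous_on UNIV X" and z: "\<And>x. x \<notin> cbox a b \<Longrightarrow> X x = 0"
  shows "integrable (hyperplane_measure k) X"
proof -
  have m: "X \<in> borel_measurable borel" by (rule borel_measurable_continuous_onI[OF c])
  have "bounded (X ` cbox a b)"
    by (intro compact_imp_bounded compact_continuous_image continuous_on_subset[OF c]) auto
  then obtain B0 where B0: "\<And>x. x \<in> cbox a b \<Longrightarrow> \<bar>X x\<bar> \<le> B0" by (auto simp: bounded_iff)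
  define B where "B = max B0 0"
  have B: "\<bar>X x\<bar> \<le> B" "B \<ge> 0" for x using B0[of x] z[of x] by (cases "x \<in> cbox a b"; simp add: B_def le_max_iff_disj)+
  let ?Q = "cbox (set_coord k a 0) (set_coord k b 1)"
  have "(\<integral>\<^sup>+z. ennreal (norm (X z)) \<partial>hyperplane_measure k)
    = (\<integral>\<^sup>+x. ennreal (norm (X (set_coord k x 0))) * indicator {x. 0 < x $ k \<and> x $ k < 1} x \<partial>lborel)"
    using m by (intro nn_integral_hyperplane_thicken) measurable
  also have "\<dots> \<le> (\<integral>\<^sup>+x. ennreal B * indicator ?Q x \<partial>lborel)"
  proof (rule nn_integral_mono)
    fix x
    show "ennreal (norm (X (set_coord k x 0))) * indicator {x. 0 < x $ k \<and> x $ k < 1} x \<le> ennreal B * indicator ?Q x"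
    proof (cases "X (set_coord k x 0) \<noteq> 0 \<and> 0 < x $ k \<and> x $ k < 1")
      case True
      then have "set_coord k x 0 \<in> cbox a b" using z by blast
      then have "x \<in> ?Q" using True by (auto simp: mem_box_cart split: if_splits)
      then show ?thesis using B(1)[of "set_coord k x 0"] True by (simp add: ennreal_leI)
    qed auto
  qed
  also have "\<dots> < \<infinity>"
  proof -
    have "emeasure lborel ?Q < \<infinity>" by (rule emeasure_lborel_cbox_finite)
    then show ?thesis by (subst nn_integral_cmult_indicator) (auto simp: ennreal_mult_less_top)
  qed
  finally show ?thesis using m by (intro integrableI_bounded) auto
qed

text \<open>Column \<open>k\<close> is a unit vector, so the other entries of row \<open>k\<close> do not
  contribute.  With Cramer's rule this identifies \<open>principal_minor k G\<close> with \<open>det G\<close>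
  times the entry \<open>(k, k)\<close> of the inverse.\<close>

lemma det_column_replaced:
  fixes G :: "real ^ 'n::finite ^ 'n"
  shows "det (\<chi> i j. if j = k then axis k 1 $ i else G $ i $ j) = principal_minor k G"
  unfolding principal_minor_def det_def
proof (rule sum.cong[OF refl])
  fix p assume "p \<in> {p. p permutes (UNIV :: 'n set)}"
  then have p: "p permutes UNIV" by simp
  let ?M = "(\<chi> i j. if j = k then axis k 1 $ i else G $ i $ j) :: real ^ 'n ^ 'n"
  let ?P = "(\<chi> i j. if i = k \<or> j = k then if i = j then 1 else 0 else G $ i $ j) :: real ^ 'n ^ 'n"
  have "(\<Prod>i\<in>UNIV. ?M $ i $ p i) = (\<Prod>i\<in>UNIV. ?P $ i $ p i)"
  proof (cases "p k = k")
    case True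
    then have "p i \<noteq> k" if "i \<noteq> k" for i using permutes_inj[OF p] that by (metis injD)
    then have "?M $ i $ p i = ?P $ i $ p i" for i using True by (cases "i = k") (auto simp: axis_def)
    then show ?thesis by simp
  next
    case False
    obtain i where i: "p i = k" using permutes_surj[OF p] by (metis surjD)
    then have "i \<noteq> k" using False by auto
    then have "?M $ i $ p i = 0" "?P $ i $ p i = 0" using i by (auto simp: axis_def)
    then have "(\<Prod>i\<in>UNIV. ?M $ i $ p i) = 0" "(\<Prod>i\<in>UNIV. ?P $ i $ p i) = 0"
      by (metis (mono_tags, lifting) UNIV_I finite prod_zero)+
    then show ?thesis by (simp only:)
  qed
  then show "of_int (sign p) * (\<Prod>i\<in>UNIV. ?M $ i $ p i) = of_int (sign p) * (\<Prod>i\<in>UNIV. ?P $ i $ p i)"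
    by (simp only:)
qed

context smooth_manifold
begin

definition smooth_step :: "real \<Rightarrow> real" where "smooth_step t = flat 0 t / (flat 0 t + flat 0 (1 - t))"

lemma smooth_step: "smooth_on UNIV smooth_step" "t \<le> 0 \<Longrightarrow> smooth_step t = 0" "t \<ge> 1 \<Longrightarrow> smooth_step t = 1"
proof -
  have pos: "flat 0 t + flat 0 (1 - t) > 0" for t
    using flat_pos_iff[of t] flat_pos_iff[of "1 - t"] flat_nonneg[of t] flat_nonneg[of "1 - t"] by linarith
  have "flat 0 t + flat 0 (1 - t) \<noteq> 0" for t using pos[of t] by simp
  then show "smooth_on UNIV smooth_step" unfolding smooth_step_def[abs_def]
    by (intro smooth_intros open_UNIV)
  show "t \<le> 0 \<Longrightarrow> smooth_step t = 0" by (simp add: smooth_step_def flat_eq_0)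
  show "t \<ge> 1 \<Longrightarrow> smooth_step t = 1" using pos[of t] by (simp add: smooth_step_def flat_eq_0)
qed

text \<open>A sum of bumps is bounded below by a positive constant on \<open>K\<close>; composing it with a
  step function flattens it to \<open>1\<close> near \<open>K\<close>.\<close>

lemma cutoff_function:
  assumes K: "compact K" and S: "open S" "K \<subseteq> S"
  obtains f N L where "smooth_function_on A UNIV f" "open N" "K \<subseteq> N" "\<And>q. q \<in> N \<Longrightarrow> f q = 1"
    "compact L" "L \<subseteq> S" "\<And>q. q \<notin> L \<Longrightarrow> f q = 0"
proof -
  have NK: "open S \<and> p \<in> S" if "p \<in> K" for p using S that by auto
  show thesis
  proof (rule bump_cover[of K "\<lambda>_. S", OF K NK])
  fix P b L
  assume P: "finite P" and b: "\<And>p. p \<in> P \<Longrightarrow> smooth_function_on A UNIV (b p)"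
    and L: "\<And>p. p \<in> P \<Longrightarrow> compact (L p)" "\<And>p. p \<in> P \<Longrightarrow> L p \<subseteq> S"
    "\<And>p q. p \<in> P \<Longrightarrow> q \<notin> L p \<Longrightarrow> b p q = 0" and pos: "\<And>q. q \<in> K \<Longrightarrow> (\<Sum>p\<in>P. b p q) > (0::real)"
  define s where "s q = (\<Sum>p\<in>P. b p q)" for q
  have s: "smooth_function_on A UNIV s" unfolding s_def by (intro smooth_function_on_sum b) auto
  have cs: "continuous_on UNIV s" by (rule smooth_function_imp_continuous[OF open_UNIV s])
  obtain e where e: "e > 0" "\<And>q. q \<in> K \<Longrightarrow> e \<le> s q"
  proof (cases "K = {}")
    case False
    then obtain p where "p \<in> K" "\<forall>q\<in>K. s p \<le> s q"
      using continuous_attains_inf[OF K _ continuous_on_subset[OF cs]] by blast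
    then show ?thesis using that[of "s p"] pos by (auto simp: s_def)
  qed (use that[of 1] in auto)
  define f where "f q = smooth_step (2 / e * s q)" for q
  show thesis
  proof (rule that)
    show "smooth_function_on A UNIV f"
      unfolding smooth_function_on_def
    proof
      fix c assume c: "c \<in> A"
      have S: "open (coords c ` (UNIV \<inter> chart_dom c))" by (rule open_coords_image[OF c open_UNIV])
      have "smooth_on (coords c ` (UNIV \<inter> chart_dom c)) (s \<circ> coords_inv c)"
        using s c unfolding smooth_function_on_def by blast
      then have "smooth_on (coords c ` (UNIV \<inter> chart_dom c)) (\<lambda>x. 2 / e * (s \<circ> coords_inv c) x)"
        by (intro smooth_intros S)
      from smooth_on_compose[OF S _ this smooth_step(1)]
      show "smooth_on (coords c ` (UNIV \<inter> chart_dom c)) (f \<circ> coords_inv c)"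
        by (simp add: f_def o_def)
    qed
    show "open {q. e / 2 < s q}" by (intro open_Collect_less continuous_on_const cs)
    show "K \<subseteq> {q. e / 2 < s q}" using e by force
    show "f q = 1" if "q \<in> {q. e / 2 < s q}" for q
      unfolding f_def by (rule smooth_step(3)) (use that e in \<open>simp add: field_simps\<close>)
    show "compact (\<Union>p\<in>P. L p)" using P L by auto
    show "(\<Union>p\<in>P. L p) \<subseteq> S" using L by auto
    show "f q = 0" if "q \<notin> (\<Union>p\<in>P. L p)" for q
    proof -
      have "s q = 0" unfolding s_def by (rule sum.neutral) (use L(3) that in auto)
      then show ?thesis unfolding f_def by (simp add: smooth_step(2))
    qed
  qed
  qed
qed

text \<open>In a coordinate ball around \<open>p\<close> the boundary is the hyperplane, so each of the two
  open half balls is connected and does not meet the boundary, hence is contained in \<open>\<Omega>\<close>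
  or disjoint from it.  A vector that points out of \<open>\<Omega>\<close> decides which half ball is inside
  and that the other is outside.\<close>

lemma boundary_side:
  assumes \<Omega>: "open \<Omega>" and c: "(c, k) \<in> slice_charts A (frontier \<Omega>)" "c \<in> A"
    and p: "p \<in> frontier \<Omega>" "p \<in> chart_dom c" and X: "points_out_of A \<Omega> X p" and S: "open S" "p \<in> S"
  obtains T \<sigma> where "open T" "p \<in> T" "T \<subseteq> S" "T \<subseteq> chart_dom c" "\<sigma> = 1 \<or> \<sigma> = (- 1 :: real)"
    "T \<inter> \<Omega> = {q \<in> T. \<sigma> * coords c q $ k < 0}" "connected (T \<inter> \<Omega>)"
proof -
  let ?x = "coords c p" and ?X = "X c p"
  have slice: "q \<in> frontier \<Omega> \<longleftrightarrow> coords c q $ k = 0" if "q \<in> chart_dom c" for q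
    using c(1) that by (auto simp: slice_charts_def)
  have fr: "q \<notin> \<Omega>" if "q \<in> frontier \<Omega>" for q using that \<Omega> by (simp add: frontier_def interior_open)
  have "open (coords c ` (S \<inter> chart_dom c))" "?x \<in> coords c ` (S \<inter> chart_dom c)"
    using open_coords_image[OF c(2) S(1)] p S by auto
  then obtain r where r: "r > 0" "ball ?x r \<subseteq> coords c ` (S \<inter> chart_dom c)"
    by (meson openE)
  define T where "T = chart_dom c \<inter> coords c -` ball ?x r"
  have T: "open T" "p \<in> T" "T \<subseteq> chart_dom c"
    unfolding T_def using p r by (auto intro: open_coords_preimage[OF c(2)])
  have TS: "T \<subseteq> S"
  proof
    fix q assume "q \<in> T"
    then have q: "q \<in> chart_dom c" "coords c q \<in> coords c ` (S \<inter> chart_dom c)" using r by (auto simp: T_def)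
    then show "q \<in> S" using coords_mem_image_iff[OF c(2)] by simp
  qed
  define H where "H \<sigma> = {q \<in> T. \<sigma> * coords c q $ k < 0}" for \<sigma> :: real
  have conn: "connected (H \<sigma>)" for \<sigma>
  proof -
    have "H \<sigma> = coords_inv c ` (ball ?x r \<inter> {y. (\<sigma> *\<^sub>R axis k 1) \<bullet> y < 0})"
    proof -
      have D: "y \<in> coords c ` chart_dom c" if "y \<in> ball ?x r" for y using r(2) that by auto
      show ?thesis
      proof (intro equalityI subsetI)
        fix q assume "q \<in> H \<sigma>"
        then have "coords c q \<in> ball ?x r \<inter> {y. (\<sigma> *\<^sub>R axis k 1) \<bullet> y < 0}" "q = coords_inv c (coords c q)"
          using c(2) by (auto simp: H_def T_def inner_axis')
        then show "q \<in> coords_inv c ` (ball ?x r \<inter> {y. (\<sigma> *\<^sub>R axis k 1) \<bullet> y < 0})" by blast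
      next
        fix q assume "q \<in> coords_inv c ` (ball ?x r \<inter> {y. (\<sigma> *\<^sub>R axis k 1) \<bullet> y < 0})"
        then obtain y where y: "q = coords_inv c y" "y \<in> ball ?x r" "\<sigma> * y $ k < 0" by (auto simp: inner_axis')
        then show "q \<in> H \<sigma>" using D[OF y(2)] c(2) by (auto simp: H_def T_def)
      qed
    qed
    moreover have "connected (ball ?x r \<inter> {y. (\<sigma> *\<^sub>R axis k 1) \<bullet> y < 0})"
      by (intro convex_connected convex_Int convex_ball convex_halfspace_lt)
    moreover have "continuous_on (ball ?x r \<inter> {y. (\<sigma> *\<^sub>R axis k 1) \<bullet> y < 0}) (coords_inv c)"
      by (rule continuous_on_subset[OF continuous_on_coords_inv[OF c(2)]]) (use r(2) in auto)
    ultimately show ?thesis by (simp add: connected_continuous_image)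
  qed
  have dich: "H \<sigma> \<subseteq> \<Omega> \<or> H \<sigma> \<inter> \<Omega> = {}" for \<sigma>
  proof -
    have "H \<sigma> \<inter> frontier \<Omega> = {}" using slice by (auto simp: H_def T_def)
    then show ?thesis using connected_Int_frontier[OF conn, of \<sigma> \<Omega>] by blast
  qed
  have evT: "\<forall>\<^sub>F t in at_right 0. ?x + t *\<^sub>R v \<in> ball ?x r" for v
  proof -
    have "((\<lambda>t. ?x + t *\<^sub>R v) \<longlongrightarrow> ?x + 0 *\<^sub>R v) (at_right 0)" by (intro tendsto_intros)
    then show ?thesis by (rule topological_tendstoD) (use r in auto)
  qed
  have ev: "\<forall>\<^sub>F t in at_right 0. ?x + t *\<^sub>R ?X \<in> coords c ` (chart_dom c - closure \<Omega>) \<and>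
      ?x - t *\<^sub>R ?X \<in> coords c ` (chart_dom c \<inter> \<Omega>) \<and> ?x + t *\<^sub>R ?X \<in> ball ?x r \<and> ?x - t *\<^sub>R ?X \<in> ball ?x r \<and> t > 0"
  proof (intro eventually_conj)
    show "\<forall>\<^sub>F t in at_right 0. ?x - t *\<^sub>R ?X \<in> ball ?x r" using evT[of "- ?X"] by simp
  qed (use X c(2) p(2) evT[of ?X] in \<open>simp_all add: points_out_of_def eventually_at_right_less\<close>)
  from eventually_happens'[OF trivial_limit_at_right_real ev] obtain t where t: "?x + t *\<^sub>R ?X \<in> coords c ` (chart_dom c - closure \<Omega>)"
      "?x - t *\<^sub>R ?X \<in> coords c ` (chart_dom c \<inter> \<Omega>)" "?x + t *\<^sub>R ?X \<in> ball ?x r" "?x - t *\<^sub>R ?X \<in> ball ?x r" "t > 0"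
    by blast
  obtain q where q: "?x + t *\<^sub>R ?X = coords c q" "q \<in> chart_dom c" "q \<notin> closure \<Omega>" using t(1) by auto
  obtain q' where q': "?x - t *\<^sub>R ?X = coords c q'" "q' \<in> chart_dom c" "q' \<in> \<Omega>" using t(2) by auto
  have xk: "?x $ k = 0" using slice p by auto
  have qk: "coords c q $ k = t * ?X $ k" "coords c q' $ k = - t * ?X $ k"
    unfolding q(1)[symmetric] q'(1)[symmetric] using xk by auto
  have Xk: "?X $ k \<noteq> 0"
  proof
    assume "?X $ k = 0"
    then have "q' \<in> frontier \<Omega>" using slice[OF q'(2)] qk by simp
    then show False using fr q'(3) by blast
  qed
  define \<sigma> where "\<sigma> = sgn (?X $ k)"
  have \<sigma>: "\<sigma> = 1 \<or> \<sigma> = - 1" "\<sigma> * ?X $ k > 0" using Xk by (auto simp: \<sigma>_def sgn_real_def)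
  have "\<sigma> * (- t * ?X $ k) < 0" "- \<sigma> * (t * ?X $ k) < 0"
    using mult_pos_pos[OF t(5) \<sigma>(2)] by (auto simp: algebra_simps)
  then have "q' \<in> H \<sigma>" "q \<in> H (- \<sigma>)"
    using qk q q' t(3,4) by (auto simp: H_def T_def)
  then have "H \<sigma> \<subseteq> \<Omega>" "H (- \<sigma>) \<inter> \<Omega> = {}"
    using dich[of \<sigma>] dich[of "- \<sigma>"] q'(3) q(3) closure_subset[of \<Omega>] by blast+
  moreover have "s \<in> H \<sigma> \<or> s \<in> H (- \<sigma>) \<or> s \<in> frontier \<Omega>" if "s \<in> T" for s
    using that slice[of s] T(3) \<sigma>(1) by (auto simp: H_def)
  ultimately have TO: "T \<inter> \<Omega> = H \<sigma>" using fr by (auto simp: H_def)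
  show ?thesis
    by (rule that[OF T(1,2) TS T(3) \<sigma>(1)]) (use TO conn[of \<sigma>] in \<open>simp_all add: H_def\<close>)
qed

text \<open>A short step against an outward vector ends in \<open>\<Omega>\<close>, that is, in the half space
  \<open>\<sigma> x\<^sub>k < 0\<close>.\<close>

lemma outward_sign:
  assumes \<Omega>: "open \<Omega>" and c: "(c, k) \<in> slice_charts A (frontier \<Omega>)" "c \<in> A"
    and q: "q \<in> frontier \<Omega>" "q \<in> T" and T: "open T" "T \<subseteq> chart_dom c"
    and side: "T \<inter> \<Omega> = {q \<in> T. \<sigma> * coords c q $ k < 0}" and X: "points_out_of A \<Omega> X q"
  shows "\<sigma> * X c q $ k > 0"
proof -
  let ?x = "coords c q" and ?X = "X c q"
  have qc: "q \<in> chart_dom c" using q T by auto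
  have xk: "?x $ k = 0" using c(1) q qc by (auto simp: slice_charts_def)
  have opT: "open (coords c ` T)" using open_coords_image[OF c(2) T(1)] T(2) by (simp add: Int_absorb2)
  have evT: "\<forall>\<^sub>F t in at_right 0. ?x - t *\<^sub>R ?X \<in> coords c ` T"
  proof -
    have "((\<lambda>t. ?x - t *\<^sub>R ?X) \<longlongrightarrow> ?x - 0 *\<^sub>R ?X) (at_right 0)" by (intro tendsto_intros)
    then show ?thesis by (rule topological_tendstoD) (use q opT in auto)
  qed
  have ev: "\<forall>\<^sub>F t in at_right 0. ?x - t *\<^sub>R ?X \<in> coords c ` (chart_dom c \<inter> \<Omega>) \<and> ?x - t *\<^sub>R ?X \<in> coords c ` T \<and> t > 0"
    using X c(2) qc evT unfolding points_out_of_def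
    by (intro eventually_conj) (auto simp: eventually_at_right_less)
  from eventually_happens'[OF trivial_limit_at_right_real ev] obtain t where t: "?x - t *\<^sub>R ?X \<in> coords c ` (chart_dom c \<inter> \<Omega>)" "?x - t *\<^sub>R ?X \<in> coords c ` T" "t > 0"
    by blast
  obtain s where s: "?x - t *\<^sub>R ?X = coords c s" "s \<in> chart_dom c" "s \<in> \<Omega>" using t(1) by auto
  have "s \<in> T"
    using t(2) s(2) T(2) inj_on_coords[OF c(2)] unfolding s(1) by (auto dest: inj_onD)
  then have "\<sigma> * coords c s $ k < 0" using side s(3) by blast
  then have "t * (\<sigma> * ?X $ k) > 0" unfolding s(1)[symmetric] using xk by (simp add: algebra_simps)
  then show ?thesis using t(3) by (simp add: zero_less_mult_iff)
qed

end

context riemannian_manifold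
begin

section \<open>The divergence theorem for a small support\<close>

text \<open>The covector \<open>g \<nu>\<close> annihilates the tangent hyperplane, so it is a multiple
  \<open>\<mu>\<close> of \<open>dx\<^sub>k\<close>, and unit length gives \<open>\<mu>\<^sup>2
  g\<^sup>k\<^sup>k = 1\<close>.  Since \<open>g\<^sup>k\<^sup>k\<close> is the principal minor divided by
  \<open>det g\<close>, the area density times \<open>\<omega>(\<nu>)\<close> is, up to sign, the
  \<open>k\<close>-th component of the flux density.\<close>

lemma area_times_normal_component:
  assumes c: "(c, k) \<in> slice_charts A \<Sigma>" "c \<in> A" and \<nu>: "unit_normal_on A g \<Sigma> \<nu>" and q: "q \<in> \<Sigma>" "q \<in> chart_dom c"
  shows "area c k q * (\<omega> c q \<bullet> \<nu> c q) = sgn (\<nu> c q $ k) * flux c \<omega> k q"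
proof -
  let ?G = "g c q" and ?J = "matrix_inv (g c q)" and ?n = "\<nu> c q"
  note pos = posdef_metric[OF c(2) q(2)]
  have n1: "?n \<bullet> (?G *v ?n) = 1" using \<nu> c(2) q by (auto simp: unit_normal_on_def)
  have n0: "x \<bullet> (?G *v ?n) = 0" if "x $ k = 0" for x
    using \<nu> c(1) q that unfolding unit_normal_on_def by blast
  define \<mu> where "\<mu> = (?G *v ?n) $ k"
  have Gn: "?G *v ?n = \<mu> *\<^sub>R axis k 1"
  proof -
    have "(?G *v ?n) $ i = 0" if "i \<noteq> k" for i
    proof -
      have "axis i 1 $ k = (0 :: real)" using that by (simp add: axis_def)
      from n0[OF this] show ?thesis by (simp add: inner_axis')
    qed
    then show ?thesis by (auto simp: vec_eq_iff axis_def \<mu>_def)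
  qed
  have "?n = ?J *v (?G *v ?n)"
    using matrix_inv_mult(2)[OF posdef_det_nz[OF pos]] by (simp add: matrix_vector_mul_assoc)
  then have n: "?n $ i = \<mu> * ?J $ i $ k" for i
    unfolding Gn by (simp add: matrix_vector_mult_scaleR matrix_vector_mult_basis column_def)
  have nk: "\<mu> * (\<mu> * ?J $ k $ k) = 1"
    using n1 unfolding Gn by (simp add: inner_axis n mult.commute)
  have Jk: "?J $ k $ k = principal_minor k ?G / det ?G"
    using matrix_inv_entry[OF posdef_det_nz[OF pos], of k k] det_column_replaced[of k ?G] by simp
  have Jpos: "?J $ k $ k > 0"
    unfolding Jk using posdef_principal_minor[OF pos] posdef_det_pos[OF pos] by simp
  have ar: "area c k q = vol c q * sqrt (?J $ k $ k)"
    unfolding area_def vol_def Jk using posdef_det_pos[OF pos] by (simp add: real_sqrt_divide)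
  have lam: "\<mu> * sqrt (?J $ k $ k) = sgn (?n $ k)"
  proof -
    have "(\<mu> * sqrt (?J $ k $ k))\<^sup>2 = \<mu>\<^sup>2 * ?J $ k $ k" using Jpos by (simp add: power_mult_distrib)
    then have sq: "(\<mu> * sqrt (?J $ k $ k))\<^sup>2 = 1" using nk by (simp add: power2_eq_square mult.assoc)
    have "sgn (?n $ k) = sgn \<mu>" using Jpos by (simp add: n sgn_mult)
    moreover have "sgn (\<mu> * sqrt (?J $ k $ k)) = sgn \<mu>" using Jpos by (simp add: sgn_mult)
    moreover have "\<mu> * sqrt (?J $ k $ k) = 1 \<or> \<mu> * sqrt (?J $ k $ k) = - 1" using sq by (simp add: power2_eq_1_iff)
    ultimately show ?thesis by auto
  qed
  have "\<omega> c q \<bullet> ?n = \<mu> * (\<Sum>j\<in>UNIV. ?J $ k $ j * \<omega> c q $ j)"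
    by (simp add: inner_vec_def n posdef_inv_symmetric[OF pos, of k] sum_distrib_left algebra_simps)
  then have "area c k q * (\<omega> c q \<bullet> ?n) = (\<mu> * sqrt (?J $ k $ k)) * (vol c q * (\<Sum>j\<in>UNIV. ?J $ k $ j * \<omega> c q $ j))"
    by (simp add: ar algebra_simps)
  then show ?thesis unfolding lam flux_eq .
qed

lemma apply_form_chart:
  assumes \<omega>: "smooth_one_form_on A S \<omega>" and \<nu>: "vector_field_on A \<Sigma> \<nu>" and q: "q \<in> S" "q \<in> \<Sigma>" and c: "c \<in> A" "q \<in> chart_dom c"
  shows "apply_form A \<omega> \<nu> q = \<omega> c q \<bullet> \<nu> c q"
proof -
  have "\<nu> (chart_at A q) q = transition_deriv c (chart_at A q) q (\<nu> c q)"
    using \<nu>[unfolded vector_field_on_def] q c chart_at by blast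
  then show ?thesis
    using one_form_eq[OF \<omega> c(1) chart_at(1) q(1) c(2) chart_at(2), of "\<nu> c q"] by (simp add: apply_form_def Let_def)
qed

text \<open>In the chart the left-hand side is the integral of a divergence over a half space, hence an
  integral of the flux component \<open>k\<close> over the hyperplane; by
  \<open>area_times_normal_component\<close> that is the boundary integral.  The sign
  \<open>\<epsilon>\<close> records whether \<open>\<nu>\<close> or \<open>-\<nu>\<close> points outwards, and
  \<open>\<sigma>\<close> on which side of the hyperplane \<open>\<Omega>\<close> lies.\<close>

lemma divergence_theorem_boundary_piece:
  assumes \<Omega>: "open \<Omega>" and c: "(c, k) \<in> slice_charts A (frontier \<Omega>)" "c \<in> A"
    and \<nu>: "unit_normal_on A g (frontier \<Omega>) \<nu>"
    and T: "open T" "T \<subseteq> chart_dom c" and \<sigma>: "\<sigma> = 1 \<or> \<sigma> = (- 1 :: real)"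
    and side: "T \<inter> \<Omega> = {q \<in> T. \<sigma> * coords c q $ k < 0}"
    and out: "\<And>q. q \<in> T \<inter> frontier \<Omega> \<Longrightarrow> points_out_of A \<Omega> (\<lambda>c q. \<epsilon> *\<^sub>R \<nu> c q) q" and \<epsilon>: "\<epsilon> = 1 \<or> \<epsilon> = (- 1 :: real)"
    and \<theta>: "smooth_one_form_on A T \<theta>" and C: "compact C" "C \<subseteq> T" "\<And>c q. c \<in> A \<Longrightarrow> q \<notin> C \<Longrightarrow> \<theta> c q = 0"
    and v: "\<And>q. q \<in> T \<inter> closure \<Omega> \<Longrightarrow> v q = a"
    and \<Gamma>: "\<Gamma> \<subseteq> frontier \<Omega>" "T \<inter> frontier \<Omega> \<subseteq> \<Gamma>"
  shows "integrable (riemannian_measure A g) (\<lambda>q. indicator \<Omega> q * (codifferential A g \<theta> q * v q))"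
    "integrable (hypersurface_measure A g (frontier \<Omega>)) (\<lambda>q. indicator \<Gamma> q * (apply_form A \<theta> \<nu> q * v q))"
    "(\<integral>q. indicator \<Omega> q * (codifferential A g \<theta> q * v q) \<partial>riemannian_measure A g)
      = - \<epsilon> * (\<integral>q. indicator \<Gamma> q * (apply_form A \<theta> \<nu> q * v q) \<partial>hypersurface_measure A g (frontier \<Omega>))"
proof -
  have CT: "C \<subseteq> T \<inter> chart_dom c" using C T by auto
  have clC: "closed C" by (rule compact_imp_closed[OF C(1)])
  have \<theta>c: "\<And>q. q \<notin> C \<Longrightarrow> \<theta> c q = 0" using C(3) c by auto
  have cl: "\<Omega> \<subseteq> closure \<Omega>" "frontier \<Omega> \<subseteq> closure \<Omega>" by (auto simp: closure_subset frontier_def)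
  have fr: "q \<notin> \<Omega>" if "q \<in> frontier \<Omega>" for q using that \<Omega> by (simp add: frontier_def interior_open)
  have slice: "q \<in> frontier \<Omega> \<longleftrightarrow> coords c q $ k = 0" if "q \<in> chart_dom c" for q
    using c(1) that by (auto simp: slice_charts_def)
  define u where "u = (\<lambda>q. if q \<in> T then codiff_in c \<theta> q else 0)"
  note uI = integral_codiff_in[OF c(2) T \<theta> C(1,2) \<theta>c, folded u_def]
  have cod: "codifferential A g \<theta> q = u q" for q
  proof (cases "q \<in> T")
    case True
    then show ?thesis using codifferential_chart[OF c(2) T(1) True _ \<theta>] T by (auto simp: u_def)
  next
    case False
    then have "q \<notin> C" using C by auto
    then show ?thesis using codifferential_eq_0[OF clC _ C(3)] False by (simp add: u_def)
  qed
  have u0: "u q = 0" if "q \<notin> C" for q using codifferential_eq_0[OF clC that C(3)] cod[of q] by simp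
  let ?f = "\<lambda>q. indicator \<Omega> q * (a * u q)"
  have f: "(\<lambda>q. indicator \<Omega> q * (codifferential A g \<theta> q * v q)) = ?f"
  proof
    fix q show "indicator \<Omega> q * (codifferential A g \<theta> q * v q) = ?f q"
      using v[of q] u0[of q] C(2) cl by (cases "q \<in> T \<inter> \<Omega>") (auto simp: cod indicator_def)
  qed
  have \<Omega>m: "\<Omega> \<in> sets borel" using \<Omega> by auto
  have um: "u \<in> borel_measurable borel" by (rule smooth_function_measurable) (use uI(1) in simp)
  have fm: "?f \<in> borel_measurable borel" using um \<Omega>m by measurable
  have iu: "integrable (riemannian_measure A g) u" using uI(3) by simp
  have "integrable (riemannian_measure A g) (\<lambda>q. indicator \<Omega> q *\<^sub>R (a * u q))"
    by (rule integrable_mult_indicator) (use \<Omega>m iu in auto)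
  then show "integrable (riemannian_measure A g) (\<lambda>q. indicator \<Omega> q * (codifferential A g \<theta> q * v q))"
    unfolding f by simp
  let ?H = "{x :: real ^ 'n. \<sigma> * x $ k < 0}"
  have "in_chart c (\<lambda>q. vol c q * ?f q) x = a * (indicator ?H x * in_chart c (\<lambda>q. vol c q * codiff_in c \<theta> q) x)" for x
  proof (cases "x \<in> coords c ` chart_dom c")
    case True
    then obtain q where q: "x = coords c q" "q \<in> chart_dom c" by auto
    have eq: "indicator \<Omega> q * u q = indicator ?H (coords c q) * codiff_in c \<theta> q"
    proof (cases "q \<in> T")
      case True
      then have "q \<in> \<Omega> \<longleftrightarrow> coords c q \<in> ?H" using side by auto
      then show ?thesis using True by (simp add: u_def indicator_def)
    next
      case False
      then have "q \<notin> C" using C by auto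
      then show ?thesis using False codiff_in_eq_0[OF c(2) T(1) \<theta> C(1) CT \<theta>c q(2)] by (simp add: u_def)
    qed
    have "in_chart c (\<lambda>q. vol c q * ?f q) x = a * vol c q * (indicator \<Omega> q * u q)"
      using q c(2) by (simp add: in_chart_def)
    also have "\<dots> = a * (indicator ?H x * in_chart c (\<lambda>q. vol c q * codiff_in c \<theta> q) x)"
      unfolding eq using q c(2) by (simp add: in_chart_def)
    finally show ?thesis .
  qed (simp add: in_chart_def)
  moreover have f0: "?f q = 0" if "q \<notin> chart_dom c" for q using u0[of q] CT that by auto
  ultimately have "integral\<^sup>L (riemannian_measure A g) ?f
      = (\<integral>x. a * (indicator ?H x * in_chart c (\<lambda>q. vol c q * codiff_in c \<theta> q) x) \<partial>lborel)"
    using integral_riemannian_chart(1)[OF c(2) fm] by simp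
  also have "\<dots> = a * (\<integral>x. indicator ?H x * in_chart c (\<lambda>q. vol c q * codiff_in c \<theta> q) x \<partial>lborel)"
    by (rule integral_mult_right_zero)
  also have "(\<integral>x. indicator ?H x * in_chart c (\<lambda>q. vol c q * codiff_in c \<theta> q) x \<partial>lborel)
      = - \<sigma> * (\<integral>x. in_chart c (flux c \<theta> k) x \<partial>hyperplane_measure k)"
    using \<sigma> integral_in_chart_codiff_half_space[OF c(2) T(1) \<theta> C(1) CT \<theta>c, of k] by auto
  finally have lhs: "integral\<^sup>L (riemannian_measure A g) ?f = - a * \<sigma> * (\<integral>x. in_chart c (flux c \<theta> k) x \<partial>hyperplane_measure k)"
    by simp
  \<comment> \<open>On the boundary \<open>\<phi>\<close> is \<open>\<theta>(\<nu>)\<close> up to sign, but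
    unlike \<open>\<nu>\<close> it is defined and smooth off the boundary, which settles
    measurability.\<close>
  define \<phi> where "\<phi> q = (if q \<in> T then flux c \<theta> k q / area c k q else 0)" for q
  have \<phi>0: "\<phi> q = 0" if "q \<notin> C" for q
    using flux_eq_0[OF c(2) T(1) \<theta> C(1) CT \<theta>c that] by (simp add: \<phi>_def)
  have "smooth_function_on A T \<phi>"
  proof (rule smooth_function_onI_chart[OF c(2) T])
    have opT: "open (coords c ` T)" using open_coords_image[OF c(2) T(1)] T(2) by (simp add: Int_absorb2)
    have "smooth_on (coords c ` T) (\<lambda>x. (flux c \<theta> k \<circ> coords_inv c) x / area c k (coords_inv c x))"
    proof (rule smooth_on_divide[OF opT])
      show "smooth_on (coords c ` T) (flux c \<theta> k \<circ> coords_inv c)"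
        using smooth_flux[OF c(2) T(1) \<theta>, of k] T(2) by (simp add: Int_absorb2)
      show "smooth_on (coords c ` T) (\<lambda>x. area c k (coords_inv c x))"
        by (rule smooth_on_subset[OF smooth_area[OF c(2)]]) (use T in auto)
      fix x assume "x \<in> coords c ` T"
      then obtain q where "x = coords c q" "q \<in> chart_dom c" using T by auto
      then show "area c k (coords_inv c x) \<noteq> 0" using area_pos[OF c(2), of q k] c(2) by simp
    qed
    then show "smooth_on (coords c ` T) (\<phi> \<circ> coords_inv c)"
      by (rule smooth_on_cong[OF opT, rotated]) (use c(2) T in \<open>auto simp: \<phi>_def subset_iff\<close>)
  qed
  then have "smooth_function_on A UNIV \<phi>"
    by (rule smooth_function_extend_zero[OF T(1) _ C(1,2) \<phi>0])
  then have \<phi>m: "\<phi> \<in> borel_measurable borel" by (rule smooth_function_measurable)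
  let ?h = "\<lambda>q. indicator (frontier \<Omega>) q * (a * \<sigma> * \<epsilon> * \<phi> q)"
  have Fm: "frontier \<Omega> \<in> sets borel" using frontier_closed by auto
  have h: "(\<lambda>q. indicator \<Gamma> q * (apply_form A \<theta> \<nu> q * v q)) = ?h"
  proof
    fix q
    show "indicator \<Gamma> q * (apply_form A \<theta> \<nu> q * v q) = ?h q"
    proof (cases "q \<in> T \<inter> frontier \<Omega>")
      case True
      then have q: "q \<in> T" "q \<in> frontier \<Omega>" "q \<in> chart_dom c" "q \<in> \<Gamma>" "v q = a"
        using T \<Gamma> v[of q] cl by auto
      have "vector_field_on A (frontier \<Omega>) \<nu>" using \<nu> by (simp add: unit_normal_on_def)
      then have ap: "apply_form A \<theta> \<nu> q = \<theta> c q \<bullet> \<nu> c q"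
        by (rule apply_form_chart[OF \<theta> _ q(1,2) c(2) q(3)])
      have "\<sigma> * (\<epsilon> *\<^sub>R \<nu> c q) $ k > 0"
        by (rule outward_sign[OF \<Omega> c q(2,1) T side out[OF True]])
      then have "sgn (\<nu> c q $ k) = \<sigma> * \<epsilon>"
        using \<sigma> \<epsilon> by (auto simp: sgn_real_def)
      then have "area c k q * (\<theta> c q \<bullet> \<nu> c q) = \<sigma> * \<epsilon> * flux c \<theta> k q"
        using area_times_normal_component[OF c \<nu> q(2,3), of \<theta>] by simp
      then have "\<theta> c q \<bullet> \<nu> c q = \<sigma> * \<epsilon> * \<phi> q"
        using area_pos[OF c(2) q(3), of k] q(1) by (simp add: \<phi>_def field_simps)
      then show ?thesis using q by (simp add: ap)
    next
      case False
      show ?thesis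
      proof (cases "q \<in> T")
        case True
        then show ?thesis using False \<Gamma> by (auto simp: indicator_def)
      next
        case F: False
        then have "q \<notin> C" using C by auto
        then have "apply_form A \<theta> \<nu> q = 0" using C(3)[OF chart_at(1)] by (simp add: apply_form_def Let_def)
        then show ?thesis using F by (simp add: \<phi>_def)
      qed
    qed
  qed
  have hm: "?h \<in> borel_measurable borel" using \<phi>m Fm by measurable
  have h0: "?h q = 0" if "q \<notin> chart_dom c" for q using \<phi>0[of q] CT that by auto
  note hI = integral_hypersurface_chart[OF c(1) Fm hm h0]
  have ae: "AE x in hyperplane_measure k. in_chart c (\<lambda>q. area c k q * ?h q) x = a * \<sigma> * \<epsilon> * in_chart c (flux c \<theta> k) x"
    using AE_hyperplane_measure[of k]
  proof eventually_elim
    case (elim x)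
    show ?case
    proof (cases "x \<in> coords c ` chart_dom c")
      case True
      then obtain q where q: "x = coords c q" "q \<in> chart_dom c" by auto
      have "q \<in> frontier \<Omega>" using slice[OF q(2)] elim q by simp
      moreover have "area c k q * \<phi> q = flux c \<theta> k q"
      proof (cases "q \<in> T")
        case True
        then show ?thesis using area_pos[OF c(2) q(2), of k] by (simp add: \<phi>_def)
      next
        case False
        then have "q \<notin> C" using C by auto
        then show ?thesis using flux_eq_0[OF c(2) T(1) \<theta> C(1) CT \<theta>c] \<phi>0 by simp
      qed
      ultimately show ?thesis using q c(2) by (simp add: in_chart_def algebra_simps)
    qed (simp add: in_chart_def)
  qed
  obtain l r where lr: "\<And>i x. x \<notin> cbox l r \<Longrightarrow> in_chart c (flux c \<theta> i) x = 0"
    using in_chart_flux_support[OF c(2) T(1) \<theta> C(1) CT \<theta>c] by blast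
  have cont: "continuous_on UNIV (in_chart c (flux c \<theta> k))"
    by (rule smooth_on_imp_continuous_on[OF smooth_in_chart_flux[OF c(2) T(1) \<theta> C(1) CT \<theta>c]])
  have intF: "integrable (hyperplane_measure k) (in_chart c (flux c \<theta> k))"
    by (rule integrable_hyperplane_measure[OF cont lr])
  have meas1: "in_chart c (\<lambda>q. area c k q * ?h q) \<in> borel_measurable (hyperplane_measure k)"
  proof -
    have i: "in_chart c (\<lambda>q. area c k q * ?h q)
      = (\<lambda>x. (indicator (coords c ` chart_dom c) x *\<^sub>R area c k (coords_inv c x)) *
           (indicator (coords c ` (frontier \<Omega> \<inter> chart_dom c)) x * (a * \<sigma> * \<epsilon> * in_chart c \<phi> x)))"
    proof
      fix x
      show "in_chart c (\<lambda>q. area c k q * ?h q) x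
        = (indicator (coords c ` chart_dom c) x *\<^sub>R area c k (coords_inv c x)) *
           (indicator (coords c ` (frontier \<Omega> \<inter> chart_dom c)) x * (a * \<sigma> * \<epsilon> * in_chart c \<phi> x))"
      proof (cases "x \<in> coords c ` chart_dom c")
        case True
        then obtain q where q: "x = coords c q" "q \<in> chart_dom c" by auto
        then show ?thesis using c(2) coords_mem_image_iff[OF c(2) q(2), of "frontier \<Omega>"]
          by (simp add: in_chart_def indicator_def)
      qed (simp add: in_chart_def)
    qed
    have "(\<lambda>x. indicator (coords c ` chart_dom c) x *\<^sub>R area c k (coords_inv c x)) \<in> borel_measurable borel"
      by (rule borel_measurable_continuous_on_indicator[OF _ continuous_on_area[OF c(2)]]) (use open_chart_range[OF c(2)] in auto)
    moreover have "in_chart c \<phi> \<in> borel_measurable borel"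
    proof (rule borel_measurable_continuous_onI[OF smooth_on_imp_continuous_on])
      show "smooth_on UNIV (in_chart c \<phi>)"
        by (rule smooth_in_chart[OF c(2) open_UNIV C(1) _ \<phi>0])
          (use CT \<open>smooth_function_on A UNIV \<phi>\<close> c(2) in \<open>auto simp: smooth_function_on_def\<close>)
    qed
    moreover have "coords c ` (frontier \<Omega> \<inter> chart_dom c) \<in> sets borel" by (rule borel_coords_image[OF c(2) Fm])
    ultimately show ?thesis unfolding i by measurable
  qed
  have meas2: "(\<lambda>x. a * \<sigma> * \<epsilon> * in_chart c (flux c \<theta> k) x) \<in> borel_measurable (hyperplane_measure k)"
    using intF by auto
  have "integrable (hyperplane_measure k) (in_chart c (\<lambda>q. area c k q * ?h q))"
    unfolding integrable_cong_AE[OF meas1 meas2 ae] using intF by simp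
  then show "integrable (hypersurface_measure A g (frontier \<Omega>)) (\<lambda>q. indicator \<Gamma> q * (apply_form A \<theta> \<nu> q * v q))"
    unfolding h using hI(2) by simp
  have "integral\<^sup>L (hypersurface_measure A g (frontier \<Omega>)) ?h = (\<integral>x. a * \<sigma> * \<epsilon> * in_chart c (flux c \<theta> k) x \<partial>hyperplane_measure k)"
    by (rule trans[OF hI(1) integral_cong_AE[OF meas1 meas2 ae]])
  also have "\<dots> = a * \<sigma> * \<epsilon> * (\<integral>x. in_chart c (flux c \<theta> k) x \<partial>hyperplane_measure k)" by (rule integral_mult_right_zero)
  finally have rhs: "integral\<^sup>L (hypersurface_measure A g (frontier \<Omega>)) ?h
    = a * \<sigma> * \<epsilon> * (\<integral>x. in_chart c (flux c \<theta> k) x \<partial>hyperplane_measure k)" .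
  show "(\<integral>q. indicator \<Omega> q * (codifferential A g \<theta> q * v q) \<partial>riemannian_measure A g)
      = - \<epsilon> * (\<integral>q. indicator \<Gamma> q * (apply_form A \<theta> \<nu> q * v q) \<partial>hypersurface_measure A g (frontier \<Omega>))"
    unfolding f h lhs rhs using \<epsilon> by auto
qed

end

section \<open>Locally constant functions up to the boundary\<close>

context smooth_manifold
begin

lemma locally_constant_on_connected:
  assumes v: "locally_constant_on S v" and C: "connected C" "C \<subseteq> S" and pq: "p \<in> C" "q \<in> C"
  shows "v p = v q"
proof (rule connected_local_const[OF C(1) pq], rule ballI)
  fix x assume "x \<in> C"
  then have "x \<in> S" using C by auto
  with v obtain N a where N: "open N" "x \<in> N" "\<forall>y\<in>N. v y = a" by (rule locally_constant_onE)
  show "\<forall>\<^sub>F y in at x within C. v x = v y"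
    unfolding eventually_at_topological using N by (intro exI[of _ N]) auto
qed

text \<open>Near a boundary point \<open>v\<close> takes a single value on \<open>\<Omega>\<close>, because
  \<open>\<Omega>\<close> is connected there; this value is the extension.\<close>

lemma locally_constant_extends_to_closure:
  assumes \<Omega>: "open \<Omega>" and v: "locally_constant_on \<Omega> v"
    and side: "\<And>p. p \<in> frontier \<Omega> \<Longrightarrow> \<exists>T. open T \<and> p \<in> T \<and> connected (T \<inter> \<Omega>)"
  obtains v' where "\<And>p. p \<in> \<Omega> \<Longrightarrow> v' p = v p"
    "\<And>p. p \<in> closure \<Omega> \<Longrightarrow> \<exists>T a. open T \<and> p \<in> T \<and> (\<forall>q\<in>T \<inter> closure \<Omega>. v' q = a)"
proof -
  \<comment> \<open>\<open>a\<close> is the value that \<open>v\<close> takes on \<open>\<Omega>\<close> near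
    \<open>p\<close>.\<close>
  define Q where "Q p a \<longleftrightarrow> (\<exists>T. open T \<and> p \<in> T \<and> (\<forall>q\<in>T \<inter> \<Omega>. v q = a))" for p a
  have unique: "a = b" if "Q p a" "Q p b" "p \<in> closure \<Omega>" for p a b
  proof -
    obtain T where T: "open T" "p \<in> T" "\<forall>q\<in>T \<inter> \<Omega>. v q = a" using \<open>Q p a\<close> unfolding Q_def by blast
    obtain T' where T': "open T'" "p \<in> T'" "\<forall>q\<in>T' \<inter> \<Omega>. v q = b" using \<open>Q p b\<close> unfolding Q_def by blast
    have "T \<inter> T' \<inter> closure \<Omega> \<noteq> {}" using T T' \<open>p \<in> closure \<Omega>\<close> by blast
    then have "T \<inter> T' \<inter> \<Omega> \<noteq> {}" using open_Int_closure_eq_empty[of "T \<inter> T'" \<Omega>] T T' by blast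
    then show ?thesis using T(3) T'(3) by fastforce
  qed
  define v' where "v' p = (if p \<in> \<Omega> then v p else (SOME a. Q p a))" for p
  have ex: "\<exists>a. Q p a" if p: "p \<in> closure \<Omega>" for p
  proof (cases "p \<in> \<Omega>")
    case True
    with v obtain N a where "open N" "p \<in> N" "\<forall>q\<in>N. v q = a" by (rule locally_constant_onE)
    then show ?thesis unfolding Q_def by blast
  next
    case False
    then have "p \<in> frontier \<Omega>" using p \<Omega> by (simp add: frontier_def interior_open)
    then obtain T where T: "open T" "p \<in> T" "connected (T \<inter> \<Omega>)" using side by blast
    then have "T \<inter> \<Omega> \<noteq> {}" using open_Int_closure_eq_empty[of T \<Omega>] p by blast
    then obtain y where y: "y \<in> T \<inter> \<Omega>" by blast
    have "\<forall>q\<in>T \<inter> \<Omega>. v q = v y"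
      using locally_constant_on_connected[OF v T(3) _ _ y] by blast
    then show ?thesis unfolding Q_def using T by blast
  qed
  have val: "v' p = a" if "Q p a" "p \<in> closure \<Omega>" for p a
  proof (cases "p \<in> \<Omega>")
    case True
    then show ?thesis using that(1) unfolding Q_def v'_def by auto
  next
    case False
    have "Q p (SOME a. Q p a)" using ex[OF that(2)] by (rule someI_ex)
    then show ?thesis using unique[OF _ that(1,2)] False by (simp add: v'_def)
  qed
  show ?thesis
  proof
    show "v' p = v p" if "p \<in> \<Omega>" for p using that by (simp add: v'_def)
    fix p assume p: "p \<in> closure \<Omega>"
    obtain a where "Q p a" using ex[OF p] by blast
    then obtain T where T: "open T" "p \<in> T" "\<forall>q\<in>T \<inter> \<Omega>. v q = a" unfolding Q_def by blast
    have "\<forall>q\<in>T \<inter> closure \<Omega>. v' q = a"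
    proof
      fix q assume q: "q \<in> T \<inter> closure \<Omega>"
      show "v' q = a"
      proof (rule val)
        have "q \<in> T" using q by blast
        with T(1,3) show "Q q a" unfolding Q_def by blast
      qed (use q in blast)
    qed
    with T(1,2) show "\<exists>T a. open T \<and> p \<in> T \<and> (\<forall>q\<in>T \<inter> closure \<Omega>. v' q = a)"
      by (intro exI[of _ T] exI[of _ a] conjI)
  qed
qed

end

context riemannian_manifold
begin

section \<open>The divergence theorem\<close>

lemma codifferential_sum:
  assumes S: "open S" "q \<in> S" and I: "finite I" and \<omega>: "\<And>i. i \<in> I \<Longrightarrow> smooth_one_form_on A S (\<omega> i)"
  shows "codifferential A g (\<lambda>c p. \<Sum>i\<in>I. \<omega> i c p) q = (\<Sum>i\<in>I. codifferential A g (\<omega> i) q)"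
  using I \<omega>
proof induction
  case empty
  then show ?case by (simp add: codifferential_zero)
next
  case (insert i I)
  then show ?case
    using codifferential_add[OF S insert.prems[of i] smooth_one_form_on_sum[OF S(1) insert.hyps(1) insert.prems]] by simp
qed

lemma apply_form_scale: "apply_form A (\<lambda>c q. F q *\<^sub>R \<omega> c q) \<nu> q = F q * apply_form A \<omega> \<nu> q"
  by (simp add: apply_form_def Let_def)

text \<open>Decompose a cutoff function of the closure of \<open>\<Omega>\<close> into functions
  \<open>F\<close> with small supports.  For the forms \<open>F \<omega>\<close> the formula is the vanishing
  of the integral of a divergence if the support lies inside \<open>\<Omega>\<close>,
  \<open>divergence_theorem_boundary_piece\<close> if it is near a boundary point, and trivial if it lies
  outside the closure.  As \<open>\<nu>\<close> points into \<open>\<Omega>\<close> along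
  \<open>\<Gamma>1\<close>, the two boundary parts enter with opposite signs.\<close>

theorem divergence_theorem:
  assumes \<Omega>: "open \<Omega>" "compact (closure \<Omega>)" and hyp: "smooth_hypersurface A (frontier \<Omega>)"
    and M: "open M1" "open M2" "\<Gamma>1 \<subseteq> M1" "\<Gamma>2 \<subseteq> M2" "M1 \<inter> \<Gamma>2 = {}" "M2 \<inter> \<Gamma>1 = {}" "\<Omega> \<subseteq> M1 \<union> M2"
    and \<Gamma>: "frontier \<Omega> = \<Gamma>1 \<union> \<Gamma>2"
    and \<nu>: "unit_normal_on A g (frontier \<Omega>) \<nu>"
    and out: "\<And>q. q \<in> \<Gamma>2 \<Longrightarrow> points_out_of A \<Omega> \<nu> q" and into: "\<And>q. q \<in> \<Gamma>1 \<Longrightarrow> points_into A \<Omega> \<nu> q"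
    and \<omega>: "smooth_one_form_on A (M1 \<union> M2) \<omega>"
    and v: "\<And>p. p \<in> closure \<Omega> \<Longrightarrow> \<exists>T a. open T \<and> p \<in> T \<and> (\<forall>q\<in>T \<inter> closure \<Omega>. v q = a)"
  shows "(\<integral>q. indicator \<Omega> q * (codifferential A g \<omega> q * v q) \<partial>riemannian_measure A g)
      = (\<integral>q. indicator \<Gamma>1 q * (apply_form A \<omega> \<nu> q * v q) \<partial>hypersurface_measure A g (frontier \<Omega>))
      - (\<integral>q. indicator \<Gamma>2 q * (apply_form A \<omega> \<nu> q * v q) \<partial>hypersurface_measure A g (frontier \<Omega>))"
proof -
  let ?\<mu> = "riemannian_measure A g" and ?s = "hypersurface_measure A g (frontier \<Omega>)" and ?M = "M1 \<union> M2"
  let ?F\<omega> = "\<lambda>F c q. F q *\<^sub>R \<omega> c q"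
  let ?I = "\<lambda>F q. indicator \<Omega> q * (codifferential A g (?F\<omega> F) q * v q)"
  let ?B = "\<lambda>\<Gamma> F q. indicator \<Gamma> q * (apply_form A (?F\<omega> F) \<nu> q * v q)"
  have fr: "q \<notin> \<Omega>" if "q \<in> frontier \<Omega>" for q using that \<Omega> by (simp add: frontier_def interior_open)
  have cl: "closure \<Omega> = \<Omega> \<union> \<Gamma>1 \<union> \<Gamma>2"
    using \<Gamma> \<Omega> closure_subset[of \<Omega>] by (auto simp: frontier_def interior_open)
  have oM: "open ?M" using M by auto
  have clM: "closure \<Omega> \<subseteq> ?M" unfolding cl using M by auto
  have F\<omega>: "smooth_one_form_on A ?M (?F\<omega> F)" if "smooth_function_on A UNIV F" for F
    by (rule smooth_one_form_on_scale[OF oM smooth_function_on_subset[OF that] \<omega>]) simp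
  \<comment> \<open>The formula holds, with all integrals finite, for \<open>F \<omega>\<close> whenever
    \<open>F\<close> has compact support in \<open>N\<close>.\<close>
  define Good where "Good N \<longleftrightarrow> (\<forall>F C. smooth_function_on A UNIV F \<and> compact C \<and> C \<subseteq> N \<and> (\<forall>q. q \<notin> C \<longrightarrow> F q = 0) \<longrightarrow>
      integrable ?\<mu> (?I F) \<and> integrable ?s (?B \<Gamma>1 F) \<and> integrable ?s (?B \<Gamma>2 F) \<and>
      integral\<^sup>L ?\<mu> (?I F) = integral\<^sup>L ?s (?B \<Gamma>1 F) - integral\<^sup>L ?s (?B \<Gamma>2 F))" for N
  have boundary: "\<exists>T. open T \<and> p \<in> T \<and> T \<subseteq> M' \<and>
      (\<forall>F C. smooth_function_on A UNIV F \<and> compact C \<and> C \<subseteq> T \<and> (\<forall>q. q \<notin> C \<longrightarrow> F q = 0) \<longrightarrow>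
        integrable ?\<mu> (?I F) \<and> integrable ?s (?B \<Gamma>' F) \<and> integral\<^sup>L ?\<mu> (?I F) = - \<epsilon> * integral\<^sup>L ?s (?B \<Gamma>' F))"
    if p: "p \<in> \<Gamma>'" and M': "open M'" "M' \<subseteq> ?M" "\<Gamma>' \<subseteq> M'" and \<Gamma>': "\<Gamma>' \<subseteq> frontier \<Omega>" "M' \<inter> frontier \<Omega> \<subseteq> \<Gamma>'"
      and \<epsilon>: "\<epsilon> = 1 \<or> \<epsilon> = (- 1 :: real)" and X: "\<And>q. q \<in> \<Gamma>' \<Longrightarrow> points_out_of A \<Omega> (\<lambda>c q. \<epsilon> *\<^sub>R \<nu> c q) q"
    for p M' \<Gamma>' \<epsilon>
  proof -
    have pf: "p \<in> frontier \<Omega>" using p \<Gamma>' by auto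
    then obtain c k where ck: "(c, k) \<in> slice_charts A (frontier \<Omega>)" "p \<in> chart_dom c"
      using hyp by (auto simp: smooth_hypersurface_def)
    have c: "c \<in> A" using ck by (auto simp: slice_charts_def)
    have pcl: "p \<in> closure \<Omega>" using pf by (simp add: frontier_def)
    then obtain T' a where T': "open T'" "p \<in> T'" "\<forall>q\<in>T' \<inter> closure \<Omega>. v q = a" using v by blast
    have S: "open (M' \<inter> T')" "p \<in> M' \<inter> T'" using M' T' p by auto
    show ?thesis
    proof (rule boundary_side[OF \<Omega>(1) ck(1) c pf ck(2) X[OF p] S])
      fix T \<sigma>
      assume T: "open T" "p \<in> T" "T \<subseteq> M' \<inter> T'" "T \<subseteq> chart_dom c" and \<sigma>: "\<sigma> = 1 \<or> \<sigma> = (- 1 :: real)"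
        and side: "T \<inter> \<Omega> = {q \<in> T. \<sigma> * coords c q $ k < 0}"
      have "integrable ?\<mu> (?I F) \<and> integrable ?s (?B \<Gamma>' F) \<and> integral\<^sup>L ?\<mu> (?I F) = - \<epsilon> * integral\<^sup>L ?s (?B \<Gamma>' F)"
        if F: "smooth_function_on A UNIV F" and C: "compact C" "C \<subseteq> T" "\<And>q. q \<notin> C \<Longrightarrow> F q = 0" for F C
      proof -
        have \<theta>: "smooth_one_form_on A T (?F\<omega> F)"
          by (rule smooth_one_form_on_subset[OF F\<omega>[OF F]]) (use T M' in auto)
        have out': "points_out_of A \<Omega> (\<lambda>c q. \<epsilon> *\<^sub>R \<nu> c q) q" if "q \<in> T \<inter> frontier \<Omega>" for q
          by (rule X) (use that T \<Gamma>' in auto)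
        have C0: "?F\<omega> F c q = 0" if "c \<in> A" "q \<notin> C" for c q using C(3) that by simp
        have va: "v q = a" if "q \<in> T \<inter> closure \<Omega>" for q using T'(3) T that by auto
        have TG: "T \<inter> frontier \<Omega> \<subseteq> \<Gamma>'" using T \<Gamma>' by auto
        show ?thesis
          by (intro conjI divergence_theorem_boundary_piece[where v = v and a = a,
                OF \<Omega>(1) ck(1) c \<nu> T(1,4) \<sigma> side out' \<epsilon> \<theta> C(1,2) C0 va \<Gamma>'(1) TG])
      qed
      then show ?thesis using T by (intro exI[of _ T]) auto
    qed
  qed
  have zero_int: "integrable N (\<lambda>q. 0 :: real)" "integral\<^sup>L N (\<lambda>q. 0 :: real) = 0" for N :: "'a measure" by auto
  have Bzero: "?B \<Gamma>' F = (\<lambda>q. 0)" if "\<And>q. q \<in> \<Gamma>' \<Longrightarrow> F q = 0" for \<Gamma>' F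
    using that by (auto simp: fun_eq_iff apply_form_scale indicator_def)
  have local: "\<exists>N. open N \<and> p \<in> N \<and> Good N" if pM: "p \<in> ?M" for p
  proof -
    consider "p \<in> \<Omega>" | "p \<in> \<Gamma>1" | "p \<in> \<Gamma>2" | "p \<notin> closure \<Omega>" unfolding cl by blast
    then show ?thesis
    proof cases
      case 1
      then have "p \<in> closure \<Omega>" unfolding cl by blast
      then obtain T a where T: "open T" "p \<in> T" "\<forall>q\<in>T \<inter> closure \<Omega>. v q = a" using v by blast
      define c where "c = chart_at A p"
      have c: "c \<in> A" "p \<in> chart_dom c" using chart_at by (auto simp: c_def)
      define N where "N = T \<inter> \<Omega> \<inter> chart_dom c"
      have N: "open N" "p \<in> N" "N \<subseteq> chart_dom c" "N \<subseteq> \<Omega>"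
        unfolding N_def using T \<Omega> 1 c open_chart_dom[OF c(1)] by auto
      have "Good N" unfolding Good_def
      proof (intro allI impI, elim conjE)
        fix F C assume F: "smooth_function_on A UNIV F" and C: "compact C" "C \<subseteq> N" "\<forall>q. q \<notin> C \<longrightarrow> F q = 0"
        have \<theta>: "smooth_one_form_on A N (?F\<omega> F)"
          by (rule smooth_one_form_on_subset[OF F\<omega>[OF F]]) (use N M in auto)
        have \<theta>0: "?F\<omega> F c q = 0" if "q \<notin> C" for c q using C(3) that by simp
        define u where "u = (\<lambda>q. if q \<in> N then codiff_in c (?F\<omega> F) q else 0)"
        have u: "integrable ?\<mu> u" "integral\<^sup>L ?\<mu> u = 0" "\<And>q. q \<notin> C \<Longrightarrow> u q = 0"
          using integral_codiff_in[OF c(1) N(1,3) \<theta> C(1,2) \<theta>0] by (simp_all add: u_def)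
        have "?I F = (\<lambda>q. a * u q)"
        proof
          fix q
          have cod: "codifferential A g (?F\<omega> F) q = u q"
          proof (cases "q \<in> N")
            case True
            then show ?thesis using codifferential_chart[OF c(1) N(1) True _ \<theta>] N by (auto simp: u_def)
          next
            case False
            then have "q \<notin> C" using C by auto
            from codifferential_eq_0[OF compact_imp_closed[OF C(1)] this \<theta>0] show ?thesis using False by (simp add: u_def)
          qed
          show "?I F q = a * u q"
          proof (cases "q \<in> N")
            case True
            then have "v q = a" "q \<in> \<Omega>" using T(3) unfolding N_def cl by auto
            then show ?thesis by (simp add: cod)
          qed (simp add: cod u_def)
        qed
        moreover have "?B \<Gamma>' F = (\<lambda>q. 0)" if "\<Gamma>' \<subseteq> frontier \<Omega>" for \<Gamma>'
          by (rule Bzero) (use that fr N C in blast)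
        ultimately show "integrable ?\<mu> (?I F) \<and> integrable ?s (?B \<Gamma>1 F) \<and> integrable ?s (?B \<Gamma>2 F) \<and>
          integral\<^sup>L ?\<mu> (?I F) = integral\<^sup>L ?s (?B \<Gamma>1 F) - integral\<^sup>L ?s (?B \<Gamma>2 F)"
          using u(1,2) \<Gamma> by (simp add: zero_int)
      qed
      then show ?thesis using N by blast
    next
      case 2
      have X: "points_out_of A \<Omega> (\<lambda>c q. (- 1) *\<^sub>R \<nu> c q) q" if "q \<in> \<Gamma>1" for q
        using into[OF that] by (simp add: points_into_def)
      have "\<exists>T. open T \<and> p \<in> T \<and> T \<subseteq> M1 \<and>
        (\<forall>F C. smooth_function_on A UNIV F \<and> compact C \<and> C \<subseteq> T \<and> (\<forall>q. q \<notin> C \<longrightarrow> F q = 0) \<longrightarrow>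
          integrable ?\<mu> (?I F) \<and> integrable ?s (?B \<Gamma>1 F) \<and> integral\<^sup>L ?\<mu> (?I F) = - (- 1) * integral\<^sup>L ?s (?B \<Gamma>1 F))"
        by (rule boundary[OF 2 M(1) _ M(3)]) (use X M(5,6) \<Gamma> in auto)
      then obtain T where T: "open T" "p \<in> T" "T \<subseteq> M1"
        "\<forall>F C. smooth_function_on A UNIV F \<and> compact C \<and> C \<subseteq> T \<and> (\<forall>q. q \<notin> C \<longrightarrow> F q = 0) \<longrightarrow>
          integrable ?\<mu> (?I F) \<and> integrable ?s (?B \<Gamma>1 F) \<and> integral\<^sup>L ?\<mu> (?I F) = - (- 1) * integral\<^sup>L ?s (?B \<Gamma>1 F)"
        by (elim exE conjE) (rule that)
      have "Good T" unfolding Good_def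
      proof (intro allI impI)
        fix F C assume FC: "smooth_function_on A UNIV F \<and> compact C \<and> C \<subseteq> T \<and> (\<forall>q. q \<notin> C \<longrightarrow> F q = 0)"
        have "?B \<Gamma>2 F = (\<lambda>q. 0)" by (rule Bzero) (use FC T(3) M(5) in blast)
        then show "integrable ?\<mu> (?I F) \<and> integrable ?s (?B \<Gamma>1 F) \<and> integrable ?s (?B \<Gamma>2 F) \<and>
          integral\<^sup>L ?\<mu> (?I F) = integral\<^sup>L ?s (?B \<Gamma>1 F) - integral\<^sup>L ?s (?B \<Gamma>2 F)"
          using T(4)[rule_format, OF FC] by (simp add: zero_int)
      qed
      then show ?thesis using T by blast
    next
      case 3
      have X: "points_out_of A \<Omega> (\<lambda>c q. 1 *\<^sub>R \<nu> c q) q" if "q \<in> \<Gamma>2" for q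
        using out[OF that] by simp
      have "\<exists>T. open T \<and> p \<in> T \<and> T \<subseteq> M2 \<and>
        (\<forall>F C. smooth_function_on A UNIV F \<and> compact C \<and> C \<subseteq> T \<and> (\<forall>q. q \<notin> C \<longrightarrow> F q = 0) \<longrightarrow>
          integrable ?\<mu> (?I F) \<and> integrable ?s (?B \<Gamma>2 F) \<and> integral\<^sup>L ?\<mu> (?I F) = - 1 * integral\<^sup>L ?s (?B \<Gamma>2 F))"
        by (rule boundary[OF 3 M(2) _ M(4)]) (use X M(5,6) \<Gamma> in auto)
      then obtain T where T: "open T" "p \<in> T" "T \<subseteq> M2"
        "\<forall>F C. smooth_function_on A UNIV F \<and> compact C \<and> C \<subseteq> T \<and> (\<forall>q. q \<notin> C \<longrightarrow> F q = 0) \<longrightarrow>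
          integrable ?\<mu> (?I F) \<and> integrable ?s (?B \<Gamma>2 F) \<and> integral\<^sup>L ?\<mu> (?I F) = - 1 * integral\<^sup>L ?s (?B \<Gamma>2 F)"
        by (elim exE conjE) (rule that)
      have "Good T" unfolding Good_def
      proof (intro allI impI)
        fix F C assume FC: "smooth_function_on A UNIV F \<and> compact C \<and> C \<subseteq> T \<and> (\<forall>q. q \<notin> C \<longrightarrow> F q = 0)"
        have "?B \<Gamma>1 F = (\<lambda>q. 0)" by (rule Bzero) (use FC T(3) M(6) in blast)
        then show "integrable ?\<mu> (?I F) \<and> integrable ?s (?B \<Gamma>1 F) \<and> integrable ?s (?B \<Gamma>2 F) \<and>
          integral\<^sup>L ?\<mu> (?I F) = integral\<^sup>L ?s (?B \<Gamma>1 F) - integral\<^sup>L ?s (?B \<Gamma>2 F)"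
          using T(4)[rule_format, OF FC] by (simp add: zero_int)
      qed
      then show ?thesis using T by blast
    next
      case 4
      have "Good (- closure \<Omega>)" unfolding Good_def
      proof (intro allI impI, elim conjE)
        fix F C assume F: "smooth_function_on A UNIV F" and C: "compact C" "C \<subseteq> - closure \<Omega>" "\<forall>q. q \<notin> C \<longrightarrow> F q = 0"
        have "?I F = (\<lambda>q. 0)"
        proof
          fix q
          show "?I F q = 0"
          proof (cases "q \<in> \<Omega>")
            case True
            then have "q \<notin> C" using C(2) closure_subset[of \<Omega>] by blast
            then have "codifferential A g (?F\<omega> F) q = 0"
              using codifferential_eq_0[OF compact_imp_closed[OF C(1)], of q "?F\<omega> F"] C(3) by simp
            then show ?thesis by simp
          qed simp
        qed
        moreover have "?B \<Gamma>1 F = (\<lambda>q. 0)" "?B \<Gamma>2 F = (\<lambda>q. 0)"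
          by (rule Bzero; use C cl in blast)+
        ultimately show "integrable ?\<mu> (?I F) \<and> integrable ?s (?B \<Gamma>1 F) \<and> integrable ?s (?B \<Gamma>2 F) \<and>
          integral\<^sup>L ?\<mu> (?I F) = integral\<^sup>L ?s (?B \<Gamma>1 F) - integral\<^sup>L ?s (?B \<Gamma>2 F)"
          by (simp add: zero_int)
      qed
      then show ?thesis using 4 by (intro exI[of _ "- closure \<Omega>"]) auto
    qed
  qed
  from cutoff_function[OF \<Omega>(2) oM clM] obtain f N L where f: "smooth_function_on A UNIV f" "open N" "closure \<Omega> \<subseteq> N"
    "\<forall>q\<in>N. f q = 1" "compact L" "L \<subseteq> ?M" "\<forall>q. q \<notin> L \<longrightarrow> f q = 0" by metis
  have "\<forall>p\<in>L. \<exists>N. open N \<and> p \<in> N \<and> Good N" using local f(6) by blast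
  from bchoice[OF this] obtain Np where Np: "\<forall>p\<in>L. open (Np p) \<and> p \<in> Np p \<and> Good (Np p)" by blast
  have f0: "f q = 0" if "q \<notin> L" for q using f(7) that by blast
  have NpO: "open (Np p) \<and> p \<in> Np p" if "p \<in> L" for p using Np that by blast
  show ?thesis
  proof (rule smooth_decomposition[OF f(1) f(5) f0 NpO])
    fix P F C
    assume P: "finite P" "P \<subseteq> L" and F: "\<And>p. p \<in> P \<Longrightarrow> smooth_function_on A UNIV (F p)"
      and C: "\<And>p. p \<in> P \<Longrightarrow> compact (C p)" "\<And>p. p \<in> P \<Longrightarrow> C p \<subseteq> Np p" "\<And>p q. p \<in> P \<Longrightarrow> q \<notin> C p \<Longrightarrow> F p q = 0"
      and fF: "\<And>q. f q = (\<Sum>p\<in>P. F p q)"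
    have good: "integrable ?\<mu> (?I (F p))" "integrable ?s (?B \<Gamma>1 (F p))" "integrable ?s (?B \<Gamma>2 (F p))"
      "integral\<^sup>L ?\<mu> (?I (F p)) = integral\<^sup>L ?s (?B \<Gamma>1 (F p)) - integral\<^sup>L ?s (?B \<Gamma>2 (F p))" if p: "p \<in> P" for p
    proof -
      have "Good (Np p)" using Np P p by blast
      from this[unfolded Good_def, rule_format, of "F p" "C p"]
      show "integrable ?\<mu> (?I (F p))" "integrable ?s (?B \<Gamma>1 (F p))" "integrable ?s (?B \<Gamma>2 (F p))"
        "integral\<^sup>L ?\<mu> (?I (F p)) = integral\<^sup>L ?s (?B \<Gamma>1 (F p)) - integral\<^sup>L ?s (?B \<Gamma>2 (F p))"
        using F[OF p] C(1,2)[OF p] C(3)[OF p] by blast+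
    qed
    have sum1: "(\<Sum>p\<in>P. F p q) = 1" if "q \<in> closure \<Omega>" for q using f(3,4) fF[of q] that by auto
    have Isum: "(\<Sum>p\<in>P. ?I (F p) q) = indicator \<Omega> q * (codifferential A g \<omega> q * v q)" for q
    proof (cases "q \<in> \<Omega>")
      case True
      have qN: "q \<in> N \<inter> ?M" using True f(3) clM unfolding cl by blast
      have "(\<Sum>p\<in>P. codifferential A g (?F\<omega> (F p)) q) = codifferential A g (\<lambda>c q. \<Sum>p\<in>P. ?F\<omega> (F p) c q) q"
        by (rule codifferential_sum[symmetric, OF oM _ P(1)]) (use qN F\<omega> F in auto)
      also have "\<dots> = codifferential A g \<omega> q"
      proof (rule codifferential_cong)
        show "open (N \<inter> ?M)" using f(2) oM by auto
        show "q \<in> N \<inter> ?M" by (rule qN)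
        fix c y assume "y \<in> N \<inter> ?M"
        then have "(\<Sum>p\<in>P. F p y) = 1" using f(4) fF[of y] by simp
        then show "(\<Sum>p\<in>P. ?F\<omega> (F p) c y) = \<omega> c y" by (simp add: scaleR_sum_left[symmetric])
      qed
      finally show ?thesis using True by (simp add: sum_distrib_right[symmetric])
    qed simp
    have Bsum: "(\<Sum>p\<in>P. ?B \<Gamma>' (F p) q) = indicator \<Gamma>' q * (apply_form A \<omega> \<nu> q * v q)" if G: "\<Gamma>' \<subseteq> closure \<Omega>" for \<Gamma>' q
    proof (cases "q \<in> \<Gamma>'")
      case True
      have "(\<Sum>p\<in>P. F p q * apply_form A \<omega> \<nu> q * v q) = (\<Sum>p\<in>P. F p q) * (apply_form A \<omega> \<nu> q * v q)"
        by (simp only: sum_distrib_right mult.assoc)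
      then show ?thesis using True sum1[of q] G by (auto simp: apply_form_scale)
    qed simp
    have "(\<integral>q. indicator \<Omega> q * (codifferential A g \<omega> q * v q) \<partial>?\<mu>) = (\<Sum>p\<in>P. integral\<^sup>L ?\<mu> (?I (F p)))"
      unfolding Isum[symmetric] by (rule Bochner_Integration.integral_sum) (rule good(1))
    also have "\<dots> = (\<Sum>p\<in>P. integral\<^sup>L ?s (?B \<Gamma>1 (F p))) - (\<Sum>p\<in>P. integral\<^sup>L ?s (?B \<Gamma>2 (F p)))"
      unfolding sum_subtractf[symmetric] by (rule sum.cong[OF refl]) (rule good(4))
    also have "(\<Sum>p\<in>P. integral\<^sup>L ?s (?B \<Gamma>1 (F p))) = (\<integral>q. indicator \<Gamma>1 q * (apply_form A \<omega> \<nu> q * v q) \<partial>?s)"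
    proof -
      have G: "\<Gamma>1 \<subseteq> closure \<Omega>" using cl by blast
      show ?thesis unfolding Bsum[OF G, symmetric]
        by (rule Bochner_Integration.integral_sum[symmetric]) (rule good(2))
    qed
    also have "(\<Sum>p\<in>P. integral\<^sup>L ?s (?B \<Gamma>2 (F p))) = (\<integral>q. indicator \<Gamma>2 q * (apply_form A \<omega> \<nu> q * v q) \<partial>?s)"
    proof -
      have G: "\<Gamma>2 \<subseteq> closure \<Omega>" using cl by blast
      show ?thesis unfolding Bsum[OF G, symmetric]
        by (rule Bochner_Integration.integral_sum[symmetric]) (rule good(3))
    qed
    finally show ?thesis .
  qed
qed

section \<open>Gluing divergence-free forms\<close>

text \<open>The function \<open>f = d\<^sup>*\<omega>\<close> vanishes near the boundary of
  \<open>\<Omega>\<close>, and by the divergence theorem its integral against a locally constant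
  \<open>v\<close> is the difference of the two boundary integrals, that is, zero.  So \<open>-f\<close> is
  the codifferential of a form with compact support in \<open>\<Omega>\<close>.\<close>

theorem divergence_free_gluing:
  assumes M: "open M1" "open M2" and \<Omega>: "\<Omega> = M1 \<inter> M2" and cpt: "compact (closure \<Omega>)"
    and hyp: "smooth_hypersurface A (frontier \<Omega>)"
    and \<Gamma>: "frontier \<Omega> = \<Gamma>1 \<union> \<Gamma>2" "\<Gamma>1 \<subseteq> M1" "\<Gamma>2 \<subseteq> M2"
    and \<nu>: "unit_normal_on A g (frontier \<Omega>) \<nu>"
    and out: "\<And>q. q \<in> \<Gamma>2 \<Longrightarrow> points_out_of A \<Omega> \<nu> q" and into: "\<And>q. q \<in> \<Gamma>1 \<Longrightarrow> points_into A \<Omega> \<nu> q"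
    and V: "smooth_one_form_on A M1 V" "\<And>p. p \<in> M1 \<Longrightarrow> codifferential A g V p = 0"
    and W: "smooth_one_form_on A M2 W" "\<And>p. p \<in> M2 \<Longrightarrow> codifferential A g W p = 0"
    and \<eta>: "smooth_function_on A (M1 \<union> M2) \<eta>"
    and N1: "open N1" "closure (M1 - \<Omega>) \<subseteq> N1" "\<And>p. p \<in> N1 \<inter> (M1 \<union> M2) \<Longrightarrow> \<eta> p = 1"
    and N2: "open N2" "closure (M2 - \<Omega>) \<subseteq> N2" "\<And>p. p \<in> N2 \<inter> (M1 \<union> M2) \<Longrightarrow> \<eta> p = 0"
    and compat: "\<And>v. smooth_function_on A \<Omega> v \<Longrightarrow> zero_differential_on A \<Omega> v \<Longrightarrow> continuous_on (closure \<Omega>) v \<Longrightarrow>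
      (LINT p:\<Gamma>2|hypersurface_measure A g (frontier \<Omega>). apply_form A W \<nu> p * v p) =
      (LINT p:\<Gamma>1|hypersurface_measure A g (frontier \<Omega>). apply_form A V \<nu> p * v p)"
  defines "\<omega> \<equiv> \<lambda>c q. (if q \<in> M1 then \<eta> q *\<^sub>R V c q else 0) + (if q \<in> M2 then (1 - \<eta> q) *\<^sub>R W c q else 0)"
  obtains U where "smooth_one_form_on A UNIV U" "form_support A (M1 \<union> M2) U \<subseteq> closure \<Omega>"
    "\<And>p. p \<in> M1 \<union> M2 \<Longrightarrow> codifferential A g (\<lambda>c q. \<omega> c q + U c q) p = 0"
proof -
  let ?M = "M1 \<union> M2"
  have oM: "open ?M" and o\<Omega>: "open \<Omega>" using M \<Omega> by auto
  have fr: "q \<notin> \<Omega>" if "q \<in> frontier \<Omega>" for q using that o\<Omega> by (simp add: frontier_def interior_open)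
  have cl: "closure \<Omega> = \<Omega> \<union> \<Gamma>1 \<union> \<Gamma>2"
    using \<Gamma>(1) o\<Omega> closure_subset[of \<Omega>] by (auto simp: frontier_def interior_open)
  have disj: "M1 \<inter> \<Gamma>2 = {}" "M2 \<inter> \<Gamma>1 = {}" using fr \<Gamma> \<Omega> by blast+
  have sub1: "M1 - \<Omega> \<subseteq> N1" using N1(2) closure_subset by blast
  have sub2: "M2 - \<Omega> \<subseteq> N2" using N2(2) closure_subset by blast
  have \<Gamma>N: "\<Gamma>1 \<subseteq> N1" "\<Gamma>2 \<subseteq> N2" using sub1 sub2 \<Gamma> fr by blast+
  have o1: "open (N1 \<inter> M1)" and o2: "open (N2 \<inter> M2)" using N1 N2 M by auto
  have \<omega>V: "\<omega> c q = V c q" if "q \<in> N1 \<inter> M1" for c q using N1(3)[of q] that by (simp add: \<omega>_def)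
  have \<omega>W: "\<omega> c q = W c q" if "q \<in> N2 \<inter> M2" for c q using N2(3)[of q] that by (simp add: \<omega>_def)
  have s\<Omega>: "smooth_one_form_on A \<Omega> \<omega>"
  proof (rule smooth_one_form_on_cong[OF o\<Omega>])
    have e: "smooth_function_on A \<Omega> \<eta>" by (rule smooth_function_on_subset[OF \<eta>]) (use \<Omega> in auto)
    show "smooth_one_form_on A \<Omega> (\<lambda>c q. \<eta> q *\<^sub>R V c q + (1 - \<eta> q) *\<^sub>R W c q)"
      by (intro smooth_one_form_on_add smooth_one_form_on_scale o\<Omega> e smooth_function_on_diff smooth_function_on_const
          smooth_one_form_on_subset[OF V(1)] smooth_one_form_on_subset[OF W(1)]) (use \<Omega> in auto)
  qed (simp add: \<omega>_def \<Omega>)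
  have sV: "smooth_one_form_on A (N1 \<inter> M1) \<omega>"
    by (rule smooth_one_form_on_cong[OF o1 _ smooth_one_form_on_subset[OF V(1)]]) (use \<omega>V in auto)
  have sW: "smooth_one_form_on A (N2 \<inter> M2) \<omega>"
    by (rule smooth_one_form_on_cong[OF o2 _ smooth_one_form_on_subset[OF W(1)]]) (use \<omega>W in auto)
  have \<omega>: "smooth_one_form_on A ?M \<omega>"
  proof (rule smooth_one_form_on_locally)
    fix p assume "p \<in> ?M"
    then have "p \<in> \<Omega> \<or> p \<in> N1 \<inter> M1 \<or> p \<in> N2 \<inter> M2" using sub1 sub2 by blast
    then show "\<exists>T. open T \<and> p \<in> T \<and> smooth_one_form_on A T \<omega>" using s\<Omega> sV sW o\<Omega> o1 o2 by blast
  qed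
  have cV: "codifferential A g \<omega> q = 0" if "q \<in> N1 \<inter> M1" for q
    using codifferential_cong[OF o1 that, of \<omega> V] \<omega>V V(2)[of q] that by simp
  have cW: "codifferential A g \<omega> q = 0" if "q \<in> N2 \<inter> M2" for q
    using codifferential_cong[OF o2 that, of \<omega> W] \<omega>W W(2)[of q] that by simp
  define f where "f q = (if q \<in> \<Omega> then codifferential A g \<omega> q else 0)" for q
  have f\<omega>: "f q = codifferential A g \<omega> q" if "q \<in> ?M" for q
    using cV[of q] cW[of q] that sub1 sub2 by (auto simp: f_def)
  \<comment> \<open>Outside \<open>K\<close> the form is \<open>V\<close> or \<open>W\<close> nearby, so
    \<open>f\<close> vanishes there.\<close>
  define K where "K = closure \<Omega> - (N1 \<union> N2)"
  have K: "compact K" "K \<subseteq> \<Omega>"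
  proof -
    have "K = closure \<Omega> \<inter> (- (N1 \<union> N2))" by (auto simp: K_def)
    then show "compact K" using cpt N1(1) N2(1) by (auto intro!: compact_Int_closed)
    show "K \<subseteq> \<Omega>" unfolding K_def cl using \<Gamma>N by auto
  qed
  have f0: "f q = 0" if "q \<notin> K" for q
  proof (cases "q \<in> \<Omega>")
    case True
    then have "q \<in> N1 \<inter> M1 \<or> q \<in> N2 \<inter> M2" using that closure_subset[of \<Omega>] \<Omega> unfolding K_def by blast
    then show ?thesis using cV cW by (auto simp: f_def)
  qed (simp add: f_def)
  have f: "smooth_function_on A UNIV f"
  proof (rule smooth_function_extend_zero[OF o\<Omega> _ K f0])
    show "smooth_function_on A \<Omega> f"
      by (rule smooth_function_on_cong[OF o\<Omega> _ smooth_codifferential[OF o\<Omega> s\<Omega>]]) (simp add: f_def)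
  qed
  have side: "\<exists>T. open T \<and> p \<in> T \<and> connected (T \<inter> \<Omega>)" if p: "p \<in> frontier \<Omega>" for p
  proof -
    obtain c k where ck: "(c, k) \<in> slice_charts A (frontier \<Omega>)" "p \<in> chart_dom c"
      using hyp p by (auto simp: smooth_hypersurface_def)
    have c: "c \<in> A" using ck by (auto simp: slice_charts_def)
    have "\<exists>X. points_out_of A \<Omega> X p" using p \<Gamma>(1) out into unfolding points_into_def by blast
    then obtain X where "points_out_of A \<Omega> X p" by blast
    from boundary_side[OF o\<Omega> ck(1) c p ck(2) this open_UNIV UNIV_I] show ?thesis by metis
  qed
  have "f \<in> coexact_on \<Omega>"
  proof (rule coexact_if_orthogonal_to_locally_constant[OF o\<Omega> f K f0])
    fix v assume v: "locally_constant_on \<Omega> v"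
    show "integral\<^sup>L (riemannian_measure A g) (\<lambda>p. f p * v p) = 0"
    proof (rule locally_constant_extends_to_closure[OF o\<Omega> v side])
    fix v' assume v': "\<And>p. p \<in> \<Omega> \<Longrightarrow> v' p = v p"
      "\<And>p. p \<in> closure \<Omega> \<Longrightarrow> \<exists>T a. open T \<and> p \<in> T \<and> (\<forall>q\<in>T \<inter> closure \<Omega>. v' q = a)"
    have lc: "locally_constant_on \<Omega> v'"
      unfolding locally_constant_on_def
    proof
      fix p assume p: "p \<in> \<Omega>"
      then have "p \<in> closure \<Omega>" unfolding cl by blast
      then obtain T a where T: "open T" "p \<in> T" "\<forall>q\<in>T \<inter> closure \<Omega>. v' q = a" using v'(2) by blast
      then show "\<exists>N a. open N \<and> p \<in> N \<and> (\<forall>q\<in>N. v' q = a)"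
        using p o\<Omega> unfolding cl by (intro exI[of _ "T \<inter> \<Omega>"] exI[of _ a]) auto
    qed
    have "continuous_on (closure \<Omega>) v'"
      unfolding continuous_on_def
    proof
      fix p assume p: "p \<in> closure \<Omega>"
      then obtain T a where T: "open T" "p \<in> T" "\<forall>q\<in>T \<inter> closure \<Omega>. v' q = a" using v'(2) by blast
      have "\<forall>\<^sub>F q in at p within closure \<Omega>. v' p = v' q"
        unfolding eventually_at_topological using T p by (intro exI[of _ T]) auto
      then show "(v' \<longlongrightarrow> v' p) (at p within closure \<Omega>)"
        by (rule Lim_transform_eventually[OF tendsto_const])
    qed
    from compat[OF locally_constant_smooth[OF lc] locally_constant_zero_differential[OF lc] this]
    have eq: "(LINT p:\<Gamma>2|hypersurface_measure A g (frontier \<Omega>). apply_form A W \<nu> p * v' p) =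
      (LINT p:\<Gamma>1|hypersurface_measure A g (frontier \<Omega>). apply_form A V \<nu> p * v' p)" .
    have b1: "(LINT p:\<Gamma>1|hypersurface_measure A g (frontier \<Omega>). apply_form A V \<nu> p * v' p)
      = (\<integral>q. indicator \<Gamma>1 q * (apply_form A \<omega> \<nu> q * v' q) \<partial>hypersurface_measure A g (frontier \<Omega>))"
      unfolding set_lebesgue_integral_def
    proof (rule Bochner_Integration.integral_cong[OF refl])
      fix q show "indicator \<Gamma>1 q *\<^sub>R (apply_form A V \<nu> q * v' q) = indicator \<Gamma>1 q * (apply_form A \<omega> \<nu> q * v' q)"
      proof (cases "q \<in> \<Gamma>1")
        case True
        then have "q \<in> N1 \<inter> M1" using \<Gamma>N(1) \<Gamma>(2) by blast
        then have "\<omega> (chart_at A q) q = V (chart_at A q) q" by (rule \<omega>V)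
        then show ?thesis by (simp add: apply_form_def Let_def)
      qed simp
    qed
    have b2: "(LINT p:\<Gamma>2|hypersurface_measure A g (frontier \<Omega>). apply_form A W \<nu> p * v' p)
      = (\<integral>q. indicator \<Gamma>2 q * (apply_form A \<omega> \<nu> q * v' q) \<partial>hypersurface_measure A g (frontier \<Omega>))"
      unfolding set_lebesgue_integral_def
    proof (rule Bochner_Integration.integral_cong[OF refl])
      fix q show "indicator \<Gamma>2 q *\<^sub>R (apply_form A W \<nu> q * v' q) = indicator \<Gamma>2 q * (apply_form A \<omega> \<nu> q * v' q)"
      proof (cases "q \<in> \<Gamma>2")
        case True
        then have "q \<in> N2 \<inter> M2" using \<Gamma>N(2) \<Gamma>(3) by blast
        then have "\<omega> (chart_at A q) q = W (chart_at A q) q" by (rule \<omega>W)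
        then show ?thesis by (simp add: apply_form_def Let_def)
      qed simp
    qed
    have "(\<lambda>p. f p * v p) = (\<lambda>q. indicator \<Omega> q * (codifferential A g \<omega> q * v' q))"
      using v'(1) by (auto simp: f_def fun_eq_iff)
    then have "integral\<^sup>L (riemannian_measure A g) (\<lambda>p. f p * v p)
      = (\<integral>q. indicator \<Omega> q * (codifferential A g \<omega> q * v' q) \<partial>riemannian_measure A g)" by simp
    also have "\<dots> = (\<integral>q. indicator \<Gamma>1 q * (apply_form A \<omega> \<nu> q * v' q) \<partial>hypersurface_measure A g (frontier \<Omega>))
      - (\<integral>q. indicator \<Gamma>2 q * (apply_form A \<omega> \<nu> q * v' q) \<partial>hypersurface_measure A g (frontier \<Omega>))"
      by (rule divergence_theorem[OF o\<Omega> cpt hyp M \<Gamma>(2,3) disj _ \<Gamma>(1) \<nu> out into \<omega> v'(2)]) (use \<Omega> in auto)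
    also have "\<dots> = 0" using eq b1 b2 by simp
    finally show "integral\<^sup>L (riemannian_measure A g) (\<lambda>p. f p * v p) = 0" .
    qed
  qed
  then have "(\<lambda>p. (- 1) * f p) \<in> coexact_on \<Omega>" by (rule coexact_on_scale)
  then obtain U L where U: "smooth_one_form_on A UNIV U" "compact L" "L \<subseteq> \<Omega>"
    "\<And>c q. c \<in> A \<Longrightarrow> q \<notin> L \<Longrightarrow> U c q = 0" and Uf: "(\<lambda>p. (- 1) * f p) = codifferential A g U"
    unfolding coexact_on_def by blast
  show thesis
  proof (rule that[OF U(1)])
    show "form_support A ?M U \<subseteq> closure \<Omega>"
    proof -
      have "form_support A ?M U \<subseteq> L" by (rule form_support_subset[OF U(2,4)])
      then show ?thesis using U(3) closure_subset[of \<Omega>] by blast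
    qed
    fix p assume p: "p \<in> ?M"
    have "codifferential A g (\<lambda>c q. \<omega> c q + U c q) p = codifferential A g \<omega> p + codifferential A g U p"
      by (rule codifferential_add[OF oM p \<omega> smooth_one_form_on_subset[OF U(1)]]) simp
    then show "codifferential A g (\<lambda>c q. \<omega> c q + U c q) p = 0"
      using f\<omega>[OF p] fun_cong[OF Uf, of p] by simp
  qed
qed

end

section \<open>Solvability and gluing for the divergence operator\<close>

theorem corollary1p6:
  fixes A :: "('a::{t2_space, second_countable_topology}, 'n::finite) chart set"
    and g :: "('a, 'n) chart \<Rightarrow> 'a \<Rightarrow> real ^ 'n ^ 'n"
  assumes "riemannian_manifold A g"
  shows
    "(\<forall>(\<Omega> :: 'a set) (f :: 'a \<Rightarrow> real).
        open \<Omega> \<and> compact (closure \<Omega>) \<and> smooth_boundary A \<Omega> \<and>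
        smooth_function_on A UNIV f \<and>
        compact (closure {p. f p \<noteq> 0}) \<and> closure {p. f p \<noteq> 0} \<subseteq> \<Omega> \<and>
        (\<forall>v. smooth_function_on A \<Omega> v \<and> zero_differential_on A \<Omega> v \<longrightarrow>
             (LINT p:\<Omega>|riemannian_measure A g. f p * v p) = 0)
        \<longrightarrow>
        (\<exists>U. smooth_one_form_on A UNIV U \<and>
             compact (form_support A UNIV U) \<and> form_support A UNIV U \<subseteq> closure \<Omega> \<and>
             (\<forall>p. codifferential A g U p = f p)))
     \<and>
     (\<forall>(\<Omega>\<^sub>1 :: 'a set) (\<Omega>\<^sub>2 :: 'a set) (\<Omega> :: 'a set) (\<Gamma>\<^sub>1 :: 'a set) (\<Gamma>\<^sub>2 :: 'a set)
        (\<nu> :: ('a, 'n) chart \<Rightarrow> 'a \<Rightarrow> real ^ 'n)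
        (V :: ('a, 'n) chart \<Rightarrow> 'a \<Rightarrow> real ^ 'n)
        (W :: ('a, 'n) chart \<Rightarrow> 'a \<Rightarrow> real ^ 'n)
        (\<eta> :: 'a \<Rightarrow> real).
        open \<Omega>\<^sub>1 \<and> open \<Omega>\<^sub>2 \<and> \<Omega> = \<Omega>\<^sub>1 \<inter> \<Omega>\<^sub>2 \<and> \<Omega> \<noteq> {} \<and> compact (closure \<Omega>) \<and>
        smooth_hypersurface A (frontier \<Omega>) \<and>
        smooth_hypersurface A \<Gamma>\<^sub>1 \<and> smooth_hypersurface A \<Gamma>\<^sub>2 \<and>
        frontier \<Omega> = \<Gamma>\<^sub>1 \<union> \<Gamma>\<^sub>2 \<and> \<Gamma>\<^sub>1 \<inter> \<Gamma>\<^sub>2 = {} \<and> \<Gamma>\<^sub>1 \<subseteq> \<Omega>\<^sub>1 \<and> \<Gamma>\<^sub>2 \<subseteq> \<Omega>\<^sub>2 \<and>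
        unit_normal_on A g (frontier \<Omega>) \<nu> \<and>
        (\<forall>p\<in>\<Gamma>\<^sub>2. points_out_of A \<Omega> \<nu> p) \<and> (\<forall>p\<in>\<Gamma>\<^sub>1. points_into A \<Omega> \<nu> p) \<and>
        smooth_one_form_on A \<Omega>\<^sub>1 V \<and> (\<forall>p\<in>\<Omega>\<^sub>1. codifferential A g V p = 0) \<and>
        smooth_one_form_on A \<Omega>\<^sub>2 W \<and> (\<forall>p\<in>\<Omega>\<^sub>2. codifferential A g W p = 0) \<and>
        smooth_function_on A (\<Omega>\<^sub>1 \<union> \<Omega>\<^sub>2) \<eta> \<and>
        (\<exists>N. open N \<and> closure (\<Omega>\<^sub>1 - \<Omega>) \<subseteq> N \<and> (\<forall>p\<in>N \<inter> (\<Omega>\<^sub>1 \<union> \<Omega>\<^sub>2). \<eta> p = 1)) \<and>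
        (\<exists>N. open N \<and> closure (\<Omega>\<^sub>2 - \<Omega>) \<subseteq> N \<and> (\<forall>p\<in>N \<inter> (\<Omega>\<^sub>1 \<union> \<Omega>\<^sub>2). \<eta> p = 0)) \<and>
        (\<forall>v. smooth_function_on A \<Omega> v \<and> zero_differential_on A \<Omega> v \<and>
             continuous_on (closure \<Omega>) v \<longrightarrow>
             (LINT p:\<Gamma>\<^sub>2|hypersurface_measure A g (frontier \<Omega>). apply_form A W \<nu> p * v p) =
             (LINT p:\<Gamma>\<^sub>1|hypersurface_measure A g (frontier \<Omega>). apply_form A V \<nu> p * v p))
        \<longrightarrow>
        (\<exists>U. smooth_one_form_on A (\<Omega>\<^sub>1 \<union> \<Omega>\<^sub>2) U \<and>
             form_support A (\<Omega>\<^sub>1 \<union> \<Omega>\<^sub>2) U \<subseteq> closure \<Omega> \<and>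
             (\<forall>p\<in>\<Omega>\<^sub>1 \<union> \<Omega>\<^sub>2.
                codifferential A g
                  (\<lambda>c q. (if q \<in> \<Omega>\<^sub>1 then \<eta> q *\<^sub>R V c q else 0)
                       + (if q \<in> \<Omega>\<^sub>2 then (1 - \<eta> q) *\<^sub>R W c q else 0)
                       + U c q) p = 0)))"
proof (intro conjI allI impI; elim conjE exE)
  interpret riemannian_manifold A g by fact
  fix \<Omega> f
  assume \<Omega>: "open \<Omega>" and f: "smooth_function_on A UNIV f"
    and K: "compact (closure {p. f p \<noteq> 0})" "closure {p. f p \<noteq> 0} \<subseteq> \<Omega>"
    and orth: "\<forall>v. smooth_function_on A \<Omega> v \<and> zero_differential_on A \<Omega> v \<longrightarrow>
      (LINT p:\<Omega>|riemannian_measure A g. f p * v p) = 0"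
  obtain U where U: "smooth_one_form_on A UNIV U" "compact (form_support A UNIV U)"
    "form_support A UNIV U \<subseteq> \<Omega>" "\<And>p. codifferential A g U p = f p"
  proof (rule codifferential_solvable[OF \<Omega> f K])
    show "(LINT p:\<Omega>|riemannian_measure A g. f p * v p) = 0"
      if "smooth_function_on A \<Omega> v" "zero_differential_on A \<Omega> v" for v using orth that by blast
  qed (rule that)
  show "\<exists>U. smooth_one_form_on A UNIV U \<and> compact (form_support A UNIV U) \<and>
      form_support A UNIV U \<subseteq> closure \<Omega> \<and> (\<forall>p. codifferential A g U p = f p)"
    by (intro exI[of _ U] conjI allI U(1,2,4) subset_trans[OF U(3) closure_subset])
next
  interpret riemannian_manifold A g by fact
  fix \<Omega>\<^sub>1 \<Omega>\<^sub>2 \<Omega> \<Gamma>\<^sub>1 \<Gamma>\<^sub>2 :: "'a set" and \<nu> V W :: "('a, 'n) chart \<Rightarrow> 'a \<Rightarrow> real ^ 'n" and \<eta> N\<^sub>1 N\<^sub>2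
  assume M: "open \<Omega>\<^sub>1" "open \<Omega>\<^sub>2" "\<Omega> = \<Omega>\<^sub>1 \<inter> \<Omega>\<^sub>2" "compact (closure \<Omega>)" "smooth_hypersurface A (frontier \<Omega>)"
    and \<Gamma>: "frontier \<Omega> = \<Gamma>\<^sub>1 \<union> \<Gamma>\<^sub>2" "\<Gamma>\<^sub>1 \<subseteq> \<Omega>\<^sub>1" "\<Gamma>\<^sub>2 \<subseteq> \<Omega>\<^sub>2" "unit_normal_on A g (frontier \<Omega>) \<nu>"
    and out: "\<forall>p\<in>\<Gamma>\<^sub>2. points_out_of A \<Omega> \<nu> p" and into: "\<forall>p\<in>\<Gamma>\<^sub>1. points_into A \<Omega> \<nu> p"
    and V: "smooth_one_form_on A \<Omega>\<^sub>1 V" "\<forall>p\<in>\<Omega>\<^sub>1. codifferential A g V p = 0"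
    and W: "smooth_one_form_on A \<Omega>\<^sub>2 W" "\<forall>p\<in>\<Omega>\<^sub>2. codifferential A g W p = 0"
    and \<eta>: "smooth_function_on A (\<Omega>\<^sub>1 \<union> \<Omega>\<^sub>2) \<eta>"
    and N\<^sub>1: "open N\<^sub>1" "closure (\<Omega>\<^sub>1 - \<Omega>) \<subseteq> N\<^sub>1" "\<forall>p\<in>N\<^sub>1 \<inter> (\<Omega>\<^sub>1 \<union> \<Omega>\<^sub>2). \<eta> p = 1"
    and N\<^sub>2: "open N\<^sub>2" "closure (\<Omega>\<^sub>2 - \<Omega>) \<subseteq> N\<^sub>2" "\<forall>p\<in>N\<^sub>2 \<inter> (\<Omega>\<^sub>1 \<union> \<Omega>\<^sub>2). \<eta> p = 0"
    and compat: "\<forall>v. smooth_function_on A \<Omega> v \<and> zero_differential_on A \<Omega> v \<and> continuous_on (closure \<Omega>) v \<longrightarrow>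
      (LINT p:\<Gamma>\<^sub>2|hypersurface_measure A g (frontier \<Omega>). apply_form A W \<nu> p * v p) =
      (LINT p:\<Gamma>\<^sub>1|hypersurface_measure A g (frontier \<Omega>). apply_form A V \<nu> p * v p)"
  let ?Z = "\<lambda>c q. (if q \<in> \<Omega>\<^sub>1 then \<eta> q *\<^sub>R V c q else 0) + (if q \<in> \<Omega>\<^sub>2 then (1 - \<eta> q) *\<^sub>R W c q else 0)"
  obtain U where U: "smooth_one_form_on A UNIV U" "form_support A (\<Omega>\<^sub>1 \<union> \<Omega>\<^sub>2) U \<subseteq> closure \<Omega>"
    "\<And>p. p \<in> \<Omega>\<^sub>1 \<union> \<Omega>\<^sub>2 \<Longrightarrow> codifferential A g (\<lambda>c q. ?Z c q + U c q) p = 0"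
  proof (rule divergence_free_gluing[OF M \<Gamma> _ _ V(1) _ W(1) _ \<eta> N\<^sub>1(1,2) _ N\<^sub>2(1,2)])
    show "points_out_of A \<Omega> \<nu> q" if "q \<in> \<Gamma>\<^sub>2" for q using out that by blast
    show "points_into A \<Omega> \<nu> q" if "q \<in> \<Gamma>\<^sub>1" for q using into that by blast
    show "codifferential A g V p = 0" if "p \<in> \<Omega>\<^sub>1" for p using V that by blast
    show "codifferential A g W p = 0" if "p \<in> \<Omega>\<^sub>2" for p using W that by blast
    show "\<eta> p = 1" if "p \<in> N\<^sub>1 \<inter> (\<Omega>\<^sub>1 \<union> \<Omega>\<^sub>2)" for p using N\<^sub>1 that by blast
    show "\<eta> p = 0" if "p \<in> N\<^sub>2 \<inter> (\<Omega>\<^sub>1 \<union> \<Omega>\<^sub>2)" for p using N\<^sub>2 that by blast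
    show "(LINT p:\<Gamma>\<^sub>2|hypersurface_measure A g (frontier \<Omega>). apply_form A W \<nu> p * v p) =
      (LINT p:\<Gamma>\<^sub>1|hypersurface_measure A g (frontier \<Omega>). apply_form A V \<nu> p * v p)"
      if "smooth_function_on A \<Omega> v" "zero_differential_on A \<Omega> v" "continuous_on (closure \<Omega>) v" for v
      using compat that by blast
  qed (rule that)
  show "\<exists>U. smooth_one_form_on A (\<Omega>\<^sub>1 \<union> \<Omega>\<^sub>2) U \<and> form_support A (\<Omega>\<^sub>1 \<union> \<Omega>\<^sub>2) U \<subseteq> closure \<Omega> \<and>
      (\<forall>p\<in>\<Omega>\<^sub>1 \<union> \<Omega>\<^sub>2. codifferential A g (\<lambda>c q. ?Z c q + U c q) p = 0)"
  proof (intro exI[of _ U] conjI ballI)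
    show "smooth_one_form_on A (\<Omega>\<^sub>1 \<union> \<Omega>\<^sub>2) U" by (rule smooth_one_form_on_subset[OF U(1)]) simp
    show "codifferential A g (\<lambda>c q. ?Z c q + U c q) p = 0" if "p \<in> \<Omega>\<^sub>1 \<union> \<Omega>\<^sub>2" for p by (rule U(3)[OF that])
  qed (rule U(2))
qed

end
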